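(* Let $v:\mathbb X\times\mathbb X\to[0,\infty]$ be a measurable symmetric pair potential and $z:\mathbb X\to[0,\infty)$ measurable with $\int_B z\,d\lambda<\infty$ for all $B\in\mathcal X_{\mathsf b}$, and assume $f\le0$ $\lambda^2$-a.e. Suppose there exist a measurable $a:\mathbb X\to[0,\infty)$ and $t>0$ such that for $\lambda$-almost all $x_0\in\mathbb X$, $$\sum_{k=1}^\infty\frac{e^{tk}}{k!}\int_{\mathbb X^k}\prod_{j=1}^k|f(x_0,y_j)|\prod_{1\le i<j\le k}\bigl(1+f(y_i,y_j)\bigr)\prod_{j=1}^k z(y_j)e^{a(y_j)}\,d\lambda^k(\mathbf y)\le e^{a(x_0)}-1.$$ Then the correlation functions of the unique Gibbs measure $\mathsf P\in\mathscr G(z)$ are given, for all $n\in\mathbb N$ and $\lambda^n$-almost all $(x_1,\dots,x_n)$, by $$\rho_n(x_1,\dots,x_n)=\prod_{j=1}^nz(x_j)\Bigl(\psi_{n,n}(x_1,\dots,x_n)+\sum_{k=1}^\infty\frac1{k!}\int_{\mathbb X^k}\psi_{n,n+k}(x_1,\dots,x_n,y_1,\dots,y_k)\,d\lambda_z^k(\mathbf y)\Bigr),$$ with $$|\psi_{n,n}(x_1,\dots,x_n)|+\sum_{k=1}^\infty\frac{e^{tk}}{k!}\int_{\mathbb X^k}|\psi_{n,n+k}(x_1,\dots,x_n,y_1,\dots,y_k)|\,d\lambda_z^k(\mathbf y)\le\prod_{1\le i<j\le n}\bigl(1+f(x_i,x_j)\bigr)e^{\sum_{i=1}^na(x_i)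}.$$
   Context: $(\mathbb X,\mathrm{dist})$ is a complete separable metric space with Borel $\sigma$-algebra $\mathcal X$, $\mathcal X_{\mathsf b}$ the bounded Borel sets, $\lambda$ a measure finite on bounded sets. $\mathcal N$ is the set of locally finite counting measures on $\mathbb X$ with $\sigma$-algebra $\mathfrak N$ generated by $\eta\mapsto\eta(B)$, $B\in\mathcal X_{\mathsf b}$. $f(x,y)=e^{-v(x,y)}-1$, $W(x;\eta)=\int v(x,y)\,d\eta(y)$, $\lambda_z(dx)=z(x)\lambda(dx)$. $\mathsf P\in\mathscr G(z)$ (Gibbs measure) means $\mathsf E[\int F(x,\eta)\,d\eta(x)]=\int\mathsf E[F(x,\eta+\delta_x)e^{-W(x;\eta)}]z(x)\,d\lambda(x)$ for all measurable $F:\mathbb X\times\mathcal N\to[0,\infty)$. Its correlation functions are $\rho_n(x_1,\dots,x_n)=\prod_jz(x_j)\,e^{-\sum_{i<j}v(x_i,x_j)}\int_{\mathcal N}e^{-\sum_{i}W(x_i;\eta)}\,d\mathsf P(\eta)$ (densities w.r.t. $\lambda^n$ of the factorial moment measures). For $k\le n$, $\mathcal D_{k,n}$ is the set of simple graphs $G$ on vertex set $\{1,\dots,n\}$ such that every vertex $j\in\{k+1,\dots,n\}$ is joined by a path in $G$ to some vertex in $\{1,\dots,k\}$ (in particular $\mathcal D_{n,n}$ is the set of all graphs on $\{1,\dots,n\}$). Set $\psi_{k,n}(x_1,\dots,x_n)=\sum_{G\in\mathcal D_{k,n}}\prod_{\{i,j\}\in E(G)}f(x_i,x_j)$. *)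

theory Defs
  imports "HOL-Probability.Probability"
begin

text \<open>The ground space is a type of class polish_space (complete separable metric space);
  its Borel sigma-algebra is borel.  Points of X^n are functions nat => 'a, indexed 0..n-1.\<close>

definition expneg :: "ennreal \<Rightarrow> real" where
  "expneg w = (if w = \<infinity> then 0 else exp (- enn2real w))"

definition ff :: "('a \<Rightarrow> 'a \<Rightarrow> ennreal) \<Rightarrow> 'a \<Rightarrow> 'a \<Rightarrow> real" where
  "ff v x y = expneg (v x y) - 1"

definition NN :: "'a::metric_space measure set" where
  "NN = {\<eta>. sets \<eta> = sets borel \<and>
            (\<forall>B\<in>sets borel. emeasure \<eta> B \<in> insert \<infinity> (range of_nat)) \<and>
            (\<forall>B\<in>sets borel. bounded B \<longrightarrow> emeasure \<eta> B < \<infinity>)}"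

text \<open>The sigma-algebra on NN generated by the maps eta |-> eta(B), B bounded Borel.
  (Since eta(B) is a natural number for such B, it is generated by the sets {eta(B) = k}.)\<close>
definition NNsig :: "'a::metric_space measure measure" where
  "NNsig = sigma NN {{\<eta>\<in>NN. emeasure \<eta> B = of_nat k} | B k. B \<in> sets borel \<and> bounded B}"

definition add_dirac :: "'a::topological_space measure \<Rightarrow> 'a \<Rightarrow> 'a measure" where
  "add_dirac \<eta> x = measure_of UNIV (sets borel) (\<lambda>A. emeasure \<eta> A + indicator A x)"

definition WW :: "('a \<Rightarrow> 'a \<Rightarrow> ennreal) \<Rightarrow> 'a \<Rightarrow> 'a measure \<Rightarrow> ennreal" where
  "WW v x \<eta> = (\<integral>\<^sup>+ y. v x y \<partial>\<eta>)"

text \<open>Gibbs measures P in G(z) (GNZ / Georgii-Nguyen-Zessin equation).\<close>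
definition gibbs :: "'a::metric_space measure \<Rightarrow> ('a \<Rightarrow> 'a \<Rightarrow> ennreal) \<Rightarrow> ('a \<Rightarrow> real)
                     \<Rightarrow> 'a measure measure \<Rightarrow> bool" where
  "gibbs lam v z P \<longleftrightarrow> prob_space P \<and> space P = NN \<and> sets P = sets NNsig \<and>
     (\<forall>F \<in> borel_measurable (borel \<Otimes>\<^sub>M NNsig). (\<forall>p. F p < \<infinity>) \<longrightarrow>
        (\<integral>\<^sup>+ \<eta>. (\<integral>\<^sup>+ x. F (x, \<eta>) \<partial>\<eta>) \<partial>P) =
        (\<integral>\<^sup>+ x. (\<integral>\<^sup>+ \<eta>. F (x, add_dirac \<eta> x) * ennreal (expneg (WW v x \<eta>)) \<partial>P)
                 * ennreal (z x) \<partial>lam))"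

definition corr :: "('a \<Rightarrow> 'a \<Rightarrow> ennreal) \<Rightarrow> ('a \<Rightarrow> real) \<Rightarrow> 'a measure measure
                    \<Rightarrow> nat \<Rightarrow> (nat \<Rightarrow> 'a) \<Rightarrow> real" where
  "corr v z P n x = (\<Prod>j<n. z (x j)) *
      expneg (\<Sum>(i,j)\<in>{(i,j). i < j \<and> j < n}. v (x i) (x j)) *
      (\<integral> \<eta>. expneg (\<Sum>i<n. WW v (x i) \<eta>) \<partial>P)"

definition graphs :: "nat \<Rightarrow> nat set set set" where
  "graphs n = Pow {{i, j} | i j. i < n \<and> j < n \<and> i \<noteq> j}"

definition adj :: "nat set set \<Rightarrow> (nat \<times> nat) set" where
  "adj E = {(i, j). {i, j} \<in> E}"

definition DD :: "nat \<Rightarrow> nat \<Rightarrow> nat set set set" where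
  "DD k n = {E \<in> graphs n. \<forall>j\<in>{k..<n}. \<exists>i<k. (j, i) \<in> (adj E)\<^sup>*}"

definition psi :: "('a \<Rightarrow> 'a \<Rightarrow> ennreal) \<Rightarrow> nat \<Rightarrow> nat \<Rightarrow> (nat \<Rightarrow> 'a) \<Rightarrow> real" where
  "psi v k n x = (\<Sum>E\<in>DD k n. \<Prod>(i,j)\<in>{(i,j). i < j \<and> {i,j} \<in> E}. ff v (x i) (x j))"

definition append_pts :: "nat \<Rightarrow> (nat \<Rightarrow> 'a) \<Rightarrow> (nat \<Rightarrow> 'a) \<Rightarrow> nat \<Rightarrow> 'a" where
  "append_pts n x y = (\<lambda>i. if i < n then x i else y (i - n))"

end

theory Submission
  imports Defs
begin

text \<open>Interpolating between the weights \<open>1\<close> and \<open>exp (- W (x; \<eta>))\<close>, the defining equation of a Gibbs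
  measure yields alternating expansions with Bonferroni brackets, hence a convergent Mayer expansion,
  and so the Kirkwood--Salsburg equations for the correlation functions. The rooted graph sums satisfy
  the same recursion; removing one root at a time, the hypothesis reproduces the bound
  \<open>\<Prod> (1 + f) exp (\<Sum> a)\<close> and so gives absolute convergence. Two solutions with this bound agree,
  since every use of the equations gains a factor \<open>exp (- t)\<close>; this is the formula for the correlation
  functions. They determine the Janossy densities and with them the measure. For existence, the
  Janossy densities of the finite-volume Gibbs measures converge to a consistent family, and the
  Ionescu-Tulcea theorem applied along an exhausting sequence of balls realises it as a point process.\<close>

section \<open>Boltzmann factors\<close>

text \<open>Almost everything is a value of one functional, \<open>LL P u\<close>, the expectation
  of exp (- \<integral> u d\<eta>), where u may be infinite. For u a sum of pair potentials it is,
  up to explicit factors, a correlation function; for u infinite on B a void probability; for the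
  sum of both a Janossy density. So one expansion of \<open>LL P\<close> in powers of 1 - exp (- u)
  serves the Kirkwood--Salsburg equations and the local laws alike. Since v \<ge> 0, every Gibbs
  measure obeys RR \<le> eH, and b = exp a \<ge> 1 puts this bound into the class on which the
  iteration contracts; hence uniqueness among all Gibbs measures. The gain comes from counting
  roots: a step trades one root for the points of J, errors carry the weight T ^ (number of roots)
  with T = exp t, the factor exp (t k) of the hypothesis pays for J, and the root removed leaves 1 /
  T. Two obstacles shape the existence part. The limiting Janossy densities are alternating series,
  so their positivity has to be inherited from finite volumes. And exp (- W (x; \<eta>)) depends on
  the whole configuration, so convergence of local laws does not by itself carry the Gibbs equation
  to the limit.\<close>

lemma expneg_0[simp]: "expneg 0 = 1"
  and expneg_top[simp]: "expneg \<infinity> = 0" "expneg \<top> = 0"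
  by (simp_all add: expneg_def)

lemma expneg_nonneg[simp]: "0 \<le> expneg w"
  and expneg_le_1[simp]: "expneg w \<le> 1"
  by (simp_all add: expneg_def)

lemma expneg_add: "expneg (a + b) = expneg a * expneg b"
proof (cases "a = \<infinity> \<or> b = \<infinity>")
  case False
  then have "a < top" "b < top" by (simp_all add: less_top)
  then show ?thesis using False
    by (simp add: expneg_def enn2real_plus mult_exp_exp)
qed (auto simp: expneg_def)

lemma expneg_sum: "expneg (\<Sum>i\<in>A. g i) = (\<Prod>i\<in>A. expneg (g i))"
  by (induction A rule: infinite_finite_induct) (auto simp: expneg_add)

lemma expneg_antimono: "a \<le> b \<Longrightarrow> expneg b \<le> expneg a"
  by (auto simp: expneg_def top_unique less_top[symmetric] intro!: enn2real_mono)

lemma expneg_measurable[measurable]: "expneg \<in> borel_measurable borel"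
  unfolding expneg_def[abs_def] by measurable

text \<open>Continuity includes the point infinity, so hard cores pass through all later limits
  without a case distinction.\<close>

lemma isCont_expneg: "isCont expneg w"
proof (cases "w = \<infinity>")
  case False
  then obtain r where r: "w = ennreal r" "0 \<le> r" by (cases w) auto
  have "((\<lambda>x. x) \<longlongrightarrow> ennreal r) (nhds w)"
    using r by (simp add: filterlim_ident)
  then have "((\<lambda>x. enn2real x) \<longlongrightarrow> r) (nhds w)"
    using r(2) by (intro tendsto_enn2real)
  then have "((\<lambda>w. exp (- enn2real w)) \<longlongrightarrow> exp (- r)) (nhds w)"
    by (intro tendsto_exp tendsto_minus)
  moreover have "eventually (\<lambda>w. expneg w = exp (- enn2real w)) (nhds w)"
  proof -
    have "eventually (\<lambda>x. x < top) (nhds w)"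
      using False by (intro eventually_nhds_in_open[of "{..<top}", simplified]) (auto simp: less_top)
    then show ?thesis by eventually_elim (auto simp: expneg_def)
  qed
  ultimately have "(expneg \<longlongrightarrow> exp (- r)) (nhds w)"
    by (subst tendsto_cong)
  then show ?thesis
    using r by (simp add: continuous_at_imp_continuous_within isCont_def tendsto_nhds_iff expneg_def)
next
  case True
  have "(expneg \<longlongrightarrow> 0) (at w)"
  proof (rule order_tendstoI)
    fix a :: real assume "a < 0"
    then show "eventually (\<lambda>x. a < expneg x) (at w)"
      by (intro always_eventually allI) (rule less_le_trans[OF _ expneg_nonneg])
  next
    fix a :: real assume a: "0 < a"
    \<comment> \<open>Beyond 1 - ln a the Boltzmann factor is at most a / e; the maximum keeps the
      threshold nonnegative for large a.\<close>
    have "eventually (\<lambda>x. ennreal (max 0 (1 - ln a)) < x) (nhds w)"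
      using True by (intro eventually_nhds_in_open[of "{ennreal _<..}", simplified]) auto
    then have "eventually (\<lambda>x. ennreal (max 0 (1 - ln a)) < x) (at w)"
      by (rule filter_leD[OF at_within_le_nhds])
    then show "eventually (\<lambda>x. expneg x < a) (at w)"
    proof eventually_elim
      case (elim x)
      have "expneg x \<le> expneg (ennreal (max 0 (1 - ln a)))"
        using elim by (intro expneg_antimono) simp
      also have "\<dots> = exp (- max 0 (1 - ln a))"
        by (subst expneg_def) (simp del: ennreal_max_0 ennreal_max_0')
      also have "\<dots> \<le> exp (ln a - 1)" by simp
      also have "\<dots> < exp (ln a)" by (subst exp_less_cancel_iff) simp
      finally show ?case using a by simp
    qed
  qed
  then show ?thesis using True by (simp add: isCont_def)
qed

lemma tendsto_expneg: "(g \<longlongrightarrow> w) F \<Longrightarrow> ((\<lambda>x. expneg (g x)) \<longlongrightarrow> expneg w) F"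
  by (rule isCont_tendsto_compose[OF isCont_expneg])

section \<open>Countable sums of measures\<close>

text \<open>Used for the Lebesgue--Poisson measure, a weighted sum over particle numbers, and for
  gluing together the configurations in successive shells.\<close>

definition msum :: "(nat \<Rightarrow> 'b measure) \<Rightarrow> 'b measure" where
  "msum N = measure_of (space (N 0)) (sets (N 0)) (\<lambda>A. \<Sum>i. emeasure (N i) A)"

lemma sets_msum[simp]: "sets (msum N) = sets (N 0)"
  and space_msum[simp]: "space (msum N) = space (N 0)"
  by (simp_all add: msum_def)

lemma emeasure_msum:
  assumes "\<And>i. sets (N i) = sets (N 0)" "A \<in> sets (N 0)"
  shows "emeasure (msum N) A = (\<Sum>i. emeasure (N i) A)"
proof (rule emeasure_measure_of[OF msum_def])
  show "countably_additive (sets (msum N)) (\<lambda>A. \<Sum>i. emeasure (N i) A)"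
  proof (rule countably_additiveI)
    fix A :: "nat \<Rightarrow> _" assume A: "range A \<subseteq> sets (msum N)" "disjoint_family A" "\<Union> (range A) \<in> sets (msum N)"
    have "(\<Sum>n. \<Sum>i. emeasure (N i) (A n)) = (\<Sum>i. \<Sum>n. emeasure (N i) (A n))"
      using pair_sigma_finite.Fubini'[of "count_space UNIV" "count_space UNIV" "\<lambda>n i. emeasure (N i) (A n)"]
      by (simp add: nn_integral_count_space_nat pair_sigma_finite_def sigma_finite_measure_count_space
          pair_measure_countable)
    also have "\<dots> = (\<Sum>i. emeasure (N i) (\<Union> (range A)))"
    proof (intro suminf_cong suminf_emeasure)
      show "range A \<subseteq> sets (N i)" for i using A(1) assms(1)[of i] by simp
    qed (use A in auto)
    finally show "(\<Sum>n. \<Sum>i. emeasure (N i) (A n)) = (\<Sum>i. emeasure (N i) (\<Union> (range A)))" .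
  qed
qed (use assms in \<open>auto simp: positive_def sets.space_closed\<close>)

text \<open>Stated for any measure whose values are the summed values, because besides
  \<open>msum\<close> it is also applied to \<open>add_dirac\<close>.\<close>

lemma nn_integral_eq_suminf:
  assumes sets: "\<And>i. sets (N i) = sets M"
    and em: "\<And>A. A \<in> sets M \<Longrightarrow> emeasure M A = (\<Sum>i::nat. emeasure (N i) A)"
    and f: "f \<in> borel_measurable M"
  shows "(\<integral>\<^sup>+x. f x \<partial>M) = (\<Sum>i. \<integral>\<^sup>+x. f x \<partial>N i)"
  using f
proof (induction rule: borel_measurable_induct)
  case (cong f g)
  have "space (N i) = space M" for i using sets by (rule sets_eq_imp_space_eq)
  then show ?case using cong by (simp cong: nn_integral_cong_simp)
next
  case (set A) then show ?case by (simp add: em sets)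
next
  case (mult u c)
  then have "u \<in> borel_measurable (N i)" for i by (simp add: measurable_cong_sets[OF sets refl])
  then show ?case using mult by (simp add: nn_integral_cmult)
next
  case (add u w)
  then have "u \<in> borel_measurable (N i)" "w \<in> borel_measurable (N i)" for i
    by (simp_all add: measurable_cong_sets[OF sets refl])
  then show ?case using add by (simp add: nn_integral_add suminf_add)
next
  case (seq U)
  then have m: "U n \<in> borel_measurable (N i)" for n i by (simp add: measurable_cong_sets[OF sets refl])
  have "(\<integral>\<^sup>+x. (SUP n. U n x) \<partial>M) = (SUP n. \<integral>\<^sup>+x. U n x \<partial>M)"
    using seq by (intro nn_integral_monotone_convergence_SUP) auto
  also have "\<dots> = (SUP n. \<Sum>i. \<integral>\<^sup>+x. U n x \<partial>N i)" using seq by simp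
  also have "\<dots> = (\<Sum>i. SUP n. \<integral>\<^sup>+x. U n x \<partial>N i)"
    using seq(3) by (intro ennreal_suminf_SUP_eq[symmetric] incseq_SucI nn_integral_mono)
       (auto simp: incseq_def le_fun_def)
  also have "\<dots> = (\<Sum>i. \<integral>\<^sup>+x. (SUP n. U n x) \<partial>N i)"
    using seq m by (intro suminf_cong nn_integral_monotone_convergence_SUP[symmetric]) auto
  finally show ?case using seq by (simp add: image_comp)
qed

lemma nn_integral_msum:
  assumes "\<And>i. sets (N i) = sets (N 0)" "f \<in> borel_measurable (N 0)"
  shows "(\<integral>\<^sup>+x. f x \<partial>msum N) = (\<Sum>i. \<integral>\<^sup>+x. f x \<partial>N i)"
proof (rule nn_integral_eq_suminf)
  show "f \<in> borel_measurable (msum N)"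
    using assms(2) by (simp add: measurable_cong_sets[OF sets_msum refl])
  show "sets (N i) = sets (msum N)" for i using assms(1) by simp
  show "emeasure (msum N) A = (\<Sum>i. emeasure (N i) A)" if "A \<in> sets (msum N)" for A
    using that by (intro emeasure_msum assms(1)) simp
qed

section \<open>Point configurations\<close>

text \<open>An exhaustion by balls around an arbitrary centre. Every bounded set lies in some
  \<open>Lam n\<close>, and \<open>Lam 0\<close> is empty, so that constructions along the sequence
  start from the empty configuration.\<close>

definition Lam :: "nat \<Rightarrow> 'a::metric_space set" where
  "Lam n = ball undefined (real n)"

lemma Lam_sets[measurable, simp]: "Lam n \<in> sets borel"
  and Lam_bounded[simp]: "bounded (Lam n)"
  by (simp_all add: Lam_def)

lemma Lam_mono: "m \<le> n \<Longrightarrow> Lam m \<subseteq> Lam n"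
  by (auto simp: Lam_def)

lemma Lam_cover: "\<exists>n. x \<in> Lam n"
  using reals_Archimedean2[of "dist undefined x"] by (auto simp: Lam_def)

lemma UN_Lam: "(\<Union>n. Lam n) = UNIV"
  using Lam_cover by auto

lemma bounded_Lam: "bounded B \<Longrightarrow> \<exists>n. B \<subseteq> Lam n"
proof -
  assume "bounded B"
  then obtain e where e: "\<And>y. y \<in> B \<Longrightarrow> dist undefined y \<le> e"
    using bounded_any_center[of B undefined] by auto
  obtain n where "e < real n" using reals_Archimedean2 by blast
  then show ?thesis using e by (intro exI[of _ n]) (force simp: Lam_def)
qed

lemma Lam_0[simp]: "Lam 0 = {}"
  by (simp add: Lam_def)

lemma indicator_Lam_SUP: "(SUP n. u * indicator (Lam n) x :: ennreal) = u"
proof (rule antisym)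
  obtain n where "x \<in> Lam n" using Lam_cover by blast
  then have "u \<le> u * indicator (Lam n) x" by simp
  then show "u \<le> (SUP n. u * indicator (Lam n) x)" by (rule order_trans) (rule SUP_upper, simp)
qed (auto intro!: SUP_least simp: indicator_def)

lemma NN_sets: "\<eta> \<in> NN \<Longrightarrow> sets \<eta> = sets borel"
  and NN_space: "\<eta> \<in> NN \<Longrightarrow> space \<eta> = UNIV"
  and NN_finite: "\<eta> \<in> NN \<Longrightarrow> B \<in> sets borel \<Longrightarrow> bounded B \<Longrightarrow> emeasure \<eta> B < \<infinity>"
  by (auto simp: NN_def dest: sets_eq_imp_space_eq)

lemma NN_nat: "\<eta> \<in> NN \<Longrightarrow> B \<in> sets borel \<Longrightarrow> bounded B \<Longrightarrow> \<exists>k. emeasure \<eta> B = of_nat k"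
  unfolding NN_def by (simp, blast dest: less_imp_neq)

lemma NN_measurable: "\<eta> \<in> NN \<Longrightarrow> f \<in> borel_measurable borel \<Longrightarrow> f \<in> borel_measurable \<eta>"
  by (simp add: measurable_cong_sets[OF NN_sets refl])

lemma space_NNsig: "space NNsig = (NN :: 'a::metric_space measure set)"
  unfolding NNsig_def by (rule space_measure_of) auto

lemma sets_NNsig: "sets NNsig = sigma_sets (NN :: 'a::metric_space measure set)
    {{\<eta>\<in>NN. emeasure \<eta> B = of_nat k} | B k. B \<in> sets borel \<and> bounded B}"
  unfolding NNsig_def by (rule sets_measure_of) auto

lemma measurable_NNsigI:
  assumes "\<And>m. m \<in> space M \<Longrightarrow> K m \<in> NN"
    and "\<And>B. B \<in> sets borel \<Longrightarrow> bounded B \<Longrightarrow> (\<lambda>m. emeasure (K m) B) \<in> borel_measurable M"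
  shows "K \<in> measurable M (NNsig :: 'a::metric_space measure measure)"
  unfolding NNsig_def
proof (rule measurable_measure_of)
  fix A :: "'a measure set"
  assume "A \<in> {{\<eta>\<in>NN. emeasure \<eta> B = of_nat k} | B k. B \<in> sets borel \<and> bounded B}"
  then obtain B k where B: "A = {\<eta>\<in>NN. emeasure \<eta> B = of_nat k}" "B \<in> sets borel" "bounded B" by auto
  have "K -` A \<inter> space M = {m\<in>space M. emeasure (K m) B = of_nat k}"
    using assms(1) by (auto simp: B)
  also have "\<dots> \<in> sets M" using assms(2)[OF B(2,3)] by measurable
  finally show "K -` A \<inter> space M \<in> sets M" .
qed (use assms(1) in auto)

text \<open>On a bounded set the count takes values in the natural numbers only, so each preimage is
  a countable union of generators.\<close>

lemma measurable_emeasure_NNsig_bounded: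
  assumes B: "B \<in> sets borel" "bounded B"
  shows "(\<lambda>\<eta>. emeasure \<eta> B) \<in> borel_measurable (NNsig :: 'a::metric_space measure measure)"
proof (rule measurableI)
  fix A :: "ennreal set" assume "A \<in> sets borel"
  have "(\<lambda>\<eta>. emeasure \<eta> B) -` A \<inter> space (NNsig :: 'a measure measure) =
      (\<Union>k\<in>{k. of_nat k \<in> A}. {\<eta>\<in>NN. emeasure \<eta> B = of_nat k})"
    using NN_nat[OF _ B] by (fastforce simp: space_NNsig)
  also have "\<dots> \<in> sets NNsig"
    using B by (intro sets.countable_UN') (auto simp: sets_NNsig intro!: sigma_sets.Basic)
  finally show "(\<lambda>\<eta>. emeasure \<eta> B) -` A \<inter> space (NNsig :: 'a measure measure) \<in> sets NNsig" .
qed auto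

lemma nn_integral_Lam_SUP:
  assumes [measurable_cong]: "sets \<eta> = sets borel" and f[measurable]: "f \<in> borel_measurable borel"
  shows "(\<integral>\<^sup>+y. f y \<partial>\<eta>) = (SUP n. \<integral>\<^sup>+y. f y * indicator (Lam n) y \<partial>\<eta>)"
proof -
  have "(\<integral>\<^sup>+y. f y \<partial>\<eta>) = (\<integral>\<^sup>+y. (SUP n. f y * indicator (Lam n) y) \<partial>\<eta>)"
    by (simp add: indicator_Lam_SUP)
  also have "\<dots> = (SUP n. \<integral>\<^sup>+y. f y * indicator (Lam n) y \<partial>\<eta>)"
    by (intro nn_integral_monotone_convergence_SUP)
       (auto simp: incseq_def le_fun_def indicator_def dest: Lam_mono)
  finally show ?thesis .
qed

text \<open>\<open>K m\<close> is merely locally finite. Restricted to a ball and divided by one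
  plus its mass there, it becomes a subprobability kernel, for which integrals depend measurably on
  the parameter; multiplying back and enlarging the ball gives the claim.\<close>

lemma measurable_nn_integral_NN:
  fixes K :: "'m \<Rightarrow> 'a::metric_space measure"
  assumes k[measurable]: "(\<lambda>(m, y). k m y) \<in> borel_measurable (M \<Otimes>\<^sub>M borel)"
    and K: "K \<in> measurable M NNsig"
  shows "(\<lambda>m. \<integral>\<^sup>+y. k m y \<partial>K m) \<in> borel_measurable M"
proof -
  have KN: "K m \<in> NN" if "m \<in> space M" for m
    using measurable_space[OF K that] by (simp add: space_NNsig)
  have em: "(\<lambda>m. emeasure (K m) B) \<in> borel_measurable M" if "B \<in> sets borel" "bounded B" for B
    using measurable_compose[OF K measurable_emeasure_NNsig_bounded[OF that]] .
  \<comment> \<open>The summand 1 keeps the divisor away from 0 when the ball contains no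
    point.\<close>
  define c where "c n m = 1 + emeasure (K m) (Lam n)" for n m
  have c: "c n m \<noteq> 0 \<and> c n m \<noteq> \<infinity>" if "m \<in> space M" for n m
    using NN_finite[OF KN[OF that], of "Lam n"] by (auto simp: c_def add_eq_0_iff_both_eq_0)
  have [measurable]: "(\<lambda>m. c n m) \<in> borel_measurable M" for n
    unfolding c_def using em[of "Lam n"] by simp
  define L where "L n m = density (K m) (\<lambda>y. indicator (Lam n) y / c n m)" for n m
  have sL: "sets (L n m) = sets borel" if "m \<in> space M" for n m
    using NN_sets[OF KN[OF that]] by (simp add: L_def)
  have eL: "emeasure (L n m) A = emeasure (K m) (A \<inter> Lam n) / c n m"
    if m: "m \<in> space M" and A: "A \<in> sets borel" for n m A
  proof -
    note [measurable_cong] = NN_sets[OF KN[OF m]]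
    have [measurable]: "A \<in> sets borel" by fact
    have "emeasure (L n m) A = (\<integral>\<^sup>+y. indicator (A \<inter> Lam n) y / c n m \<partial>K m)"
      unfolding L_def by (subst emeasure_density) (auto intro!: nn_integral_cong simp: indicator_def)
    also have "\<dots> = emeasure (K m) (A \<inter> Lam n) / c n m"
      by (subst nn_integral_divide) auto
    finally show ?thesis .
  qed
  have Lm: "L n \<in> measurable M (subprob_algebra borel)" for n
  proof (rule measurable_subprob_algebra)
    fix m assume m: "m \<in> space M"
    have "emeasure (K m) (UNIV \<inter> Lam n) / c n m \<le> 1"
      by (rule divide_le_posI_ennreal) (simp_all add: c_def add_pos_nonneg)
    then have "emeasure (L n m) UNIV \<le> 1"
      by (subst eL[OF m]) auto
    then show "subprob_space (L n m)"
      using sets_eq_imp_space_eq[OF sL[OF m]] by (intro subprob_spaceI) auto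
  next
    fix A :: "'a set" assume A: "A \<in> sets borel"
    then have "(\<lambda>m. emeasure (K m) (A \<inter> Lam n) / c n m) \<in> borel_measurable M"
      using em[of "A \<inter> Lam n"] by (auto intro!: borel_measurable_divide_ennreal bounded_subset[OF Lam_bounded])
    then show "(\<lambda>m. emeasure (L n m) A) \<in> borel_measurable M"
      using A by (subst measurable_cong[OF eL]) auto
  qed (use sL in auto)
  have "(\<lambda>m. SUP n. c n m * (\<integral>\<^sup>+y. k m y \<partial>L n m)) \<in> borel_measurable M"
    using nn_integral_measurable_subprob_algebra2[OF k Lm] by measurable
  also have "?this \<longleftrightarrow> ?thesis"
  proof (rule measurable_cong)
    fix m assume m: "m \<in> space M"
    note [measurable_cong] = NN_sets[OF KN[OF m]]
    have [measurable]: "k m \<in> borel_measurable borel" using m k by measurable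
    have "c n m * (\<integral>\<^sup>+y. k m y \<partial>L n m) = (\<integral>\<^sup>+y. k m y * indicator (Lam n) y \<partial>K m)" for n
    proof -
      have "c n m * (\<integral>\<^sup>+y. k m y \<partial>L n m) = c n m * (\<integral>\<^sup>+y. k m y * indicator (Lam n) y / c n m \<partial>K m)"
        unfolding L_def by (subst nn_integral_density)
          (auto simp: mult.commute divide_ennreal_def mult_ac)
      also have "\<dots> = c n m * ((\<integral>\<^sup>+y. k m y * indicator (Lam n) y \<partial>K m) / c n m)"
        by (subst nn_integral_divide) auto
      also have "\<dots> = (\<integral>\<^sup>+y. k m y * indicator (Lam n) y \<partial>K m)"
        using c[OF m, of n] by (subst ennreal_times_divide) (simp add: mult.commute[of "c n m"] ennreal_mult_divide_eq)
      finally show ?thesis .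
    qed
    then show "(SUP n. c n m * (\<integral>\<^sup>+y. k m y \<partial>L n m)) = (\<integral>\<^sup>+y. k m y \<partial>K m)"
      by (subst nn_integral_Lam_SUP[of "K m"]) (simp_all add: NN_sets[OF KN[OF m]])
  qed
  finally show ?thesis .
qed

lemma measurable_emeasure_NNsig[measurable]:
  "B \<in> sets borel \<Longrightarrow> (\<lambda>\<eta>. emeasure \<eta> B) \<in> borel_measurable (NNsig :: 'a::metric_space measure measure)"
proof -
  assume [measurable]: "B \<in> sets borel"
  have "(\<lambda>\<eta>. \<integral>\<^sup>+y. indicator B y \<partial>\<eta>) \<in> borel_measurable (NNsig :: 'a measure measure)"
    by (rule measurable_nn_integral_NN) auto
  also have "?this \<longleftrightarrow> ?thesis"
    by (rule measurable_cong) (simp add: space_NNsig NN_sets)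
  finally show ?thesis .
qed

section \<open>Adding a point to a configuration\<close>

lemma sets_add_dirac[simp]: "sets (add_dirac \<eta> x) = sets borel"
  and space_add_dirac[simp]: "space (add_dirac \<eta> x) = UNIV"
  by (auto simp: add_dirac_def sets_measure_of_conv space_measure_of_conv
      sets.sigma_sets_eq[of borel, simplified])

lemma emeasure_add_dirac:
  assumes "sets \<eta> = sets borel" "A \<in> sets borel"
  shows "emeasure (add_dirac \<eta> x) A = emeasure \<eta> A + indicator A x"
proof (rule emeasure_measure_of[OF add_dirac_def])
  show "countably_additive (sets (add_dirac \<eta> x)) (\<lambda>A. emeasure \<eta> A + indicator A x)"
  proof (rule countably_additiveI)
    fix A :: "nat \<Rightarrow> _" assume A: "range A \<subseteq> sets (add_dirac \<eta> x)" "disjoint_family A"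
      "\<Union> (range A) \<in> sets (add_dirac \<eta> x)"
    have "(\<Sum>i. emeasure \<eta> (A i)) = emeasure \<eta> (\<Union> (range A))"
      using A assms by (intro suminf_emeasure) auto
    moreover have "(\<Sum>i. emeasure (return borel x) (A i)) = emeasure (return borel x) (\<Union> (range A))"
      using A assms by (intro suminf_emeasure) auto
    moreover have "(\<Sum>i. emeasure (return borel x) (A i)) = (\<Sum>i. indicator (A i) x)"
      using A by (intro suminf_cong) auto
    moreover have "emeasure (return borel x) (\<Union> (range A)) = indicator (\<Union> (range A)) x"
      using A by auto
    ultimately show "(\<Sum>i. emeasure \<eta> (A i) + indicator (A i) x) = emeasure \<eta> (\<Union> (range A)) + indicator (\<Union> (range A)) x"
      by (subst suminf_add[symmetric]) auto
  qed
qed (use assms in \<open>auto simp: positive_def\<close>)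

lemma nn_integral_add_dirac:
  assumes s: "sets \<eta> = sets borel" and f[measurable]: "f \<in> borel_measurable borel"
  shows "(\<integral>\<^sup>+y. f y \<partial>add_dirac \<eta> x) = (\<integral>\<^sup>+y. f y \<partial>\<eta>) + f x"
proof -
  \<comment> \<open>The sum of two measures is read as a series padded by null measures.\<close>
  define N where "N i = (if i = 0 then \<eta> else if i = 1 then return borel x else null_measure borel)" for i :: nat
  have 2: "(\<Sum>i. g i) = g 0 + g 1" if "\<And>i. i \<ge> 2 \<Longrightarrow> g i = 0" for g :: "nat \<Rightarrow> ennreal"
    using that by (subst suminf_finite[of "{0,1}"]) auto
  have "(\<integral>\<^sup>+y. f y \<partial>add_dirac \<eta> x) = (\<Sum>i. \<integral>\<^sup>+y. f y \<partial>N i)"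
    by (rule nn_integral_eq_suminf)
       (auto simp: N_def s 2 emeasure_add_dirac measurable_cong_sets[OF sets_add_dirac refl])
  also have "\<dots> = (\<integral>\<^sup>+y. f y \<partial>\<eta>) + f x"
    by (subst 2) (auto simp: N_def nn_integral_return nn_integral_null_measure)
  finally show ?thesis .
qed

lemma null_measure_NN[simp]: "null_measure borel \<in> NN"
  by (auto simp: NN_def intro!: image_eqI[of _ _ 0])

lemma add_dirac_NN:
  assumes "\<eta> \<in> NN" shows "add_dirac \<eta> x \<in> NN"
  unfolding NN_def
proof (safe; simp)
  fix B :: "'a set" assume B: "B \<in> sets borel"
  have eq: "emeasure (add_dirac \<eta> x) B = emeasure \<eta> B + indicator B x"
    using assms B by (simp add: emeasure_add_dirac NN_sets)
  { assume "bounded B"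
    then show "emeasure (add_dirac \<eta> x) B < \<top>"
      using NN_finite[OF assms B] by (simp add: eq indicator_def) }
  assume n: "emeasure (add_dirac \<eta> x) B \<notin> range of_nat"
  have "emeasure \<eta> B = \<infinity> \<or> (\<exists>k. emeasure \<eta> B = of_nat k)"
    using assms B by (auto simp: NN_def)
  then show "emeasure (add_dirac \<eta> x) B = \<top>"
  proof
    assume "\<exists>k. emeasure \<eta> B = of_nat k"
    then obtain k where "emeasure \<eta> B = of_nat k" ..
    then have "emeasure (add_dirac \<eta> x) B = of_nat (k + (if x \<in> B then 1 else 0))"
      by (simp add: eq)
    then show ?thesis using n by blast
  qed (simp add: eq)
qed

lemma measurable_add_dirac[measurable]:
  assumes K: "K \<in> measurable M NNsig" and g[measurable]: "g \<in> borel_measurable M"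
  shows "(\<lambda>m. add_dirac (K m) (g m :: 'a::metric_space)) \<in> measurable M NNsig"
proof (rule measurable_NNsigI)
  have KN: "K m \<in> NN" if "m \<in> space M" for m
    using measurable_space[OF K that] by (simp add: space_NNsig)
  then show "add_dirac (K m) (g m) \<in> NN" if "m \<in> space M" for m
    using that by (simp add: add_dirac_NN)
  fix B :: "'a set" assume B[measurable]: "B \<in> sets borel" "bounded B"
  have "(\<lambda>m. emeasure (K m) B + indicator B (g m)) \<in> borel_measurable M"
    using K by measurable
  also have "?this \<longleftrightarrow> (\<lambda>m. emeasure (add_dirac (K m) (g m)) B) \<in> borel_measurable M"
    by (rule measurable_cong) (simp add: emeasure_add_dirac KN NN_sets)
  finally show "(\<lambda>m. emeasure (add_dirac (K m) (g m)) B) \<in> borel_measurable M" .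
qed

text \<open>A density rather than a trace measure: the sigma-algebra stays the Borel one, so
  restricted configurations remain in \<open>NN\<close>. The same operation cuts the intensity
  measure down to a finite volume.\<close>

definition restr :: "'a set \<Rightarrow> 'a measure \<Rightarrow> 'a measure" where
  "restr B \<eta> = density \<eta> (indicator B)"

lemma sets_restr[simp]: "sets (restr B \<eta>) = sets \<eta>"
  by (simp add: restr_def)

lemma emeasure_restr:
  assumes "sets \<eta> = sets borel" "A \<in> sets borel" "B \<in> sets borel"
  shows "emeasure (restr B \<eta>) A = emeasure \<eta> (A \<inter> B)"
proof -
  have "emeasure (restr B \<eta>) A = (\<integral>\<^sup>+y. indicator B y * indicator A y \<partial>\<eta>)"
    unfolding restr_def using assms by (intro emeasure_density) (auto simp: measurable_cong_sets[OF assms(1) refl])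
  also have "\<dots> = (\<integral>\<^sup>+y. indicator (A \<inter> B) y \<partial>\<eta>)"
    by (intro nn_integral_cong) (auto simp: indicator_def)
  finally show ?thesis using assms by simp
qed

lemma nn_integral_restr:
  assumes [measurable_cong]: "sets \<eta> = sets borel" and [measurable]: "B \<in> sets borel" "f \<in> borel_measurable borel"
  shows "(\<integral>\<^sup>+y. f y \<partial>restr B \<eta>) = (\<integral>\<^sup>+y. f y * indicator B y \<partial>\<eta>)"
  unfolding restr_def by (subst nn_integral_density) (auto simp: mult.commute)

lemma restr_NN: "\<eta> \<in> NN \<Longrightarrow> B \<in> sets borel \<Longrightarrow> restr B \<eta> \<in> NN"
  unfolding NN_def by (auto simp: emeasure_restr intro: bounded_subset)

lemma measurable_restr[measurable]:
  assumes K: "K \<in> measurable M NNsig" and B[measurable]: "B \<in> sets borel"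
  shows "(\<lambda>m. restr B (K m) :: 'a::metric_space measure) \<in> measurable M NNsig"
proof (rule measurable_NNsigI)
  have KN: "K m \<in> NN" if "m \<in> space M" for m
    using measurable_space[OF K that] by (simp add: space_NNsig)
  then show "restr B (K m) \<in> NN" if "m \<in> space M" for m
    using that by (simp add: restr_NN)
  fix A :: "'a set" assume A[measurable]: "A \<in> sets borel" "bounded A"
  have "(\<lambda>m. emeasure (K m) (A \<inter> B)) \<in> borel_measurable M"
    using K by measurable
  also have "?this \<longleftrightarrow> (\<lambda>m. emeasure (restr B (K m)) A) \<in> borel_measurable M"
    by (rule measurable_cong) (simp add: emeasure_restr KN NN_sets)
  finally show "(\<lambda>m. emeasure (restr B (K m)) A) \<in> borel_measurable M" .
qed

lemma restr_add_dirac: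
  assumes "sets \<eta> = sets borel" "B \<in> sets borel" "x \<in> B"
  shows "restr B (add_dirac \<eta> x) = add_dirac (restr B \<eta>) x"
  by (rule measure_eqI) (use assms in \<open>auto simp: emeasure_restr emeasure_add_dirac indicator_def\<close>)

lemma restr_eq_null:
  assumes "sets \<eta> = sets borel" "B \<in> sets borel" "emeasure \<eta> B = 0"
  shows "restr B \<eta> = null_measure borel"
proof (rule measure_eqI)
  fix A assume "A \<in> sets (restr B \<eta>)"
  then have "A \<in> sets borel" using assms by simp
  moreover have "emeasure \<eta> (A \<inter> B) = 0"
    using emeasure_mono[of "A \<inter> B" B \<eta>] assms by auto
  ultimately show "emeasure (restr B \<eta>) A = emeasure (null_measure borel) A"
    using assms by (simp add: emeasure_restr)
qed (use assms in auto)

lemma restr_restr: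
  assumes "sets \<eta> = sets borel" "A \<in> sets borel" "B \<in> sets borel"
  shows "restr A (restr B \<eta>) = restr (A \<inter> B) \<eta>"
  by (rule measure_eqI) (use assms in \<open>auto simp: emeasure_restr Int_assoc\<close>)

section \<open>Finite sequences as a measurable space\<close>

text \<open>Tuples of all lengths form one measurable space, so that a sum over k of integrals over
  X^k becomes a single integral. The padding makes the entries a point of a fixed product space; its
  value is immaterial, since the length is recorded as well.\<close>

definition LS :: "'a::topological_space list measure" where
  "LS = vimage_algebra UNIV (\<lambda>xs. (length xs, \<lambda>i. if i < length xs then xs ! i else undefined))
     (count_space UNIV \<Otimes>\<^sub>M (\<Pi>\<^sub>M i\<in>UNIV. borel))"

lemma space_LS[simp]: "space LS = UNIV"
  by (simp add: LS_def)

lemma measurable_LS_emb: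
  "(\<lambda>xs. (length xs, \<lambda>i. if i < length xs then xs ! i else undefined))
    \<in> measurable LS (count_space UNIV \<Otimes>\<^sub>M (\<Pi>\<^sub>M i\<in>UNIV. borel))"
  unfolding LS_def by (rule measurable_vimage_algebra1) (auto simp: space_pair_measure space_PiM)

lemma measurable_length_LS[measurable]: "length \<in> measurable LS (count_space UNIV)"
  using measurable_compose[OF measurable_LS_emb measurable_fst] by simp

lemma measurable_dec_LS[measurable]:
  "(\<lambda>xs i. if i < length xs then xs ! i else undefined) \<in> measurable LS (\<Pi>\<^sub>M i\<in>UNIV. borel)"
  using measurable_compose[OF measurable_LS_emb measurable_snd] by simp

lemma measurable_nth_LS: 
  "(\<lambda>xs. if i < length xs then xs ! i else undefined) \<in> borel_measurable LS"
  using measurable_compose[OF measurable_dec_LS measurable_component_singleton[of i]] by simp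

lemma measurable_LSI:
  assumes "(\<lambda>m. length (h m)) \<in> measurable M (count_space UNIV)"
    and "\<And>i. (\<lambda>m. if i < length (h m) then h m ! i else undefined) \<in> borel_measurable M"
  shows "h \<in> measurable M LS"
  unfolding LS_def
  by (rule measurable_vimage_algebra2) (use assms in \<open>auto intro!: measurable_Pair measurable_PiM_single'\<close>)

lemma map_nth_upt: "map (\<lambda>i. if i < length xs then xs ! i else undefined) [0..<length xs] = xs"
  by (rule nth_equalityI) auto

text \<open>Measurability may be checked one length at a time: for each fixed n the function is
  composed with the padded sequence of entries, and then n is replaced by the actual length, which
  takes countably many values.\<close>

lemma measurable_pair_LSI:
  assumes "\<And>n. (\<lambda>(m, x). F (m, map x [0..<n])) \<in> measurable (M \<Otimes>\<^sub>M (\<Pi>\<^sub>M i\<in>UNIV. borel)) N"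
  shows "F \<in> measurable (M \<Otimes>\<^sub>M LS) N"
proof -
  have "(\<lambda>p. (\<lambda>(m, x). F (m, map x [0..<n]))
      (fst p, \<lambda>i. if i < length (snd p) then snd p ! i else undefined)) \<in> measurable (M \<Otimes>\<^sub>M LS) N" for n
    by (rule measurable_compose[OF _ assms]) measurable
  then have "(\<lambda>p. (\<lambda>(m, x). F (m, map x [0..<length (snd p)]))
      (fst p, \<lambda>i. if i < length (snd p) then snd p ! i else undefined)) \<in> measurable (M \<Otimes>\<^sub>M LS) N"
    by (rule measurable_compose_countable) measurable
  then show ?thesis by (simp add: case_prod_unfold map_nth_upt)
qed

lemma measurable_LS_fromI:
  assumes "\<And>n. (\<lambda>x. F (map x [0..<n])) \<in> measurable (\<Pi>\<^sub>M i\<in>UNIV. borel) N"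
  shows "F \<in> measurable LS N"
proof -
  have "(\<lambda>p. F (snd p)) \<in> measurable (count_space {()} \<Otimes>\<^sub>M LS) N"
    by (rule measurable_pair_LSI) (use assms in \<open>simp add: case_prod_unfold\<close>)
  from measurable_compose[OF measurable_Pair1'[of "()"] this] show ?thesis by simp
qed

lemma measurable_pair_LS_LSI:
  assumes "\<And>n k. (\<lambda>(x, y). F (map x [0..<n], map y [0..<k]))
      \<in> measurable ((\<Pi>\<^sub>M i\<in>UNIV. borel) \<Otimes>\<^sub>M (\<Pi>\<^sub>M i\<in>UNIV. borel)) N"
  shows "F \<in> measurable (LS \<Otimes>\<^sub>M LS) N"
proof (rule measurable_pair_LSI)
  fix n
  have "(\<lambda>(y, x). F (x, map y [0..<n])) \<in> measurable ((\<Pi>\<^sub>M i\<in>UNIV. borel) \<Otimes>\<^sub>M LS) N"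
  proof (rule measurable_pair_LSI)
    fix k show "(\<lambda>(m, x). case (m, map x [0..<k]) of (y, x) \<Rightarrow> F (x, map y [0..<n])) 
      \<in> measurable (Pi\<^sub>M UNIV (\<lambda>i. borel) \<Otimes>\<^sub>M Pi\<^sub>M UNIV (\<lambda>i. borel)) N"
      using measurable_pair_swap[OF assms[of k n]] by (simp add: case_prod_unfold)
  qed
  from measurable_pair_swap[OF this]
  show "(\<lambda>(m, x). F (m, map x [0..<n])) \<in> measurable (LS \<Otimes>\<^sub>M (\<Pi>\<^sub>M i\<in>UNIV. borel)) N"
    by (simp add: case_prod_unfold)
qed

lemma measurable_nth_LS'[measurable (raw)]:
  assumes h[measurable]: "h \<in> measurable M LS" and g[measurable]: "g \<in> measurable M (count_space UNIV)"
  shows "(\<lambda>m. if g m < length (h m) then h m ! g m else undefined) \<in> borel_measurable M"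
  by (rule measurable_compose_countable[OF _ g]) (rule measurable_compose[OF h measurable_nth_LS])

lemma measurable_Cons_LS[measurable (raw)]:
  assumes [measurable]: "g \<in> borel_measurable M" "h \<in> measurable M LS"
  shows "(\<lambda>m. g m # h m) \<in> measurable M LS"
proof (rule measurable_LSI)
  fix i
  show "(\<lambda>m. if i < length (g m # h m) then (g m # h m) ! i else undefined) \<in> borel_measurable M"
  proof (cases i)
    case (Suc j)
    have "(\<lambda>m. if j < length (h m) then h m ! j else undefined) \<in> borel_measurable M" by measurable
    then show ?thesis by (simp add: Suc cong: if_cong)
  qed simp
qed (simp; measurable)

lemma measurable_append_LS[measurable (raw)]:
  assumes [measurable]: "g \<in> measurable M LS" "h \<in> measurable M LS"
  shows "(\<lambda>m. g m @ h m) \<in> measurable M LS"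
proof (rule measurable_LSI)
  fix i
  have "(\<lambda>m. if i < length (g m) then (if i < length (g m) then g m ! i else undefined)
     else if i - length (g m) < length (h m) then h m ! (i - length (g m)) else undefined) \<in> borel_measurable M"
    by measurable
  also have "?this \<longleftrightarrow> (\<lambda>m. if i < length (g m @ h m) then (g m @ h m) ! i else undefined) \<in> borel_measurable M"
    by (intro arg_cong[where f="\<lambda>f. f \<in> borel_measurable M"] ext) (auto simp: nth_append)
  finally show "(\<lambda>m. if i < length (g m @ h m) then (g m @ h m) ! i else undefined) \<in> borel_measurable M" .
qed (simp; measurable)

lemma measurable_map_LS:
  assumes "set is \<subseteq> I" shows "(\<lambda>x. map x is) \<in> measurable (\<Pi>\<^sub>M i\<in>I. borel) LS"
  using assms by (induction "is") (auto intro!: measurable_Cons_LS measurable_component_singleton)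

lemma borel_measurable_prod_list_LS[measurable (raw)]:
  fixes g :: "'m \<Rightarrow> 'a::topological_space \<Rightarrow> real"
  assumes g[measurable]: "(\<lambda>(m, y). g m y) \<in> borel_measurable (M \<Otimes>\<^sub>M borel)" and h: "h \<in> measurable M LS"
  shows "(\<lambda>m. prod_list (map (g m) (h m))) \<in> borel_measurable M"
proof -
  have "(\<lambda>(m, x). prod_list (map (g m) (map x is))) \<in> borel_measurable (M \<Otimes>\<^sub>M (\<Pi>\<^sub>M i\<in>UNIV. borel))" for "is"
  proof (induction "is")
    case (Cons i "is")
    note [measurable] = Cons
    have "(\<lambda>(m, x). g m (x i) * prod_list (map (g m) (map x is))) \<in> borel_measurable (M \<Otimes>\<^sub>M (\<Pi>\<^sub>M i\<in>UNIV. borel))"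
      by measurable
    then show ?case by simp
  qed (simp add: case_prod_unfold)
  then have "(\<lambda>(m, xs). prod_list (map (g m) xs)) \<in> borel_measurable (M \<Otimes>\<^sub>M LS)"
    by (intro measurable_pair_LSI) simp
  from measurable_compose[OF measurable_Pair[OF measurable_ident_sets[OF refl] h] this] show ?thesis by simp
qed

lemma borel_measurable_sum_list_LS[measurable (raw)]:
  fixes g :: "'m \<Rightarrow> 'a::topological_space \<Rightarrow> ennreal"
  assumes g[measurable]: "(\<lambda>(m, y). g m y) \<in> borel_measurable (M \<Otimes>\<^sub>M borel)" and h: "h \<in> measurable M LS"
  shows "(\<lambda>m. sum_list (map (g m) (h m))) \<in> borel_measurable M"
proof -
  have "(\<lambda>(m, x). sum_list (map (g m) (map x is))) \<in> borel_measurable (M \<Otimes>\<^sub>M (\<Pi>\<^sub>M i\<in>UNIV. borel))" for "is"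
  proof (induction "is")
    case (Cons i "is")
    note [measurable] = Cons
    have "(\<lambda>(m, x). g m (x i) + sum_list (map (g m) (map x is))) \<in> borel_measurable (M \<Otimes>\<^sub>M (\<Pi>\<^sub>M i\<in>UNIV. borel))"
      by measurable
    then show ?case by simp
  qed (simp add: case_prod_unfold)
  then have "(\<lambda>(m, xs). sum_list (map (g m) xs)) \<in> borel_measurable (M \<Otimes>\<^sub>M LS)"
    by (intro measurable_pair_LSI) simp
  from measurable_compose[OF measurable_Pair[OF measurable_ident_sets[OF refl] h] this] show ?thesis by simp
qed

lemma measurable_set_subset_LS[measurable (raw)]:
  fixes h :: "'m \<Rightarrow> 'a::topological_space list"
  assumes [measurable]: "B \<in> sets borel" "h \<in> measurable M LS"
  shows "Measurable.pred M (\<lambda>m. set (h m) \<subseteq> B)"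
proof -
  have "prod_list (map (indicator B) xs) = (if set xs \<subseteq> B then 1 else 0 :: real)" for xs :: "'a list"
    by (induction xs) auto
  then have "(\<lambda>m. set (h m) \<subseteq> B) = (\<lambda>m. prod_list (map (indicator B) (h m)) = (1::real))"
    by (auto simp: fun_eq_iff)
  also have "Measurable.pred M \<dots>" by measurable
  finally show ?thesis .
qed

lemma set_subset_in_LS[measurable]: "B \<in> sets borel \<Longrightarrow> {\<xi>. set \<xi> \<subseteq> B} \<in> sets LS"
  using measurable_set_subset_LS[OF _ measurable_ident_sets[OF refl], of B] by (simp add: pred_def)

lemma compl_set_subset_in_LS[measurable]: "B \<in> sets borel \<Longrightarrow> - {\<xi>. set \<xi> \<subseteq> B} \<in> sets LS"
  using sets.compl_sets[OF set_subset_in_LS[of B]] by (simp add: Compl_eq_Diff_UNIV)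

section \<open>Counting measures of finite sequences\<close>

primrec conf :: "'a::topological_space list \<Rightarrow> 'a measure" where
  "conf [] = null_measure borel"
| "conf (x # xs) = add_dirac (conf xs) x"

lemma sets_conf[simp]: "sets (conf xs) = sets borel"
  by (cases xs) simp_all

lemma measurable_conf[measurable]: "conf \<in> measurable LS (NNsig :: 'a::metric_space measure measure)"
proof (rule measurable_LS_fromI)
  fix n
  have "(\<lambda>x. conf (map x is)) \<in> measurable (\<Pi>\<^sub>M i\<in>UNIV. borel) (NNsig :: 'a measure measure)" for "is"
    by (induction "is") (auto intro!: measurable_add_dirac measurable_const simp: space_NNsig)
  then show "(\<lambda>x. conf (map x [0..<n])) \<in> measurable (\<Pi>\<^sub>M i\<in>UNIV. borel) (NNsig :: 'a measure measure)" .
qed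

lemma nn_integral_conf:
  "f \<in> borel_measurable borel \<Longrightarrow> (\<integral>\<^sup>+y. f y \<partial>conf xs) = sum_list (map f xs)"
  by (induction xs) (simp_all add: nn_integral_add_dirac nn_integral_null_measure add.commute)

lemma emeasure_conf: "A \<in> sets borel \<Longrightarrow> emeasure (conf xs) A = sum_list (map (indicator A) xs)"
  using nn_integral_conf[of "indicator A" xs] by simp

lemma conf_mset_cong: "mset xs = mset ys \<Longrightarrow> conf xs = conf ys"
proof (rule measure_eqI)
  fix A assume "mset xs = mset ys" "A \<in> sets (conf xs)"
  moreover have "sum_list (map (indicator A) xs) = (\<Sum>x\<in>#mset xs. indicator A x :: ennreal)" for xs
    by (simp only: mset_map[symmetric] sum_mset_sum_list)
  ultimately show "emeasure (conf xs) A = emeasure (conf ys) A"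
    by (simp add: emeasure_conf)
qed simp

section \<open>The Lebesgue--Poisson measure\<close>

text \<open>The reversed order puts the last coordinate at the head of the list, so that splitting
  off the last factor of the product measure is the same as removing the head of the list.\<close>

definition Lk :: "'a::topological_space measure \<Rightarrow> nat \<Rightarrow> 'a list measure" where
  "Lk \<mu> k = distr (\<Pi>\<^sub>M i\<in>{..<k}. \<mu>) LS (\<lambda>x. map x (rev [0..<k]))"

definition ell :: "'a::topological_space measure \<Rightarrow> 'a list measure" where
  "ell \<mu> = msum (\<lambda>k. scale_measure (ennreal (1 / fact k)) (Lk \<mu> k))"

lemma sets_Lk[simp, measurable_cong]: "sets (Lk \<mu> k) = sets LS"
  and space_Lk[simp]: "space (Lk \<mu> k) = UNIV"
  and sets_ell[simp, measurable_cong]: "sets (ell \<mu>) = sets LS"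
  and space_ell[simp]: "space (ell \<mu>) = UNIV"
  by (simp_all add: Lk_def ell_def space_scale_measure)

lemma nn_integral_ell:
  assumes "F \<in> borel_measurable LS"
  shows "(\<integral>\<^sup>+\<xi>. F \<xi> \<partial>ell \<mu>) = (\<Sum>k. ennreal (1 / fact k) * (\<integral>\<^sup>+\<xi>. F \<xi> \<partial>Lk \<mu> k))"
  unfolding ell_def using assms
  by (subst nn_integral_msum) (auto intro!: suminf_cong nn_integral_scale_measure)

locale bd_finite =
  fixes \<mu> :: "'a::polish_space measure"
  assumes sets_mu[simp, measurable_cong]: "sets \<mu> = sets borel"
    and fin_mu: "\<And>B. B \<in> sets borel \<Longrightarrow> bounded B \<Longrightarrow> emeasure \<mu> B < \<infinity>"
begin

lemma space_mu[simp]: "space \<mu> = UNIV"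
  using sets_eq_imp_space_eq[OF sets_mu] by simp

sublocale sigma_finite_measure \<mu>
proof
  show "\<exists>A. countable A \<and> A \<subseteq> sets \<mu> \<and> \<Union>A = space \<mu> \<and> (\<forall>a\<in>A. emeasure \<mu> a \<noteq> \<infinity>)"
    using fin_mu[OF Lam_sets Lam_bounded] UN_Lam
    by (intro exI[of _ "range Lam"]) (auto simp: less_top)
qed

sublocale P: product_sigma_finite "\<lambda>_::nat. \<mu>"
  by standard

lemma measurable_map_rev: "(\<lambda>x. map x (rev [0..<k])) \<in> measurable (\<Pi>\<^sub>M i\<in>{..<k}. \<mu>) LS"
proof -
  have "sets (\<Pi>\<^sub>M i\<in>{..<k}. \<mu>) = sets (\<Pi>\<^sub>M i\<in>{..<k}. borel)"
    by (intro sets_PiM_cong) auto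
  then show ?thesis
    by (subst measurable_cong_sets[OF _ refl]) (auto intro!: measurable_map_LS)
qed

lemma nn_integral_Lk:
  "F \<in> borel_measurable LS \<Longrightarrow> (\<integral>\<^sup>+\<xi>. F \<xi> \<partial>Lk \<mu> k) = (\<integral>\<^sup>+x. F (map x (rev [0..<k])) \<partial>(\<Pi>\<^sub>M i\<in>{..<k}. \<mu>))"
  unfolding Lk_def using measurable_map_rev by (intro nn_integral_distr) auto

lemma nn_integral_Lk_0[simp]: "F \<in> borel_measurable LS \<Longrightarrow> (\<integral>\<^sup>+\<xi>. F \<xi> \<partial>Lk \<mu> 0) = F []"
  by (simp add: nn_integral_Lk PiM_empty nn_integral_count_space_finite)

lemma nn_integral_Lk_Suc:
  assumes F[measurable]: "F \<in> borel_measurable LS"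
  shows "(\<integral>\<^sup>+\<xi>. F \<xi> \<partial>Lk \<mu> (Suc k)) = (\<integral>\<^sup>+x. (\<integral>\<^sup>+\<xi>. F (x # \<xi>) \<partial>Lk \<mu> k) \<partial>\<mu>)"
proof -
  have m: "(\<lambda>x. F (map x (rev [0..<Suc k]))) \<in> borel_measurable (\<Pi>\<^sub>M i\<in>insert k {..<k}. \<mu>)"
    using measurable_compose[OF measurable_map_rev F, of "Suc k"] unfolding lessThan_Suc .
  have "(\<integral>\<^sup>+\<xi>. F \<xi> \<partial>Lk \<mu> (Suc k)) = (\<integral>\<^sup>+x. F (map x (rev [0..<Suc k])) \<partial>(\<Pi>\<^sub>M i\<in>insert k {..<k}. \<mu>))"
    by (simp only: nn_integral_Lk[OF F] lessThan_Suc)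
  also have "\<dots> = (\<integral>\<^sup>+y. (\<integral>\<^sup>+x. F (map (x(k := y)) (rev [0..<Suc k])) \<partial>(\<Pi>\<^sub>M i\<in>{..<k}. \<mu>)) \<partial>\<mu>)"
    by (rule P.product_nn_integral_insert_rev[OF _ _ m]) auto
  also have "\<dots> = (\<integral>\<^sup>+y. (\<integral>\<^sup>+\<xi>. F (y # \<xi>) \<partial>Lk \<mu> k) \<partial>\<mu>)"
  proof (rule nn_integral_cong)
    fix y
    have "map (x(k := y)) (rev [0..<k]) = map x (rev [0..<k])" for x :: "nat \<Rightarrow> 'a" by auto
    then show "(\<integral>\<^sup>+x. F (map (x(k := y)) (rev [0..<Suc k])) \<partial>(\<Pi>\<^sub>M i\<in>{..<k}. \<mu>)) = (\<integral>\<^sup>+\<xi>. F (y # \<xi>) \<partial>Lk \<mu> k)"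
      by (subst nn_integral_Lk) auto
  qed
  finally show ?thesis .
qed

lemma emeasure_Lk_subset:
  assumes [measurable]: "B \<in> sets borel"
  shows "emeasure (Lk \<mu> k) {\<xi>. set \<xi> \<subseteq> B} = emeasure \<mu> B ^ k"
proof -
  have "(\<integral>\<^sup>+\<xi>. indicator {\<xi>. set \<xi> \<subseteq> B} \<xi> \<partial>Lk \<mu> k) = emeasure \<mu> B ^ k"
  proof (induction k)
    case (Suc k)
    have "(\<integral>\<^sup>+\<xi>. indicator {\<xi>. set \<xi> \<subseteq> B} \<xi> \<partial>Lk \<mu> (Suc k))
        = (\<integral>\<^sup>+x. (\<integral>\<^sup>+\<xi>. indicator B x * indicator {\<xi>. set \<xi> \<subseteq> B} \<xi> \<partial>Lk \<mu> k) \<partial>\<mu>)"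
      by (subst nn_integral_Lk_Suc) (auto intro!: nn_integral_cong simp: indicator_def)
    also have "\<dots> = (\<integral>\<^sup>+x. indicator B x * emeasure \<mu> B ^ k \<partial>\<mu>)"
      by (subst nn_integral_cmult) (auto simp del: nn_integral_indicator simp: Suc)
    also have "\<dots> = emeasure \<mu> B ^ Suc k"
      by (subst nn_integral_multc) auto
    finally show ?case .
  qed (simp del: nn_integral_indicator)
  then show ?thesis by simp
qed

text \<open>Exponential series. On configurations inside a set B of finite mass,
  \<open>ell \<mu>\<close> is thus exp (\<mu> B) times the law of a Poisson process in B; this is
  also what makes \<open>ell \<mu>\<close> sigma-finite.\<close>

lemma emeasure_ell_subset:
  assumes [measurable]: "B \<in> sets borel" and fin: "emeasure \<mu> B < \<infinity>"
  shows "emeasure (ell \<mu>) {\<xi>. set \<xi> \<subseteq> B} = ennreal (exp (measure \<mu> B))"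
proof -
  have em: "emeasure \<mu> B = ennreal (measure \<mu> B)"
    using fin by (intro emeasure_eq_ennreal_measure) (simp add: less_top)
  have "emeasure (ell \<mu>) {\<xi>. set \<xi> \<subseteq> B} = (\<Sum>k. ennreal (1 / fact k) * (\<integral>\<^sup>+\<xi>. indicator {\<xi>. set \<xi> \<subseteq> B} \<xi> \<partial>Lk \<mu> k))"
    by (subst nn_integral_ell[symmetric]) auto
  also have "\<dots> = (\<Sum>k. ennreal (measure \<mu> B ^ k /\<^sub>R fact k))"
    by (intro suminf_cong)
      (simp add: emeasure_Lk_subset em ennreal_power ennreal_mult[symmetric] divide_inverse mult.commute)
  also have "\<dots> = ennreal (exp (measure \<mu> B))"
    by (rule suminf_ennreal_eq[OF _ exp_converges]) simp
  finally show ?thesis .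
qed

lemma sigma_finite_ell: "sigma_finite_measure (ell \<mu>)"
proof
  have "\<exists>n. set \<xi> \<subseteq> Lam n" for \<xi> :: "'a list"
    by (rule bounded_Lam[OF finite_imp_bounded[OF finite_set]])
  then show "\<exists>A. countable A \<and> A \<subseteq> sets (ell \<mu>) \<and> \<Union>A = space (ell \<mu>) \<and> (\<forall>a\<in>A. emeasure (ell \<mu>) a \<noteq> \<infinity>)"
    by (intro exI[of _ "range (\<lambda>n. {\<xi>. set \<xi> \<subseteq> Lam n})"])
       (auto simp: emeasure_ell_subset[OF Lam_sets fin_mu[OF Lam_sets Lam_bounded]])
qed

sublocale ell: sigma_finite_measure "ell \<mu>"
  by (rule sigma_finite_ell)

sublocale ell2: pair_sigma_finite "ell \<mu>" "ell \<mu>"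
  by standard

lemma sigma_finite_Lk: "sigma_finite_measure (Lk \<mu> k)"
proof
  have "\<exists>n. set \<xi> \<subseteq> Lam n" for \<xi> :: "'a list"
    by (rule bounded_Lam[OF finite_imp_bounded[OF finite_set]])
  then show "\<exists>A. countable A \<and> A \<subseteq> sets (Lk \<mu> k) \<and> \<Union>A = space (Lk \<mu> k) \<and> (\<forall>a\<in>A. emeasure (Lk \<mu> k) a \<noteq> \<infinity>)"
    using fin_mu[OF Lam_sets Lam_bounded]
    by (intro exI[of _ "range (\<lambda>n. {\<xi>. set \<xi> \<subseteq> Lam n})"])
       (auto simp: emeasure_Lk_subset power_eq_top_ennreal less_top[symmetric] dest: less_imp_neq)
qed

lemma nn_integral_Lk_measurable[measurable (raw)]:
  assumes "(\<lambda>(m, \<xi>). f m \<xi>) \<in> borel_measurable (M \<Otimes>\<^sub>M LS)"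
  shows "(\<lambda>m. \<integral>\<^sup>+\<xi>. f m \<xi> \<partial>Lk \<mu> k) \<in> borel_measurable M"
  by (rule sigma_finite_measure.borel_measurable_nn_integral[OF sigma_finite_Lk]) (use assms in measurable)

text \<open>This and \<open>AE_ell\<close> are how the null set of points violating the hypothesis
  is avoided by all entries of almost every configuration.\<close>

lemma AE_Lk:
  assumes "AE x in \<mu>. Q x"
  shows "AE \<xi> in Lk \<mu> k. \<forall>x\<in>set \<xi>. Q x"
proof -
  obtain N where N: "N \<in> sets \<mu>" "emeasure \<mu> N = 0" "{x\<in>space \<mu>. \<not> Q x} \<subseteq> N"
    using assms by (auto elim!: AE_E)
  have [measurable]: "N \<in> sets borel" using N by simp
  have "(\<integral>\<^sup>+\<xi>. indicator (- {\<xi>. set \<xi> \<subseteq> - N}) \<xi> \<partial>Lk \<mu> k) = 0"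
  proof (induction k)
    case (Suc k)
    have N0: "AE x in \<mu>. x \<notin> N" using N by (intro AE_not_in) (auto simp: null_sets_def)
    have "(\<integral>\<^sup>+\<xi>. indicator (- {\<xi>. set \<xi> \<subseteq> - N}) \<xi> \<partial>Lk \<mu> (Suc k))
        = (\<integral>\<^sup>+x. (\<integral>\<^sup>+\<xi>. indicator (- {\<xi>. set \<xi> \<subseteq> - N}) (x # \<xi>) \<partial>Lk \<mu> k) \<partial>\<mu>)"
      by (subst nn_integral_Lk_Suc) auto
    also have "\<dots> = (\<integral>\<^sup>+x. (\<integral>\<^sup>+\<xi>. indicator (- {\<xi>. set \<xi> \<subseteq> - N}) \<xi> \<partial>Lk \<mu> k) \<partial>\<mu>)"
      using N0 by (intro nn_integral_cong_AE) (auto simp: indicator_def)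
    finally show ?case using Suc by simp
  qed (simp del: nn_integral_indicator)
  then have "AE \<xi> in Lk \<mu> k. indicator (- {\<xi>. set \<xi> \<subseteq> - N}) \<xi> = (0::ennreal)"
    by (subst (asm) nn_integral_0_iff_AE) auto
  then show ?thesis
    by eventually_elim (use N(3) in \<open>auto simp: indicator_def\<close>)
qed

lemma AE_ell:
  assumes "AE x in \<mu>. Q x"
  shows "AE \<xi> in ell \<mu>. \<forall>x\<in>set \<xi>. Q x"
proof -
  obtain N where N: "N \<in> sets \<mu>" "emeasure \<mu> N = 0" "{x\<in>space \<mu>. \<not> Q x} \<subseteq> N"
    using assms by (auto elim!: AE_E)
  have [measurable]: "N \<in> sets borel" using N by simp
  have N0: "AE x in \<mu>. x \<in> - N" using N AE_not_in[of N \<mu>] by (auto simp: null_sets_def)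
  have "(\<integral>\<^sup>+\<xi>. indicator (- {\<xi>. set \<xi> \<subseteq> - N}) \<xi> \<partial>Lk \<mu> k) = 0" for k
    using AE_Lk[OF N0, of k] by (subst nn_integral_0_iff_AE) (auto simp: indicator_def)
  then have "(\<integral>\<^sup>+\<xi>. indicator (- {\<xi>. set \<xi> \<subseteq> - N}) \<xi> \<partial>ell \<mu>) = 0"
    by (subst nn_integral_ell) (auto simp del: nn_integral_indicator)
  then have "AE \<xi> in ell \<mu>. indicator (- {\<xi>. set \<xi> \<subseteq> - N}) \<xi> = (0::ennreal)"
    by (subst (asm) nn_integral_0_iff_AE) auto
  then show ?thesis
    by eventually_elim (use N(3) in \<open>auto simp: indicator_def\<close>)
qed

lemma AE_Lk_length: "AE \<xi> in Lk \<mu> k. length \<xi> = k"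
proof -
  have "{\<xi>. length \<xi> = k} = length -` {k} \<inter> space LS" by auto
  also have "\<dots> \<in> sets LS" by (rule measurable_sets[OF measurable_length_LS]) simp
  finally show ?thesis
    unfolding Lk_def by (subst AE_distr_iff) (auto intro!: measurable_map_rev)
qed

end

section \<open>Interaction of finite configurations\<close>

definition crossH :: "('a \<Rightarrow> 'a \<Rightarrow> ennreal) \<Rightarrow> 'a list \<Rightarrow> 'a list \<Rightarrow> real" where
  "crossH v xs ys = prod_list (map (\<lambda>x. prod_list (map (\<lambda>y. expneg (v x y)) ys)) xs)"

text \<open>The Boltzmann factor of the internal energy, that is, \<Prod> (1 + f) over all pairs of
  positions; \<open>crossH\<close> is the one of the mutual energy of two configurations.\<close>

primrec eH :: "('a \<Rightarrow> 'a \<Rightarrow> ennreal) \<Rightarrow> 'a list \<Rightarrow> real" where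
  "eH v [] = 1"
| "eH v (x # xs) = prod_list (map (\<lambda>y. expneg (v x y)) xs) * eH v xs"

definition vL :: "('a \<Rightarrow> 'a \<Rightarrow> ennreal) \<Rightarrow> 'a list \<Rightarrow> 'a \<Rightarrow> ennreal" where
  "vL v xs y = sum_list (map (\<lambda>x. v x y) xs)"

lemma vL_Nil[simp]: "vL v [] y = 0" and vL_Cons: "vL v (x # xs) y = v x y + vL v xs y"
  and vL_append: "vL v (xs @ ys) y = vL v xs y + vL v ys y"
  by (simp_all add: vL_def)

lemma prod_list_nonneg_le1:
  fixes g :: "'b \<Rightarrow> real"
  assumes "\<And>x. x \<in> set xs \<Longrightarrow> 0 \<le> g x \<and> g x \<le> 1"
  shows "0 \<le> prod_list (map g xs) \<and> prod_list (map g xs) \<le> 1"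
  using assms by (induction xs) (auto intro: mult_le_one)

lemma prod_list_mult: "prod_list (map (\<lambda>x. f x * g x) xs) = prod_list (map f xs) * prod_list (map g xs :: real list)"
  by (induction xs) simp_all

lemma crossH_Nil[simp]: "crossH v [] ys = 1" "crossH v xs [] = 1"
  by (induction xs) (auto simp: crossH_def)

lemma crossH_Cons: "crossH v (x # xs) ys = prod_list (map (\<lambda>y. expneg (v x y)) ys) * crossH v xs ys"
  by (simp add: crossH_def)

text \<open>Exchanging the two products turns the interaction with \<open>xs\<close> into a one-body
  potential felt by the points of \<open>ys\<close>.\<close>

lemma crossH_eq: "crossH v xs ys = prod_list (map (\<lambda>y. expneg (vL v xs y)) ys)"
  by (induction xs) (simp_all add: crossH_Cons vL_Cons expneg_add prod_list_mult, induction ys, auto)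

lemma eH_append: "eH v (xs @ ys) = eH v xs * crossH v xs ys * eH v ys"
  by (induction xs) (simp_all add: crossH_Cons)

lemma eH_bounds: "0 \<le> eH v xs \<and> eH v xs \<le> 1"
proof (induction xs)
  case (Cons x xs)
  have "0 \<le> prod_list (map (\<lambda>y. expneg (v x y)) xs) \<and> prod_list (map (\<lambda>y. expneg (v x y)) xs) \<le> 1"
    by (rule prod_list_nonneg_le1) simp
  then show ?case using Cons by (auto intro: mult_le_one)
qed simp

lemma eH_nonneg[simp]: "0 \<le> eH v xs" and eH_le_1[simp]: "eH v xs \<le> 1"
  using eH_bounds by auto

lemma crossH_bounds: "0 \<le> crossH v xs ys \<and> crossH v xs ys \<le> 1"
  unfolding crossH_eq by (rule prod_list_nonneg_le1) simp

lemma crossH_le_1[simp]: "crossH v xs ys \<le> 1"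
  using crossH_bounds by auto

lemma prod_list_mset: "mset xs = mset ys \<Longrightarrow> prod_list (map f xs) = prod_list (map f ys :: real list)"
  by (simp flip: prod_mset_prod_list)

lemma vL_mset: "mset xs = mset ys \<Longrightarrow> vL v xs = vL v ys"
  unfolding vL_def by (intro ext) (simp flip: sum_mset_sum_list)

lemma eH_middle:
  assumes "\<And>x y. v x y = v y x"
  shows "eH v (xs @ x # ys) = eH v (x # xs @ ys)"
  by (induction xs) (simp_all add: assms)

lemma eH_mset:
  assumes v: "\<And>x y. v x y = v y x" shows "mset xs = mset ys \<Longrightarrow> eH v xs = eH v ys"
proof (induction xs arbitrary: ys)
  case (Cons x xs)
  then have "x \<in> set ys" using mset_eq_setD by fastforce
  then obtain y1 y2 where ys: "ys = y1 @ x # y2" by (meson split_list)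
  have m: "mset xs = mset (y1 @ y2)" using Cons.prems by (simp add: ys)
  show ?case
    unfolding ys eH_middle[OF v] eH.simps using Cons.IH[OF m] prod_list_mset[OF m] by simp
qed simp

section \<open>Gibbs measures\<close>

text \<open>\<open>gibbs\<close> with the activity absorbed into the measure: \<mu> stands for z
  times lam.\<close>

definition gibbsm :: "'a::metric_space measure \<Rightarrow> ('a \<Rightarrow> 'a \<Rightarrow> ennreal) \<Rightarrow> 'a measure measure \<Rightarrow> bool" where
  "gibbsm \<mu> v P \<longleftrightarrow> prob_space P \<and> sets P = sets NNsig \<and>
     (\<forall>F \<in> borel_measurable (borel \<Otimes>\<^sub>M NNsig). (\<forall>p. F p < \<infinity>) \<longrightarrow>
        (\<integral>\<^sup>+ \<eta>. (\<integral>\<^sup>+ x. F (x, \<eta>) \<partial>\<eta>) \<partial>P) =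
        (\<integral>\<^sup>+ x. (\<integral>\<^sup>+ \<eta>. F (x, add_dirac \<eta> x) * ennreal (expneg (WW v x \<eta>)) \<partial>P) \<partial>\<mu>))"

definition LL :: "'a measure measure \<Rightarrow> ('a \<Rightarrow> ennreal) \<Rightarrow> real" where
  "LL P u = (\<integral>\<eta>. expneg (\<integral>\<^sup>+y. u y \<partial>\<eta>) \<partial>P)"

locale potential = bd_finite \<mu> for \<mu> :: "'a::polish_space measure" +
  fixes v :: "'a \<Rightarrow> 'a \<Rightarrow> ennreal"
  assumes v_measurable: "(\<lambda>p. v (fst p) (snd p)) \<in> borel_measurable (borel \<Otimes>\<^sub>M borel)"
    and v_sym: "v x y = v y x"
begin

lemma v_measurable'[measurable]: "(\<lambda>(x, y). v x y) \<in> borel_measurable (borel \<Otimes>\<^sub>M borel)"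
  using v_measurable by (simp add: case_prod_unfold)

lemma vL_measurable[measurable (raw)]:
  assumes [measurable]: "f \<in> measurable M LS" "g \<in> borel_measurable M"
  shows "(\<lambda>m. vL v (f m) (g m)) \<in> borel_measurable M"
  unfolding vL_def by measurable

lemma eH_measurable[measurable]: "eH v \<in> borel_measurable LS"
proof (rule measurable_LS_fromI)
  fix n
  have "(\<lambda>x. eH v (map x is)) \<in> borel_measurable (\<Pi>\<^sub>M i\<in>UNIV. borel)" for "is"
  proof (induction "is")
    case (Cons i "is")
    have [measurable]: "(\<lambda>x. map x is) \<in> measurable (\<Pi>\<^sub>M i\<in>UNIV. borel) LS"
      by (rule measurable_map_LS) simp
    have "(\<lambda>x. prod_list (map (\<lambda>y. expneg (v (x i) y)) (map x is)) * eH v (map x is)) \<in> borel_measurable (\<Pi>\<^sub>M i\<in>UNIV. borel)"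
      using Cons by measurable
    then show ?case by simp
  qed simp
  then show "(\<lambda>x. eH v (map x [0..<n])) \<in> borel_measurable (\<Pi>\<^sub>M i\<in>UNIV. borel)" .
qed

lemma WW_measurable[measurable (raw)]:
  assumes [measurable]: "f \<in> borel_measurable M" "g \<in> measurable M NNsig"
  shows "(\<lambda>m. WW v (f m) (g m)) \<in> borel_measurable M"
  unfolding WW_def by (rule measurable_nn_integral_NN) measurable

end

locale gibbs_meas = potential \<mu> v for \<mu> :: "'a::polish_space measure" and v +
  fixes P :: "'a measure measure"
  assumes gibbsP: "gibbsm \<mu> v P"
begin

sublocale prob_space P
  using gibbsP by (simp add: gibbsm_def)

lemma sets_P[simp, measurable_cong]: "sets P = sets NNsig"
  using gibbsP by (simp add: gibbsm_def)

lemma space_P[simp]: "space P = NN"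
  using sets_eq_imp_space_eq[OF sets_P] by (simp add: space_NNsig)

lemma GNZ:
  assumes "F \<in> borel_measurable (borel \<Otimes>\<^sub>M NNsig)" "\<And>p. F p < \<infinity>"
  shows "(\<integral>\<^sup>+ \<eta>. (\<integral>\<^sup>+ x. F (x, \<eta>) \<partial>\<eta>) \<partial>P) =
        (\<integral>\<^sup>+ x. (\<integral>\<^sup>+ \<eta>. F (x, add_dirac \<eta> x) * ennreal (expneg (WW v x \<eta>)) \<partial>P) \<partial>\<mu>)"
  using gibbsP assms by (simp add: gibbsm_def)

lemma measurable_inner[measurable (raw)]:
  assumes [measurable]: "(\<lambda>(m, y). u m y) \<in> borel_measurable (M \<Otimes>\<^sub>M borel)" and [measurable]: "h \<in> measurable M NNsig"
  shows "(\<lambda>m. \<integral>\<^sup>+y. u m y \<partial>h m) \<in> borel_measurable M"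
  by (rule measurable_nn_integral_NN) measurable

lemma nn_LL:
  assumes [measurable]: "u \<in> borel_measurable borel"
  shows "(\<integral>\<^sup>+\<eta>. ennreal (expneg (\<integral>\<^sup>+y. u y \<partial>\<eta>)) \<partial>P) = ennreal (LL P u)"
proof -
  have "(\<lambda>\<eta>. expneg (\<integral>\<^sup>+y. u y \<partial>\<eta>)) \<in> borel_measurable P" by measurable
  then show ?thesis unfolding LL_def
    by (intro nn_integral_eq_integral integrable_const_bound[where B=1]) auto
qed

lemma LL_nonneg[simp]: "0 \<le> LL P u"
  unfolding LL_def by (rule Bochner_Integration.integral_nonneg) simp

lemma LL_le_1:
  assumes [measurable]: "u \<in> borel_measurable borel"
  shows "LL P u \<le> 1"
proof -
  have "ennreal (LL P u) \<le> (\<integral>\<^sup>+\<eta>. 1 \<partial>P)"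
    unfolding nn_LL[OF assms, symmetric] by (intro nn_integral_mono) simp
  also have "(\<integral>\<^sup>+\<eta>. 1 \<partial>P) = 1" using emeasure_space_1 by simp
  finally show ?thesis by simp
qed

lemma LL_measurable[measurable (raw)]:
  assumes [measurable]: "(\<lambda>(m, y). u m y) \<in> borel_measurable (M \<Otimes>\<^sub>M borel)"
  shows "(\<lambda>m. LL P (u m)) \<in> borel_measurable M"
proof -
  have "(\<lambda>(m, \<eta>). ennreal (expneg (\<integral>\<^sup>+y. u m y \<partial>\<eta>))) \<in> borel_measurable (M \<Otimes>\<^sub>M P)"
    by measurable
  then have "(\<lambda>m. enn2real (\<integral>\<^sup>+\<eta>. ennreal (expneg (\<integral>\<^sup>+y. u m y \<partial>\<eta>)) \<partial>P)) \<in> borel_measurable M"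
    by (intro borel_measurable_enn2real borel_measurable_nn_integral)
  also have "?this \<longleftrightarrow> ?thesis"
  proof (rule measurable_cong)
    fix m assume "m \<in> space M"
    then have "u m \<in> borel_measurable borel" using assms by measurable
    then show "enn2real (\<integral>\<^sup>+\<eta>. ennreal (expneg (\<integral>\<^sup>+y. u m y \<partial>\<eta>)) \<partial>P) = LL P (u m)"
      by (simp add: nn_LL)
  qed
  finally show ?thesis .
qed

text \<open>The Gibbs equation closes on Laplace functionals: the added point x contributes the
  factor exp (- u x), and its Boltzmann factor merely adds \<open>v x\<close> to the potential
  u.\<close>

lemma GNZ_exp:
  assumes [measurable]: "f \<in> borel_measurable borel" "u \<in> borel_measurable borel" and fin: "\<And>x. f x < \<infinity>"
  shows "(\<integral>\<^sup>+ \<eta>. (\<integral>\<^sup>+ x. f x \<partial>\<eta>) * ennreal (expneg (\<integral>\<^sup>+y. u y \<partial>\<eta>)) \<partial>P) =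
    (\<integral>\<^sup>+ x. f x * ennreal (expneg (u x)) * ennreal (LL P (\<lambda>y. u y + v x y)) \<partial>\<mu>)"
proof -
  let ?F = "\<lambda>(x, \<eta>). f x * ennreal (expneg (\<integral>\<^sup>+y. u y \<partial>\<eta>))"
  have "(\<integral>\<^sup>+ \<eta>. (\<integral>\<^sup>+ x. f x \<partial>\<eta>) * ennreal (expneg (\<integral>\<^sup>+y. u y \<partial>\<eta>)) \<partial>P) =
      (\<integral>\<^sup>+ \<eta>. (\<integral>\<^sup>+ x. ?F (x, \<eta>) \<partial>\<eta>) \<partial>P)"
    by (intro nn_integral_cong) (simp add: nn_integral_multc NN_measurable)
  also have "\<dots> = (\<integral>\<^sup>+ x. (\<integral>\<^sup>+ \<eta>. ?F (x, add_dirac \<eta> x) * ennreal (expneg (WW v x \<eta>)) \<partial>P) \<partial>\<mu>)"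
    using fin by (intro GNZ) (measurable, auto simp: ennreal_mult_less_top)
  also have "\<dots> = (\<integral>\<^sup>+ x. f x * ennreal (expneg (u x)) * ennreal (LL P (\<lambda>y. u y + v x y)) \<partial>\<mu>)"
  proof (intro nn_integral_cong)
    fix x
    have "(\<integral>\<^sup>+ \<eta>. ?F (x, add_dirac \<eta> x) * ennreal (expneg (WW v x \<eta>)) \<partial>P) =
        (\<integral>\<^sup>+ \<eta>. f x * ennreal (expneg (u x)) * ennreal (expneg (\<integral>\<^sup>+y. u y + v x y \<partial>\<eta>)) \<partial>P)"
      by (intro nn_integral_cong)
         (simp add: nn_integral_add_dirac NN_sets NN_measurable nn_integral_add expneg_add WW_def ennreal_mult mult_ac)
    also have "\<dots> = f x * ennreal (expneg (u x)) * ennreal (LL P (\<lambda>y. u y + v x y))"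
      by (subst nn_integral_cmult) (simp_all add: nn_LL)
    finally show "(\<integral>\<^sup>+ \<eta>. ?F (x, add_dirac \<eta> x) * ennreal (expneg (WW v x \<eta>)) \<partial>P) = \<dots>" .
  qed
  finally show ?thesis .
qed

text \<open>By repulsion the intensity measure of P is dominated by \<mu>. It follows that
  \<mu>-integrable functions have finite \<eta>-integrals almost surely.\<close>

lemma nn_integral_P_le:
  assumes f[measurable]: "f \<in> borel_measurable borel" and fin: "\<And>x. f x < \<infinity>"
  shows "(\<integral>\<^sup>+ \<eta>. (\<integral>\<^sup>+ x. f x \<partial>\<eta>) \<partial>P) \<le> (\<integral>\<^sup>+ x. f x \<partial>\<mu>)"
proof -
  have "(\<integral>\<^sup>+ \<eta>. (\<integral>\<^sup>+ x. f x \<partial>\<eta>) \<partial>P) = (\<integral>\<^sup>+ x. f x * ennreal (LL P (v x)) \<partial>\<mu>)"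
    using GNZ_exp[OF f _ fin, of "\<lambda>_. 0"] by simp
  also have "\<dots> \<le> (\<integral>\<^sup>+ x. f x * 1 \<partial>\<mu>)"
    by (intro nn_integral_mono mult_left_mono) (auto intro!: LL_le_1 simp: ennreal_le_1)
  finally show ?thesis by simp
qed

end

section \<open>Interpolation towards an additional one-body potential\<close>

text \<open>The potential whose Boltzmann factor is \<open>1 - r p\<close>.\<close>

definition lg :: "real \<Rightarrow> real \<Rightarrow> ennreal" where
  "lg r p = (if r * p < 1 then ennreal (- ln (1 - r * p)) else \<infinity>)"

lemma lg_measurable[measurable (raw)]:
  assumes [measurable]: "f \<in> borel_measurable M" "g \<in> borel_measurable M"
  shows "(\<lambda>m. lg (f m) (g m)) \<in> borel_measurable M"
  unfolding lg_def by measurable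

lemma expneg_lg: "0 \<le> r * p \<Longrightarrow> r * p \<le> 1 \<Longrightarrow> expneg (lg r p) = 1 - r * p"
  by (auto simp: lg_def expneg_def enn2real_ennreal)

lemma lg_expneg: "lg 1 (1 - expneg w) = w"
  by (cases w) (auto simp: lg_def expneg_def)

lemma lg_mono: "0 \<le> p \<Longrightarrow> r \<le> s \<Longrightarrow> lg r p \<le> lg s p"
proof -
  assume a: "0 \<le> p" "r \<le> s"
  then have "r * p \<le> s * p" by (rule mult_right_mono[rotated])
  then show ?thesis by (auto simp: lg_def intro!: ennreal_leI)
qed

text \<open>The fundamental theorem of calculus for exp (- A r), where A r = \<integral> - ln (1 - r
  g) d\<eta>. Differentiation under the integral is avoided by expanding the logarithm: A is a power
  series in r with coefficients \<integral> g^n d\<eta> / n, all bounded by \<integral> g d\<eta>,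
  hence differentiable termwise for r < 1.\<close>

lemma interpolation_path_lt1:
  fixes \<eta> :: "'b measure"
  assumes g[measurable]: "g \<in> borel_measurable \<eta>" and g01: "\<And>y. 0 \<le> g y \<and> g y \<le> 1"
    and fin: "(\<integral>\<^sup>+y. ennreal (g y) \<partial>\<eta>) < \<infinity>" and s: "0 \<le> s" "s < 1"
  shows "1 = ennreal (expneg (\<integral>\<^sup>+y. lg s (g y) \<partial>\<eta>)) +
    (\<integral>\<^sup>+r. (\<integral>\<^sup>+y. ennreal (g y / (1 - r * g y)) \<partial>\<eta>) * ennreal (expneg (\<integral>\<^sup>+y. lg r (g y) \<partial>\<eta>)) * indicator {0..s} r \<partial>lborel)"
proof -
  define p where "p j = enn2real (\<integral>\<^sup>+y. ennreal (g y ^ j) \<partial>\<eta>)" for j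
  have gle: "g y ^ Suc j \<le> g y" for y j
    using g01[of y] by (simp add: mult_left_le power_le_one)
  have pfin: "(\<integral>\<^sup>+y. ennreal (g y ^ Suc j) \<partial>\<eta>) \<le> (\<integral>\<^sup>+y. ennreal (g y) \<partial>\<eta>)" for j
    by (intro nn_integral_mono ennreal_leI gle)
  have pe: "(\<integral>\<^sup>+y. ennreal (g y ^ Suc j) \<partial>\<eta>) = ennreal (p (Suc j))" for j
    unfolding p_def using le_less_trans[OF pfin[of j]] fin by (intro ennreal_enn2real[symmetric]) simp
  have p0: "0 \<le> p j" for j by (simp add: p_def)
  have p1: "p (Suc j) \<le> p 1" for j
    unfolding p_def using pfin[of j] fin by (simp add: enn2real_mono)
  define c where "c n = p n / real n" for n
  have c0: "0 \<le> c n" for n using p0 by (simp add: c_def)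
  have cle: "c n \<le> p 1" for n
  proof (cases n)
    case (Suc m)
    have "p (Suc m) / real (Suc m) \<le> p (Suc m) / 1"
      by (intro divide_left_mono) (use p0 in auto)
    then show ?thesis using p1[of m] by (simp add: c_def Suc)
  qed (simp add: c_def p0)
  have summ: "summable (\<lambda>n. c n * K ^ n)" if "0 \<le> K" "K < 1" for K :: real
  proof (rule summable_comparison_test')
    show "summable (\<lambda>n. p 1 * K ^ n)" using that by (intro summable_mult summable_geometric) simp
    show "norm (c n * K ^ n) \<le> p 1 * K ^ n" for n
      using c0 cle that by (simp add: abs_mult mult_right_mono)
  qed
  define A where "A r = (\<Sum>n. c n * r ^ n)" for r
  define a where "a r = (\<Sum>n. diffs c n * r ^ n)" for r
  have dA: "DERIV A r :> a r" if "0 \<le> r" "r < 1" for r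
    unfolding A_def[abs_def] a_def
    by (rule termdiffs_strong[where K="(1 + r) / 2"]) (use that in \<open>auto intro!: summ\<close>)
  have summ': "summable (\<lambda>n. diffs c n * r ^ n)" if "0 \<le> r" "r < 1" for r
    by (rule termdiff_converges[where K="1"]) (use that in \<open>auto intro!: summable_comparison_test'[OF summ[of "\<bar>_\<bar>"], where N=0] simp: abs_mult c0 power_abs\<close>)
  have diffs: "diffs c n = p (Suc n)" for n by (simp add: diffs_def c_def)
  have a0: "0 \<le> a r" if "0 \<le> r" "r < 1" for r
    unfolding a_def using that p0 summ'[OF that] by (intro suminf_nonneg) (auto simp: diffs)
  have A0: "0 \<le> A r" if "0 \<le> r" "r < 1" for r
    unfolding A_def using that c0 summ[OF that] by (intro suminf_nonneg) auto
  have eA: "(\<integral>\<^sup>+y. lg r (g y) \<partial>\<eta>) = ennreal (A r)" if r: "0 \<le> r" "r < 1" for r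
  proof -
    have rg: "0 \<le> r * g y \<and> r * g y < 1" for y
      using r g01[of y] by (auto intro: le_less_trans[OF mult_left_le])
    have "lg r (g y) = (\<Sum>n. ennreal (r ^ n / real n) * ennreal (g y ^ n))" for y
    proof -
      have "(\<lambda>n. (r * g y) ^ n / real n) sums (- ln (1 - r * g y))"
        using sums_minus[OF ln_series'[of "- (r * g y)"]] rg[of y] by simp
      then have "(\<Sum>n. ennreal ((r * g y) ^ n / real n)) = ennreal (- ln (1 - r * g y))"
        using rg[of y] by (intro suminf_ennreal_eq) auto
      then show ?thesis using rg[of y] r g01[of y]
        by (simp add: lg_def power_mult_distrib ennreal_mult[symmetric] divide_simps)
    qed
    then have "(\<integral>\<^sup>+y. lg r (g y) \<partial>\<eta>) = (\<Sum>n. ennreal (r ^ n / real n) * (\<integral>\<^sup>+y. ennreal (g y ^ n) \<partial>\<eta>))"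
      by (simp add: nn_integral_suminf nn_integral_cmult)
    also have "\<dots> = (\<Sum>n. ennreal (c n * r ^ n))"
    proof (rule suminf_cong)
      fix n show "ennreal (r ^ n / real n) * (\<integral>\<^sup>+y. ennreal (g y ^ n) \<partial>\<eta>) = ennreal (c n * r ^ n)"
      proof (cases n)
        case (Suc m) then show ?thesis using pe[of m] r p0
          by (simp del: power_Suc add: ennreal_mult[symmetric] c_def mult.commute)
      qed (simp add: c_def)
    qed
    also have "\<dots> = ennreal (A r)"
      using r c0 summ[OF r] unfolding A_def by (intro suminf_ennreal2) auto
    finally show ?thesis .
  qed
  have ea: "(\<integral>\<^sup>+y. ennreal (g y / (1 - r * g y)) \<partial>\<eta>) = ennreal (a r)" if r: "0 \<le> r" "r < 1" for r
  proof -
    have rg: "0 \<le> r * g y \<and> r * g y < 1" for y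
      using r g01[of y] by (auto intro: le_less_trans[OF mult_left_le])
    have "ennreal (g y / (1 - r * g y)) = (\<Sum>n. ennreal (r ^ n) * ennreal (g y ^ Suc n))" for y
    proof -
      have "(\<lambda>n. g y * (r * g y) ^ n) sums (g y * (1 / (1 - r * g y)))"
        using rg[of y] by (intro sums_mult geometric_sums) simp
      then have "(\<Sum>n. ennreal (g y * (r * g y) ^ n)) = ennreal (g y / (1 - r * g y))"
        using rg[of y] g01[of y] by (intro suminf_ennreal_eq) auto
      then show ?thesis using r g01[of y]
        by (simp add: power_mult_distrib ennreal_mult[symmetric] mult_ac)
    qed
    then have "(\<integral>\<^sup>+y. ennreal (g y / (1 - r * g y)) \<partial>\<eta>) = (\<Sum>n. ennreal (r ^ n) * (\<integral>\<^sup>+y. ennreal (g y ^ Suc n) \<partial>\<eta>))"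
      by (simp add: nn_integral_suminf nn_integral_cmult del: power_Suc)
    also have "\<dots> = (\<Sum>n. ennreal (diffs c n * r ^ n))"
      using r p0 by (intro suminf_cong) (simp del: power_Suc add: pe ennreal_mult[symmetric] diffs mult.commute)
    also have "\<dots> = ennreal (a r)"
      using r p0 summ'[OF r] unfolding a_def by (intro suminf_ennreal2) (auto simp: diffs)
    finally show ?thesis .
  qed
  have [measurable]: "A \<in> borel_measurable borel" "a \<in> borel_measurable borel"
    unfolding A_def[abs_def] a_def[abs_def] by measurable
  \<comment> \<open>The antiderivative is - exp (- A r), with A' = a and A 0 = 0.\<close>
  have "(\<integral>\<^sup>+r. ennreal (a r * exp (- A r)) * indicator {0..s} r \<partial>lborel) = ennreal (- exp (- A s) - (- exp (- A 0)))"
    using s by (intro nn_integral_FTC_Icc) (auto intro!: derivative_eq_intros dA a0 mult_nonneg_nonneg)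
  also have "A 0 = 0" unfolding A_def by (subst powser_zero) (simp add: c_def)
  finally have F: "(\<integral>\<^sup>+r. ennreal (a r * exp (- A r)) * indicator {0..s} r \<partial>lborel) = ennreal (1 - exp (- A s))"
    by simp
  have "(\<integral>\<^sup>+r. (\<integral>\<^sup>+y. ennreal (g y / (1 - r * g y)) \<partial>\<eta>) * ennreal (expneg (\<integral>\<^sup>+y. lg r (g y) \<partial>\<eta>)) * indicator {0..s} r \<partial>lborel)
     = (\<integral>\<^sup>+r. ennreal (a r * exp (- A r)) * indicator {0..s} r \<partial>lborel)"
    using s by (intro nn_integral_cong) (auto simp: indicator_def ea eA A0 a0 expneg_def ennreal_mult)
  moreover have "expneg (\<integral>\<^sup>+y. lg s (g y) \<partial>\<eta>) = exp (- A s)"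
    using s by (simp add: eA A0 expneg_def)
  ultimately show ?thesis
    using A0[OF s] by (simp add: F flip: ennreal_plus)
qed

text \<open>The endpoint s = 1 is the one of interest, but there the logarithm is infinite wherever
  g = 1. It is reached by monotone convergence along parameters increasing to s.\<close>

lemma interpolation_path:
  fixes \<eta> :: "'b measure"
  assumes g[measurable]: "g \<in> borel_measurable \<eta>" and g01: "\<And>y. 0 \<le> g y \<and> g y \<le> 1"
    and fin: "(\<integral>\<^sup>+y. ennreal (g y) \<partial>\<eta>) < \<infinity>" and s: "0 \<le> s" "s \<le> 1"
    and meas: "(\<lambda>r. (\<integral>\<^sup>+y. ennreal (g y / (1 - r * g y)) \<partial>\<eta>) * ennreal (expneg (\<integral>\<^sup>+y. lg r (g y) \<partial>\<eta>))) \<in> borel_measurable borel"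
  shows "1 = ennreal (expneg (\<integral>\<^sup>+y. lg s (g y) \<partial>\<eta>)) +
    (\<integral>\<^sup>+r. (\<integral>\<^sup>+y. ennreal (g y / (1 - r * g y)) \<partial>\<eta>) * ennreal (expneg (\<integral>\<^sup>+y. lg r (g y) \<partial>\<eta>)) * indicator {0..<s} r \<partial>lborel)"
proof -
  define q where "q r = (\<integral>\<^sup>+y. ennreal (g y / (1 - r * g y)) \<partial>\<eta>) * ennreal (expneg (\<integral>\<^sup>+y. lg r (g y) \<partial>\<eta>))" for r
  have [measurable]: "q \<in> borel_measurable borel" using meas by (simp add: q_def[abs_def])
  \<comment> \<open>Strictly below 1 even for s = 1, and increasing to s.\<close>
  define t where "t n = s * (1 - 1 / (real n + 2))" for n
  have t: "0 \<le> t n \<and> t n < 1 \<and> t n \<le> s" for n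
  proof -
    have a: "1 - 1 / (real n + 2) < 1" "0 \<le> 1 - 1 / (real n + 2)" by (simp_all add: divide_simps)
    then have "t n \<le> s * 1" "t n \<le> 1 * (1 - 1 / (real n + 2))" "0 \<le> t n"
      unfolding t_def using s by (intro mult_left_mono mult_right_mono mult_nonneg_nonneg; simp)+
    then show ?thesis using a by (auto intro: le_less_trans)
  qed
  have tmono: "t n \<le> t m" if "n \<le> m" for n m
    unfolding t_def using that s by (intro mult_left_mono diff_left_mono divide_left_mono) auto
  have tlim: "t \<longlonglongrightarrow> s"
  proof -
    have "(\<lambda>n. 1 / (real n + 2)) \<longlonglongrightarrow> 0"
      using LIMSEQ_ignore_initial_segment[OF lim_1_over_n, of 2] by (simp add: add.commute)
    then have "(\<lambda>n. s * (1 - 1 / (real n + 2))) \<longlonglongrightarrow> s * (1 - 0)"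
      by (intro tendsto_intros)
    then show ?thesis by (simp add: t_def[abs_def])
  qed
  have lgtendsto: "(\<lambda>n. lg (t n) p) \<longlonglongrightarrow> lg s p" if p: "0 \<le> p" "p \<le> 1" for p
  proof (cases "s * p < 1")
    case True
    have "t n * p < 1" for n using t[of n] p True by (meson le_less_trans mult_right_mono)
    moreover have "(\<lambda>n. ennreal (- ln (1 - t n * p))) \<longlonglongrightarrow> ennreal (- ln (1 - s * p))"
      using True by (intro tendsto_intros tendsto_ennrealI tlim) auto
    ultimately show ?thesis using True by (simp add: lg_def)
  next
    case False
    \<comment> \<open>The singular case occurs only for s = p = 1, where both sides are infinite in
      the limit.\<close>
    have "s * p \<le> s * 1" using p s by (intro mult_left_mono) auto
    then have "s = 1" using False s by auto
    then have s1: "s = 1" "p = 1" using False p by auto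
    have "(\<lambda>n. ennreal (- ln (1 - t n))) \<longlonglongrightarrow> \<infinity>"
    proof -
      have "filterlim (\<lambda>n. 1 - t n) (at_right 0) sequentially"
        using t tlim s1 by (intro tendsto_imp_filterlim_at_right) (auto intro!: tendsto_eq_intros always_eventually)
      from filterlim_compose[OF ln_at_0 this]
      have "filterlim (\<lambda>n. - ln (1 - t n)) at_top sequentially" by (simp add: filterlim_uminus_at_top)
      then show ?thesis by (simp add: ennreal_tendsto_top_eq_at_top)
    qed
    then show ?thesis using t s1 by (simp add: lg_def)
  qed
  have "(\<lambda>n. \<integral>\<^sup>+y. lg (t n) (g y) \<partial>\<eta>) \<longlonglongrightarrow> (\<integral>\<^sup>+y. lg s (g y) \<partial>\<eta>)"
    using g01 tmono lgtendsto
    by (intro nn_integral_LIMSEQ) (auto simp: incseq_def le_fun_def intro!: lg_mono)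
  then have 1: "(\<lambda>n. ennreal (expneg (\<integral>\<^sup>+y. lg (t n) (g y) \<partial>\<eta>))) \<longlonglongrightarrow> ennreal (expneg (\<integral>\<^sup>+y. lg s (g y) \<partial>\<eta>))"
    by (intro tendsto_ennrealI tendsto_expneg)
  have 2: "(\<lambda>n. \<integral>\<^sup>+r. q r * indicator {0..<s} r * indicator {0..t n} r \<partial>lborel) \<longlonglongrightarrow> (\<integral>\<^sup>+r. q r * indicator {0..<s} r \<partial>lborel)"
  proof (rule nn_integral_LIMSEQ)
    show "incseq (\<lambda>n r. q r * indicator {0..<s} r * indicator {0..t n} r)"
      using tmono by (auto simp: incseq_def le_fun_def indicator_def intro: order_trans)
    fix r
    show "(\<lambda>n. q r * indicator {0..<s} r * indicator {0..t n} r) \<longlonglongrightarrow> q r * indicator {0..<s} r"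
    proof (cases "r \<in> {0..<s}")
      case True
      then have "eventually (\<lambda>n. r < t n) sequentially" using order_tendstoD(1)[OF tlim, of r] by simp
      then have "eventually (\<lambda>n. q r * indicator {0..<s} r * indicator {0..t n} r = q r * indicator {0..<s} r) sequentially"
        by eventually_elim (use True in auto)
      then show ?thesis by (rule tendsto_eventually)
    qed simp
  qed simp_all
  have "(\<integral>\<^sup>+r. q r * indicator {0..<s} r * indicator {0..t n} r \<partial>lborel) = (\<integral>\<^sup>+r. q r * indicator {0..t n} r \<partial>lborel)" for n
  proof (rule nn_integral_cong_AE)
    have "AE r in lborel. r \<noteq> s" by (rule AE_lborel_singleton)
    then show "AE r in lborel. q r * indicator {0..<s} r * indicator {0..t n} r = q r * indicator {0..t n} r"
      by eventually_elim (use t[of n] in \<open>auto simp: indicator_def\<close>)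
  qed
  then have "1 = ennreal (expneg (\<integral>\<^sup>+y. lg (t n) (g y) \<partial>\<eta>)) + (\<integral>\<^sup>+r. q r * indicator {0..<s} r * indicator {0..t n} r \<partial>lborel)" for n
    using interpolation_path_lt1[OF g g01 fin, of "t n"] t[of n] by (simp add: q_def)
  moreover from tendsto_add[OF 1 2] have "(\<lambda>n. ennreal (expneg (\<integral>\<^sup>+y. lg (t n) (g y) \<partial>\<eta>)) + (\<integral>\<^sup>+r. q r * indicator {0..<s} r * indicator {0..t n} r \<partial>lborel))
    \<longlonglongrightarrow> ennreal (expneg (\<integral>\<^sup>+y. lg s (g y) \<partial>\<eta>)) + (\<integral>\<^sup>+r. q r * indicator {0..<s} r \<partial>lborel)" .
  ultimately have "(\<lambda>n. 1::ennreal) \<longlonglongrightarrow> ennreal (expneg (\<integral>\<^sup>+y. lg s (g y) \<partial>\<eta>)) + (\<integral>\<^sup>+r. q r * indicator {0..<s} r \<partial>lborel)"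
    by simp
  from LIMSEQ_unique[OF tendsto_const this] show ?thesis by (simp add: q_def)
qed

lemma nn_integral_monomial:
  assumes "0 \<le> s"
  shows "(\<integral>\<^sup>+r. ennreal (r ^ k / fact k) * indicator {0..<s} r \<partial>lborel) = ennreal (s ^ Suc k / fact (Suc k))"
proof -
  have "(\<integral>\<^sup>+r. ennreal (r ^ k / fact k) * indicator {0..<s} r \<partial>lborel) = (\<integral>\<^sup>+r. ennreal (r ^ k / fact k) * indicator {0..s} r \<partial>lborel)"
    by (rule nn_integral_cong_AE) (use AE_lborel_singleton[of s] in \<open>eventually_elim, auto simp: indicator_def\<close>)
  also have "\<dots> = ennreal (s ^ Suc k / fact (Suc k) - 0 ^ Suc k / fact (Suc k))"
  proof (rule nn_integral_FTC_Icc)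
    fix r :: real
    have "((\<lambda>r. r ^ Suc k / fact (Suc k)) has_real_derivative (real (Suc k) * r ^ k / fact (Suc k))) (at r)"
      by (auto intro!: derivative_eq_intros simp del: power_Suc fact_Suc)
    moreover have "real (Suc k) * r ^ k / fact (Suc k) = r ^ k / fact k"
      unfolding fact_Suc by (rule mult_divide_mult_cancel_left) simp
    ultimately show "((\<lambda>r. r ^ Suc k / fact (Suc k)) has_real_derivative r ^ k / fact k) (at r)"
      by (simp only:)
  qed (use assms in auto)
  finally show ?thesis by simp
qed

section \<open>Interpolated Laplace functionals and their alternating expansion\<close>

context gibbs_meas
begin

text \<open>The pathwise identity, weighted with exp (- \<integral> h d\<eta>) and averaged;
  \<open>GNZ_exp\<close> turns the derivative term into an integral over one added point. This is
  what the logarithmic interpolation is made for: no r-dependent factor of the added point survives,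
  so that iterating the identity produces pure powers of r.\<close>

lemma interpolation:
  assumes g[measurable]: "g \<in> borel_measurable borel" and g01: "\<And>y. 0 \<le> g y \<and> g y \<le> 1"
    and fin: "(\<integral>\<^sup>+y. ennreal (g y) \<partial>\<mu>) < \<infinity>" and s: "0 \<le> s" "s \<le> 1"
    and h[measurable]: "h \<in> borel_measurable borel"
  shows "ennreal (LL P h) = ennreal (LL P (\<lambda>y. lg s (g y) + h y)) +
    (\<integral>\<^sup>+r. (\<integral>\<^sup>+x. ennreal (g x * expneg (h x)) * ennreal (LL P (\<lambda>y. lg r (g y) + (h y + v x y))) \<partial>\<mu>) * indicator {0..<s} r \<partial>lborel)"
proof -
  have AEfin: "AE \<eta> in P. (\<integral>\<^sup>+y. ennreal (g y) \<partial>\<eta>) < \<infinity>"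
  proof -
    have "(\<integral>\<^sup>+\<eta>. (\<integral>\<^sup>+y. ennreal (g y) \<partial>\<eta>) \<partial>P) < \<infinity>"
      by (rule le_less_trans[OF nn_integral_P_le fin]) auto
    then have "AE \<eta> in P. (\<integral>\<^sup>+y. ennreal (g y) \<partial>\<eta>) \<noteq> \<infinity>"
      by (intro nn_integral_PInf_AE) auto
    then show ?thesis by (simp add: less_top)
  qed
  define q where "q r \<eta> = (\<integral>\<^sup>+y. ennreal (g y / (1 - r * g y)) \<partial>\<eta>) * ennreal (expneg (\<integral>\<^sup>+y. lg r (g y) \<partial>\<eta>))" for r \<eta>
  have [measurable]: "(\<lambda>(r, \<eta>). q r \<eta>) \<in> borel_measurable (borel \<Otimes>\<^sub>M P)"
    unfolding q_def by measurable
  have [measurable]: "(\<lambda>(\<eta>, r). q r \<eta>) \<in> borel_measurable (P \<Otimes>\<^sub>M borel)"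
    unfolding q_def by measurable
  let ?H = "\<lambda>\<eta>. ennreal (expneg (\<integral>\<^sup>+y. h y \<partial>\<eta>))"
  have "ennreal (LL P h) = (\<integral>\<^sup>+\<eta>. ?H \<eta> \<partial>P)" by (simp add: nn_LL)
  also have "\<dots> = (\<integral>\<^sup>+\<eta>. ennreal (expneg (\<integral>\<^sup>+y. lg s (g y) + h y \<partial>\<eta>)) +
      (\<integral>\<^sup>+r. q r \<eta> * ?H \<eta> * indicator {0..<s} r \<partial>lborel) \<partial>P)"
  proof (rule nn_integral_cong_AE)
    show "AE \<eta> in P. ?H \<eta> = ennreal (expneg (\<integral>\<^sup>+y. lg s (g y) + h y \<partial>\<eta>)) +
      (\<integral>\<^sup>+r. q r \<eta> * ?H \<eta> * indicator {0..<s} r \<partial>lborel)"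
      using AEfin AE_space
    proof eventually_elim
      case (elim \<eta>)
      then have N: "\<eta> \<in> NN" by simp
      note [measurable] = NN_measurable[OF N g] NN_measurable[OF N h]
      have m[measurable]: "(\<lambda>r. q r \<eta>) \<in> borel_measurable borel" using elim by measurable
      have "?H \<eta> = 1 * ?H \<eta>" by simp
      also have "1 = ennreal (expneg (\<integral>\<^sup>+y. lg s (g y) \<partial>\<eta>)) + (\<integral>\<^sup>+r. q r \<eta> * indicator {0..<s} r \<partial>lborel)"
        using elim(1) m unfolding q_def by (intro interpolation_path g01 s) auto
      also have "\<dots> * ?H \<eta> = ennreal (expneg (\<integral>\<^sup>+y. lg s (g y) + h y \<partial>\<eta>)) +
          (\<integral>\<^sup>+r. q r \<eta> * indicator {0..<s} r * ?H \<eta> \<partial>lborel)"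
        by (subst nn_integral_multc) (auto simp: distrib_right nn_integral_add expneg_add ennreal_mult)
      also have "\<dots> = ennreal (expneg (\<integral>\<^sup>+y. lg s (g y) + h y \<partial>\<eta>)) +
          (\<integral>\<^sup>+r. q r \<eta> * ?H \<eta> * indicator {0..<s} r \<partial>lborel)"
        by (simp only: mult_ac)
      finally show ?case .
    qed
  qed
  also have "\<dots> = ennreal (LL P (\<lambda>y. lg s (g y) + h y)) +
      (\<integral>\<^sup>+\<eta>. (\<integral>\<^sup>+r. q r \<eta> * ?H \<eta> * indicator {0..<s} r \<partial>lborel) \<partial>P)"
    by (subst nn_integral_add) (auto simp: nn_LL)
  also have "(\<integral>\<^sup>+\<eta>. (\<integral>\<^sup>+r. q r \<eta> * ?H \<eta> * indicator {0..<s} r \<partial>lborel) \<partial>P)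
      = (\<integral>\<^sup>+r. (\<integral>\<^sup>+\<eta>. q r \<eta> * ?H \<eta> * indicator {0..<s} r \<partial>P) \<partial>lborel)"
  proof -
    interpret PL: pair_sigma_finite P lborel
      by (intro pair_sigma_finite.intro sigma_finite_measure_axioms sigma_finite_lborel)
    show ?thesis by (rule PL.Fubini'[symmetric]) measurable
  qed
  also have "\<dots> = (\<integral>\<^sup>+r. (\<integral>\<^sup>+x. ennreal (g x * expneg (h x)) * ennreal (LL P (\<lambda>y. lg r (g y) + (h y + v x y))) \<partial>\<mu>) * indicator {0..<s} r \<partial>lborel)"
  proof (rule nn_integral_cong)
    fix r :: real
    show "(\<integral>\<^sup>+\<eta>. q r \<eta> * ?H \<eta> * indicator {0..<s} r \<partial>P) =
       (\<integral>\<^sup>+x. ennreal (g x * expneg (h x)) * ennreal (LL P (\<lambda>y. lg r (g y) + (h y + v x y))) \<partial>\<mu>) * indicator {0..<s} r"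
    proof (cases "r \<in> {0..<s}")
      case True
      \<comment> \<open>The half-open interval excludes r = 1; hence r g < 1, and the Boltzmann
        factor 1 - r g of the added point cancels the denominator.\<close>
      then have r: "0 \<le> r" "r < 1" using s by auto
      have rg: "0 \<le> r * g y \<and> r * g y < 1" for y
        using r g01[of y] by (auto intro: le_less_trans[OF mult_left_le])
      have "(\<integral>\<^sup>+\<eta>. q r \<eta> * ?H \<eta> \<partial>P) =
          (\<integral>\<^sup>+\<eta>. (\<integral>\<^sup>+y. ennreal (g y / (1 - r * g y)) \<partial>\<eta>) * ennreal (expneg (\<integral>\<^sup>+y. lg r (g y) + h y \<partial>\<eta>)) \<partial>P)"
        by (intro nn_integral_cong) (simp add: q_def nn_integral_add NN_measurable expneg_add ennreal_mult mult_ac)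
      also have "\<dots> = (\<integral>\<^sup>+ x. ennreal (g x / (1 - r * g x)) * ennreal (expneg (lg r (g x) + h x)) *
          ennreal (LL P (\<lambda>y. lg r (g y) + h y + v x y)) \<partial>\<mu>)"
        by (rule GNZ_exp) auto
      also have "\<dots> = (\<integral>\<^sup>+x. ennreal (g x * expneg (h x)) * ennreal (LL P (\<lambda>y. lg r (g y) + (h y + v x y))) \<partial>\<mu>)"
      proof (intro nn_integral_cong arg_cong2[where f="(*)"])
        fix x
        show "ennreal (g x / (1 - r * g x)) * ennreal (expneg (lg r (g x) + h x)) = ennreal (g x * expneg (h x))"
          using rg[of x] g01[of x] by (simp add: expneg_add expneg_lg ennreal_mult[symmetric] less_imp_le)
      qed (simp add: add.assoc)
      finally show ?thesis using True by simp
    qed simp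
  qed
  finally show ?thesis .
qed

text \<open>The integral of \<Prod> g against the k-th factorial moment measure of P weighted by exp
  (- \<integral> h d\<eta>), written out by means of the Gibbs equation. It is, up to sign, the k-th
  Taylor coefficient times k! at r = 0.\<close>

definition cc :: "('a \<Rightarrow> real) \<Rightarrow> nat \<Rightarrow> ('a \<Rightarrow> ennreal) \<Rightarrow> ennreal" where
  "cc g k h = (\<integral>\<^sup>+\<xi>. ennreal (prod_list (map (\<lambda>y. g y * expneg (h y)) \<xi>) * eH v \<xi> * LL P (\<lambda>y. h y + vL v \<xi> y)) \<partial>Lk \<mu> k)"

lemma cc_0: assumes [measurable]: "g \<in> borel_measurable borel" "h \<in> borel_measurable borel" shows "cc g 0 h = ennreal (LL P h)"
  unfolding cc_def by (subst nn_integral_Lk_0) auto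

lemma cc_Suc:
  assumes g[measurable]: "g \<in> borel_measurable borel" and g01: "\<And>y. 0 \<le> g y \<and> g y \<le> 1" and h[measurable]: "h \<in> borel_measurable borel"
  shows "cc g (Suc k) h = (\<integral>\<^sup>+x. ennreal (g x * expneg (h x)) * cc g k (\<lambda>y. h y + v x y) \<partial>\<mu>)"
proof -
  have "cc g (Suc k) h = (\<integral>\<^sup>+x. \<integral>\<^sup>+\<xi>. ennreal (prod_list (map (\<lambda>y. g y * expneg (h y)) (x # \<xi>)) * eH v (x # \<xi>) * LL P (\<lambda>y. h y + vL v (x # \<xi>) y)) \<partial>Lk \<mu> k \<partial>\<mu>)"
    unfolding cc_def by (subst nn_integral_Lk_Suc) auto
  also have "\<dots> = (\<integral>\<^sup>+x. ennreal (g x * expneg (h x)) * cc g k (\<lambda>y. h y + v x y) \<partial>\<mu>)"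
  proof (rule nn_integral_cong)
    fix x
    have "ennreal (prod_list (map (\<lambda>y. g y * expneg (h y)) (x # \<xi>)) * eH v (x # \<xi>) * LL P (\<lambda>y. h y + vL v (x # \<xi>) y)) =
       ennreal (g x * expneg (h x)) * ennreal (prod_list (map (\<lambda>y. g y * expneg (h y + v x y)) \<xi>) * eH v \<xi> * LL P (\<lambda>y. h y + v x y + vL v \<xi> y))" for \<xi>
    proof -
      have "prod_list (map (\<lambda>y. g y * expneg (h y)) (x # \<xi>)) * eH v (x # \<xi>) * LL P (\<lambda>y. h y + vL v (x # \<xi>) y) =
         g x * expneg (h x) * (prod_list (map (\<lambda>y. g y * expneg (h y + v x y)) \<xi>) * eH v \<xi> * LL P (\<lambda>y. h y + v x y + vL v \<xi> y))"
        by (simp add: expneg_add prod_list_mult vL_Cons add.assoc mult_ac)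
      moreover have "0 \<le> g x * expneg (h x)" using g01 by simp
      moreover have "0 \<le> prod_list (map (\<lambda>y. g y * expneg (h y + v x y)) \<xi>) * eH v \<xi> * LL P (\<lambda>y. h y + v x y + vL v \<xi> y)"
        using g01 by (intro mult_nonneg_nonneg prod_list_nonneg) auto
      ultimately show ?thesis by (simp only: ennreal_mult)
    qed
    then show "(\<integral>\<^sup>+\<xi>. ennreal (prod_list (map (\<lambda>y. g y * expneg (h y)) (x # \<xi>)) * eH v (x # \<xi>) * LL P (\<lambda>y. h y + vL v (x # \<xi>) y)) \<partial>Lk \<mu> k)
      = ennreal (g x * expneg (h x)) * cc g k (\<lambda>y. h y + v x y)"
      unfolding cc_def by (simp add: nn_integral_cmult)
  qed
  finally show ?thesis .
qed

lemma cc_measurable[measurable (raw)]: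
  assumes [measurable]: "g \<in> borel_measurable borel" "(\<lambda>(m, y). h m y) \<in> borel_measurable (M \<Otimes>\<^sub>M borel)"
  shows "(\<lambda>m. cc g k (h m)) \<in> borel_measurable M"
proof -
  interpret L: sigma_finite_measure "Lk \<mu> k" by (rule sigma_finite_Lk)
  show ?thesis unfolding cc_def
    by (rule L.borel_measurable_nn_integral) measurable
qed

text \<open>All Boltzmann factors are at most 1. Together with 1 / k! this makes the expansion
  converge for every integrable g, with no smallness condition.\<close>

lemma cc_le:
  assumes g[measurable]: "g \<in> borel_measurable borel" and g01: "\<And>y. 0 \<le> g y \<and> g y \<le> 1"
    and h: "h \<in> borel_measurable borel"
  shows "cc g k h \<le> (\<integral>\<^sup>+y. ennreal (g y) \<partial>\<mu>) ^ k"
  using h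
proof (induction k arbitrary: h)
  case 0 then show ?case by (simp add: cc_0 LL_le_1 ennreal_le_1)
next
  case (Suc k)
  note [measurable] = Suc.prems
  have "cc g (Suc k) h \<le> (\<integral>\<^sup>+x. ennreal (g x) * (\<integral>\<^sup>+y. ennreal (g y) \<partial>\<mu>) ^ k \<partial>\<mu>)"
    unfolding cc_Suc[OF g g01 Suc.prems]
    using g01 by (intro nn_integral_mono mult_mono Suc.IH ennreal_leI mult_left_le) auto
  also have "\<dots> = (\<integral>\<^sup>+y. ennreal (g y) \<partial>\<mu>) ^ Suc k"
    by (subst nn_integral_multc) auto
  finally show ?case .
qed

text \<open>\<open>b = True\<close> collects the even terms below order m and
  \<open>b = False\<close> the odd ones; even minus odd is the Taylor polynomial.\<close>

definition Ssum :: "bool \<Rightarrow> ('a \<Rightarrow> real) \<Rightarrow> nat \<Rightarrow> real \<Rightarrow> ('a \<Rightarrow> ennreal) \<Rightarrow> ennreal" where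
  "Ssum b g m s h = (\<Sum>k\<in>{k. k < m \<and> even k = b}. ennreal (s ^ k / fact k) * cc g k h)"

lemma finite_lt_parity: "finite {k::nat. k < m \<and> even k = b}"
  by (rule finite_subset[of _ "{..<m}"]) auto

lemma Ssum_Suc:
  "Ssum True g (Suc m) s h = cc g 0 h + (\<Sum>k\<in>{k. k < m \<and> even k = False}. ennreal (s ^ Suc k / fact (Suc k)) * cc g (Suc k) h)"
  "Ssum False g (Suc m) s h = (\<Sum>k\<in>{k. k < m \<and> even k = True}. ennreal (s ^ Suc k / fact (Suc k)) * cc g (Suc k) h)"
proof -
  have 1: "{k. k < Suc m \<and> even k = True} = insert 0 (Suc ` {k. k < m \<and> even k = False})"
    by (auto simp: image_iff elim: less_SucE) (metis Suc_less_eq not0_implies_Suc even_Suc)+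
  have 2: "{k. k < Suc m \<and> even k = False} = Suc ` {k. k < m \<and> even k = True}"
    by (auto simp: image_iff) (metis Suc_less_eq not0_implies_Suc even_Suc even_zero)+
  have fin: "finite (Suc ` {k. k < m \<and> even k = b})" for b by (intro finite_imageI finite_lt_parity)
  show "Ssum True g (Suc m) s h = cc g 0 h + (\<Sum>k\<in>{k. k < m \<and> even k = False}. ennreal (s ^ Suc k / fact (Suc k)) * cc g (Suc k) h)"
    unfolding Ssum_def 1 by (subst sum.insert[OF fin]) (auto simp: sum.reindex comp_def simp del: power_Suc fact_Suc)
  show "Ssum False g (Suc m) s h = (\<Sum>k\<in>{k. k < m \<and> even k = True}. ennreal (s ^ Suc k / fact (Suc k)) * cc g (Suc k) h)"
    unfolding Ssum_def 2 by (simp add: sum.reindex comp_def del: power_Suc fact_Suc)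
qed

text \<open>Integration over a new point and over r raises the order of every term by one; this is
  the operation that occurs in \<open>interpolation\<close>.\<close>

lemma Ssum_integral:
  assumes g[measurable]: "g \<in> borel_measurable borel" and g01: "\<And>y. 0 \<le> g y \<and> g y \<le> 1"
    and h[measurable]: "h \<in> borel_measurable borel" and s: "0 \<le> s"
  shows "(\<integral>\<^sup>+r. (\<integral>\<^sup>+x. ennreal (g x * expneg (h x)) * Ssum b g m r (\<lambda>y. h y + v x y) \<partial>\<mu>) * indicator {0..<s} r \<partial>lborel) =
    (\<Sum>k\<in>{k. k < m \<and> even k = b}. ennreal (s ^ Suc k / fact (Suc k)) * cc g (Suc k) h)"
proof -
  have "(\<integral>\<^sup>+x. ennreal (g x * expneg (h x)) * Ssum b g m r (\<lambda>y. h y + v x y) \<partial>\<mu>) =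
      (\<Sum>k\<in>{k. k < m \<and> even k = b}. ennreal (r ^ k / fact k) * cc g (Suc k) h)" for r
  proof -
    have "(\<integral>\<^sup>+x. ennreal (g x * expneg (h x)) * Ssum b g m r (\<lambda>y. h y + v x y) \<partial>\<mu>) =
       (\<integral>\<^sup>+x. (\<Sum>k\<in>{k. k < m \<and> even k = b}. ennreal (r ^ k / fact k) * (ennreal (g x * expneg (h x)) * cc g k (\<lambda>y. h y + v x y))) \<partial>\<mu>)"
      by (simp add: Ssum_def sum_distrib_left mult_ac)
    also have "\<dots> = (\<Sum>k\<in>{k. k < m \<and> even k = b}. ennreal (r ^ k / fact k) * cc g (Suc k) h)"
      by (subst nn_integral_sum) (auto simp: nn_integral_cmult cc_Suc[OF g g01 h])
    finally show ?thesis .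
  qed
  then have "(\<integral>\<^sup>+r. (\<integral>\<^sup>+x. ennreal (g x * expneg (h x)) * Ssum b g m r (\<lambda>y. h y + v x y) \<partial>\<mu>) * indicator {0..<s} r \<partial>lborel) =
     (\<integral>\<^sup>+r. (\<Sum>k\<in>{k. k < m \<and> even k = b}. cc g (Suc k) h * (ennreal (r ^ k / fact k) * indicator {0..<s} r)) \<partial>lborel)"
    by (simp only: sum_distrib_right) (intro nn_integral_cong sum.cong refl, simp only: mult_ac)
  also have "\<dots> = (\<Sum>k\<in>{k. k < m \<and> even k = b}. cc g (Suc k) h * (\<integral>\<^sup>+r. ennreal (r ^ k / fact k) * indicator {0..<s} r \<partial>lborel))"
    by (subst nn_integral_sum) (auto intro!: sum.cong nn_integral_cmult)
  finally show ?thesis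
    unfolding nn_integral_monomial[OF s] by (simp only: mult.commute)
qed

text \<open>The partial sums of the alternating expansion bracket the interpolated functional
  (Bonferroni inequalities); with all terms moved to the side on which they are positive the
  induction takes place in \<open>[0, \<infinity>]\<close> and no integrability has to be discussed.\<close>

lemma bonferroni:
  assumes g[measurable]: "g \<in> borel_measurable borel" and g01: "\<And>y. 0 \<le> g y \<and> g y \<le> 1"
    and fin: "(\<integral>\<^sup>+y. ennreal (g y) \<partial>\<mu>) < \<infinity>" and s: "0 \<le> s" "s \<le> 1"
    and h: "h \<in> borel_measurable borel"
  shows "(odd m \<longrightarrow> ennreal (LL P (\<lambda>y. lg s (g y) + h y)) + Ssum False g m s h \<le> Ssum True g m s h) \<and>
    (even m \<longrightarrow> Ssum True g m s h \<le> ennreal (LL P (\<lambda>y. lg s (g y) + h y)) + Ssum False g m s h)"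
  using s h
proof (induction m arbitrary: s h)
  case 0 then show ?case by (simp add: Ssum_def)
next
  case (Suc m)
  note h[measurable] = Suc.prems(3)
  define \<Lambda> where "\<Lambda> r x = ennreal (LL P (\<lambda>y. lg r (g y) + (h y + v x y)))" for r x
  define J where "J X = (\<integral>\<^sup>+r. (\<integral>\<^sup>+x. ennreal (g x * expneg (h x)) * X r x \<partial>\<mu>) * indicator {0..<s} r \<partial>lborel)" for X
  \<comment> \<open>The functional and the remainder \<open>J \<Lambda>\<close> have a fixed sum, so
    an upper bound for \<Lambda> at order m becomes a lower bound for the functional at order m + 1,
    and conversely.\<close>
  have ie: "cc g 0 h = ennreal (LL P (\<lambda>y. lg s (g y) + h y)) + J \<Lambda>"
    unfolding J_def \<Lambda>_def using interpolation[OF g g01 fin Suc.prems] by (simp add: cc_0)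
  have Jmono: "J X \<le> J Y" if "\<And>r x. 0 \<le> r \<Longrightarrow> r < s \<Longrightarrow> X r x \<le> Y r x" for X Y
    unfolding J_def by (intro nn_integral_mono) (auto simp: indicator_def intro!: nn_integral_mono mult_left_mono that)
  have m1[measurable]: "(\<lambda>(r, x). \<Lambda> r x) \<in> borel_measurable (borel \<Otimes>\<^sub>M borel)"
    unfolding \<Lambda>_def by measurable
  have m2[measurable]: "(\<lambda>(r, x). Ssum b g m r (\<lambda>y. h y + v x y)) \<in> borel_measurable (borel \<Otimes>\<^sub>M borel)" for b
    unfolding Ssum_def by measurable
  have Jadd: "J (\<lambda>r x. \<Lambda> r x + Ssum False g m r (\<lambda>y. h y + v x y)) = J \<Lambda> + J (\<lambda>r x. Ssum False g m r (\<lambda>y. h y + v x y))"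
  proof -
    have "(\<integral>\<^sup>+x. ennreal (g x * expneg (h x)) * (\<Lambda> r x + Ssum False g m r (\<lambda>y. h y + v x y)) \<partial>\<mu>) =
       (\<integral>\<^sup>+x. ennreal (g x * expneg (h x)) * \<Lambda> r x \<partial>\<mu>) + (\<integral>\<^sup>+x. ennreal (g x * expneg (h x)) * Ssum False g m r (\<lambda>y. h y + v x y) \<partial>\<mu>)" for r
      unfolding distrib_left by (rule nn_integral_add) measurable
    then show ?thesis unfolding J_def
      by (simp add: distrib_right) (rule nn_integral_add; measurable)
  qed
  have S1: "Ssum True g (Suc m) s h = cc g 0 h + J (\<lambda>r x. Ssum False g m r (\<lambda>y. h y + v x y))"
    and S2: "Ssum False g (Suc m) s h = J (\<lambda>r x. Ssum True g m r (\<lambda>y. h y + v x y))"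
    unfolding J_def by (simp_all only: Ssum_integral[OF g g01 h Suc.prems(1)] Ssum_Suc)
  have IH: "(odd m \<longrightarrow> \<Lambda> r x + Ssum False g m r (\<lambda>y. h y + v x y) \<le> Ssum True g m r (\<lambda>y. h y + v x y)) \<and>
    (even m \<longrightarrow> Ssum True g m r (\<lambda>y. h y + v x y) \<le> \<Lambda> r x + Ssum False g m r (\<lambda>y. h y + v x y))"
    if "0 \<le> r" "r < s" for r x
    unfolding \<Lambda>_def using that Suc.prems(2) by (intro Suc.IH) auto
  show ?case
  proof (cases "odd m")
    case True
    then have "J \<Lambda> + J (\<lambda>r x. Ssum False g m r (\<lambda>y. h y + v x y)) \<le> J (\<lambda>r x. Ssum True g m r (\<lambda>y. h y + v x y))"
      unfolding Jadd[symmetric] using IH by (intro Jmono) auto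
    then show ?thesis using True unfolding S1 S2 ie by (simp add: add.assoc add_left_mono)
  next
    case False
    then have "J (\<lambda>r x. Ssum True g m r (\<lambda>y. h y + v x y)) \<le> J \<Lambda> + J (\<lambda>r x. Ssum False g m r (\<lambda>y. h y + v x y))"
      unfolding Jadd[symmetric] using IH by (intro Jmono) auto
    then show ?thesis using False unfolding S1 S2 ie by (simp add: add.assoc add_left_mono)
  qed
qed

end

section \<open>Integrals over finite configurations as series in the number of points\<close>

context bd_finite
begin

lemma sums_ell_nonneg:
  fixes F :: "'a list \<Rightarrow> real"
  assumes F: "integrable (ell \<mu>) F" and nn: "\<And>\<xi>. 0 \<le> F \<xi>"
  shows "(\<lambda>k. (1 / fact k) * (\<integral>\<xi>. F \<xi> \<partial>Lk \<mu> k)) sums (\<integral>\<xi>. F \<xi> \<partial>ell \<mu>)"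
    and "integrable (Lk \<mu> k) F"
proof -
  have m[measurable]: "F \<in> borel_measurable LS"
    using borel_measurable_integrable[OF F] by (simp add: measurable_cong_sets[OF sets_ell refl])
  have e: "ennreal (\<integral>\<xi>. F \<xi> \<partial>ell \<mu>) = (\<Sum>k. ennreal (1 / fact k) * (\<integral>\<^sup>+\<xi>. ennreal (F \<xi>) \<partial>Lk \<mu> k))"
    using nn F by (subst nn_integral_eq_integral[symmetric]) (simp_all add: nn_integral_ell)
  have fin: "(\<integral>\<^sup>+\<xi>. ennreal (F \<xi>) \<partial>Lk \<mu> k) < \<infinity>" for k
  proof -
    have "ennreal (1 / fact k) * (\<integral>\<^sup>+\<xi>. ennreal (F \<xi>) \<partial>Lk \<mu> k) \<le> (\<Sum>k. ennreal (1 / fact k) * (\<integral>\<^sup>+\<xi>. ennreal (F \<xi>) \<partial>Lk \<mu> k))"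
      using sum_le_suminf[OF summableI, of "{k}" "\<lambda>k. ennreal (1 / fact k) * (\<integral>\<^sup>+\<xi>. ennreal (F \<xi>) \<partial>Lk \<mu> k)"] by simp
    also have "\<dots> < \<infinity>" by (simp flip: e)
    finally show ?thesis by (auto simp: ennreal_mult_less_top)
  qed
  show int: "integrable (Lk \<mu> k) F" for k
    using fin[of k] nn by (intro integrableI_nonneg) auto
  have t: "ennreal (1 / fact k) * (\<integral>\<^sup>+\<xi>. ennreal (F \<xi>) \<partial>Lk \<mu> k) = ennreal ((1 / fact k) * (\<integral>\<xi>. F \<xi> \<partial>Lk \<mu> k))" for k
    using nn by (subst nn_integral_eq_integral[OF int]) (simp_all add: ennreal_mult[symmetric] integral_nonneg_AE)
  have p: "0 \<le> (1 / fact k) * (\<integral>\<xi>. F \<xi> \<partial>Lk \<mu> k)" for k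
    using nn by (intro mult_nonneg_nonneg integral_nonneg_AE) auto
  have "(\<Sum>k. ennreal ((1 / fact k) * (\<integral>\<xi>. F \<xi> \<partial>Lk \<mu> k))) = ennreal (\<integral>\<xi>. F \<xi> \<partial>ell \<mu>)"
    by (simp only: e t)
  moreover from this have "summable (\<lambda>k. (1 / fact k) * (\<integral>\<xi>. F \<xi> \<partial>Lk \<mu> k))"
    using p by (intro summable_suminf_not_top) auto
  ultimately have "(\<Sum>k. (1 / fact k) * (\<integral>\<xi>. F \<xi> \<partial>Lk \<mu> k)) = (\<integral>\<xi>. F \<xi> \<partial>ell \<mu>)"
    using p nn by (subst (asm) suminf_ennreal2) (auto simp: suminf_nonneg integral_nonneg_AE)
  with \<open>summable _\<close> show "(\<lambda>k. (1 / fact k) * (\<integral>\<xi>. F \<xi> \<partial>Lk \<mu> k)) sums (\<integral>\<xi>. F \<xi> \<partial>ell \<mu>)"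
    by (simp add: sums_iff)
qed

lemma sums_ell:
  fixes F :: "'a list \<Rightarrow> real"
  assumes F: "integrable (ell \<mu>) F"
  shows "(\<lambda>k. (1 / fact k) * (\<integral>\<xi>. F \<xi> \<partial>Lk \<mu> k)) sums (\<integral>\<xi>. F \<xi> \<partial>ell \<mu>)"
proof -
  have 1: "integrable (ell \<mu>) (\<lambda>\<xi>. max 0 (F \<xi>))" "integrable (ell \<mu>) (\<lambda>\<xi>. max 0 (- F \<xi>))"
    using F by auto
  have eq: "F \<xi> = max 0 (F \<xi>) - max 0 (- F \<xi>)" for \<xi> by auto
  have "(\<integral>\<xi>. F \<xi> \<partial>Lk \<mu> k) = (\<integral>\<xi>. max 0 (F \<xi>) \<partial>Lk \<mu> k) - (\<integral>\<xi>. max 0 (- F \<xi>) \<partial>Lk \<mu> k)" for k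
    by (subst eq, rule Bochner_Integration.integral_diff) (auto intro!: sums_ell_nonneg(2) 1)
  moreover have "(\<integral>\<xi>. F \<xi> \<partial>ell \<mu>) = (\<integral>\<xi>. max 0 (F \<xi>) \<partial>ell \<mu>) - (\<integral>\<xi>. max 0 (- F \<xi>) \<partial>ell \<mu>)"
    by (subst eq, rule Bochner_Integration.integral_diff) (auto intro!: 1)
  moreover have "(\<lambda>k. (1 / fact k) * (\<integral>\<xi>. max 0 (F \<xi>) \<partial>Lk \<mu> k) - (1 / fact k) * (\<integral>\<xi>. max 0 (- F \<xi>) \<partial>Lk \<mu> k))
     sums ((\<integral>\<xi>. max 0 (F \<xi>) \<partial>ell \<mu>) - (\<integral>\<xi>. max 0 (- F \<xi>) \<partial>ell \<mu>))"
    by (intro sums_diff sums_ell_nonneg(1) 1) auto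
  ultimately show ?thesis by (simp add: right_diff_distrib)
qed

end

section \<open>The convergent Mayer expansion\<close>

context gibbs_meas
begin

text \<open>Consecutive partial sums lie on opposite sides of the value, so the error is at most the
  next term, which \<open>cc_le\<close> bounds by \<gamma> ^ m / m!.\<close>

lemma taylor_sums:
  assumes g[measurable]: "g \<in> borel_measurable borel" and g01: "\<And>y. 0 \<le> g y \<and> g y \<le> 1"
    and fin: "(\<integral>\<^sup>+y. ennreal (g y) \<partial>\<mu>) < \<infinity>" and h[measurable]: "h \<in> borel_measurable borel"
  shows "(\<lambda>k. (- 1) ^ k / fact k * enn2real (cc g k h)) sums LL P (\<lambda>y. lg 1 (g y) + h y)"
proof -
  define \<gamma> where "\<gamma> = enn2real (\<integral>\<^sup>+y. ennreal (g y) \<partial>\<mu>)"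
  define C where "C k = enn2real (cc g k h)" for k
  have \<gamma>: "(\<integral>\<^sup>+y. ennreal (g y) \<partial>\<mu>) = ennreal \<gamma>" "0 \<le> \<gamma>"
    unfolding \<gamma>_def using fin by simp_all
  have "cc g k h \<le> ennreal (\<gamma> ^ k)" for k
    using cc_le[OF g g01 h, of k] \<gamma> by (simp add: ennreal_power)
  then have C: "cc g k h = ennreal (C k)" "C k \<le> \<gamma> ^ k" "0 \<le> C k" for k
  proof -
    show "cc g k h = ennreal (C k)" unfolding C_def
      using le_less_trans[OF \<open>cc g k h \<le> ennreal (\<gamma> ^ k)\<close> ennreal_less_top] by simp
    then show "C k \<le> \<gamma> ^ k" using \<open>cc g k h \<le> ennreal (\<gamma> ^ k)\<close> \<gamma>(2) by simp
  qed (simp add: C_def)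
  define R where "R b m = (\<Sum>k<m. if even k = b then C k / fact k else 0)" for b m
  have R0: "0 \<le> R b m" for b m unfolding R_def using C(3) by (intro sum_nonneg) auto
  have S: "Ssum b g m 1 h = ennreal (R b m)" for b m
  proof -
    have "Ssum b g m 1 h = (\<Sum>k\<in>{k. k < m \<and> even k = b}. ennreal (C k / fact k))"
      unfolding Ssum_def using C by (intro sum.cong) (simp_all add: ennreal_mult[symmetric])
    also have "\<dots> = ennreal (\<Sum>k\<in>{k. k < m \<and> even k = b}. C k / fact k)"
      using C(3) by (intro sum_ennreal) auto
    also have "(\<Sum>k\<in>{k. k < m \<and> even k = b}. C k / fact k) = R b m"
      unfolding R_def by (subst sum.inter_filter[symmetric]) (auto intro!: sum.cong)
    finally show ?thesis .
  qed
  define X where "X = LL P (\<lambda>y. lg 1 (g y) + h y)"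
  have X: "(odd m \<longrightarrow> X + R False m \<le> R True m) \<and> (even m \<longrightarrow> R True m \<le> X + R False m)" for m
  proof -
    have "0 \<le> X" by (simp add: X_def)
    then have "ennreal X + ennreal (R False m) = ennreal (X + R False m)" "0 \<le> X + R False m"
      using R0 by simp_all
    then show ?thesis
      using bonferroni[OF g g01 fin _ _ h, of 1 m] R0[of True m] unfolding S X_def[symmetric] by simp
  qed
  define T where "T m = (\<Sum>k<m. (- 1) ^ k / fact k * C k)" for m
  have T: "T m = R True m - R False m" for m
    unfolding T_def R_def sum_subtractf[symmetric] by (intro sum.cong) auto
  have bnd: "\<bar>T m - X\<bar> \<le> \<gamma> ^ m / fact m" for m
  proof -
    have 1: "C m / fact m \<le> \<gamma> ^ m / fact m" using C(2) by (intro divide_right_mono) auto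
    show ?thesis
    proof (cases "even m")
      case True
      have "T m \<le> X" "X \<le> T (Suc m)" using X[of m] X[of "Suc m"] True by (simp_all add: T)
      moreover have "T (Suc m) = T m + C m / fact m" using True by (simp add: T_def)
      ultimately show ?thesis using 1 by linarith
    next
      case False
      have "X \<le> T m" "T (Suc m) \<le> X" using X[of m] X[of "Suc m"] False by (simp_all add: T)
      moreover have "T (Suc m) = T m - C m / fact m" using False by (simp add: T_def)
      ultimately show ?thesis using 1 by linarith
    qed
  qed
  have "(\<lambda>m. \<gamma> ^ m / fact m) \<longlonglongrightarrow> 0"
    using summable_LIMSEQ_zero[OF summable_exp[of \<gamma>]] by (simp add: field_simps)
  then have "(\<lambda>m. T m - X) \<longlonglongrightarrow> 0"
    by (rule Lim_null_comparison[rotated]) (simp add: bnd)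
  then have "T \<longlonglongrightarrow> X" by (rule LIM_zero_cancel)
  then show ?thesis unfolding sums_def T_def C_def X_def .
qed

text \<open>For g = 1 - exp (- u) the endpoint potential of the interpolation is u itself. The
  Taylor series is rewritten as a single integral over finite configurations, absolutely convergent
  because the k-th term is at most \<gamma> ^ k / k! with \<gamma> = \<integral> (1 - exp (- u))
  d\<mu>.\<close>

lemma mayer_expansion:
  assumes u[measurable]: "u \<in> borel_measurable borel" and h[measurable]: "h \<in> borel_measurable borel"
    and fin: "(\<integral>\<^sup>+y. ennreal (1 - expneg (u y)) \<partial>\<mu>) < \<infinity>"
  defines "F \<equiv> \<lambda>\<xi>. (- 1) ^ length \<xi> * (prod_list (map (\<lambda>y. (1 - expneg (u y)) * expneg (h y)) \<xi>) * eH v \<xi> * LL P (\<lambda>y. h y + vL v \<xi> y))"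
  shows "integrable (ell \<mu>) F" and "LL P (\<lambda>y. u y + h y) = (\<integral>\<xi>. F \<xi> \<partial>ell \<mu>)"
proof -
  define g where "g y = 1 - expneg (u y)" for y
  have g01: "0 \<le> g y \<and> g y \<le> 1" for y by (simp add: g_def)
  have g[measurable]: "g \<in> borel_measurable borel" unfolding g_def by measurable
  have fin': "(\<integral>\<^sup>+y. ennreal (g y) \<partial>\<mu>) < \<infinity>" using fin by (simp add: g_def)
  define w where "w \<xi> = prod_list (map (\<lambda>y. g y * expneg (h y)) \<xi>) * eH v \<xi> * LL P (\<lambda>y. h y + vL v \<xi> y)" for \<xi>
  have w0: "0 \<le> w \<xi>" for \<xi> unfolding w_def using g01 by (intro mult_nonneg_nonneg prod_list_nonneg) auto
  have w[measurable]: "w \<in> borel_measurable LS" unfolding w_def by measurable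
  have Fw: "F = (\<lambda>\<xi>. (- 1) ^ length \<xi> * w \<xi>)" by (simp add: F_def w_def g_def)
  have Fm[measurable]: "F \<in> borel_measurable LS" unfolding Fw by measurable
  have cw: "(\<integral>\<^sup>+\<xi>. ennreal (w \<xi>) \<partial>Lk \<mu> k) = cc g k h" for k unfolding cc_def w_def ..
  define \<gamma> where "\<gamma> = enn2real (\<integral>\<^sup>+y. ennreal (g y) \<partial>\<mu>)"
  have \<gamma>: "(\<integral>\<^sup>+y. ennreal (g y) \<partial>\<mu>) = ennreal \<gamma>" "0 \<le> \<gamma>"
    unfolding \<gamma>_def using fin' by simp_all
  have ccle: "cc g k h \<le> ennreal (\<gamma> ^ k)" for k
    using cc_le[OF g g01 h, of k] \<gamma> by (simp add: ennreal_power)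
  have "(\<integral>\<^sup>+\<xi>. ennreal (w \<xi>) \<partial>ell \<mu>) = (\<Sum>k. ennreal (1 / fact k) * cc g k h)"
    by (simp add: nn_integral_ell cw)
  also have "\<dots> \<le> (\<Sum>k. ennreal (\<gamma> ^ k /\<^sub>R fact k))"
  proof (intro suminf_le summableI)
    fix k
    have "ennreal (\<gamma> ^ k /\<^sub>R fact k) = ennreal (1 / fact k) * ennreal (\<gamma> ^ k)"
      using \<gamma>(2) by (subst ennreal_mult[symmetric]) (simp_all add: field_simps)
    then show "ennreal (1 / fact k) * cc g k h \<le> ennreal (\<gamma> ^ k /\<^sub>R fact k)"
      using ccle[of k] by (simp add: mult_left_mono)
  qed
  also have "\<dots> = ennreal (exp \<gamma>)"
    using \<gamma>(2) by (intro suminf_ennreal_eq exp_converges) auto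
  finally have wfin: "(\<integral>\<^sup>+\<xi>. ennreal (w \<xi>) \<partial>ell \<mu>) < \<infinity>" by (rule le_less_trans) simp
  have "norm (F \<xi>) = w \<xi>" for \<xi> using w0[of \<xi>] by (simp add: Fw abs_mult power_abs)
  then show int: "integrable (ell \<mu>) F"
    using wfin by (intro integrableI_bounded) auto
  have "(\<integral>\<xi>. F \<xi> \<partial>Lk \<mu> k) = (- 1) ^ k * enn2real (cc g k h)" for k
  proof -
    have "(\<integral>\<xi>. F \<xi> \<partial>Lk \<mu> k) = (\<integral>\<xi>. (- 1) ^ k * w \<xi> \<partial>Lk \<mu> k)"
    proof (rule integral_cong_AE)
      show "AE \<xi> in Lk \<mu> k. F \<xi> = (- 1) ^ k * w \<xi>"
        using AE_Lk_length[of k] by eventually_elim (simp add: Fw)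
    qed measurable
    then show ?thesis using w0 by (simp add: integral_eq_nn_integral cw)
  qed
  then have "(\<lambda>k. (- 1) ^ k / fact k * enn2real (cc g k h)) sums (\<integral>\<xi>. F \<xi> \<partial>ell \<mu>)"
    using sums_ell[OF int] by simp
  from sums_unique2[OF taylor_sums[OF g g01 fin' h] this]
  show "LL P (\<lambda>y. u y + h y) = (\<integral>\<xi>. F \<xi> \<partial>ell \<mu>)"
    by (simp add: g_def lg_expneg)
qed

end

section \<open>Splitting finite sequences\<close>

text \<open>The sum over all ways to split a list into two complementary subsequences: the
  convolution of the calculus of functions of finite configurations.\<close>

primrec ssum :: "'a list \<Rightarrow> ('a list \<Rightarrow> 'a list \<Rightarrow> 'b::comm_monoid_add) \<Rightarrow> 'b" where
  "ssum [] G = G [] []"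
| "ssum (y # zs) G = ssum zs (\<lambda>J K. G (y # J) K) + ssum zs (\<lambda>J K. G J (y # K))"

text \<open>The information on the lengths is what the termination proof of \<open>psiL\<close>
  relies on.\<close>

lemma ssum_cong[fundef_cong]:
  assumes "zs = zs'" and "\<And>J K. length J + length K = length zs' \<Longrightarrow> G J K = G' J K"
  shows "ssum zs G = ssum zs' G'"
  unfolding assms(1) using assms(2)
proof (induction zs' arbitrary: G G')
  case (Cons y zs)
  have "ssum zs (\<lambda>J K. G (y # J) K) = ssum zs (\<lambda>J K. G' (y # J) K)"
    "ssum zs (\<lambda>J K. G J (y # K)) = ssum zs (\<lambda>J K. G' J (y # K))"
    by (intro Cons.IH Cons.prems; simp)+
  then show ?case by simp
qed simp

lemma ssum_map: "ssum (map f zs) G = ssum zs (\<lambda>J K. G (map f J) (map f K))"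
  by (induction zs arbitrary: G) simp_all

lemma ssum_mult: "c * ssum zs G = ssum zs (\<lambda>J K. c * G J K :: 'b::semiring_0)"
  by (induction zs arbitrary: G) (simp_all add: distrib_left)

lemma ssum_ennreal: "(\<And>J K. 0 \<le> G J K) \<Longrightarrow> ssum zs (\<lambda>J K. ennreal (G J K)) = ennreal (ssum zs G) \<and> 0 \<le> ssum zs G"
  by (induction zs arbitrary: G) simp_all

lemma ssum_abs: "\<bar>ssum zs G\<bar> \<le> ssum zs (\<lambda>J K. \<bar>G J K :: real\<bar>)"
proof (induction zs arbitrary: G)
  case (Cons y zs)
  show ?case using Cons[of "\<lambda>J K. G (y # J) K"] Cons[of "\<lambda>J K. G J (y # K)"] by simp
qed simp

lemma ssum_diff: "ssum zs (\<lambda>J K. G J K - H J K :: real) = ssum zs G - ssum zs H"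
  by (induction zs arbitrary: G H) simp_all

lemma measurable_ssum_fixed:
  fixes G :: "'m \<Rightarrow> 'i list \<Rightarrow> 'i list \<Rightarrow> real"
  assumes "\<And>J K. length J + length K = length js \<Longrightarrow> (\<lambda>x. G x J K) \<in> borel_measurable M"
  shows "(\<lambda>x. ssum js (G x)) \<in> borel_measurable M"
  using assms
proof (induction js arbitrary: G)
  case (Cons i js)
  have "(\<lambda>x. ssum js (\<lambda>J K. G x (i # J) K)) \<in> borel_measurable M" "(\<lambda>x. ssum js (\<lambda>J K. G x J (i # K))) \<in> borel_measurable M"
    by (intro Cons.IH Cons.prems; simp)+
  then show ?case by simp
qed simp

lemma measurable_ssum:
  fixes G :: "'a::topological_space list \<Rightarrow> 'a list \<Rightarrow> 'b::{second_countable_topology, topological_comm_monoid_add}"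
  assumes G: "(\<lambda>(J, K). G J K) \<in> borel_measurable (LS \<Otimes>\<^sub>M LS)"
  shows "(\<lambda>zs. ssum zs G) \<in> borel_measurable LS"
proof (rule measurable_LS_fromI)
  fix n
  \<comment> \<open>The function must be allowed to depend on the whole sequence x, because the
    recursion stores the entries already treated in it.\<close>
  have *: "(\<lambda>x. ssum (map x is) (G x)) \<in> borel_measurable (\<Pi>\<^sub>M i\<in>UNIV. borel)"
    if "(\<lambda>(x, J, K). G x J K) \<in> borel_measurable ((\<Pi>\<^sub>M i\<in>UNIV. borel) \<Otimes>\<^sub>M (LS \<Otimes>\<^sub>M LS))"
    for G :: "(nat \<Rightarrow> 'a) \<Rightarrow> 'a list \<Rightarrow> 'a list \<Rightarrow> 'b" and "is"
    using that
  proof (induction "is" arbitrary: G)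
    case Nil
    then have "(\<lambda>x. (\<lambda>(x, J, K). G x J K) (x, [], [])) \<in> borel_measurable (\<Pi>\<^sub>M i\<in>UNIV. borel)"
      by (intro measurable_compose[OF _ Nil]) measurable
    then show ?case by simp
  next
    case (Cons i "is")
    have "(\<lambda>p. (\<lambda>(x, J, K). G x J K) (fst p, fst p i # fst (snd p), snd (snd p))) \<in> borel_measurable ((\<Pi>\<^sub>M i\<in>UNIV. borel) \<Otimes>\<^sub>M (LS \<Otimes>\<^sub>M LS))"
      "(\<lambda>p. (\<lambda>(x, J, K). G x J K) (fst p, fst (snd p), fst p i # snd (snd p))) \<in> borel_measurable ((\<Pi>\<^sub>M i\<in>UNIV. borel) \<Otimes>\<^sub>M (LS \<Otimes>\<^sub>M LS))"
      by (intro measurable_compose[OF _ Cons.prems]; measurable)+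
    then have "(\<lambda>x. ssum (map x is) (\<lambda>J K. G x (x i # J) K)) \<in> borel_measurable (\<Pi>\<^sub>M i\<in>UNIV. borel)"
      "(\<lambda>x. ssum (map x is) (\<lambda>J K. G x J (x i # K))) \<in> borel_measurable (\<Pi>\<^sub>M i\<in>UNIV. borel)"
      by (auto intro!: Cons.IH simp: case_prod_unfold)
    then show ?case by (simp add: borel_measurable_add)
  qed
  show "(\<lambda>x. ssum (map x [0..<n]) G) \<in> borel_measurable (\<Pi>\<^sub>M i\<in>UNIV. borel)"
  proof (rule *)
    have "(\<lambda>p. (\<lambda>(J, K). G J K) (snd p)) \<in> borel_measurable ((PiM UNIV (\<lambda>_. borel) :: (nat \<Rightarrow> 'a) measure) \<Otimes>\<^sub>M (LS \<Otimes>\<^sub>M LS))"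
      by (rule measurable_compose[OF measurable_snd G])
    then show "(\<lambda>(x :: nat \<Rightarrow> 'a, J, K). G J K) \<in> borel_measurable ((\<Pi>\<^sub>M i\<in>UNIV. borel) \<Otimes>\<^sub>M (LS \<Otimes>\<^sub>M LS))"
      by (simp add: case_prod_unfold)
  qed
qed

lemma suminf_triangle:
  fixes f :: "nat \<Rightarrow> nat \<Rightarrow> ennreal"
  shows "(\<Sum>k. \<Sum>l\<le>k. f l (k - l)) = (\<Sum>l. \<Sum>m. f l m)"
proof -
  have "(\<Sum>k. \<Sum>l\<le>k. f l (k - l)) = (\<Sum>k. \<Sum>l. if l \<le> k then f l (k - l) else 0)"
    by (intro suminf_cong) (subst suminf_finite[of "{.._}"], auto)
  also have "\<dots> = (\<Sum>l. \<Sum>k. if l \<le> k then f l (k - l) else 0)"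
    using pair_sigma_finite.Fubini'[of "count_space UNIV" "count_space UNIV" "\<lambda>k l. if l \<le> k then f l (k - l) else 0"]
    by (simp add: nn_integral_count_space_nat pair_sigma_finite_def sigma_finite_measure_count_space
        pair_measure_countable)
  also have "\<dots> = (\<Sum>l. \<Sum>m. f l m)"
  proof (rule suminf_cong)
    fix l
    show "(\<Sum>k. if l \<le> k then f l (k - l) else 0) = (\<Sum>m. f l m)"
      by (subst suminf_offset[OF summableI, of _ l]) auto
  qed
  finally show ?thesis .
qed

section \<open>Splittings and products of Lebesgue--Poisson measures\<close>

context bd_finite
begin

text \<open>After integration only the number of points put into J matters, and the binomial
  coefficient counts the splittings with that number. In the induction the head of the list goes to
  J or to K, which is Pascal's rule.\<close>

lemma nn_integral_ssum_Lk:
  fixes G :: "'a list \<Rightarrow> 'a list \<Rightarrow> ennreal"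
  assumes "(\<lambda>(J, K). G J K) \<in> borel_measurable (LS \<Otimes>\<^sub>M LS)"
  shows "(\<integral>\<^sup>+\<xi>. ssum \<xi> G \<partial>Lk \<mu> k) = (\<Sum>l\<le>k. of_nat (k choose l) * (\<integral>\<^sup>+J. \<integral>\<^sup>+K. G J K \<partial>Lk \<mu> (k - l) \<partial>Lk \<mu> l))"
  using assms
proof (induction k arbitrary: G)
  case (0 G)
  have [measurable]: "(\<lambda>m. G (f m) (g m)) \<in> borel_measurable M" if "f \<in> measurable M LS" "g \<in> measurable M LS" for f g M
    using measurable_compose[OF measurable_Pair[OF that] 0] by simp
  have [measurable]: "(\<lambda>\<xi>. ssum \<xi> G) \<in> borel_measurable LS" by (rule measurable_ssum[OF 0])
  show ?case by simp
next
  case (Suc k G)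
  have Gm[measurable (raw)]: "(\<lambda>m. G (f m) (g m)) \<in> borel_measurable M" if "f \<in> measurable M LS" "g \<in> measurable M LS" for f g M
    using measurable_compose[OF measurable_Pair[OF that] Suc.prems] by simp
  have [measurable]: "(\<lambda>\<xi>. ssum \<xi> G) \<in> borel_measurable LS" by (rule measurable_ssum[OF Suc.prems])
  have m1: "(\<lambda>(J, K). G (x # J) K) \<in> borel_measurable (LS \<Otimes>\<^sub>M LS)"
    and m2: "(\<lambda>(J, K). G J (x # K)) \<in> borel_measurable (LS \<Otimes>\<^sub>M LS)" for x
    by measurable
  define b where "b l m = (\<integral>\<^sup>+J. \<integral>\<^sup>+K. G J K \<partial>Lk \<mu> m \<partial>Lk \<mu> l)" for l m
  have b1: "(\<integral>\<^sup>+x. \<integral>\<^sup>+J. \<integral>\<^sup>+K. G (x # J) K \<partial>Lk \<mu> m \<partial>Lk \<mu> l \<partial>\<mu>) = b (Suc l) m" for l m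
    unfolding b_def by (rule nn_integral_Lk_Suc[symmetric]) measurable
  have b2: "(\<integral>\<^sup>+x. \<integral>\<^sup>+J. \<integral>\<^sup>+K. G J (x # K) \<partial>Lk \<mu> m \<partial>Lk \<mu> l \<partial>\<mu>) = b l (Suc m)" for l m
  proof -
    interpret pair_sigma_finite "Lk \<mu> l" \<mu>
      by (intro pair_sigma_finite.intro sigma_finite_Lk sigma_finite_measure_axioms)
    have "(\<integral>\<^sup>+x. \<integral>\<^sup>+J. \<integral>\<^sup>+K. G J (x # K) \<partial>Lk \<mu> m \<partial>Lk \<mu> l \<partial>\<mu>) = (\<integral>\<^sup>+J. \<integral>\<^sup>+x. \<integral>\<^sup>+K. G J (x # K) \<partial>Lk \<mu> m \<partial>\<mu> \<partial>Lk \<mu> l)"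
      by (rule Fubini') measurable
    also have "\<dots> = b l (Suc m)"
      unfolding b_def by (intro nn_integral_cong nn_integral_Lk_Suc[symmetric]) measurable
    finally show ?thesis .
  qed
  have "(\<integral>\<^sup>+\<xi>. ssum \<xi> G \<partial>Lk \<mu> (Suc k)) = (\<integral>\<^sup>+x. \<integral>\<^sup>+\<xi>. ssum (x # \<xi>) G \<partial>Lk \<mu> k \<partial>\<mu>)"
    by (rule nn_integral_Lk_Suc) measurable
  also have "\<dots> = (\<integral>\<^sup>+x. (\<integral>\<^sup>+\<xi>. ssum \<xi> (\<lambda>J K. G (x # J) K) \<partial>Lk \<mu> k) + (\<integral>\<^sup>+\<xi>. ssum \<xi> (\<lambda>J K. G J (x # K)) \<partial>Lk \<mu> k) \<partial>\<mu>)"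
  proof (intro nn_integral_cong)
    fix x
    have [measurable]: "(\<lambda>\<xi>. ssum \<xi> (\<lambda>J K. G (x # J) K)) \<in> borel_measurable LS"
      "(\<lambda>\<xi>. ssum \<xi> (\<lambda>J K. G J (x # K))) \<in> borel_measurable LS"
      by (rule measurable_ssum[OF m1], rule measurable_ssum[OF m2])
    show "(\<integral>\<^sup>+\<xi>. ssum (x # \<xi>) G \<partial>Lk \<mu> k) = (\<integral>\<^sup>+\<xi>. ssum \<xi> (\<lambda>J K. G (x # J) K) \<partial>Lk \<mu> k) + (\<integral>\<^sup>+\<xi>. ssum \<xi> (\<lambda>J K. G J (x # K)) \<partial>Lk \<mu> k)"
      unfolding ssum.simps by (rule nn_integral_add) measurable
  qed
  also have "\<dots> = (\<integral>\<^sup>+x. (\<Sum>l\<le>k. of_nat (k choose l) * (\<integral>\<^sup>+J. \<integral>\<^sup>+K. G (x # J) K \<partial>Lk \<mu> (k - l) \<partial>Lk \<mu> l)) +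
      (\<Sum>l\<le>k. of_nat (k choose l) * (\<integral>\<^sup>+J. \<integral>\<^sup>+K. G J (x # K) \<partial>Lk \<mu> (k - l) \<partial>Lk \<mu> l)) \<partial>\<mu>)"
    by (intro nn_integral_cong) (simp add: Suc.IH[OF m1] Suc.IH[OF m2])
  also have "\<dots> = (\<Sum>l\<le>k. of_nat (k choose l) * b (Suc l) (k - l)) + (\<Sum>l\<le>k. of_nat (k choose l) * b l (Suc (k - l)))"
    by (simp add: nn_integral_add nn_integral_sum nn_integral_cmult b1 b2)
  also have "\<dots> = (\<Sum>l\<le>Suc k. of_nat (Suc k choose l) * b l (Suc k - l))"
  proof -
    have "(\<Sum>l\<le>Suc k. of_nat (Suc k choose l) * b l (Suc k - l)) =
        b 0 (Suc k) + (\<Sum>l\<le>k. of_nat (Suc k choose Suc l) * b (Suc l) (k - l))"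
      by (subst sum.atMost_Suc_shift) simp
    also have "\<dots> = (\<Sum>l\<le>k. of_nat (k choose l) * b (Suc l) (k - l)) + (b 0 (Suc k) + (\<Sum>l\<le>k. of_nat (k choose Suc l) * b (Suc l) (k - l)))"
      by (simp only: binomial_Suc_Suc of_nat_add distrib_right sum.distrib add_ac)
    also have "b 0 (Suc k) + (\<Sum>l\<le>k. of_nat (k choose Suc l) * b (Suc l) (k - l)) = (\<Sum>l\<le>Suc k. of_nat (k choose l) * b l (Suc k - l))"
      by (subst sum.atMost_Suc_shift) simp
    also have "\<dots> = (\<Sum>l\<le>k. of_nat (k choose l) * b l (Suc (k - l)))"
      by (simp add: Suc_diff_le)
    finally show ?thesis ..
  qed
  finally show ?case by (simp only: b_def)
qed

text \<open>The binomial coefficient times 1 / k! equals 1 / l! times 1 / (k - l)!, so the two parts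
  of a splitting become independent variables of integration. This is the step that turns recursions
  for graph sums into integral equations.\<close>

lemma nn_integral_ssum:
  fixes G :: "'a list \<Rightarrow> 'a list \<Rightarrow> ennreal"
  assumes G: "(\<lambda>(J, K). G J K) \<in> borel_measurable (LS \<Otimes>\<^sub>M LS)"
  shows "(\<integral>\<^sup>+\<xi>. ssum \<xi> G \<partial>ell \<mu>) = (\<integral>\<^sup>+J. \<integral>\<^sup>+K. G J K \<partial>ell \<mu> \<partial>ell \<mu>)"
proof -
  have Gm[measurable (raw)]: "(\<lambda>m. G (f m) (g m)) \<in> borel_measurable M" if "f \<in> measurable M LS" "g \<in> measurable M LS" for f g M
    using measurable_compose[OF measurable_Pair[OF that] G] by simp
  define b where "b l m = (\<integral>\<^sup>+J. \<integral>\<^sup>+K. G J K \<partial>Lk \<mu> m \<partial>Lk \<mu> l)" for l m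
  have "(\<integral>\<^sup>+\<xi>. ssum \<xi> G \<partial>ell \<mu>) = (\<Sum>k. ennreal (1 / fact k) * (\<Sum>l\<le>k. of_nat (k choose l) * b l (k - l)))"
    by (simp add: nn_integral_ell measurable_ssum[OF G] nn_integral_ssum_Lk[OF G] b_def)
  also have "\<dots> = (\<Sum>k. \<Sum>l\<le>k. ennreal (1 / fact l) * (ennreal (1 / fact (k - l)) * b l (k - l)))"
  proof (intro suminf_cong)
    fix k
    have "ennreal (1 / fact k) * (of_nat (k choose l) * b l (k - l)) = ennreal (1 / fact l) * (ennreal (1 / fact (k - l)) * b l (k - l))"
      if "l \<le> k" for l
    proof -
      have "(1 / fact k) * real (k choose l) = 1 / fact l * (1 / fact (k - l))"
        using that by (simp add: binomial_fact)
      then have "ennreal (1 / fact k) * of_nat (k choose l) = ennreal (1 / fact l) * ennreal (1 / fact (k - l))"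
        by (simp add: ennreal_of_nat_eq_real_of_nat ennreal_mult[symmetric])
      then show ?thesis by (simp add: mult.assoc[symmetric])
    qed
    then show "ennreal (1 / fact k) * (\<Sum>l\<le>k. of_nat (k choose l) * b l (k - l)) = (\<Sum>l\<le>k. ennreal (1 / fact l) * (ennreal (1 / fact (k - l)) * b l (k - l)))"
      by (simp add: sum_distrib_left)
  qed
  also have "\<dots> = (\<Sum>l. \<Sum>m. ennreal (1 / fact l) * (ennreal (1 / fact m) * b l m))"
    by (rule suminf_triangle)
  also have "\<dots> = (\<Sum>l. ennreal (1 / fact l) * (\<Sum>m. ennreal (1 / fact m) * b l m))"
    by (simp add: ennreal_suminf_cmult)
  also have "\<dots> = (\<integral>\<^sup>+J. \<integral>\<^sup>+K. G J K \<partial>ell \<mu> \<partial>ell \<mu>)"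
  proof -
    have inner: "(\<integral>\<^sup>+J. \<integral>\<^sup>+K. G J K \<partial>ell \<mu> \<partial>Lk \<mu> l) = (\<Sum>m. ennreal (1 / fact m) * b l m)" for l
    proof -
      have "(\<integral>\<^sup>+K. G J K \<partial>ell \<mu>) = (\<Sum>m. ennreal (1 / fact m) * (\<integral>\<^sup>+K. G J K \<partial>Lk \<mu> m))" for J
        by (rule nn_integral_ell) measurable
      then show ?thesis by (simp add: b_def nn_integral_suminf nn_integral_cmult)
    qed
    have "(\<integral>\<^sup>+J. \<integral>\<^sup>+K. G J K \<partial>ell \<mu> \<partial>ell \<mu>) = (\<Sum>l. ennreal (1 / fact l) * (\<integral>\<^sup>+J. \<integral>\<^sup>+K. G J K \<partial>ell \<mu> \<partial>Lk \<mu> l))"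
      by (rule nn_integral_ell) measurable
    then show ?thesis by (simp only: inner)
  qed
  finally show ?thesis .
qed

lemma integral_ssum:
  fixes G :: "'a list \<Rightarrow> 'a list \<Rightarrow> real"
  assumes G: "integrable (ell \<mu> \<Otimes>\<^sub>M ell \<mu>) (\<lambda>(J, K). G J K)"
  shows "integrable (ell \<mu>) (\<lambda>\<xi>. ssum \<xi> G)"
    and "(\<integral>\<xi>. ssum \<xi> G \<partial>ell \<mu>) = (\<integral>p. (case p of (J, K) \<Rightarrow> G J K) \<partial>(ell \<mu> \<Otimes>\<^sub>M ell \<mu>))"
proof -
  have *: "integrable (ell \<mu>) (\<lambda>\<xi>. ssum \<xi> G) \<and>
      (\<integral>\<xi>. ssum \<xi> G \<partial>ell \<mu>) = (\<integral>p. (case p of (J, K) \<Rightarrow> G J K) \<partial>(ell \<mu> \<Otimes>\<^sub>M ell \<mu>))"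
    if G: "integrable (ell \<mu> \<Otimes>\<^sub>M ell \<mu>) (\<lambda>(J, K). G J K)" and nn: "\<And>J K. 0 \<le> G J K" for G :: "'a list \<Rightarrow> 'a list \<Rightarrow> real"
  proof -
    have m: "(\<lambda>(J, K). G J K) \<in> borel_measurable (LS \<Otimes>\<^sub>M LS)"
      using borel_measurable_integrable[OF G] by (simp cong: measurable_cong_sets)
    have m': "(\<lambda>(J, K). ennreal (G J K)) \<in> borel_measurable (LS \<Otimes>\<^sub>M LS)"
      using m by (simp add: case_prod_unfold)
    have se: "ssum \<xi> (\<lambda>J K. ennreal (G J K)) = ennreal (ssum \<xi> G)" "0 \<le> ssum \<xi> G" for \<xi>
      using ssum_ennreal[of G \<xi>] nn by auto
    have "(\<integral>\<^sup>+\<xi>. ennreal (ssum \<xi> G) \<partial>ell \<mu>) = (\<integral>\<^sup>+J. \<integral>\<^sup>+K. ennreal (G J K) \<partial>ell \<mu> \<partial>ell \<mu>)"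
      using nn_integral_ssum[OF m'] by (simp add: se)
    also have "\<dots> = (\<integral>\<^sup>+p. ennreal (case p of (J, K) \<Rightarrow> G J K) \<partial>(ell \<mu> \<Otimes>\<^sub>M ell \<mu>))"
      using ell.nn_integral_fst[of "\<lambda>p. ennreal (case p of (J, K) \<Rightarrow> G J K)" "ell \<mu>"] m
      by (simp cong: measurable_cong_sets)
    finally have e: "(\<integral>\<^sup>+\<xi>. ennreal (ssum \<xi> G) \<partial>ell \<mu>) = (\<integral>\<^sup>+p. ennreal (case p of (J, K) \<Rightarrow> G J K) \<partial>(ell \<mu> \<Otimes>\<^sub>M ell \<mu>))" .
    have mS: "(\<lambda>\<xi>. ssum \<xi> G) \<in> borel_measurable (ell \<mu>)"
      using measurable_ssum[OF m] by (simp cong: measurable_cong_sets)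
    have fin: "(\<integral>\<^sup>+p. ennreal (case p of (J, K) \<Rightarrow> G J K) \<partial>(ell \<mu> \<Otimes>\<^sub>M ell \<mu>)) < \<infinity>"
      using G nn by (subst nn_integral_eq_integral) (auto simp: case_prod_unfold)
    have "integrable (ell \<mu>) (\<lambda>\<xi>. ssum \<xi> G)"
      using mS se(2) fin by (intro integrableI_nonneg) (auto simp: e)
    then show ?thesis
      using mS se(2) borel_measurable_integrable[OF G] nn e
      by (subst (1 2) integral_eq_nn_integral) (auto simp: case_prod_unfold)
  qed
  have i1: "integrable (ell \<mu> \<Otimes>\<^sub>M ell \<mu>) (\<lambda>(J, K). max 0 (G J K))"
    and i2: "integrable (ell \<mu> \<Otimes>\<^sub>M ell \<mu>) (\<lambda>(J, K). max 0 (- G J K))"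
    using integrable_max[OF integrable_zero G] integrable_max[OF integrable_zero integrable_minus[OF G]]
    by (simp_all add: case_prod_unfold)
  have s: "ssum \<xi> G = ssum \<xi> (\<lambda>J K. max 0 (G J K)) - ssum \<xi> (\<lambda>J K. max 0 (- G J K))" for \<xi>
    unfolding ssum_diff[symmetric] by (rule ssum_cong) auto
  have p: "(case p of (J, K) \<Rightarrow> G J K) = (case p of (J, K) \<Rightarrow> max 0 (G J K)) - (case p of (J, K) \<Rightarrow> max 0 (- G J K))" for p
    by (auto split: prod.splits)
  show "integrable (ell \<mu>) (\<lambda>\<xi>. ssum \<xi> G)"
    unfolding s using *[OF i1] *[OF i2] by (intro Bochner_Integration.integrable_diff) auto
  show "(\<integral>\<xi>. ssum \<xi> G \<partial>ell \<mu>) = (\<integral>p. (case p of (J, K) \<Rightarrow> G J K) \<partial>(ell \<mu> \<Otimes>\<^sub>M ell \<mu>))"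
  proof -
    have "(\<integral>\<xi>. ssum \<xi> G \<partial>ell \<mu>) = (\<integral>\<xi>. ssum \<xi> (\<lambda>J K. max 0 (G J K)) \<partial>ell \<mu>) - (\<integral>\<xi>. ssum \<xi> (\<lambda>J K. max 0 (- G J K)) \<partial>ell \<mu>)"
      unfolding s using *[OF i1] *[OF i2] by (intro Bochner_Integration.integral_diff) auto
    also have "\<dots> = (\<integral>p. (case p of (J, K) \<Rightarrow> max 0 (G J K)) \<partial>(ell \<mu> \<Otimes>\<^sub>M ell \<mu>)) - (\<integral>p. (case p of (J, K) \<Rightarrow> max 0 (- G J K)) \<partial>(ell \<mu> \<Otimes>\<^sub>M ell \<mu>))"
      using *[OF i1] *[OF i2] by simp
    also have "\<dots> = (\<integral>p. (case p of (J, K) \<Rightarrow> G J K) \<partial>(ell \<mu> \<Otimes>\<^sub>M ell \<mu>))"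
      by (subst p) (rule Bochner_Integration.integral_diff[OF i1 i2, symmetric])
    finally show ?thesis .
  qed
qed

end

section \<open>Rooted graph sums\<close>

text \<open>\<open>psiL v xs zs\<close> sums over the graphs in which every vertex of \<open>zs\<close> is connected to \<open>xs\<close>;
  the recursion removes the first root and turns its neighbours \<open>J\<close> in \<open>zs\<close> into roots.\<close>

function psiL :: "('a \<Rightarrow> 'a \<Rightarrow> ennreal) \<Rightarrow> 'a list \<Rightarrow> 'a list \<Rightarrow> real" where
  "psiL v [] zs = (if zs = [] then 1 else 0)"
| "psiL v (x # xs) zs = prod_list (map (\<lambda>y. expneg (v x y)) xs) *
     ssum zs (\<lambda>J K. prod_list (map (ff v x) J) * psiL v (xs @ J) K)"
  by pat_completeness auto
termination by (relation "Wellfounded.measure (\<lambda>(v, xs, zs). length xs + length zs)") auto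

lemma psiL_map_measurable:
  fixes v :: "'a::topological_space \<Rightarrow> 'a \<Rightarrow> ennreal"
  assumes v: "(\<lambda>p. v (fst p) (snd p)) \<in> borel_measurable (borel \<Otimes>\<^sub>M borel)"
  shows "(\<lambda>X. psiL v (map X is) (map X js)) \<in> borel_measurable (\<Pi>\<^sub>M i\<in>(UNIV :: nat set). borel)"
proof (induction "length is + length js" arbitrary: "is" js rule: less_induct)
  case less
  have vm: "(\<lambda>X. v (X i) (X j)) \<in> borel_measurable (\<Pi>\<^sub>M i\<in>(UNIV :: nat set). borel)" for i j
    using measurable_compose[OF measurable_Pair[OF measurable_component_singleton[of i UNIV] measurable_component_singleton[of j UNIV]] v] by simp
  have prodm: "(\<lambda>X. prod_list (map (\<lambda>j. f X j) ks)) \<in> borel_measurable M"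
    if "\<And>j. (\<lambda>X. f X j) \<in> borel_measurable M" for f :: "_ \<Rightarrow> nat \<Rightarrow> real" and ks M
    using that by (induction ks) auto
  show ?case
  proof (cases "is")
    case Nil then show ?thesis by simp
  next
    case (Cons i is')
    have "(\<lambda>X. prod_list (map (\<lambda>j. expneg (v (X i) (X j))) is') *
       ssum js (\<lambda>J K. prod_list (map (\<lambda>j. ff v (X i) (X j)) J) * psiL v (map X (is' @ J)) (map X K))) \<in> borel_measurable (\<Pi>\<^sub>M i\<in>(UNIV :: nat set). borel)"
    proof (intro borel_measurable_times measurable_ssum_fixed prodm)
      fix J K :: "nat list" assume "length J + length K = length js"
      then show "(\<lambda>X. psiL v (map X (is' @ J)) (map X K)) \<in> borel_measurable (\<Pi>\<^sub>M i\<in>UNIV. borel)"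
        by (intro less) (simp add: Cons)
    qed (use vm in \<open>auto simp: ff_def\<close>)
    then show ?thesis by (simp add: Cons ssum_map comp_def)
  qed
qed

context potential
begin

lemma ff_measurable[measurable (raw)]:
  assumes [measurable]: "f \<in> borel_measurable M" "g \<in> borel_measurable M"
  shows "(\<lambda>m. ff v (f m) (g m)) \<in> borel_measurable M"
  unfolding ff_def by measurable

lemma psiL_measurable[measurable (raw)]:
  assumes "f \<in> measurable M LS" "g \<in> measurable M LS"
  shows "(\<lambda>m. psiL v (f m) (g m)) \<in> borel_measurable M"
proof -
  have "(\<lambda>(xs, zs). psiL v xs zs) \<in> borel_measurable (LS \<Otimes>\<^sub>M LS)"
  proof (rule measurable_pair_LS_LSI)
    fix n k
    have "(\<lambda>p. (\<lambda>i. if i < n then fst p i else snd p (i - n))) \<in>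
       measurable ((\<Pi>\<^sub>M i\<in>UNIV. borel) \<Otimes>\<^sub>M (\<Pi>\<^sub>M i\<in>UNIV. borel)) (\<Pi>\<^sub>M i\<in>(UNIV :: nat set). borel :: 'a measure)"
      by (rule measurable_PiM_single') (auto simp: space_pair_measure space_PiM)
    from measurable_compose[OF this psiL_map_measurable[OF v_measurable, of "[0..<n]" "[n..<n+k]"]]
    have "(\<lambda>p. psiL v (map (\<lambda>i. if i < n then fst p i else snd p (i - n)) [0..<n])
        (map (\<lambda>i. if i < n then fst p i else snd p (i - n)) [n..<n+k]))
        \<in> borel_measurable ((\<Pi>\<^sub>M i\<in>UNIV. borel) \<Otimes>\<^sub>M (\<Pi>\<^sub>M i\<in>UNIV. borel))" .
    moreover have "map (\<lambda>i. if i < n then x i else y (i - n)) [0..<n] = map x [0..<n]"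
      "map (\<lambda>i. if i < n then x i else y (i - n)) [n..<n+k] = map y [0..<k]" for x y :: "nat \<Rightarrow> 'a"
      by (auto intro!: nth_equalityI)
    ultimately show "(\<lambda>(x, y). case (map x [0..<n], map y [0..<k]) of (xs, zs) \<Rightarrow> psiL v xs zs)
      \<in> borel_measurable (Pi\<^sub>M UNIV (\<lambda>i. borel) \<Otimes>\<^sub>M Pi\<^sub>M UNIV (\<lambda>i. borel))"
      by (simp add: case_prod_unfold)
  qed
  from measurable_compose[OF measurable_Pair[OF assms] this] show ?thesis by simp
qed

end

section \<open>Convergence of the rooted graph sums and their integral equation\<close>

lemma abs_ff: "\<bar>ff v x y\<bar> = 1 - expneg (v x y)"
  by (simp add: ff_def)

lemma prod_list_ff: "prod_list (map (ff v x) \<xi>) = (- 1) ^ length \<xi> * prod_list (map (\<lambda>y. 1 - expneg (v x y)) \<xi>)"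
  by (induction \<xi>) (simp_all add: ff_def algebra_simps)

lemma abs_prod_list_ff: "\<bar>prod_list (map (ff v x) \<xi>)\<bar> = prod_list (map (\<lambda>y. 1 - expneg (v x y)) \<xi>)"
proof -
  have "0 \<le> prod_list (map (\<lambda>y. 1 - expneg (v x y)) \<xi>)" by (rule prod_list_nonneg) auto
  then show ?thesis by (simp add: prod_list_ff abs_mult power_abs)
qed

text \<open>In the application b = exp a, T = exp t, and G is the set of good points, of full
  measure. The integral in \<open>cond\<close> includes the empty configuration, whose contribution
  is 1; this accounts for b x = exp (a x) in place of exp (a x) - 1.\<close>

locale fp = potential \<mu> v for \<mu> :: "'a::polish_space measure" and v +
  fixes b :: "'a \<Rightarrow> real" and T :: real and G :: "'a set"
  assumes b_measurable[measurable]: "b \<in> borel_measurable borel" and b_ge1: "1 \<le> b x"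
    and T_gt1: "1 < T" and G_sets[measurable]: "G \<in> sets borel" and AE_G: "AE x in \<mu>. x \<in> G"
    and cond: "x \<in> G \<Longrightarrow> (\<integral>\<^sup>+\<xi>. ennreal (T ^ length \<xi> * prod_list (map (\<lambda>y. (1 - expneg (v x y)) * b y) \<xi>) * eH v \<xi>) \<partial>ell \<mu>) \<le> ennreal (b x)"
begin

lemma b_nonneg: "0 \<le> b x" using b_ge1[of x] by simp

lemma prod_b_ge1: "1 \<le> prod_list (map b xs)"
proof (induction xs)
  case (Cons x xs)
  have "1 * 1 \<le> b x * prod_list (map b xs)" using Cons b_ge1 b_nonneg by (intro mult_mono) auto
  then show ?case by simp
qed simp

lemma prod_b_nonneg: "0 \<le> prod_list (map b xs)" using prod_b_ge1[of xs] by simp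

lemma T_power_ge1: "1 \<le> T ^ n" using T_gt1 by simp

lemma AE_ell_G: "AE \<xi> in ell \<mu>. set \<xi> \<subseteq> G"
  using AE_ell[OF AE_G] by (simp add: subset_eq)

text \<open>The one-point term of \<open>cond\<close> alone is an upper bound, since T and b are at
  least 1. This is the integrability that \<open>mayer_expansion\<close> demands of the potential
  \<open>v x\<close>.\<close>

lemma integral_f_finite: "x \<in> G \<Longrightarrow> (\<integral>\<^sup>+y. ennreal (1 - expneg (v x y)) \<partial>\<mu>) < \<infinity>"
proof -
  assume x: "x \<in> G"
  let ?F = "\<lambda>\<xi>. ennreal (T ^ length \<xi> * prod_list (map (\<lambda>y. (1 - expneg (v x y)) * b y) \<xi>) * eH v \<xi>)"
  have "(\<integral>\<^sup>+y. ennreal (1 - expneg (v x y)) \<partial>\<mu>) \<le> (\<integral>\<^sup>+y. ennreal (T * ((1 - expneg (v x y)) * b y)) \<partial>\<mu>)"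
  proof (intro nn_integral_mono ennreal_leI)
    fix y
    have "(1 - expneg (v x y)) * 1 \<le> (1 - expneg (v x y)) * b y" by (intro mult_left_mono b_ge1) simp
    moreover have "1 * ((1 - expneg (v x y)) * b y) \<le> T * ((1 - expneg (v x y)) * b y)"
      using T_gt1 b_nonneg by (intro mult_right_mono) auto
    ultimately show "1 - expneg (v x y) \<le> T * ((1 - expneg (v x y)) * b y)" by simp
  qed
  also have "\<dots> = (\<integral>\<^sup>+\<xi>. ?F \<xi> \<partial>Lk \<mu> (Suc 0))"
    by (subst nn_integral_Lk_Suc) auto
  also have "\<dots> = (\<Sum>k\<in>{Suc 0}. ennreal (1 / fact k) * (\<integral>\<^sup>+\<xi>. ?F \<xi> \<partial>Lk \<mu> k))" by simp
  also have "\<dots> \<le> (\<Sum>k. ennreal (1 / fact k) * (\<integral>\<^sup>+\<xi>. ?F \<xi> \<partial>Lk \<mu> k))"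
    by (intro sum_le_suminf summableI) auto
  also have "\<dots> = (\<integral>\<^sup>+\<xi>. ?F \<xi> \<partial>ell \<mu>)"
    by (rule nn_integral_ell[symmetric]) measurable
  also have "\<dots> < \<infinity>" by (rule le_less_trans[OF cond[OF x]]) simp
  finally show ?thesis .
qed

text \<open>A bound by \<open>eH \<cdot> \<Prod> b\<close> is reproduced by one step of the Kirkwood--Salsburg recursion.\<close>

lemma ks_step:
  assumes x: "x \<in> G" and c: "0 \<le> c"
    and q: "AE J in ell \<mu>. q J \<le> ennreal (c * T ^ length J * (eH v (xs @ J) * prod_list (map b (xs @ J))))"
  shows "ennreal (prod_list (map (\<lambda>y. expneg (v x y)) xs)) * (\<integral>\<^sup>+J. ennreal (prod_list (map (\<lambda>y. 1 - expneg (v x y)) J)) * q J \<partial>ell \<mu>)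
    \<le> ennreal (c * (eH v (x # xs) * prod_list (map b (x # xs))))"
proof -
  let ?p = "\<lambda>J. prod_list (map (\<lambda>y. 1 - expneg (v x y)) J)"
  have p0: "0 \<le> ?p J" for J by (rule prod_list_nonneg) auto
  let ?F = "\<lambda>\<xi>. T ^ length \<xi> * prod_list (map (\<lambda>y. (1 - expneg (v x y)) * b y) \<xi>) * eH v \<xi>"
  have F0: "0 \<le> ?F J" for J using T_gt1 b_nonneg by (intro mult_nonneg_nonneg prod_list_nonneg) auto
  have d: "0 \<le> c * (eH v xs * prod_list (map b xs))" using c prod_b_nonneg by simp
  have "(\<integral>\<^sup>+J. ennreal (?p J) * q J \<partial>ell \<mu>) \<le> (\<integral>\<^sup>+J. ennreal (c * (eH v xs * prod_list (map b xs))) * ennreal (?F J) \<partial>ell \<mu>)"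
  proof (rule nn_integral_mono_AE)
    show "AE J in ell \<mu>. ennreal (?p J) * q J \<le> ennreal (c * (eH v xs * prod_list (map b xs))) * ennreal (?F J)"
      using q
    proof eventually_elim
      case (elim J)
      have "ennreal (?p J) * q J \<le> ennreal (?p J) * ennreal (c * T ^ length J * (eH v (xs @ J) * prod_list (map b (xs @ J))))"
        by (intro mult_left_mono elim) simp
      also have "\<dots> = ennreal (?p J * (c * T ^ length J * (eH v (xs @ J) * prod_list (map b (xs @ J)))))"
        using p0 c T_gt1 prod_b_nonneg by (intro ennreal_mult[symmetric] mult_nonneg_nonneg) auto
      also have "\<dots> \<le> ennreal (c * (eH v xs * prod_list (map b xs)) * ?F J)"
      proof (rule ennreal_leI)
        \<comment> \<open>Only the mutual interaction \<open>crossH v xs J\<close> is thrown away;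
          the interaction inside J is kept and matches the product over pairs in the
          hypothesis.\<close>
        have "?p J * (c * T ^ length J * (eH v (xs @ J) * prod_list (map b (xs @ J)))) =
            crossH v xs J * (c * (eH v xs * prod_list (map b xs)) * ?F J)"
          by (simp add: eH_append prod_list_mult mult_ac)
        also have "\<dots> \<le> 1 * (c * (eH v xs * prod_list (map b xs)) * ?F J)"
          by (intro mult_right_mono mult_nonneg_nonneg[OF d F0]) simp
        finally show "?p J * (c * T ^ length J * (eH v (xs @ J) * prod_list (map b (xs @ J)))) \<le> c * (eH v xs * prod_list (map b xs)) * ?F J"
          by simp
      qed
      also have "\<dots> = ennreal (c * (eH v xs * prod_list (map b xs))) * ennreal (?F J)"
        by (rule ennreal_mult[OF d F0])
      finally show ?case .
    qed
  qed
  also have "\<dots> = ennreal (c * (eH v xs * prod_list (map b xs))) * (\<integral>\<^sup>+J. ennreal (?F J) \<partial>ell \<mu>)"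
    by (rule nn_integral_cmult) measurable
  also have "\<dots> \<le> ennreal (c * (eH v xs * prod_list (map b xs))) * ennreal (b x)"
    by (intro mult_left_mono cond x) simp
  finally have "ennreal (prod_list (map (\<lambda>y. expneg (v x y)) xs)) * (\<integral>\<^sup>+J. ennreal (?p J) * q J \<partial>ell \<mu>) \<le>
     ennreal (prod_list (map (\<lambda>y. expneg (v x y)) xs)) * (ennreal (c * (eH v xs * prod_list (map b xs))) * ennreal (b x))"
    by (intro mult_left_mono) auto
  also have "\<dots> = ennreal (c * (eH v (x # xs) * prod_list (map b (x # xs))))"
  proof -
    have "0 \<le> prod_list (map (\<lambda>y. expneg (v x y)) xs)" by (rule prod_list_nonneg) auto
    then have "ennreal (prod_list (map (\<lambda>y. expneg (v x y)) xs)) * (ennreal (c * (eH v xs * prod_list (map b xs))) * ennreal (b x)) =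
        ennreal (prod_list (map (\<lambda>y. expneg (v x y)) xs) * ((c * (eH v xs * prod_list (map b xs))) * b x))"
      using mult_nonneg_nonneg[OF d b_nonneg[of x]] by (simp only: ennreal_mult[OF d b_nonneg, symmetric] ennreal_mult[symmetric])
    then show ?thesis by (simp add: mult_ac)
  qed
  finally show ?thesis .
qed

lemma abs_psiL_Cons_le:
  "T ^ length \<xi> * \<bar>psiL v (x # xs) \<xi>\<bar> \<le> prod_list (map (\<lambda>y. expneg (v x y)) xs) *
    ssum \<xi> (\<lambda>J K. prod_list (map (\<lambda>y. 1 - expneg (v x y)) J) * (T ^ length J * (T ^ length K * \<bar>psiL v (xs @ J) K\<bar>)))"
proof -
  have p0: "0 \<le> prod_list (map (\<lambda>y. expneg (v x y)) xs)" by (rule prod_list_nonneg) auto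
  have "T ^ length \<xi> * \<bar>ssum \<xi> (\<lambda>J K. prod_list (map (ff v x) J) * psiL v (xs @ J) K)\<bar> \<le>
    T ^ length \<xi> * ssum \<xi> (\<lambda>J K. \<bar>prod_list (map (ff v x) J) * psiL v (xs @ J) K\<bar>)"
    using T_gt1 by (intro mult_left_mono ssum_abs) auto
  also have "\<dots> = ssum \<xi> (\<lambda>J K. prod_list (map (\<lambda>y. 1 - expneg (v x y)) J) * (T ^ length J * (T ^ length K * \<bar>psiL v (xs @ J) K\<bar>)))"
    unfolding ssum_mult by (intro ssum_cong refl) (simp add: abs_mult abs_prod_list_ff power_add[symmetric])
  finally have "T ^ length \<xi> * \<bar>ssum \<xi> (\<lambda>J K. prod_list (map (ff v x) J) * psiL v (xs @ J) K)\<bar> \<le> \<dots>" .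
  from mult_left_mono[OF this p0] show ?thesis
    by (simp add: abs_mult abs_of_nonneg[OF p0] mult.left_commute)
qed

text \<open>Cutting off at N points makes a double induction possible, on N and then on the list of
  roots. Removing the first root either finds no neighbours, which leaves N and shortens the root
  list, or it finds a nonempty J, which may lengthen the root list but leaves at most N - length J <
  N further points. In both cases \<open>ks_step\<close> reproduces the bound with constant
  1.\<close>

lemma psiL_bound_aux:
  assumes "set xs \<subseteq> G"
  shows "(\<integral>\<^sup>+\<xi>. ennreal (T ^ length \<xi> * \<bar>psiL v xs \<xi>\<bar>) * indicator {\<xi>. length \<xi> \<le> N} \<xi> \<partial>ell \<mu>)
    \<le> ennreal (eH v xs * prod_list (map b xs))"
  using assms
proof (induction N arbitrary: xs rule: less_induct)
  case (less N)
  note IH_N = less.IH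
  have [measurable]: "{\<xi>::'a list. length \<xi> \<le> N} \<in> sets LS" for N
  proof -
    have "{\<xi>::'a list. length \<xi> \<le> N} = length -` {..N} \<inter> space LS" by auto
    also have "\<dots> \<in> sets LS" by (rule measurable_sets[OF measurable_length_LS]) simp
    finally show ?thesis .
  qed
  show ?case using less.prems
  proof (induction xs)
    case Nil
    have "(\<integral>\<^sup>+\<xi>. ennreal (T ^ length \<xi> * \<bar>psiL v [] \<xi>\<bar>) * indicator {\<xi>. length \<xi> \<le> N} \<xi> \<partial>ell \<mu>) = (\<integral>\<^sup>+\<xi>. indicator {[]} \<xi> \<partial>ell \<mu>)"
      by (intro nn_integral_cong) (auto simp: indicator_def)
    also have "\<dots> = emeasure (ell \<mu>) {\<xi>. set \<xi> \<subseteq> {}}"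
    proof -
      have "{\<xi>::'a list. set \<xi> \<subseteq> {}} = {[]}" by auto
      then show ?thesis using set_subset_in_LS[of "{}::'a set"] by simp
    qed
    also have "\<dots> = 1" by (subst emeasure_ell_subset) auto
    finally show ?case by simp
  next
    case (Cons x xs)
    then have xG: "x \<in> G" "set xs \<subseteq> G" by auto
    let ?I = "\<lambda>n. indicator {\<xi>::'a list. length \<xi> \<le> n}"
    let ?g = "\<lambda>J K. prod_list (map (\<lambda>y. 1 - expneg (v x y)) J) * (T ^ length J * (T ^ length K * \<bar>psiL v (xs @ J) K\<bar>))"
    define q where "q J = (\<integral>\<^sup>+K. ennreal (T ^ length J) * (ennreal (T ^ length K * \<bar>psiL v (xs @ J) K\<bar>) * (if length J + length K \<le> N then 1 else 0)) \<partial>ell \<mu>)" for J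
    have t1[measurable]: "(\<lambda>p. psiL v (xs @ fst p) (snd p)) \<in> borel_measurable (LS \<Otimes>\<^sub>M LS)"
      by measurable
    have t2[measurable]: "(\<lambda>p. T ^ length (fst p)) \<in> borel_measurable (LS \<Otimes>\<^sub>M (LS :: 'a list measure))"
      by measurable
    have t3[measurable]: "(\<lambda>p. prod_list (map (\<lambda>y. 1 - expneg (v x y)) (fst p))) \<in> borel_measurable (LS \<Otimes>\<^sub>M (LS :: 'a list measure))"
      by measurable
    have t4[measurable]: "(\<lambda>p. length (fst p) + length (snd p)) \<in> measurable (LS \<Otimes>\<^sub>M (LS :: 'a list measure)) (count_space UNIV)"
      by measurable
    have t5: "(\<lambda>p. if length (fst p) + length (snd p) \<le> N then 1 else 0 :: ennreal) \<in> borel_measurable (LS \<Otimes>\<^sub>M (LS :: 'a list measure))"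
      by measurable
    have p0: "0 \<le> prod_list (map (\<lambda>y. 1 - expneg (v x y)) J)" for J by (rule prod_list_nonneg) auto
    have g0: "0 \<le> ?g J K" for J K using p0 T_gt1 by simp
    have e0: "0 \<le> prod_list (map (\<lambda>y. expneg (v x y)) xs)" by (rule prod_list_nonneg) auto
    have "(\<integral>\<^sup>+\<xi>. ennreal (T ^ length \<xi> * \<bar>psiL v (x # xs) \<xi>\<bar>) * ?I N \<xi> \<partial>ell \<mu>)
       \<le> (\<integral>\<^sup>+\<xi>. ennreal (prod_list (map (\<lambda>y. expneg (v x y)) xs)) * ssum \<xi> (\<lambda>J K. ennreal (?g J K) * (if length J + length K \<le> N then 1 else 0)) \<partial>ell \<mu>)"
    proof (rule nn_integral_mono)
      fix \<xi>
      have "ssum \<xi> (\<lambda>J K. ennreal (?g J K) * (if length J + length K \<le> N then 1 else 0)) = ssum \<xi> (\<lambda>J K. ennreal (?g J K)) * ?I N \<xi>"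
        by (simp only: mult.commute[of _ "?I N \<xi>"] ssum_mult) (auto intro!: ssum_cong)
      also have "ssum \<xi> (\<lambda>J K. ennreal (?g J K)) = ennreal (ssum \<xi> ?g)"
        using ssum_ennreal[of ?g \<xi>] g0 by simp
      finally show "ennreal (T ^ length \<xi> * \<bar>psiL v (x # xs) \<xi>\<bar>) * ?I N \<xi> \<le>
          ennreal (prod_list (map (\<lambda>y. expneg (v x y)) xs)) * ssum \<xi> (\<lambda>J K. ennreal (?g J K) * (if length J + length K \<le> N then 1 else 0))"
        using ennreal_leI[OF abs_psiL_Cons_le[of \<xi> x xs]] e0 ssum_ennreal[of ?g \<xi>] g0
        by (simp add: mult.assoc[symmetric] ennreal_mult[symmetric] mult_right_mono del: psiL.simps)
    qed
    also have "\<dots> = ennreal (prod_list (map (\<lambda>y. expneg (v x y)) xs)) * (\<integral>\<^sup>+\<xi>. ssum \<xi> (\<lambda>J K. ennreal (?g J K) * (if length J + length K \<le> N then 1 else 0)) \<partial>ell \<mu>)"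
    proof (rule nn_integral_cmult)
      show "(\<lambda>\<xi>. ssum \<xi> (\<lambda>J K. ennreal (?g J K) * (if length J + length K \<le> N then 1 else 0))) \<in> borel_measurable (ell \<mu>)"
        by (subst measurable_cong_sets[OF sets_ell refl], rule measurable_ssum) measurable
    qed
    also have "(\<integral>\<^sup>+\<xi>. ssum \<xi> (\<lambda>J K. ennreal (?g J K) * (if length J + length K \<le> N then 1 else 0)) \<partial>ell \<mu>) =
      (\<integral>\<^sup>+J. \<integral>\<^sup>+K. ennreal (?g J K) * (if length J + length K \<le> N then 1 else 0) \<partial>ell \<mu> \<partial>ell \<mu>)"
      by (rule nn_integral_ssum) measurable
    also have "\<dots> = (\<integral>\<^sup>+J. ennreal (prod_list (map (\<lambda>y. 1 - expneg (v x y)) J)) * q J \<partial>ell \<mu>)"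
    proof (rule nn_integral_cong)
      fix J
      show "(\<integral>\<^sup>+K. ennreal (?g J K) * (if length J + length K \<le> N then 1 else 0) \<partial>ell \<mu>) = ennreal (prod_list (map (\<lambda>y. 1 - expneg (v x y)) J)) * q J"
        unfolding q_def using p0 T_gt1
        by (subst nn_integral_cmult[symmetric]) (simp_all add: ennreal_mult mult.assoc)
    qed
    also have "ennreal (prod_list (map (\<lambda>y. expneg (v x y)) xs)) * \<dots> \<le> ennreal (1 * (eH v (x # xs) * prod_list (map b (x # xs))))"
    proof (rule ks_step)
      show "AE J in ell \<mu>. q J \<le> ennreal (1 * T ^ length J * (eH v (xs @ J) * prod_list (map b (xs @ J))))"
        using AE_ell_G
      proof eventually_elim
        case (elim J)
        show ?case
        proof (cases "length J \<le> N")
          case True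
          have "q J = ennreal (T ^ length J) * (\<integral>\<^sup>+K. ennreal (T ^ length K * \<bar>psiL v (xs @ J) K\<bar>) * ?I (N - length J) K \<partial>ell \<mu>)"
            unfolding q_def using True by (subst nn_integral_cmult[symmetric]) (auto intro!: nn_integral_cong simp: indicator_def)
          also have "\<dots> \<le> ennreal (T ^ length J) * ennreal (eH v (xs @ J) * prod_list (map b (xs @ J)))"
          proof (intro mult_left_mono)
            show "(\<integral>\<^sup>+K. ennreal (T ^ length K * \<bar>psiL v (xs @ J) K\<bar>) * ?I (N - length J) K \<partial>ell \<mu>) \<le> ennreal (eH v (xs @ J) * prod_list (map b (xs @ J)))"
            proof (cases "J = []")
              case True then show ?thesis using Cons.IH xG by simp
            next
              case False
              then have "N - length J < N" using True by (cases J) auto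
              then show ?thesis using xG elim by (intro IH_N) auto
            qed
          qed simp
          also have "\<dots> = ennreal (1 * T ^ length J * (eH v (xs @ J) * prod_list (map b (xs @ J))))"
            using T_gt1 prod_b_nonneg by (subst ennreal_mult[symmetric]) auto
          finally show ?thesis .
        qed (simp add: q_def)
      qed
    qed (use xG in auto)
    finally show ?case by simp
  qed
qed

lemma psiL_bound:
  assumes "set xs \<subseteq> G"
  shows "(\<integral>\<^sup>+\<xi>. ennreal (T ^ length \<xi> * \<bar>psiL v xs \<xi>\<bar>) \<partial>ell \<mu>) \<le> ennreal (eH v xs * prod_list (map b xs))"
proof -
  have [measurable]: "{\<xi>::'a list. length \<xi> \<le> N} \<in> sets LS" for N
  proof -
    have "{\<xi>::'a list. length \<xi> \<le> N} = length -` {..N} \<inter> space LS" by auto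
    also have "\<dots> \<in> sets LS" by (rule measurable_sets[OF measurable_length_LS]) simp
    finally show ?thesis .
  qed
  let ?f = "\<lambda>N \<xi>. ennreal (T ^ length \<xi> * \<bar>psiL v xs \<xi>\<bar>) * indicator {\<xi>. length \<xi> \<le> N} \<xi>"
  have "(SUP N. ?f N \<xi>) = ennreal (T ^ length \<xi> * \<bar>psiL v xs \<xi>\<bar>)" for \<xi>
  proof (rule antisym)
    show "ennreal (T ^ length \<xi> * \<bar>psiL v xs \<xi>\<bar>) \<le> (SUP N. ?f N \<xi>)"
      by (rule order_trans[OF _ SUP_upper[of "length \<xi>"]]) auto
  qed (auto intro!: SUP_least simp: indicator_def)
  then have "(\<integral>\<^sup>+\<xi>. ennreal (T ^ length \<xi> * \<bar>psiL v xs \<xi>\<bar>) \<partial>ell \<mu>) = (\<integral>\<^sup>+\<xi>. (SUP N. ?f N \<xi>) \<partial>ell \<mu>)" by simp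
  also have "\<dots> = (SUP N. \<integral>\<^sup>+\<xi>. ?f N \<xi> \<partial>ell \<mu>)"
    by (intro nn_integral_monotone_convergence_SUP) (auto simp: incseq_def le_fun_def indicator_def)
  also have "\<dots> \<le> ennreal (eH v xs * prod_list (map b xs))"
    by (intro SUP_least psiL_bound_aux assms)
  finally show ?thesis .
qed

lemma psiL_nn_bound:
  assumes "set xs \<subseteq> G"
  shows "(\<integral>\<^sup>+\<xi>. ennreal \<bar>psiL v xs \<xi>\<bar> \<partial>ell \<mu>) \<le> ennreal (eH v xs * prod_list (map b xs))"
proof -
  have "(\<integral>\<^sup>+\<xi>. ennreal \<bar>psiL v xs \<xi>\<bar> \<partial>ell \<mu>) \<le> (\<integral>\<^sup>+\<xi>. ennreal (T ^ length \<xi> * \<bar>psiL v xs \<xi>\<bar>) \<partial>ell \<mu>)"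
  proof (intro nn_integral_mono ennreal_leI)
    fix \<xi> show "\<bar>psiL v xs \<xi>\<bar> \<le> T ^ length \<xi> * \<bar>psiL v xs \<xi>\<bar>"
      using mult_right_mono[OF T_power_ge1[of "length \<xi>"], of "\<bar>psiL v xs \<xi>\<bar>"] by simp
  qed
  also note psiL_bound[OF assms]
  finally show ?thesis .
qed

lemma psiL_integrable: "set xs \<subseteq> G \<Longrightarrow> integrable (ell \<mu>) (psiL v xs)"
  using le_less_trans[OF psiL_nn_bound ennreal_less_top]
  by (intro integrableI_bounded) auto

text \<open>The candidate for the correlation function divided by the activities; it is defined
  without reference to any Gibbs measure.\<close>

definition phi :: "'a list \<Rightarrow> real" where
  "phi xs = (\<integral>\<xi>. psiL v xs \<xi> \<partial>ell \<mu>)"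

lemma phi_le: "set xs \<subseteq> G \<Longrightarrow> \<bar>phi xs\<bar> \<le> eH v xs * prod_list (map b xs)"
proof -
  assume xs: "set xs \<subseteq> G"
  have "ennreal (norm (phi xs)) \<le> (\<integral>\<^sup>+\<xi>. norm (psiL v xs \<xi>) \<partial>ell \<mu>)"
    unfolding phi_def by (rule integral_norm_bound_ennreal[OF psiL_integrable[OF xs]])
  also have "\<dots> \<le> ennreal (eH v xs * prod_list (map b xs))" using psiL_nn_bound[OF xs] by simp
  finally show ?thesis using prod_b_nonneg by (simp add: ennreal_le_iff)
qed

lemma phi_Nil: "phi [] = 1"
proof -
  have "phi [] = (\<integral>\<xi>. indicator {[]} \<xi> \<partial>ell \<mu>)"
    unfolding phi_def by (intro Bochner_Integration.integral_cong) (auto simp: indicator_def)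
  also have "\<dots> = measure (ell \<mu>) {\<xi>. set \<xi> \<subseteq> {}}" by simp
  also have "\<dots> = 1" using emeasure_ell_subset[of "{}"] by (simp add: measure_def)
  finally show ?thesis .
qed

lemma phi_measurable[measurable (raw)]:
  assumes [measurable]: "f \<in> measurable M LS"
  shows "(\<lambda>m. phi (f m)) \<in> borel_measurable M"
  unfolding phi_def by (rule ell.borel_measurable_lebesgue_integral) measurable

text \<open>The Kirkwood--Salsburg equation: in the integrated recursion of \<open>psiL\<close> the
  parts J and K of a splitting become independent, and the integral over K is again a value of
  \<open>phi\<close>. The estimate at the beginning supplies the integrability for Fubini.\<close>

lemma phi_Cons:
  assumes "x \<in> G" "set xs \<subseteq> G"
  shows "phi (x # xs) = prod_list (map (\<lambda>y. expneg (v x y)) xs) * (\<integral>\<xi>. prod_list (map (ff v x) \<xi>) * phi (xs @ \<xi>) \<partial>ell \<mu>)"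
    and "integrable (ell \<mu>) (\<lambda>\<xi>. prod_list (map (ff v x) \<xi>) * phi (xs @ \<xi>))"
proof -
  let ?g = "\<lambda>J K. prod_list (map (ff v x) J) * psiL v (xs @ J) K"
  have pn: "0 \<le> prod_list (map (\<lambda>y. 1 - expneg (v x y)) J)" for J by (rule prod_list_nonneg) auto
  have "(\<integral>\<^sup>+J. \<integral>\<^sup>+K. ennreal (norm (?g J K)) \<partial>ell \<mu> \<partial>ell \<mu>) = (\<integral>\<^sup>+J. ennreal (prod_list (map (\<lambda>y. 1 - expneg (v x y)) J)) * (\<integral>\<^sup>+K. ennreal \<bar>psiL v (xs @ J) K\<bar> \<partial>ell \<mu>) \<partial>ell \<mu>)"
    by (intro nn_integral_cong, subst nn_integral_cmult[symmetric])
       (auto intro!: nn_integral_cong simp: abs_mult abs_prod_list_ff ennreal_mult' pn)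
  also have "\<dots> \<le> (\<integral>\<^sup>+J. ennreal (eH v xs * prod_list (map b xs)) * ennreal (T ^ length J * prod_list (map (\<lambda>y. (1 - expneg (v x y)) * b y) J) * eH v J) \<partial>ell \<mu>)"
  proof (rule nn_integral_mono_AE)
    show "AE J in ell \<mu>. ennreal (prod_list (map (\<lambda>y. 1 - expneg (v x y)) J)) * (\<integral>\<^sup>+K. ennreal \<bar>psiL v (xs @ J) K\<bar> \<partial>ell \<mu>) \<le>
       ennreal (eH v xs * prod_list (map b xs)) * ennreal (T ^ length J * prod_list (map (\<lambda>y. (1 - expneg (v x y)) * b y) J) * eH v J)"
      using AE_ell_G
    proof eventually_elim
      case (elim J)
      let ?p = "prod_list (map (\<lambda>y. 1 - expneg (v x y)) J)"
      have p0: "0 \<le> ?p" by (rule prod_list_nonneg) auto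
      have "ennreal ?p * (\<integral>\<^sup>+K. ennreal \<bar>psiL v (xs @ J) K\<bar> \<partial>ell \<mu>) \<le> ennreal ?p * ennreal (eH v (xs @ J) * prod_list (map b (xs @ J)))"
        using elim assms by (intro mult_left_mono psiL_nn_bound) auto
      also have "\<dots> = ennreal (?p * (eH v (xs @ J) * prod_list (map b (xs @ J))))"
        using p0 prod_b_nonneg by (intro ennreal_mult[symmetric]) auto
      also have "\<dots> \<le> ennreal (eH v xs * prod_list (map b xs) * (T ^ length J * prod_list (map (\<lambda>y. (1 - expneg (v x y)) * b y) J) * eH v J))"
      proof (rule ennreal_leI)
        have n: "0 \<le> eH v xs * prod_list (map b xs) * (?p * prod_list (map b J) * eH v J)"
          using p0 prod_b_nonneg by simp
        have "?p * (eH v (xs @ J) * prod_list (map b (xs @ J))) = crossH v xs J * (eH v xs * prod_list (map b xs) * (?p * prod_list (map b J) * eH v J))"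
          by (simp add: eH_append mult_ac)
        also have "\<dots> \<le> T ^ length J * (eH v xs * prod_list (map b xs) * (?p * prod_list (map b J) * eH v J))"
          by (intro mult_right_mono n order_trans[OF crossH_le_1 T_power_ge1])
        finally show "?p * (eH v (xs @ J) * prod_list (map b (xs @ J))) \<le> eH v xs * prod_list (map b xs) * (T ^ length J * prod_list (map (\<lambda>y. (1 - expneg (v x y)) * b y) J) * eH v J)"
          by (simp add: prod_list_mult mult_ac)
      qed
      also have "\<dots> = ennreal (eH v xs * prod_list (map b xs)) * ennreal (T ^ length J * prod_list (map (\<lambda>y. (1 - expneg (v x y)) * b y) J) * eH v J)"
        using T_gt1 b_nonneg prod_b_nonneg by (intro ennreal_mult mult_nonneg_nonneg prod_list_nonneg) auto
      finally show ?case .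
    qed
  qed
  also have "\<dots> = ennreal (eH v xs * prod_list (map b xs)) * (\<integral>\<^sup>+J. ennreal (T ^ length J * prod_list (map (\<lambda>y. (1 - expneg (v x y)) * b y) J) * eH v J) \<partial>ell \<mu>)"
    by (rule nn_integral_cmult) measurable
  also have "\<dots> < \<infinity>"
    using le_less_trans[OF cond[OF assms(1)]] by (simp add: ennreal_mult_less_top)
  finally have fin: "(\<integral>\<^sup>+J. \<integral>\<^sup>+K. ennreal (norm (?g J K)) \<partial>ell \<mu> \<partial>ell \<mu>) < \<infinity>" .
  have m: "(\<lambda>(J, K). ?g J K) \<in> borel_measurable (ell \<mu> \<Otimes>\<^sub>M ell \<mu>)" by measurable
  have int: "integrable (ell \<mu> \<Otimes>\<^sub>M ell \<mu>) (\<lambda>(J, K). ?g J K)"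
  proof (rule integrableI_bounded[OF m])
    have "(\<integral>\<^sup>+p. ennreal (norm (case p of (J, K) \<Rightarrow> ?g J K)) \<partial>(ell \<mu> \<Otimes>\<^sub>M ell \<mu>)) = (\<integral>\<^sup>+J. \<integral>\<^sup>+K. ennreal (norm (?g J K)) \<partial>ell \<mu> \<partial>ell \<mu>)"
      using m by (subst ell.nn_integral_fst[symmetric]) auto
    then show "(\<integral>\<^sup>+p. ennreal (norm (case p of (J, K) \<Rightarrow> ?g J K)) \<partial>(ell \<mu> \<Otimes>\<^sub>M ell \<mu>)) < \<infinity>" using fin by simp
  qed
  have "psiL v (x # xs) = (\<lambda>\<xi>. prod_list (map (\<lambda>y. expneg (v x y)) xs) * ssum \<xi> ?g)"
    by (intro ext) simp
  then have "phi (x # xs) = prod_list (map (\<lambda>y. expneg (v x y)) xs) * (\<integral>\<xi>. ssum \<xi> ?g \<partial>ell \<mu>)"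
    unfolding phi_def by simp
  also have "(\<integral>\<xi>. ssum \<xi> ?g \<partial>ell \<mu>) = (\<integral>J. \<integral>K. ?g J K \<partial>ell \<mu> \<partial>ell \<mu>)"
    unfolding integral_ssum(2)[OF int] using ell2.integral_fst'[OF int] by simp
  finally show "phi (x # xs) = prod_list (map (\<lambda>y. expneg (v x y)) xs) * (\<integral>\<xi>. prod_list (map (ff v x) \<xi>) * phi (xs @ \<xi>) \<partial>ell \<mu>)"
    by (simp add: phi_def)
  show "integrable (ell \<mu>) (\<lambda>\<xi>. prod_list (map (ff v x) \<xi>) * phi (xs @ \<xi>))"
    using ell2.integrable_fst'[OF int] by (simp add: phi_def)
qed

end

section \<open>The correlation functions of a Gibbs measure are the graph sums\<close>

locale gibbs_fp = fp \<mu> v b T G + gibbs_meas \<mu> v P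
  for \<mu> :: "'a::polish_space measure" and v b T G P
begin

text \<open>The correlation function divided by the activities, that is, the density of the
  factorial moment measure with respect to the powers of \<mu>.\<close>

definition RR :: "'a list \<Rightarrow> real" where
  "RR xs = eH v xs * LL P (vL v xs)"

lemma RR_measurable[measurable (raw)]:
  assumes [measurable]: "f \<in> measurable M LS"
  shows "(\<lambda>m. RR (f m)) \<in> borel_measurable M"
  unfolding RR_def by measurable

lemma RR_bounds: "0 \<le> RR xs" "RR xs \<le> eH v xs"
  unfolding RR_def by (auto intro!: mult_left_le LL_le_1)

text \<open>The Mayer expansion in the potential \<open>v x\<close> of the first point, around the
  field \<open>vL v xs\<close> of the others. The factors exp (- field) on \<xi> together with
  \<open>eH v xs\<close> and \<open>eH v \<xi>\<close> assemble to
  \<open>eH v (xs @ \<xi>)\<close>.\<close>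

lemma RR_Cons:
  assumes x: "x \<in> G"
  shows "RR (x # xs) = prod_list (map (\<lambda>y. expneg (v x y)) xs) * (\<integral>\<xi>. prod_list (map (ff v x) \<xi>) * RR (xs @ \<xi>) \<partial>ell \<mu>)"
    and "integrable (ell \<mu>) (\<lambda>\<xi>. prod_list (map (ff v x) \<xi>) * RR (xs @ \<xi>))"
proof -
  let ?F = "\<lambda>\<xi>. (- 1) ^ length \<xi> * (prod_list (map (\<lambda>y. (1 - expneg (v x y)) * expneg (vL v xs y)) \<xi>) * eH v \<xi> * LL P (\<lambda>y. vL v xs y + vL v \<xi> y))"
  have int: "integrable (ell \<mu>) ?F" and eq: "LL P (\<lambda>y. v x y + vL v xs y) = (\<integral>\<xi>. ?F \<xi> \<partial>ell \<mu>)"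
    by (rule mayer_expansion; use integral_f_finite[OF x] in measurable)+
  have F: "eH v xs * ?F \<xi> = prod_list (map (ff v x) \<xi>) * RR (xs @ \<xi>)" for \<xi>
    by (simp add: RR_def eH_append crossH_eq prod_list_ff prod_list_mult vL_append[abs_def] mult_ac)
  show "integrable (ell \<mu>) (\<lambda>\<xi>. prod_list (map (ff v x) \<xi>) * RR (xs @ \<xi>))"
    unfolding F[symmetric] using int by (rule integrable_mult_right)
  have "RR (x # xs) = prod_list (map (\<lambda>y. expneg (v x y)) xs) * (eH v xs * (\<integral>\<xi>. ?F \<xi> \<partial>ell \<mu>))"
    by (simp add: RR_def vL_Cons[abs_def] eq)
  then show "RR (x # xs) = prod_list (map (\<lambda>y. expneg (v x y)) xs) * (\<integral>\<xi>. prod_list (map (ff v x) \<xi>) * RR (xs @ \<xi>) \<partial>ell \<mu>)"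
    unfolding integral_mult_right_zero[symmetric] F .
qed

text \<open>Both \<open>RR\<close> and \<open>phi\<close> solve the Kirkwood--Salsburg equations; every application of the equations
  gains a factor \<open>1 / T\<close> on their difference.\<close>

lemma RR_phi_diff:
  assumes "set xs \<subseteq> G"
  shows "\<bar>RR xs - phi xs\<bar> \<le> 2 / T ^ p * T ^ length xs * (eH v xs * prod_list (map b xs))"
  using assms
proof (induction p arbitrary: xs)
  \<comment> \<open>Both functions obey the bound eH \<cdot> \<Prod> b, the Gibbs one because RR
    \<le> eH and b \<ge> 1; hence the constant 2.\<close>
  case 0
  have "\<bar>RR xs\<bar> \<le> eH v xs * prod_list (map b xs)"
    using RR_bounds[of xs] mult_left_mono[OF prod_b_ge1[of xs] eH_nonneg[of v xs]] by simp
  then have "\<bar>RR xs - phi xs\<bar> \<le> 2 * (eH v xs * prod_list (map b xs))"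
    using phi_le[OF 0] by linarith
  also have "\<dots> \<le> T ^ length xs * (2 * (eH v xs * prod_list (map b xs)))"
    using mult_right_mono[OF T_power_ge1[of "length xs"], of "2 * (eH v xs * prod_list (map b xs))"] prod_b_nonneg by simp
  finally show ?case by (simp add: mult_ac)
next
  case (Suc p)
  show ?case
  proof (cases xs)
    case Nil then show ?thesis using T_gt1
      by (simp add: phi_Nil RR_def LL_def prob_space del: space_P)
  next
    case (Cons x ys)
    then have G: "x \<in> G" "set ys \<subseteq> G" using Suc.prems by auto
    let ?e = "prod_list (map (\<lambda>y. expneg (v x y)) ys)"
    let ?D = "\<lambda>\<xi>. prod_list (map (ff v x) \<xi>) * (RR (ys @ \<xi>) - phi (ys @ \<xi>))"
    have e0: "0 \<le> ?e" by (rule prod_list_nonneg) auto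
    have pn: "0 \<le> prod_list (map (\<lambda>y. 1 - expneg (v x y)) J)" for J by (rule prod_list_nonneg) auto
    have int: "integrable (ell \<mu>) ?D"
      unfolding right_diff_distrib by (intro Bochner_Integration.integrable_diff RR_Cons(2) phi_Cons(2) G)
    have "RR xs - phi xs = ?e * (\<integral>\<xi>. ?D \<xi> \<partial>ell \<mu>)"
      unfolding Cons RR_Cons(1)[OF G(1)] phi_Cons(1)[OF G] right_diff_distrib
      by (subst Bochner_Integration.integral_diff[OF RR_Cons(2) phi_Cons(2)]) (use G in \<open>auto simp: right_diff_distrib\<close>)
    then have "ennreal \<bar>RR xs - phi xs\<bar> = ennreal ?e * ennreal (norm (\<integral>\<xi>. ?D \<xi> \<partial>ell \<mu>))"
      using e0 by (simp add: abs_mult ennreal_mult)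
    also have "\<dots> \<le> ennreal ?e * (\<integral>\<^sup>+\<xi>. norm (?D \<xi>) \<partial>ell \<mu>)"
      by (intro mult_left_mono integral_norm_bound_ennreal int) simp
    also have "(\<integral>\<^sup>+\<xi>. norm (?D \<xi>) \<partial>ell \<mu>) = (\<integral>\<^sup>+\<xi>. ennreal (prod_list (map (\<lambda>y. 1 - expneg (v x y)) \<xi>)) * ennreal \<bar>RR (ys @ \<xi>) - phi (ys @ \<xi>)\<bar> \<partial>ell \<mu>)"
      by (intro nn_integral_cong) (simp add: abs_mult abs_prod_list_ff ennreal_mult' pn)
    also have "ennreal ?e * \<dots> \<le> ennreal (2 / T ^ p * T ^ length ys * (eH v (x # ys) * prod_list (map b (x # ys))))"
    proof (rule ks_step[OF G(1)])
      show "AE J in ell \<mu>. ennreal \<bar>RR (ys @ J) - phi (ys @ J)\<bar> \<le> ennreal (2 / T ^ p * T ^ length ys * T ^ length J * (eH v (ys @ J) * prod_list (map b (ys @ J))))"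
        using AE_ell_G
      proof eventually_elim
        case (elim J)
        then show ?case using Suc.IH[of "ys @ J"] G(2) by (intro ennreal_leI) (simp add: power_add mult_ac)
      qed
    qed (use T_gt1 in auto)
    finally have "\<bar>RR xs - phi xs\<bar> \<le> 2 / T ^ p * T ^ length ys * (eH v xs * prod_list (map b xs))"
      unfolding Cons[symmetric] using T_gt1 prod_b_nonneg by (subst (asm) ennreal_le_iff) auto
    \<comment> \<open>The root removed is the whole gain: \<open>ys\<close> is shorter than
      \<open>xs\<close> by one.\<close>
    also have "2 / T ^ p * T ^ length ys = 2 / T ^ Suc p * T ^ length xs"
      using T_gt1 by (simp add: Cons field_simps)
    finally show ?thesis .
  qed
qed

theorem RR_eq_phi:
  assumes "set xs \<subseteq> G" shows "RR xs = phi xs"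
proof -
  have "(\<lambda>p. 2 * T ^ length xs * (eH v xs * prod_list (map b xs)) * (1 / T) ^ p) \<longlonglongrightarrow> 2 * T ^ length xs * (eH v xs * prod_list (map b xs)) * 0"
    using T_gt1 by (intro tendsto_intros LIMSEQ_power_zero) auto
  moreover have "\<bar>RR xs - phi xs\<bar> \<le> 2 * T ^ length xs * (eH v xs * prod_list (map b xs)) * (1 / T) ^ p" for p
    using RR_phi_diff[OF assms, of p] by (simp add: power_one_over divide_inverse power_inverse mult_ac)
  ultimately have "\<bar>RR xs - phi xs\<bar> \<le> 2 * T ^ length xs * (eH v xs * prod_list (map b xs)) * 0"
    by (intro LIMSEQ_le_const) auto
  then show ?thesis by simp
qed

end

section \<open>Janossy densities and uniqueness\<close>

text \<open>A hard wall on B: the weight exp (- \<integral> hardB B d\<eta>) is the indicator of the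
  event that B is empty of points.\<close>

definition hardB :: "'a set \<Rightarrow> 'a \<Rightarrow> ennreal" where
  "hardB B y = (if y \<in> B then \<infinity> else 0)"

lemma hardB_measurable[measurable (raw)]:
  assumes [measurable]: "f \<in> borel_measurable M" "B \<in> sets borel"
  shows "(\<lambda>m. hardB B (f m)) \<in> borel_measurable M"
  unfolding hardB_def by measurable

lemma nn_integral_hardB:
  assumes "sets \<eta> = sets borel" "B \<in> sets borel"
  shows "expneg (\<integral>\<^sup>+y. hardB B y \<partial>\<eta>) = (if emeasure \<eta> B = 0 then 1 else 0)"
proof -
  have "(\<integral>\<^sup>+y. hardB B y \<partial>\<eta>) = (\<integral>\<^sup>+y. \<infinity> * indicator B y \<partial>\<eta>)"
    by (intro nn_integral_cong) (simp add: hardB_def)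
  also have "\<dots> = \<infinity> * emeasure \<eta> B"
    using assms by (intro nn_integral_cmult_indicator) simp
  finally show ?thesis by (simp add: ennreal_top_mult)
qed

context gibbs_meas
begin

definition EN :: "nat \<Rightarrow> 'a set \<Rightarrow> ('a measure \<Rightarrow> ennreal) \<Rightarrow> ('a \<Rightarrow> ennreal) \<Rightarrow> ennreal" where
  "EN N B G u = (\<integral>\<^sup>+\<eta>. indicator {of_nat N} (emeasure \<eta> B) * G (restr B \<eta>) * ennreal (expneg (\<integral>\<^sup>+y. u y \<partial>\<eta>)) \<partial>P)"

text \<open>The Gibbs equation for the sum over the points in B; on the event of N + 1 points this
  sum has N + 1 equal terms, and taking one point away leaves N.\<close>

lemma EN_Suc:
  assumes B[measurable]: "B \<in> sets borel" "bounded B" and G: "G \<in> borel_measurable NNsig" "\<And>\<eta>. G \<eta> \<le> 1"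
    and u[measurable]: "u \<in> borel_measurable borel"
  shows "of_nat (Suc N) * EN (Suc N) B G u = (\<integral>\<^sup>+x. indicator B x * ennreal (expneg (u x)) * EN N B (\<lambda>\<eta>. G (add_dirac \<eta> x)) (\<lambda>y. u y + v x y) \<partial>\<mu>)"
proof -
  have Gm[measurable]: "(\<lambda>m. G (f m)) \<in> borel_measurable M" if "f \<in> measurable M NNsig" for f M
    using measurable_compose[OF that G(1)] by simp
  let ?F = "\<lambda>(x, \<eta>). indicator B x * (indicator {of_nat (Suc N)} (emeasure \<eta> B) * G (restr B \<eta>) * ennreal (expneg (\<integral>\<^sup>+y. u y \<partial>\<eta>)))"
  have m1: "(\<lambda>p. restr B (snd p)) \<in> measurable (borel \<Otimes>\<^sub>M NNsig) (NNsig :: 'a measure measure)" by measurable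
  have m2: "(\<lambda>p. G (restr B (snd p))) \<in> borel_measurable (borel \<Otimes>\<^sub>M NNsig)" by (rule Gm[OF m1])
  have m3: "(\<lambda>\<eta>. G (restr B \<eta>)) \<in> borel_measurable NNsig" by (rule Gm) measurable
  have "of_nat (Suc N) * EN (Suc N) B G u = (\<integral>\<^sup>+\<eta>. of_nat (Suc N) * (indicator {of_nat (Suc N)} (emeasure \<eta> B) * G (restr B \<eta>) * ennreal (expneg (\<integral>\<^sup>+y. u y \<partial>\<eta>))) \<partial>P)"
    unfolding EN_def using m3 by (subst nn_integral_cmult) auto
  also have "\<dots> = (\<integral>\<^sup>+\<eta>. \<integral>\<^sup>+x. ?F (x, \<eta>) \<partial>\<eta> \<partial>P)"
  proof (rule nn_integral_cong)
    fix \<eta> assume "\<eta> \<in> space P"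
    then have N: "\<eta> \<in> NN" by simp
    have "(\<integral>\<^sup>+x. ?F (x, \<eta>) \<partial>\<eta>) = emeasure \<eta> B * (indicator {of_nat (Suc N)} (emeasure \<eta> B) * G (restr B \<eta>) * ennreal (expneg (\<integral>\<^sup>+y. u y \<partial>\<eta>)))"
      using NN_sets[OF N] by (simp add: nn_integral_multc)
    then show "of_nat (Suc N) * (indicator {of_nat (Suc N)} (emeasure \<eta> B) * G (restr B \<eta>) * ennreal (expneg (\<integral>\<^sup>+y. u y \<partial>\<eta>))) = (\<integral>\<^sup>+x. ?F (x, \<eta>) \<partial>\<eta>)"
      by (simp add: indicator_def)
  qed
  also have "\<dots> = (\<integral>\<^sup>+ x. (\<integral>\<^sup>+ \<eta>. ?F (x, add_dirac \<eta> x) * ennreal (expneg (WW v x \<eta>)) \<partial>P) \<partial>\<mu>)"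
  proof (rule GNZ)
    show "?F \<in> borel_measurable (borel \<Otimes>\<^sub>M NNsig)" using m2 by measurable
    show "?F p < \<infinity>" for p using le_less_trans[OF G(2)]
      by (auto simp: case_prod_unfold ennreal_mult_less_top indicator_def)
  qed
  also have "\<dots> = (\<integral>\<^sup>+x. indicator B x * ennreal (expneg (u x)) * EN N B (\<lambda>\<eta>. G (add_dirac \<eta> x)) (\<lambda>y. u y + v x y) \<partial>\<mu>)"
  proof (rule nn_integral_cong)
    fix x
    have m4: "(\<lambda>\<eta>. G (add_dirac (restr B \<eta>) x)) \<in> borel_measurable NNsig" by (rule Gm) measurable
    show "(\<integral>\<^sup>+ \<eta>. ?F (x, add_dirac \<eta> x) * ennreal (expneg (WW v x \<eta>)) \<partial>P) =
       indicator B x * ennreal (expneg (u x)) * EN N B (\<lambda>\<eta>. G (add_dirac \<eta> x)) (\<lambda>y. u y + v x y)"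
    proof (cases "x \<in> B")
      case True
      have "(\<integral>\<^sup>+ \<eta>. ?F (x, add_dirac \<eta> x) * ennreal (expneg (WW v x \<eta>)) \<partial>P) =
        (\<integral>\<^sup>+ \<eta>. ennreal (expneg (u x)) * (indicator {of_nat N} (emeasure \<eta> B) * G (add_dirac (restr B \<eta>) x) * ennreal (expneg (\<integral>\<^sup>+y. u y + v x y \<partial>\<eta>))) \<partial>P)"
      proof (rule nn_integral_cong)
        fix \<eta> assume "\<eta> \<in> space P"
        then have N: "\<eta> \<in> NN" by simp
        obtain k where k: "emeasure \<eta> B = of_nat k" using NN_nat[OF N B] by auto
        then have "emeasure (add_dirac \<eta> x) B = of_nat (Suc k)"
          using True N by (simp add: emeasure_add_dirac NN_sets add.commute)
        then have "indicator {of_nat (Suc N)} (emeasure (add_dirac \<eta> x) B) = (indicator {of_nat N} (emeasure \<eta> B) :: ennreal)"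
          using k by (simp add: indicator_def del: of_nat_Suc)
        then show "?F (x, add_dirac \<eta> x) * ennreal (expneg (WW v x \<eta>)) =
          ennreal (expneg (u x)) * (indicator {of_nat N} (emeasure \<eta> B) * G (add_dirac (restr B \<eta>) x) * ennreal (expneg (\<integral>\<^sup>+y. u y + v x y \<partial>\<eta>)))"
          using True N
          by (simp add: restr_add_dirac NN_sets nn_integral_add_dirac NN_measurable nn_integral_add expneg_add WW_def ennreal_mult mult_ac)
      qed
      also have "\<dots> = ennreal (expneg (u x)) * EN N B (\<lambda>\<eta>. G (add_dirac \<eta> x)) (\<lambda>y. u y + v x y)"
        unfolding EN_def using m4 by (intro nn_integral_cmult) measurable
      finally show ?thesis using True by simp
    qed simp
  qed
  finally show ?thesis .
qed

text \<open>Points are removed from B one by one until none is left; the event that B is then empty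
  is absorbed as the potential \<open>hardB B\<close>, and the removed points leave their fields
  behind.\<close>

lemma EN_eq:
  assumes B[measurable]: "B \<in> sets borel" "bounded B" and G: "G \<in> borel_measurable NNsig" "\<And>\<eta>. G \<eta> \<le> 1"
    and u: "u \<in> borel_measurable borel"
  shows "ennreal (fact N) * EN N B G u = (\<integral>\<^sup>+\<zeta>. indicator {\<zeta>. set \<zeta> \<subseteq> B} \<zeta> * G (conf \<zeta>) *
      ennreal (eH v \<zeta> * prod_list (map (\<lambda>y. expneg (u y)) \<zeta>) * LL P (\<lambda>y. hardB B y + (u y + vL v \<zeta> y))) \<partial>Lk \<mu> N)"
  using G u
proof (induction N arbitrary: G u)
  case 0
  note [measurable] = 0(3)
  have [measurable]: "(\<lambda>\<zeta>. G (conf \<zeta>)) \<in> borel_measurable LS"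
    by (rule measurable_compose[OF measurable_conf 0(1)])
  have "EN 0 B G u = (\<integral>\<^sup>+\<eta>. G (null_measure borel) * ennreal (expneg (\<integral>\<^sup>+y. hardB B y + u y \<partial>\<eta>)) \<partial>P)"
    unfolding EN_def
  proof (rule nn_integral_cong)
    fix \<eta> assume "\<eta> \<in> space P"
    then have N: "\<eta> \<in> NN" by simp
    show "indicator {of_nat 0} (emeasure \<eta> B) * G (restr B \<eta>) * ennreal (expneg (\<integral>\<^sup>+y. u y \<partial>\<eta>)) =
      G (null_measure borel) * ennreal (expneg (\<integral>\<^sup>+y. hardB B y + u y \<partial>\<eta>))"
      using restr_eq_null[OF NN_sets[OF N] B(1)] 
      by (subst nn_integral_add) (auto simp: NN_measurable[OF N] expneg_add nn_integral_hardB[OF NN_sets[OF N] B(1)] indicator_def)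
  qed
  also have "\<dots> = G (null_measure borel) * ennreal (LL P (\<lambda>y. hardB B y + u y))"
    by (subst nn_integral_cmult) (auto simp: nn_LL)
  finally show ?case
    by (subst nn_integral_Lk_0) auto
next
  case (Suc N)
  note G = Suc.prems(1,2) and u[measurable] = Suc.prems(3)
  have Gm: "(\<lambda>m. G (f m)) \<in> borel_measurable M" if "f \<in> measurable M NNsig" for f M
    using measurable_compose[OF that G(1)] by simp
  have [measurable]: "(\<lambda>\<zeta>. G (conf \<zeta>)) \<in> borel_measurable LS" "(\<lambda>\<zeta>. G (add_dirac (conf \<zeta>) x)) \<in> borel_measurable LS" for x
    by (rule Gm; measurable)+
  define I where "I G u \<zeta> = indicator {\<zeta>. set \<zeta> \<subseteq> B} \<zeta> * G (conf \<zeta>) *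
      ennreal (eH v \<zeta> * prod_list (map (\<lambda>y. expneg (u y)) \<zeta>) * LL P (\<lambda>y. hardB B y + (u y + vL v \<zeta> y)))" for G u \<zeta>
  have IH: "ennreal (fact N) * EN N B (\<lambda>\<eta>. G (add_dirac \<eta> x)) (\<lambda>y. u y + v x y) = (\<integral>\<^sup>+\<zeta>. I (\<lambda>\<eta>. G (add_dirac \<eta> x)) (\<lambda>y. u y + v x y) \<zeta> \<partial>Lk \<mu> N)" for x
    unfolding I_def by (rule Suc.IH) (auto intro!: Gm G(2))
  have "ennreal (fact (Suc N)) * EN (Suc N) B G u = ennreal (fact N) * (of_nat (Suc N) * EN (Suc N) B G u)"
    by (simp add: ennreal_of_nat_eq_real_of_nat ennreal_mult mult_ac del: of_nat_Suc)
  also have "\<dots> = ennreal (fact N) * (\<integral>\<^sup>+x. indicator B x * ennreal (expneg (u x)) * EN N B (\<lambda>\<eta>. G (add_dirac \<eta> x)) (\<lambda>y. u y + v x y) \<partial>\<mu>)"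
    by (simp only: EN_Suc[OF B G u])
  also have "\<dots> = (\<integral>\<^sup>+x. indicator B x * ennreal (expneg (u x)) * (ennreal (fact N) * EN N B (\<lambda>\<eta>. G (add_dirac \<eta> x)) (\<lambda>y. u y + v x y)) \<partial>\<mu>)"
  proof -
    have "(\<lambda>p. G (add_dirac (restr B (snd p)) (fst p))) \<in> borel_measurable (borel \<Otimes>\<^sub>M P)"
      by (rule Gm) measurable
    then have "(\<lambda>(x, \<eta>). indicator {of_nat N} (emeasure \<eta> B) * G (add_dirac (restr B \<eta>) x) * ennreal (expneg (\<integral>\<^sup>+y. u y + v x y \<partial>\<eta>))) \<in> borel_measurable (borel \<Otimes>\<^sub>M P)"
      by (simp add: case_prod_unfold) measurable
    then have "(\<lambda>x. EN N B (\<lambda>\<eta>. G (add_dirac \<eta> x)) (\<lambda>y. u y + v x y)) \<in> borel_measurable borel"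
      unfolding EN_def by (rule borel_measurable_nn_integral)
    then show ?thesis by (subst nn_integral_cmult[symmetric]) (auto simp: mult_ac)
  qed
  also have "\<dots> = (\<integral>\<^sup>+x. \<integral>\<^sup>+\<zeta>. I G u (x # \<zeta>) \<partial>Lk \<mu> N \<partial>\<mu>)"
  proof (rule nn_integral_cong)
    fix x
    have Ieq: "indicator B x * ennreal (expneg (u x)) * I (\<lambda>\<eta>. G (add_dirac \<eta> x)) (\<lambda>y. u y + v x y) \<zeta> = I G u (x # \<zeta>)" for \<zeta>
    proof -
      have 1: "LL P (\<lambda>y. hardB B y + ((u y + v x y) + vL v \<zeta> y)) = LL P (\<lambda>y. hardB B y + (u y + vL v (x # \<zeta>) y))"
        by (simp add: vL_Cons add.assoc)
      have 2: "expneg (u x) * (eH v \<zeta> * prod_list (map (\<lambda>y. expneg (u y + v x y)) \<zeta>) * LL P (\<lambda>y. hardB B y + ((u y + v x y) + vL v \<zeta> y))) =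
        eH v (x # \<zeta>) * prod_list (map (\<lambda>y. expneg (u y)) (x # \<zeta>)) * LL P (\<lambda>y. hardB B y + (u y + vL v (x # \<zeta>) y))"
        unfolding 1 by (simp add: expneg_add prod_list_mult mult_ac)
      have "ennreal (expneg (u x)) * ennreal (eH v \<zeta> * prod_list (map (\<lambda>y. expneg (u y + v x y)) \<zeta>) * LL P (\<lambda>y. hardB B y + ((u y + v x y) + vL v \<zeta> y))) =
        ennreal (eH v (x # \<zeta>) * prod_list (map (\<lambda>y. expneg (u y)) (x # \<zeta>)) * LL P (\<lambda>y. hardB B y + (u y + vL v (x # \<zeta>) y)))"
        unfolding 2[symmetric] by (rule ennreal_mult'[symmetric]) simp
      note e1 = this
      have e2: "indicator B x * (indicator {\<zeta>. set \<zeta> \<subseteq> B} \<zeta> :: ennreal) = indicator {\<zeta>. set \<zeta> \<subseteq> B} (x # \<zeta>)"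
        by (simp add: indicator_def)
      have "i * e * (i' * g * w) = (i * i') * g * (e * w)" for i e i' g w :: ennreal
        by (simp only: mult_ac)
      then show ?thesis unfolding I_def conf.simps e1[symmetric] e2[symmetric] .
    qed
    then show "indicator B x * ennreal (expneg (u x)) * (ennreal (fact N) * EN N B (\<lambda>\<eta>. G (add_dirac \<eta> x)) (\<lambda>y. u y + v x y)) = (\<integral>\<^sup>+\<zeta>. I G u (x # \<zeta>) \<partial>Lk \<mu> N)"
    proof -
      have "I (\<lambda>\<eta>. G (add_dirac \<eta> x)) (\<lambda>y. u y + v x y) \<in> borel_measurable LS"
        unfolding I_def[abs_def] by measurable
      then show ?thesis
        unfolding IH Ieq[symmetric] by (intro nn_integral_cmult[symmetric]) simp
    qed
  qed
  also have "\<dots> = (\<integral>\<^sup>+\<zeta>. I G u \<zeta> \<partial>Lk \<mu> (Suc N))"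
    by (rule nn_integral_Lk_Suc[symmetric]) (auto simp: I_def)
  finally show ?case unfolding I_def .
qed

text \<open>Sum over the number of points in B. The last factor is the Janossy density of the law
  weighted by exp (- \<integral> u d\<eta>); this weight may depend on points outside B, which later
  serves to condition on other regions and on additional roots.\<close>

lemma janossy:
  assumes B[measurable]: "B \<in> sets borel" "bounded B" and G: "G \<in> borel_measurable NNsig" "\<And>\<eta>. G \<eta> \<le> 1"
    and u[measurable]: "u \<in> borel_measurable borel"
  shows "(\<integral>\<^sup>+\<eta>. G (restr B \<eta>) * ennreal (expneg (\<integral>\<^sup>+y. u y \<partial>\<eta>)) \<partial>P) = (\<integral>\<^sup>+\<zeta>. indicator {\<zeta>. set \<zeta> \<subseteq> B} \<zeta> * G (conf \<zeta>) *
      ennreal (eH v \<zeta> * prod_list (map (\<lambda>y. expneg (u y)) \<zeta>) * LL P (\<lambda>y. hardB B y + (u y + vL v \<zeta> y))) \<partial>ell \<mu>)"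
proof -
  have Gm: "(\<lambda>m. G (f m)) \<in> borel_measurable M" if "f \<in> measurable M NNsig" for f M
    using measurable_compose[OF that G(1)] by simp
  have [measurable]: "(\<lambda>\<zeta>. G (conf \<zeta>)) \<in> borel_measurable LS" "(\<lambda>\<eta>. G (restr B \<eta>)) \<in> borel_measurable NNsig"
    by (rule Gm; measurable)+
  have "(\<integral>\<^sup>+\<eta>. G (restr B \<eta>) * ennreal (expneg (\<integral>\<^sup>+y. u y \<partial>\<eta>)) \<partial>P) =
      (\<integral>\<^sup>+\<eta>. (\<Sum>N. indicator {of_nat N} (emeasure \<eta> B) * G (restr B \<eta>) * ennreal (expneg (\<integral>\<^sup>+y. u y \<partial>\<eta>))) \<partial>P)"
  proof (rule nn_integral_cong)
    fix \<eta> assume "\<eta> \<in> space P"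
    then obtain k where k: "emeasure \<eta> B = of_nat k" using NN_nat[OF _ B] by auto
    show "G (restr B \<eta>) * ennreal (expneg (\<integral>\<^sup>+y. u y \<partial>\<eta>)) = (\<Sum>N. indicator {of_nat N} (emeasure \<eta> B) * G (restr B \<eta>) * ennreal (expneg (\<integral>\<^sup>+y. u y \<partial>\<eta>)))"
      by (subst suminf_finite[of "{k}"]) (auto simp: k indicator_def)
  qed
  also have "\<dots> = (\<Sum>N. EN N B G u)"
    unfolding EN_def by (rule nn_integral_suminf) measurable
  also have "\<dots> = (\<Sum>N. ennreal (1 / fact N) * (ennreal (fact N) * EN N B G u))"
  proof (intro suminf_cong)
    fix N show "EN N B G u = ennreal (1 / fact N) * (ennreal (fact N) * EN N B G u)"
      by (simp add: mult.assoc[symmetric] ennreal_mult[symmetric])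
  qed
  also have "\<dots> = (\<integral>\<^sup>+\<zeta>. indicator {\<zeta>. set \<zeta> \<subseteq> B} \<zeta> * G (conf \<zeta>) *
      ennreal (eH v \<zeta> * prod_list (map (\<lambda>y. expneg (u y)) \<zeta>) * LL P (\<lambda>y. hardB B y + (u y + vL v \<zeta> y))) \<partial>ell \<mu>)"
    unfolding EN_eq[OF B G u] by (rule nn_integral_ell[symmetric]) measurable
  finally show ?thesis .
qed

end

section \<open>Janossy densities expressed through the graph sums\<close>

context fp
begin

text \<open>Inclusion-exclusion, the classical inversion from correlation functions to Janossy
  densities. It involves only \<mu> and v, and so is available before any Gibbs measure is known to
  exist.\<close>

definition jan :: "'a set \<Rightarrow> 'a list \<Rightarrow> real" where
  "jan B xs = (\<integral>\<xi>. (- 1) ^ length \<xi> * indicator {\<xi>. set \<xi> \<subseteq> B} \<xi> * phi (xs @ \<xi>) \<partial>ell \<mu>)"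

lemma jan_measurable[measurable (raw)]:
  assumes [measurable]: "f \<in> measurable M LS" "B \<in> sets borel"
  shows "(\<lambda>m. jan B (f m)) \<in> borel_measurable M"
  unfolding jan_def by (rule ell.borel_measurable_lebesgue_integral) measurable

end

context gibbs_fp
begin

text \<open>The Mayer expansion in the hard wall potential: there 1 - exp (- u) is the indicator of
  B, so the terms are integrals of correlation functions over B with alternating signs.\<close>

lemma jan_eq:
  assumes B[measurable]: "B \<in> sets borel" "bounded B" and xs: "set xs \<subseteq> G"
  shows "jan B xs = eH v xs * LL P (\<lambda>y. hardB B y + vL v xs y)"
proof -
  let ?F = "\<lambda>\<xi>. (- 1) ^ length \<xi> * (prod_list (map (\<lambda>y. (1 - expneg (hardB B y)) * expneg (vL v xs y)) \<xi>) * eH v \<xi> * LL P (\<lambda>y. vL v xs y + vL v \<xi> y))"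
  have "(\<integral>\<^sup>+y. ennreal (1 - expneg (hardB B y)) \<partial>\<mu>) = (\<integral>\<^sup>+y. indicator B y \<partial>\<mu>)"
    by (intro nn_integral_cong) (simp add: hardB_def)
  also have "\<dots> < \<infinity>" using fin_mu[OF B] by simp
  finally have eq: "LL P (\<lambda>y. hardB B y + vL v xs y) = (\<integral>\<xi>. ?F \<xi> \<partial>ell \<mu>)"
    by (intro mayer_expansion(2)) measurable
  have ind: "prod_list (map (\<lambda>y. 1 - expneg (hardB B y)) \<xi>) = indicator {\<xi>. set \<xi> \<subseteq> B} \<xi>" for \<xi>
    by (induction \<xi>) (auto simp: hardB_def indicator_def)
  have F: "eH v xs * ?F \<xi> = (- 1) ^ length \<xi> * indicator {\<xi>. set \<xi> \<subseteq> B} \<xi> * RR (xs @ \<xi>)" for \<xi>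
    by (simp add: RR_def eH_append crossH_eq prod_list_mult vL_append[abs_def] ind mult_ac)
  have "eH v xs * LL P (\<lambda>y. hardB B y + vL v xs y) = (\<integral>\<xi>. (- 1) ^ length \<xi> * indicator {\<xi>. set \<xi> \<subseteq> B} \<xi> * RR (xs @ \<xi>) \<partial>ell \<mu>)"
    unfolding eq integral_mult_right_zero[symmetric] F ..
  also have "\<dots> = jan B xs"
    unfolding jan_def
  proof (rule integral_cong_AE)
    show "AE \<xi> in ell \<mu>. (- 1) ^ length \<xi> * indicator {\<xi>. set \<xi> \<subseteq> B} \<xi> * RR (xs @ \<xi>) = (- 1) ^ length \<xi> * indicator {\<xi>. set \<xi> \<subseteq> B} \<xi> * phi (xs @ \<xi>)"
      using AE_ell_G by eventually_elim (simp add: RR_eq_phi xs)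
  qed measurable
  finally show ?thesis ..
qed

lemma jan_bounds:
  assumes "B \<in> sets borel" "bounded B" "set xs \<subseteq> G"
  shows "0 \<le> jan B xs" "jan B xs \<le> 1"
proof -
  note [measurable] = assms(1)
  have "LL P (\<lambda>y. hardB B y + vL v xs y) \<le> 1" by (intro LL_le_1) measurable
  then show "0 \<le> jan B xs" "jan B xs \<le> 1"
    unfolding jan_eq[OF assms] using eH_bounds[of v xs] by (auto intro: mult_le_one)
qed

text \<open>For empty \<open>xs\<close> this is the law of the configuration in B. Additional roots
  describe the same law weighted by the nonlocal Boltzmann factor of \<open>xs\<close>, which the
  Gibbs equation for the limit process will require.\<close>

lemma local_law:
  assumes B[measurable]: "B \<in> sets borel" "bounded B" and Gm: "F \<in> borel_measurable NNsig" "\<And>\<eta>. F \<eta> \<le> 1"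
    and xs: "set xs \<subseteq> G"
  shows "ennreal (eH v xs) * (\<integral>\<^sup>+\<eta>. F (restr B \<eta>) * ennreal (expneg (\<integral>\<^sup>+y. vL v xs y \<partial>\<eta>)) \<partial>P) =
    (\<integral>\<^sup>+\<zeta>. indicator {\<zeta>. set \<zeta> \<subseteq> B} \<zeta> * F (conf \<zeta>) * ennreal (jan B (xs @ \<zeta>)) \<partial>ell \<mu>)"
proof -
  have [measurable]: "(\<lambda>\<zeta>. F (conf \<zeta>)) \<in> borel_measurable LS"
    by (rule measurable_compose[OF _ Gm(1)]) measurable
  have "ennreal (eH v xs) * (\<integral>\<^sup>+\<eta>. F (restr B \<eta>) * ennreal (expneg (\<integral>\<^sup>+y. vL v xs y \<partial>\<eta>)) \<partial>P) =
    ennreal (eH v xs) * (\<integral>\<^sup>+\<zeta>. indicator {\<zeta>. set \<zeta> \<subseteq> B} \<zeta> * F (conf \<zeta>) *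
      ennreal (eH v \<zeta> * prod_list (map (\<lambda>y. expneg (vL v xs y)) \<zeta>) * LL P (\<lambda>y. hardB B y + (vL v xs y + vL v \<zeta> y))) \<partial>ell \<mu>)"
    by (subst janossy[OF B Gm]) auto
  also have "\<dots> = (\<integral>\<^sup>+\<zeta>. indicator {\<zeta>. set \<zeta> \<subseteq> B} \<zeta> * F (conf \<zeta>) * (ennreal (eH v xs) *
      ennreal (eH v \<zeta> * prod_list (map (\<lambda>y. expneg (vL v xs y)) \<zeta>) * LL P (\<lambda>y. hardB B y + (vL v xs y + vL v \<zeta> y)))) \<partial>ell \<mu>)"
    by (subst nn_integral_cmult[symmetric]) (auto intro!: nn_integral_cong simp: mult_ac)
  also have "\<dots> = (\<integral>\<^sup>+\<zeta>. indicator {\<zeta>. set \<zeta> \<subseteq> B} \<zeta> * F (conf \<zeta>) * ennreal (jan B (xs @ \<zeta>)) \<partial>ell \<mu>)"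
  proof (rule nn_integral_cong_AE)
    show "AE \<zeta> in ell \<mu>. indicator {\<zeta>. set \<zeta> \<subseteq> B} \<zeta> * F (conf \<zeta>) * (ennreal (eH v xs) *
      ennreal (eH v \<zeta> * prod_list (map (\<lambda>y. expneg (vL v xs y)) \<zeta>) * LL P (\<lambda>y. hardB B y + (vL v xs y + vL v \<zeta> y)))) =
      indicator {\<zeta>. set \<zeta> \<subseteq> B} \<zeta> * F (conf \<zeta>) * ennreal (jan B (xs @ \<zeta>))"
      using AE_ell_G
    proof eventually_elim
      case (elim \<zeta>)
      then have "jan B (xs @ \<zeta>) = eH v xs * (eH v \<zeta> * prod_list (map (\<lambda>y. expneg (vL v xs y)) \<zeta>) * LL P (\<lambda>y. hardB B y + (vL v xs y + vL v \<zeta> y)))"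
        using xs by (subst jan_eq[OF B]) (simp_all add: eH_append crossH_eq vL_append mult_ac)
      then show ?case by (simp add: ennreal_mult' mult_ac)
    qed
  qed
  finally show ?thesis .
qed

lemma local_law0:
  assumes "B \<in> sets borel" "bounded B" "F \<in> borel_measurable NNsig" "\<And>\<eta>. F \<eta> \<le> 1"
  shows "(\<integral>\<^sup>+\<eta>. F (restr B \<eta>) \<partial>P) = (\<integral>\<^sup>+\<zeta>. indicator {\<zeta>. set \<zeta> \<subseteq> B} \<zeta> * F (conf \<zeta>) * ennreal (jan B \<zeta>) \<partial>ell \<mu>)"
  using local_law[OF assms, of "[]"] by simp

end

section \<open>Local events\<close>

definition local_sets :: "'a::metric_space measure set set" where
  "local_sets = (\<Union>n. (\<lambda>A. restr (Lam n) -` A \<inter> NN) ` sets NNsig)"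

lemma local_setsI: "A \<in> sets NNsig \<Longrightarrow> restr (Lam n) -` A \<inter> NN \<in> local_sets"
  unfolding local_sets_def by auto

lemma local_sets_subset: "local_sets \<subseteq> sets NNsig"
proof
  fix X :: "'a measure set" assume "X \<in> local_sets"
  then obtain n A where X: "X = restr (Lam n) -` A \<inter> NN" "A \<in> sets NNsig" by (auto simp: local_sets_def)
  have "restr (Lam n) \<in> measurable NNsig (NNsig :: 'a measure measure)" by measurable
  from measurable_sets[OF this X(2)] show "X \<in> sets NNsig" by (simp add: X space_NNsig)
qed

text \<open>An event that depends on the configuration in one ball also depends only on the
  configuration in any larger ball. Finitely many local events can therefore be moved to a common
  ball, which gives stability under intersections.\<close>

lemma local_sets_level:
  assumes X: "X \<in> local_sets"
  shows "\<exists>n A. A \<in> sets NNsig \<and> (\<forall>m\<ge>n. X = restr (Lam m) -` A \<inter> (NN :: 'a::metric_space measure set))"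
proof -
  obtain n A where X: "X = restr (Lam n) -` A \<inter> NN" "A \<in> sets NNsig" using X by (auto simp: local_sets_def)
  have r: "restr (Lam n) \<in> measurable NNsig (NNsig :: 'a measure measure)" by measurable
  have "restr (Lam n) -` A \<inter> NN \<in> sets NNsig" using measurable_sets[OF r X(2)] by (simp add: space_NNsig)
  moreover have "X = restr (Lam m) -` (restr (Lam n) -` A \<inter> NN) \<inter> NN" if "n \<le> m" for m
  proof -
    have "Lam n \<inter> Lam m = (Lam n :: 'a set)" using Lam_mono[OF that] by auto
    then show ?thesis by (auto simp: X restr_restr NN_sets restr_NN)
  qed
  ultimately show ?thesis by blast
qed

lemma Int_stable_local: "Int_stable local_sets"
proof (rule Int_stableI)
  fix X Y :: "'a::metric_space measure set" assume "X \<in> local_sets" "Y \<in> local_sets"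
  then obtain n A k B where A: "A \<in> sets NNsig" "\<And>m. n \<le> m \<Longrightarrow> X = restr (Lam m) -` A \<inter> NN"
    and B: "B \<in> sets NNsig" "\<And>m. k \<le> m \<Longrightarrow> Y = restr (Lam m) -` B \<inter> NN"
    by (metis local_sets_level)
  have "X \<inter> Y = restr (Lam (max n k)) -` (A \<inter> B) \<inter> NN"
    using A(2)[of "max n k"] B(2)[of "max n k"] by auto
  also have "\<dots> \<in> local_sets" using A(1) B(1) by (intro local_setsI) auto
  finally show "X \<inter> Y \<in> local_sets" .
qed

lemma NN_local: "(NN :: 'a::metric_space measure set) \<in> local_sets"
proof -
  have "NN = restr (Lam 0) -` NN \<inter> (NN :: 'a measure set)" by (auto simp: restr_NN)
  also have "\<dots> \<in> local_sets" using sets.top[of NNsig] by (intro local_setsI) (simp add: space_NNsig)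
  finally show ?thesis .
qed

lemma sets_NNsig_local: "sets NNsig = sigma_sets NN (local_sets :: 'a::metric_space measure set set)"
proof
  show "sigma_sets NN local_sets \<subseteq> sets (NNsig :: 'a measure measure)"
    using sets.sigma_sets_subset[OF local_sets_subset] by (simp add: space_NNsig)
  show "sets (NNsig :: 'a measure measure) \<subseteq> sigma_sets NN local_sets"
    unfolding sets_NNsig
  proof (rule sigma_sets_mono, safe)
    fix B :: "'a set" and k assume B: "B \<in> sets borel" "bounded B"
    obtain n where n: "B \<subseteq> Lam n" using bounded_Lam[OF B(2)] by auto
    have A: "{\<eta>\<in>NN. emeasure \<eta> B = of_nat k} \<in> sets NNsig"
      unfolding sets_NNsig using B by (intro sigma_sets.Basic) auto
    have "{\<eta>\<in>NN. emeasure \<eta> B = of_nat k} = restr (Lam n) -` {\<eta>\<in>NN. emeasure \<eta> B = of_nat k} \<inter> NN"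
      using n B(1) by (auto simp: emeasure_restr NN_sets restr_NN Int_absorb2)
    also have "\<dots> \<in> local_sets" by (rule local_setsI[OF A])
    finally show "{\<eta>\<in>NN. emeasure \<eta> B = of_nat k} \<in> sigma_sets NN local_sets" by auto
  qed
qed

lemma measure_eqI_local:
  assumes P: "sets P = sets NNsig" and Q: "sets Q = sets NNsig" and fin: "emeasure P NN \<noteq> \<infinity>"
    and eq: "\<And>X. X \<in> local_sets \<Longrightarrow> emeasure P X = emeasure Q X"
  shows "P = (Q :: 'a::metric_space measure measure)"
proof (rule measure_eqI_generator_eq[where E=local_sets and \<Omega>=NN and A="\<lambda>_. NN"])
  show "local_sets \<subseteq> Pow (NN :: 'a measure set)"
    by (auto simp: local_sets_def)
qed (use assms NN_local Int_stable_local in \<open>auto simp: sets_NNsig_local\<close>)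

context fp
begin

text \<open>By \<open>local_law0\<close> the probabilities of local events are integrals of
  \<open>jan\<close>, which does not refer to the Gibbs measure.\<close>

lemma gibbs_unique:
  assumes "gibbsm \<mu> v P" "gibbsm \<mu> v Q" shows "P = Q"
proof -
  interpret P: gibbs_fp \<mu> v b T G P by standard (use v_measurable v_sym assms in auto)
  interpret Q: gibbs_fp \<mu> v b T G Q by standard (use v_measurable v_sym assms in auto)
  have e: "emeasure P (restr (Lam n) -` A \<inter> NN) = emeasure Q (restr (Lam n) -` A \<inter> NN)" if A: "A \<in> sets NNsig" for n A
  proof -
    have m: "indicator A \<in> borel_measurable (NNsig :: 'a measure measure)" using A by simp
    have r: "restr (Lam n) \<in> measurable NNsig (NNsig :: 'a measure measure)" by measurable
    have s: "restr (Lam n) -` A \<inter> NN \<in> sets NNsig" using measurable_sets[OF r A] by (simp add: space_NNsig)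
    have le: "indicator A \<eta> \<le> (1::ennreal)" for \<eta> by (simp add: indicator_def)
    have "emeasure R (restr (Lam n) -` A \<inter> NN) = (\<integral>\<^sup>+\<eta>. indicator A (restr (Lam n) \<eta>) \<partial>R)" if "sets R = sets NNsig" for R
    proof -
      have "space R = NN" using sets_eq_imp_space_eq[OF that] by (simp add: space_NNsig)
      then have "(\<integral>\<^sup>+\<eta>. indicator A (restr (Lam n) \<eta>) \<partial>R) = (\<integral>\<^sup>+\<eta>. indicator (restr (Lam n) -` A \<inter> NN) \<eta> \<partial>R)"
        by (intro nn_integral_cong) (auto simp: indicator_def)
      also have "\<dots> = emeasure R (restr (Lam n) -` A \<inter> NN)"
        using s that by (intro nn_integral_indicator) simp
      finally show ?thesis ..
    qed
    then show ?thesis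
      using P.local_law0[OF Lam_sets Lam_bounded m le, of n] Q.local_law0[OF Lam_sets Lam_bounded m le, of n] by simp
  qed
  show ?thesis
  proof (rule measure_eqI_local)
    show "emeasure P NN \<noteq> \<infinity>" using P.emeasure_space_1 by simp
    fix X :: "'a measure set" assume "X \<in> local_sets"
    then show "emeasure P X = emeasure Q X" by (auto simp: local_sets_def e)
  qed simp_all
qed

end

section \<open>Gibbs measures in finite volume\<close>

lemma expneg_sum_list: "expneg (sum_list (map g xs)) = prod_list (map (\<lambda>x. expneg (g x)) xs)"
  by (induction xs) (simp_all add: expneg_add)

context bd_finite
begin

text \<open>By symmetry of g and of the product measure each of the k + 1 entries may be moved to
  the head, and all contribute equally.\<close>

lemma nn_integral_sum_list_Lk:
  assumes "(\<lambda>(x, \<xi>). g x \<xi>) \<in> borel_measurable (borel \<Otimes>\<^sub>M LS)"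
    and "\<And>x \<xi> \<xi>'. mset \<xi> = mset \<xi>' \<Longrightarrow> g x \<xi> = (g x \<xi>' :: ennreal)"
  shows "(\<integral>\<^sup>+\<xi>. sum_list (map (\<lambda>x. g x \<xi>) \<xi>) \<partial>Lk \<mu> (Suc k)) = of_nat (Suc k) * (\<integral>\<^sup>+x. \<integral>\<^sup>+\<xi>. g x (x # \<xi>) \<partial>Lk \<mu> k \<partial>\<mu>)"
  using assms
proof (induction k arbitrary: g)
  case (0 g)
  have gm[measurable (raw)]: "(\<lambda>m. g (f m) (h m)) \<in> borel_measurable M" if "f \<in> borel_measurable M" "h \<in> measurable M LS" for f h M
    using measurable_compose[OF measurable_Pair[OF that] 0(1)] by simp
  have [measurable]: "(\<lambda>\<xi>. sum_list (map (\<lambda>x. g x \<xi>) \<xi>)) \<in> borel_measurable LS" by measurable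
  show ?case by (subst nn_integral_Lk_Suc) auto
next
  case (Suc k g)
  note inv = Suc.prems(2)
  have gm[measurable (raw)]: "(\<lambda>m. g (f m) (h m)) \<in> borel_measurable M" if "f \<in> borel_measurable M" "h \<in> measurable M LS" for f h M
    using measurable_compose[OF measurable_Pair[OF that] Suc.prems(1)] by simp
  have [measurable]: "(\<lambda>\<xi>. sum_list (map (\<lambda>x. g x \<xi>) \<xi>)) \<in> borel_measurable LS" by measurable
  interpret mm: pair_sigma_finite \<mu> \<mu> by standard
  have IH: "(\<integral>\<^sup>+\<xi>. sum_list (map (\<lambda>x. g x (y # \<xi>)) \<xi>) \<partial>Lk \<mu> (Suc k)) = of_nat (Suc k) * (\<integral>\<^sup>+x. \<integral>\<^sup>+\<xi>. g x (y # x # \<xi>) \<partial>Lk \<mu> k \<partial>\<mu>)" for y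
    by (rule Suc.IH) (measurable, auto intro!: inv)
  have "(\<integral>\<^sup>+\<xi>. sum_list (map (\<lambda>x. g x \<xi>) \<xi>) \<partial>Lk \<mu> (Suc (Suc k))) =
      (\<integral>\<^sup>+y. (\<integral>\<^sup>+\<xi>. g y (y # \<xi>) + sum_list (map (\<lambda>x. g x (y # \<xi>)) \<xi>) \<partial>Lk \<mu> (Suc k)) \<partial>\<mu>)"
    by (subst nn_integral_Lk_Suc) auto
  also have "\<dots> = (\<integral>\<^sup>+y. (\<integral>\<^sup>+\<xi>. g y (y # \<xi>) \<partial>Lk \<mu> (Suc k)) + of_nat (Suc k) * (\<integral>\<^sup>+x. \<integral>\<^sup>+\<xi>. g x (y # x # \<xi>) \<partial>Lk \<mu> k \<partial>\<mu>) \<partial>\<mu>)"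
    by (intro nn_integral_cong) (subst nn_integral_add, auto simp: IH simp del: of_nat_Suc)
  also have "\<dots> = (\<integral>\<^sup>+y. (\<integral>\<^sup>+\<xi>. g y (y # \<xi>) \<partial>Lk \<mu> (Suc k)) \<partial>\<mu>) + of_nat (Suc k) * (\<integral>\<^sup>+y. \<integral>\<^sup>+x. \<integral>\<^sup>+\<xi>. g x (y # x # \<xi>) \<partial>Lk \<mu> k \<partial>\<mu> \<partial>\<mu>)"
    by (subst nn_integral_add) (auto simp: nn_integral_cmult simp del: of_nat_Suc)
  also have "(\<integral>\<^sup>+y. \<integral>\<^sup>+x. \<integral>\<^sup>+\<xi>. g x (y # x # \<xi>) \<partial>Lk \<mu> k \<partial>\<mu> \<partial>\<mu>) = (\<integral>\<^sup>+x. \<integral>\<^sup>+y. \<integral>\<^sup>+\<xi>. g x (y # x # \<xi>) \<partial>Lk \<mu> k \<partial>\<mu> \<partial>\<mu>)"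
    by (rule mm.Fubini') measurable
  also have "\<dots> = (\<integral>\<^sup>+x. \<integral>\<^sup>+\<xi>. g x (x # \<xi>) \<partial>Lk \<mu> (Suc k) \<partial>\<mu>)"
  proof (rule nn_integral_cong)
    fix x
    have "g x (y # x # \<xi>) = g x (x # y # \<xi>)" for y \<xi> by (rule inv) simp
    then show "(\<integral>\<^sup>+y. \<integral>\<^sup>+\<xi>. g x (y # x # \<xi>) \<partial>Lk \<mu> k \<partial>\<mu>) = (\<integral>\<^sup>+\<xi>. g x (x # \<xi>) \<partial>Lk \<mu> (Suc k))"
      by (subst nn_integral_Lk_Suc) auto
  qed
  finally show ?case by (simp add: distrib_right)
qed

text \<open>The Mecke formula for the Lebesgue--Poisson measure: the factor k + 1 turns 1 / (k + 1)!
  into 1 / k!.\<close>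

lemma nn_integral_sum_list_ell:
  assumes g: "(\<lambda>(x, \<xi>). g x \<xi>) \<in> borel_measurable (borel \<Otimes>\<^sub>M LS)"
    and inv: "\<And>x \<xi> \<xi>'. mset \<xi> = mset \<xi>' \<Longrightarrow> g x \<xi> = (g x \<xi>' :: ennreal)"
  shows "(\<integral>\<^sup>+\<xi>. sum_list (map (\<lambda>x. g x \<xi>) \<xi>) \<partial>ell \<mu>) = (\<integral>\<^sup>+x. \<integral>\<^sup>+\<xi>. g x (x # \<xi>) \<partial>ell \<mu> \<partial>\<mu>)"
proof -
  have gm[measurable (raw)]: "(\<lambda>m. g (f m) (h m)) \<in> borel_measurable M" if "f \<in> borel_measurable M" "h \<in> measurable M LS" for f h M
    using measurable_compose[OF measurable_Pair[OF that] g] by simp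
  have [measurable]: "(\<lambda>\<xi>. sum_list (map (\<lambda>x. g x \<xi>) \<xi>)) \<in> borel_measurable LS" by measurable
  have "(\<integral>\<^sup>+\<xi>. sum_list (map (\<lambda>x. g x \<xi>) \<xi>) \<partial>ell \<mu>) = (\<Sum>k. ennreal (1 / fact (Suc k)) * (\<integral>\<^sup>+\<xi>. sum_list (map (\<lambda>x. g x \<xi>) \<xi>) \<partial>Lk \<mu> (Suc k)))"
    by (simp add: nn_integral_ell) (subst suminf_offset[OF summableI, of _ 1], simp)
  also have "\<dots> = (\<Sum>k. ennreal (1 / fact k) * (\<integral>\<^sup>+x. \<integral>\<^sup>+\<xi>. g x (x # \<xi>) \<partial>Lk \<mu> k \<partial>\<mu>))"
  proof (intro suminf_cong)
    fix k
    have "ennreal (1 / fact (Suc k)) * of_nat (Suc k) = ennreal (1 / fact k)"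
      by (simp add: ennreal_of_nat_eq_real_of_nat ennreal_mult[symmetric] divide_simps del: of_nat_Suc)
    then show "ennreal (1 / fact (Suc k)) * (\<integral>\<^sup>+\<xi>. sum_list (map (\<lambda>x. g x \<xi>) \<xi>) \<partial>Lk \<mu> (Suc k)) = ennreal (1 / fact k) * (\<integral>\<^sup>+x. \<integral>\<^sup>+\<xi>. g x (x # \<xi>) \<partial>Lk \<mu> k \<partial>\<mu>)"
      by (subst nn_integral_sum_list_Lk[where g=g, OF assms]) (simp_all only: mult.assoc[symmetric])
  qed
  also have "\<dots> = (\<integral>\<^sup>+x. \<integral>\<^sup>+\<xi>. g x (x # \<xi>) \<partial>ell \<mu> \<partial>\<mu>)"
    by (simp add: nn_integral_ell nn_integral_suminf nn_integral_cmult)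
  finally show ?thesis .
qed

lemma restr_bd_finite: "\<Lambda> \<in> sets borel \<Longrightarrow> bd_finite (restr \<Lambda> \<mu>)"
proof
  fix B :: "'a set" assume a: "\<Lambda> \<in> sets borel" "B \<in> sets borel" "bounded B"
  have "emeasure (restr \<Lambda> \<mu>) B \<le> emeasure \<mu> B"
    using a by (simp add: emeasure_restr emeasure_mono)
  also have "\<dots> < \<infinity>" by (rule fin_mu) (use a in auto)
  finally show "emeasure (restr \<Lambda> \<mu>) B < \<infinity>" .
qed simp

lemma nn_integral_Lk_restr:
  assumes L[measurable]: "\<Lambda> \<in> sets borel" and "F \<in> borel_measurable LS"
  shows "(\<integral>\<^sup>+\<xi>. F \<xi> \<partial>Lk (restr \<Lambda> \<mu>) k) = (\<integral>\<^sup>+\<xi>. F \<xi> * indicator {\<xi>. set \<xi> \<subseteq> \<Lambda>} \<xi> \<partial>Lk \<mu> k)"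
  using assms(2)
proof (induction k arbitrary: F)
  case (0 F)
  interpret R: bd_finite "restr \<Lambda> \<mu>" by (rule restr_bd_finite) fact
  note [measurable] = 0
  show ?case by simp
next
  case (Suc k F)
  interpret R: bd_finite "restr \<Lambda> \<mu>" by (rule restr_bd_finite) fact
  note [measurable] = Suc.prems
  have "(\<integral>\<^sup>+\<xi>. F \<xi> \<partial>Lk (restr \<Lambda> \<mu>) (Suc k)) = (\<integral>\<^sup>+x. \<integral>\<^sup>+\<xi>. F (x # \<xi>) * indicator {\<xi>. set \<xi> \<subseteq> \<Lambda>} \<xi> \<partial>Lk \<mu> k \<partial>restr \<Lambda> \<mu>)"
    by (simp add: R.nn_integral_Lk_Suc Suc.IH)
  also have "\<dots> = (\<integral>\<^sup>+x. (\<integral>\<^sup>+\<xi>. F (x # \<xi>) * indicator {\<xi>. set \<xi> \<subseteq> \<Lambda>} \<xi> \<partial>Lk \<mu> k) * indicator \<Lambda> x \<partial>\<mu>)"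
    by (subst nn_integral_restr) auto
  also have "\<dots> = (\<integral>\<^sup>+x. \<integral>\<^sup>+\<xi>. F (x # \<xi>) * indicator {\<xi>. set \<xi> \<subseteq> \<Lambda>} (x # \<xi>) \<partial>Lk \<mu> k \<partial>\<mu>)"
    by (intro nn_integral_cong) (simp add: indicator_def)
  also have "\<dots> = (\<integral>\<^sup>+\<xi>. F \<xi> * indicator {\<xi>. set \<xi> \<subseteq> \<Lambda>} \<xi> \<partial>Lk \<mu> (Suc k))"
    by (rule nn_integral_Lk_Suc[symmetric]) measurable
  finally show ?case .
qed

lemma ell_restr:
  assumes L[measurable]: "\<Lambda> \<in> sets borel"
  shows "ell (restr \<Lambda> \<mu>) = density (ell \<mu>) (indicator {\<xi>. set \<xi> \<subseteq> \<Lambda>})"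
proof (rule measure_eqI)
  fix A assume "A \<in> sets (ell (restr \<Lambda> \<mu>))"
  then have A[measurable]: "A \<in> sets LS" by simp
  have "emeasure (ell (restr \<Lambda> \<mu>)) A = (\<Sum>k. ennreal (1 / fact k) * (\<integral>\<^sup>+\<xi>. indicator A \<xi> \<partial>Lk (restr \<Lambda> \<mu>) k))"
    by (subst nn_integral_ell[symmetric]) auto
  also have "\<dots> = (\<Sum>k. ennreal (1 / fact k) * (\<integral>\<^sup>+\<xi>. indicator A \<xi> * indicator {\<xi>. set \<xi> \<subseteq> \<Lambda>} \<xi> \<partial>Lk \<mu> k))"
    by (intro suminf_cong arg_cong2[where f="(*)"] nn_integral_Lk_restr refl) measurable
  also have "\<dots> = (\<integral>\<^sup>+\<xi>. indicator {\<xi>. set \<xi> \<subseteq> \<Lambda>} \<xi> * indicator A \<xi> \<partial>ell \<mu>)"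
    by (subst nn_integral_ell) (auto simp: mult.commute)
  also have "\<dots> = emeasure (density (ell \<mu>) (indicator {\<xi>. set \<xi> \<subseteq> \<Lambda>})) A"
    by (subst emeasure_density) auto
  finally show "emeasure (ell (restr \<Lambda> \<mu>)) A = emeasure (density (ell \<mu>) (indicator {\<xi>. set \<xi> \<subseteq> \<Lambda>})) A" .
qed simp

lemma nn_integral_ell_restr:
  assumes [measurable]: "\<Lambda> \<in> sets borel" "F \<in> borel_measurable LS"
  shows "(\<integral>\<^sup>+\<xi>. F \<xi> \<partial>ell (restr \<Lambda> \<mu>)) = (\<integral>\<^sup>+\<xi>. indicator {\<xi>. set \<xi> \<subseteq> \<Lambda>} \<xi> * F \<xi> \<partial>ell \<mu>)"
  unfolding ell_restr[OF assms(1)] by (subst nn_integral_density) auto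

lemma integral_ell_restr:
  fixes F :: "'a list \<Rightarrow> real"
  assumes [measurable]: "\<Lambda> \<in> sets borel" "F \<in> borel_measurable LS"
  shows "(\<integral>\<xi>. F \<xi> \<partial>ell (restr \<Lambda> \<mu>)) = (\<integral>\<xi>. indicator {\<xi>. set \<xi> \<subseteq> \<Lambda>} \<xi> * F \<xi> \<partial>ell \<mu>)"
proof -
  have "(indicator {\<xi>. set \<xi> \<subseteq> \<Lambda>} :: 'a list \<Rightarrow> ennreal) = (\<lambda>\<xi>. ennreal (indicator {\<xi>. set \<xi> \<subseteq> \<Lambda>} \<xi>))"
    by (auto simp: indicator_def)
  then show ?thesis
    unfolding ell_restr[OF assms(1)] by (simp only:) (subst integral_real_density; simp)
qed

end

section \<open>Existence of a Gibbs measure when the total mass is finite\<close>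

context potential
begin

text \<open>The law with density eH / Z with respect to the Lebesgue--Poisson measure. Z is finite
  since eH \<le> 1 and \<open>ell \<mu>\<close> is finite, and Z \<ge> 1 because the empty
  configuration has mass 1. The Gibbs equation is the Mecke formula combined with eH (x # \<xi>) =
  exp (- W x) eH \<xi>.\<close>

lemma gibbs_exists_finite:
  assumes fin: "emeasure \<mu> UNIV < \<infinity>"
  shows "\<exists>P. gibbsm \<mu> v P"
proof -
  have ellfin: "emeasure (ell \<mu>) UNIV < \<infinity>"
    using emeasure_ell_subset[of UNIV] fin by simp
  define Z where "Z = enn2real (\<integral>\<^sup>+\<xi>. ennreal (eH v \<xi>) \<partial>ell \<mu>)"
  have "(\<integral>\<^sup>+\<xi>. ennreal (eH v \<xi>) \<partial>ell \<mu>) \<le> (\<integral>\<^sup>+\<xi>. 1 \<partial>ell \<mu>)"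
    by (intro nn_integral_mono) (simp add: ennreal_le_1)
  also have "\<dots> < \<infinity>" using ellfin by simp
  finally have Z: "(\<integral>\<^sup>+\<xi>. ennreal (eH v \<xi>) \<partial>ell \<mu>) = ennreal Z" by (simp add: Z_def)
  have "1 = emeasure (ell \<mu>) {\<xi>. set \<xi> \<subseteq> {}}" by (subst emeasure_ell_subset) auto
  also have "\<dots> = (\<integral>\<^sup>+\<xi>. indicator {\<xi>. set \<xi> \<subseteq> {}} \<xi> \<partial>ell \<mu>)"
    using set_subset_in_LS[of "{}::'a set"] by (intro nn_integral_indicator[symmetric]) simp
  also have "\<dots> \<le> (\<integral>\<^sup>+\<xi>. ennreal (eH v \<xi>) \<partial>ell \<mu>)"
    by (intro nn_integral_mono) (auto simp: indicator_def)
  finally have Z1: "1 \<le> Z" unfolding Z by simp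
  define w where "w \<xi> = ennreal (eH v \<xi> / Z)" for \<xi>
  have w[measurable]: "w \<in> borel_measurable LS" unfolding w_def by measurable
  have wmult: "w \<xi> = ennreal (1 / Z) * ennreal (eH v \<xi>)" for \<xi>
    unfolding w_def using Z1 by (subst ennreal_mult[symmetric]) auto
  define P where "P = distr (density (ell \<mu>) w) NNsig conf"
  have cm: "conf \<in> measurable (density (ell \<mu>) w) NNsig" by simp
  have nnP: "(\<integral>\<^sup>+\<eta>. F \<eta> \<partial>P) = (\<integral>\<^sup>+\<xi>. w \<xi> * F (conf \<xi>) \<partial>ell \<mu>)" if F: "F \<in> borel_measurable NNsig" for F
  proof -
    have [measurable]: "(\<lambda>\<xi>. F (conf \<xi>)) \<in> borel_measurable LS" by (rule measurable_compose[OF measurable_conf F])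
    show ?thesis unfolding P_def using F cm
      by (subst nn_integral_distr) (auto simp: nn_integral_density)
  qed
  have "prob_space P"
  proof
    have "emeasure P (space P) = (\<integral>\<^sup>+\<eta>. 1 \<partial>P)" by simp
    also have "\<dots> = (\<integral>\<^sup>+\<xi>. w \<xi> \<partial>ell \<mu>)" by (subst nnP) auto
    also have "\<dots> = 1" unfolding wmult using Z1 by (subst nn_integral_cmult) (auto simp: Z ennreal_mult[symmetric])
    finally show "emeasure P (space P) = 1" .
  qed
  moreover have sP: "sets P = sets NNsig" by (simp add: P_def)
  moreover have "(\<integral>\<^sup>+ \<eta>. (\<integral>\<^sup>+ x. F (x, \<eta>) \<partial>\<eta>) \<partial>P) =
        (\<integral>\<^sup>+ x. (\<integral>\<^sup>+ \<eta>. F (x, add_dirac \<eta> x) * ennreal (expneg (WW v x \<eta>)) \<partial>P) \<partial>\<mu>)"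
    if F: "F \<in> borel_measurable (borel \<Otimes>\<^sub>M NNsig)" for F
  proof -
    have Fm[measurable (raw)]: "(\<lambda>m. F (f m, h m)) \<in> borel_measurable M" if "f \<in> borel_measurable M" "h \<in> measurable M NNsig" for f h M
      using measurable_compose[OF measurable_Pair[OF that] F] by simp
    let ?g = "\<lambda>x \<xi>. w \<xi> * F (x, conf \<xi>)"
    have m1: "(\<lambda>\<eta>. \<integral>\<^sup>+ x. F (x, \<eta>) \<partial>\<eta>) \<in> borel_measurable NNsig"
      by (rule measurable_nn_integral_NN) measurable
    have m2: "(\<lambda>(x, \<xi>). ?g x \<xi>) \<in> borel_measurable (borel \<Otimes>\<^sub>M LS)" by measurable
    have "(\<integral>\<^sup>+ \<eta>. (\<integral>\<^sup>+ x. F (x, \<eta>) \<partial>\<eta>) \<partial>P) = (\<integral>\<^sup>+\<xi>. sum_list (map (\<lambda>x. ?g x \<xi>) \<xi>) \<partial>ell \<mu>)"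
      unfolding nnP[OF m1] by (intro nn_integral_cong) (simp add: nn_integral_conf sum_list_const_mult)
    also have "\<dots> = (\<integral>\<^sup>+x. \<integral>\<^sup>+\<xi>. ?g x (x # \<xi>) \<partial>ell \<mu> \<partial>\<mu>)"
    proof (rule nn_integral_sum_list_ell[OF m2])
      fix x and \<xi> \<xi>' :: "'a list" assume eq: "mset \<xi> = mset \<xi>'"
      show "?g x \<xi> = ?g x \<xi>'"
        using eH_mset[OF v_sym eq] conf_mset_cong[OF eq] by (simp add: w_def)
    qed
    also have "\<dots> = (\<integral>\<^sup>+ x. (\<integral>\<^sup>+ \<eta>. F (x, add_dirac \<eta> x) * ennreal (expneg (WW v x \<eta>)) \<partial>P) \<partial>\<mu>)"
    proof (rule nn_integral_cong)
      fix x
      have "(\<integral>\<^sup>+ \<eta>. F (x, add_dirac \<eta> x) * ennreal (expneg (WW v x \<eta>)) \<partial>P) =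
        (\<integral>\<^sup>+\<xi>. w \<xi> * (F (x, add_dirac (conf \<xi>) x) * ennreal (expneg (WW v x (conf \<xi>)))) \<partial>ell \<mu>)"
        by (rule nnP) measurable
      also have "\<dots> = (\<integral>\<^sup>+\<xi>. ?g x (x # \<xi>) \<partial>ell \<mu>)"
      proof (rule nn_integral_cong)
        fix \<xi>
        have "expneg (WW v x (conf \<xi>)) = prod_list (map (\<lambda>y. expneg (v x y)) \<xi>)"
          unfolding WW_def by (subst nn_integral_conf) (auto simp: expneg_sum_list)
        then have "w (x # \<xi>) = w \<xi> * ennreal (expneg (WW v x (conf \<xi>)))"
          unfolding w_def using Z1 by (subst ennreal_mult[symmetric]) (auto simp: mult_ac intro!: prod_list_nonneg)
        then show "w \<xi> * (F (x, add_dirac (conf \<xi>) x) * ennreal (expneg (WW v x (conf \<xi>)))) = ?g x (x # \<xi>)"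
          by (simp add: mult_ac)
      qed
      finally show "(\<integral>\<^sup>+\<xi>. ?g x (x # \<xi>) \<partial>ell \<mu>) = (\<integral>\<^sup>+ \<eta>. F (x, add_dirac \<eta> x) * ennreal (expneg (WW v x \<eta>)) \<partial>P)" ..
    qed
    finally show ?thesis .
  qed
  ultimately have "gibbsm \<mu> v P" by (simp add: gibbsm_def)
  then show ?thesis ..
qed

end

section \<open>The thermodynamic limit of the Janossy densities\<close>

context fp
begin

text \<open>Restricting \<mu> only decreases the integral in \<open>cond\<close>, so everything
  proved so far holds in every finite volume with the same b, T and G.\<close>

lemma restr_fp:
  assumes [measurable]: "\<Lambda> \<in> sets borel" shows "fp (restr \<Lambda> \<mu>) v b T G"
proof -
  interpret R: bd_finite "restr \<Lambda> \<mu>" by (rule restr_bd_finite) fact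
  show ?thesis
  proof
    show "AE x in restr \<Lambda> \<mu>. x \<in> G"
      unfolding restr_def using AE_G by (subst AE_density) auto
    fix x assume x: "x \<in> G"
    have "(\<integral>\<^sup>+\<xi>. ennreal (T ^ length \<xi> * prod_list (map (\<lambda>y. (1 - expneg (v x y)) * b y) \<xi>) * eH v \<xi>) \<partial>ell (restr \<Lambda> \<mu>)) \<le>
      (\<integral>\<^sup>+\<xi>. ennreal (T ^ length \<xi> * prod_list (map (\<lambda>y. (1 - expneg (v x y)) * b y) \<xi>) * eH v \<xi>) \<partial>ell \<mu>)"
      by (subst nn_integral_ell_restr) (auto intro!: nn_integral_mono simp: indicator_def)
    also note cond[OF x]
    finally show "(\<integral>\<^sup>+\<xi>. ennreal (T ^ length \<xi> * prod_list (map (\<lambda>y. (1 - expneg (v x y)) * b y) \<xi>) * eH v \<xi>) \<partial>ell (restr \<Lambda> \<mu>)) \<le> ennreal (b x)" .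
  qed (use v_measurable v_sym b_ge1 T_gt1 in auto)
qed

text \<open>The finite-volume Gibbs measure with empty boundary condition.\<close>

definition PM :: "nat \<Rightarrow> 'a measure measure" where
  "PM M = (SOME P. gibbsm (restr (Lam M) \<mu>) v P)"

lemma PM_gibbs: "gibbs_fp (restr (Lam M) \<mu>) v b T G (PM M)"
proof -
  interpret R: fp "restr (Lam M) \<mu>" v b T G by (rule restr_fp) simp
  have "emeasure (restr (Lam M) \<mu>) UNIV < \<infinity>"
    using fin_mu[OF Lam_sets Lam_bounded] by (simp add: emeasure_restr)
  from R.gibbs_exists_finite[OF this] have "gibbsm (restr (Lam M) \<mu>) v (PM M)"
    unfolding PM_def by (rule someI_ex)
  then show ?thesis by unfold_locales
qed

abbreviation phiM :: "nat \<Rightarrow> 'a list \<Rightarrow> real" where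
  "phiM M \<equiv> fp.phi (restr (Lam M) \<mu>) v"

abbreviation janM :: "nat \<Rightarrow> 'a set \<Rightarrow> 'a list \<Rightarrow> real" where
  "janM M \<equiv> fp.jan (restr (Lam M) \<mu>) v"

text \<open>Dominated convergence with the integrable majorant \<open>\<bar>psiL v xs\<bar>\<close>:
  every finite configuration eventually lies in the volume.\<close>

lemma phiM_tendsto:
  assumes xs: "set xs \<subseteq> G"
  shows "(\<lambda>M. phiM M xs) \<longlonglongrightarrow> phi xs"
proof -
  have "phiM M xs = (\<integral>\<xi>. indicator {\<xi>. set \<xi> \<subseteq> Lam M} \<xi> * psiL v xs \<xi> \<partial>ell \<mu>)" for M
  proof -
    interpret R: fp "restr (Lam M) \<mu>" v b T G by (rule restr_fp) simp
    show ?thesis unfolding R.phi_def by (rule integral_ell_restr) measurable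
  qed
  moreover have "(\<lambda>M. \<integral>\<xi>. indicator {\<xi>. set \<xi> \<subseteq> Lam M} \<xi> * psiL v xs \<xi> \<partial>ell \<mu>) \<longlonglongrightarrow> phi xs"
    unfolding phi_def
  proof (rule integral_dominated_convergence[where w="\<lambda>\<xi>. \<bar>psiL v xs \<xi>\<bar>"])
    show "integrable (ell \<mu>) (\<lambda>\<xi>. \<bar>psiL v xs \<xi>\<bar>)" using psiL_integrable[OF xs] by simp
    show "AE \<xi> in ell \<mu>. (\<lambda>M. indicator {\<xi>. set \<xi> \<subseteq> Lam M} \<xi> * psiL v xs \<xi>) \<longlonglongrightarrow> psiL v xs \<xi>"
    proof (rule AE_I2)
      fix \<xi> :: "'a list"
      obtain n where n: "set \<xi> \<subseteq> Lam n" using bounded_Lam[OF finite_imp_bounded[OF finite_set]] by blast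
      have "eventually (\<lambda>M. indicator {\<xi>. set \<xi> \<subseteq> Lam M} \<xi> * psiL v xs \<xi> = psiL v xs \<xi>) sequentially"
        using eventually_ge_at_top[of n] by eventually_elim (use n Lam_mono in \<open>force simp: indicator_def\<close>)
      then show "(\<lambda>M. indicator {\<xi>. set \<xi> \<subseteq> Lam M} \<xi> * psiL v xs \<xi>) \<longlonglongrightarrow> psiL v xs \<xi>" by (rule tendsto_eventually)
    qed
  qed (auto simp: indicator_def)
  ultimately show ?thesis by simp
qed

text \<open>Invisible in the signed graph series; it holds because in finite volume the series is
  the expectation \<open>RR\<close> of an existing Gibbs measure.\<close>

lemma phiM_bounds: "set xs \<subseteq> G \<Longrightarrow> 0 \<le> phiM M xs \<and> phiM M xs \<le> 1"
proof -
  assume xs: "set xs \<subseteq> G"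
  interpret R: gibbs_fp "restr (Lam M) \<mu>" v b T G "PM M" by (rule PM_gibbs)
  show ?thesis using R.RR_eq_phi[OF xs] R.RR_bounds[of xs] eH_le_1[of v xs] by linarith
qed

text \<open>Since \<open>phiM\<close> is between 0 and 1, the indicator of the configurations in B,
  of finite mass exp (\<mu> B), dominates the alternating integrand uniformly in M.\<close>

lemma janM_tendsto:
  assumes B[measurable]: "B \<in> sets borel" and Bn: "B \<subseteq> Lam n" and xs: "set xs \<subseteq> G"
  shows "(\<lambda>M. janM M B xs) \<longlonglongrightarrow> jan B xs"
proof -
  have Bb: "bounded B" by (rule bounded_subset[OF Lam_bounded Bn])
  have eq: "janM M B xs = (\<integral>\<xi>. (- 1) ^ length \<xi> * indicator {\<xi>. set \<xi> \<subseteq> B} \<xi> * phiM M (xs @ \<xi>) \<partial>ell \<mu>)" if "n \<le> M" for M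
  proof -
    interpret R: fp "restr (Lam M) \<mu>" v b T G by (rule restr_fp) simp
    have "janM M B xs = (\<integral>\<xi>. indicator {\<xi>. set \<xi> \<subseteq> Lam M} \<xi> * ((- 1) ^ length \<xi> * indicator {\<xi>. set \<xi> \<subseteq> B} \<xi> * phiM M (xs @ \<xi>)) \<partial>ell \<mu>)"
      unfolding R.jan_def by (rule integral_ell_restr) measurable
    also have "\<dots> = (\<integral>\<xi>. (- 1) ^ length \<xi> * indicator {\<xi>. set \<xi> \<subseteq> B} \<xi> * phiM M (xs @ \<xi>) \<partial>ell \<mu>)"
      using Bn Lam_mono[OF that] by (intro Bochner_Integration.integral_cong) (auto simp: indicator_def)
    finally show ?thesis .
  qed
  have "(\<lambda>M. \<integral>\<xi>. (- 1) ^ length \<xi> * indicator {\<xi>. set \<xi> \<subseteq> B} \<xi> * phiM M (xs @ \<xi>) \<partial>ell \<mu>) \<longlonglongrightarrow> jan B xs"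
    unfolding jan_def
  proof (rule integral_dominated_convergence[where w="indicator {\<xi>. set \<xi> \<subseteq> B}"])
    show "integrable (ell \<mu>) (indicator {\<xi>. set \<xi> \<subseteq> B} :: _ \<Rightarrow> real)"
      using emeasure_ell_subset[OF B fin_mu[OF B Bb]] by (intro integrable_real_indicator) auto
    show "AE \<xi> in ell \<mu>. (\<lambda>M. (- 1) ^ length \<xi> * indicator {\<xi>. set \<xi> \<subseteq> B} \<xi> * phiM M (xs @ \<xi>)) \<longlonglongrightarrow>
        (- 1) ^ length \<xi> * indicator {\<xi>. set \<xi> \<subseteq> B} \<xi> * phi (xs @ \<xi>)"
      using AE_ell_G
    proof eventually_elim
      case (elim \<xi>)
      then have "(\<lambda>M. phiM M (xs @ \<xi>)) \<longlonglongrightarrow> phi (xs @ \<xi>)" using xs by (intro phiM_tendsto) auto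
      then show ?case by (intro tendsto_intros)
    qed
    show "AE \<xi> in ell \<mu>. norm ((- 1) ^ length \<xi> * indicator {\<xi>. set \<xi> \<subseteq> B} \<xi> * phiM M (xs @ \<xi>)) \<le> indicator {\<xi>. set \<xi> \<subseteq> B} \<xi>" for M
      using AE_ell_G
    proof eventually_elim
      case (elim \<xi>)
      then have "0 \<le> phiM M (xs @ \<xi>)" "phiM M (xs @ \<xi>) \<le> 1" using xs phiM_bounds[of "xs @ \<xi>" M] by auto
      then show ?case by (simp add: abs_mult power_abs indicator_def)
    qed
    show "(\<lambda>\<xi>. (- 1) ^ length \<xi> * indicator {\<xi>. set \<xi> \<subseteq> B} \<xi> * phiM M (xs @ \<xi>)) \<in> borel_measurable (ell \<mu>)" for M
    proof -
      interpret R: fp "restr (Lam M) \<mu>" v b T G by (rule restr_fp) simp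
      show ?thesis by measurable
    qed
  qed measurable
  moreover have "eventually (\<lambda>M. (\<integral>\<xi>. (- 1) ^ length \<xi> * indicator {\<xi>. set \<xi> \<subseteq> B} \<xi> * phiM M (xs @ \<xi>) \<partial>ell \<mu>) = janM M B xs) sequentially"
    using eventually_ge_at_top[of n] by eventually_elim (simp add: eq)
  ultimately show ?thesis by (rule Lim_transform_eventually)
qed

lemma janM_bounds: "B \<in> sets borel \<Longrightarrow> bounded B \<Longrightarrow> set xs \<subseteq> G \<Longrightarrow> 0 \<le> janM M B xs \<and> janM M B xs \<le> 1"
proof -
  assume a: "B \<in> sets borel" "bounded B" "set xs \<subseteq> G"
  interpret R: gibbs_fp "restr (Lam M) \<mu>" v b T G "PM M" by (rule PM_gibbs)
  show ?thesis using R.jan_bounds[OF a] by simp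
qed

text \<open>The limit inherits the sign of the finite-volume densities; without this the alternating
  series could not serve as a density.\<close>

lemma jan_bounds:
  assumes a: "B \<in> sets borel" "bounded B" "set xs \<subseteq> G" shows "0 \<le> jan B xs" "jan B xs \<le> 1"
proof -
  obtain n where n: "B \<subseteq> Lam n" using bounded_Lam[OF a(2)] by auto
  show "0 \<le> jan B xs" "jan B xs \<le> 1"
    using janM_tendsto[OF a(1) n a(3)] janM_bounds[OF a]
    by (auto intro: LIMSEQ_le_const LIMSEQ_le_const2)
qed

lemma nn_jan_tendsto:
  assumes B[measurable]: "B \<in> sets borel" "bounded B" and F[measurable]: "F \<in> borel_measurable LS" "\<And>\<zeta>. F \<zeta> \<le> 1"
    and xs: "set xs \<subseteq> G"
  shows "(\<lambda>M. \<integral>\<^sup>+\<zeta>. indicator {\<zeta>. set \<zeta> \<subseteq> B} \<zeta> * F \<zeta> * ennreal (janM M B (xs @ \<zeta>)) \<partial>ell \<mu>) \<longlonglongrightarrow>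
    (\<integral>\<^sup>+\<zeta>. indicator {\<zeta>. set \<zeta> \<subseteq> B} \<zeta> * F \<zeta> * ennreal (jan B (xs @ \<zeta>)) \<partial>ell \<mu>)"
proof (rule nn_integral_dominated_convergence[where w="indicator {\<zeta>. set \<zeta> \<subseteq> B}"])
  obtain n where n: "B \<subseteq> Lam n" using bounded_Lam[OF B(2)] by auto
  show "(\<integral>\<^sup>+\<zeta>. indicator {\<zeta>. set \<zeta> \<subseteq> B} \<zeta> \<partial>ell \<mu>) < \<infinity>"
    using emeasure_ell_subset[OF B(1) fin_mu[OF B]] by simp
  show "AE \<zeta> in ell \<mu>. indicator {\<zeta>. set \<zeta> \<subseteq> B} \<zeta> * F \<zeta> * ennreal (janM M B (xs @ \<zeta>)) \<le> indicator {\<zeta>. set \<zeta> \<subseteq> B} \<zeta>" for M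
    using AE_ell_G
  proof eventually_elim
    case (elim \<zeta>)
    have "F \<zeta> * ennreal (janM M B (xs @ \<zeta>)) \<le> 1 * 1"
      using janM_bounds[OF B, of "xs @ \<zeta>" M] elim xs F(2) by (intro mult_mono) (auto simp: ennreal_le_1)
    then show ?case by (simp add: indicator_def)
  qed
  show "AE \<zeta> in ell \<mu>. (\<lambda>M. indicator {\<zeta>. set \<zeta> \<subseteq> B} \<zeta> * F \<zeta> * ennreal (janM M B (xs @ \<zeta>))) \<longlonglongrightarrow> indicator {\<zeta>. set \<zeta> \<subseteq> B} \<zeta> * F \<zeta> * ennreal (jan B (xs @ \<zeta>))"
    using AE_ell_G
  proof eventually_elim
    case (elim \<zeta>)
    have "(\<lambda>M. ennreal (janM M B (xs @ \<zeta>))) \<longlonglongrightarrow> ennreal (jan B (xs @ \<zeta>))"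
      using elim xs by (intro tendsto_ennrealI janM_tendsto[OF B(1) n]) auto
    moreover have "indicator {\<zeta>. set \<zeta> \<subseteq> B} \<zeta> * F \<zeta> \<noteq> \<infinity>"
      using le_less_trans[OF F(2)[of \<zeta>], of \<infinity>] by (auto simp: indicator_def)
    ultimately show ?case by (intro ennreal_tendsto_cmult) (auto simp: less_top)
  qed
  show "(\<lambda>\<zeta>. indicator {\<zeta>. set \<zeta> \<subseteq> B} \<zeta> * F \<zeta> * ennreal (janM M B (xs @ \<zeta>))) \<in> borel_measurable (ell \<mu>)" for M
  proof -
    interpret R: fp "restr (Lam M) \<mu>" v b T G by (rule restr_fp) simp
    show ?thesis by measurable
  qed
qed measurable

end

section \<open>Construction of a point process with prescribed Janossy densities\<close>

definition shell :: "nat \<Rightarrow> 'a::metric_space set" where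
  "shell i = Lam (Suc i) - Lam i"

lemma shell_sets[measurable, simp]: "shell i \<in> sets borel"
  by (simp add: shell_def)

lemma measurable_filter_LS[measurable (raw)]:
  assumes B[measurable]: "B \<in> sets borel" and h: "h \<in> measurable M LS"
  shows "(\<lambda>m. filter (\<lambda>x. x \<in> B) (h m)) \<in> measurable M LS"
proof (rule measurable_compose[OF h], rule measurable_LS_fromI)
  fix n
  have "(\<lambda>x. filter (\<lambda>x. x \<in> B) (map x is)) \<in> measurable (\<Pi>\<^sub>M i\<in>UNIV. borel) LS" for "is"
  proof (induction "is")
    case (Cons i "is")
    note [measurable] = Cons
    have "(\<lambda>x. if x i \<in> B then x i # filter (\<lambda>x. x \<in> B) (map x is) else filter (\<lambda>x. x \<in> B) (map x is)) \<in> measurable (\<Pi>\<^sub>M i\<in>UNIV. borel) LS"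
      by measurable
    then show ?case by simp
  qed simp
  then show "(\<lambda>x. filter (\<lambda>x. x \<in> B) (map x [0..<n])) \<in> measurable (\<Pi>\<^sub>M i\<in>UNIV. borel) LS" .
qed

text \<open>Among all splittings of a list exactly one can put its entries of A into J and its
  entries of B into K; symmetry of F undoes the resulting reordering.\<close>

lemma ssum_disjoint:
  assumes "A \<inter> B = {}" and inv: "\<And>\<xi> \<xi>'. mset \<xi> = mset \<xi>' \<Longrightarrow> F \<xi> = (F \<xi>' :: ennreal)"
  shows "ssum \<xi> (\<lambda>J K. indicator {\<xi>. set \<xi> \<subseteq> A} J * (indicator {\<xi>. set \<xi> \<subseteq> B} K * F (J @ K))) = indicator {\<xi>. set \<xi> \<subseteq> A \<union> B} \<xi> * F \<xi>"
  using inv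
proof (induction \<xi> arbitrary: F)
  case (Cons y \<xi> F)
  have "F (J @ y # K) = F (y # (J @ K))" for J K by (rule Cons.prems) simp
  then have "ssum (y # \<xi>) (\<lambda>J K. indicator {\<xi>. set \<xi> \<subseteq> A} J * (indicator {\<xi>. set \<xi> \<subseteq> B} K * F (J @ K))) =
     ssum \<xi> (\<lambda>J K. indicator A y * (indicator {\<xi>. set \<xi> \<subseteq> A} J * (indicator {\<xi>. set \<xi> \<subseteq> B} K * F (y # (J @ K))))) +
     ssum \<xi> (\<lambda>J K. indicator B y * (indicator {\<xi>. set \<xi> \<subseteq> A} J * (indicator {\<xi>. set \<xi> \<subseteq> B} K * F (y # (J @ K)))))"
    by (auto intro!: arg_cong2[where f="(+)"] ssum_cong simp: indicator_def)
  also have "\<dots> = (indicator A y + indicator B y) * ssum \<xi> (\<lambda>J K. indicator {\<xi>. set \<xi> \<subseteq> A} J * (indicator {\<xi>. set \<xi> \<subseteq> B} K * F (y # (J @ K))))"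
    by (simp only: ssum_mult[symmetric] distrib_right)
  also have "ssum \<xi> (\<lambda>J K. indicator {\<xi>. set \<xi> \<subseteq> A} J * (indicator {\<xi>. set \<xi> \<subseteq> B} K * F (y # (J @ K)))) = indicator {\<xi>. set \<xi> \<subseteq> A \<union> B} \<xi> * F (y # \<xi>)"
    by (rule Cons.IH) (auto intro!: Cons.prems)
  finally show ?case using assms(1) by (auto simp: indicator_def)
next
  case Nil
  show ?case by (simp add: indicator_def)
qed

context bd_finite
begin

text \<open>The multiplicativity of the Lebesgue--Poisson measure over disjoint regions, here for
  the configuration in a ball and in the next shell.\<close>

lemma superposition:
  assumes [measurable]: "A \<in> sets borel" "B \<in> sets borel" "F \<in> borel_measurable LS" and "A \<inter> B = {}"
    and inv: "\<And>\<xi> \<xi>'. mset \<xi> = mset \<xi>' \<Longrightarrow> F \<xi> = (F \<xi>' :: ennreal)"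
  shows "(\<integral>\<^sup>+\<xi>. indicator {\<xi>. set \<xi> \<subseteq> A} \<xi> * (\<integral>\<^sup>+\<zeta>. indicator {\<xi>. set \<xi> \<subseteq> B} \<zeta> * F (\<xi> @ \<zeta>) \<partial>ell \<mu>) \<partial>ell \<mu>) =
    (\<integral>\<^sup>+\<xi>. indicator {\<xi>. set \<xi> \<subseteq> A \<union> B} \<xi> * F \<xi> \<partial>ell \<mu>)"
proof -
  have "(\<integral>\<^sup>+\<xi>. indicator {\<xi>. set \<xi> \<subseteq> A \<union> B} \<xi> * F \<xi> \<partial>ell \<mu>) =
     (\<integral>\<^sup>+J. \<integral>\<^sup>+K. indicator {\<xi>. set \<xi> \<subseteq> A} J * (indicator {\<xi>. set \<xi> \<subseteq> B} K * F (J @ K)) \<partial>ell \<mu> \<partial>ell \<mu>)"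
  proof -
    have "indicator {\<xi>. set \<xi> \<subseteq> A \<union> B} \<xi> * F \<xi> = ssum \<xi> (\<lambda>J K. indicator {\<xi>. set \<xi> \<subseteq> A} J * (indicator {\<xi>. set \<xi> \<subseteq> B} K * F (J @ K)))" for \<xi>
      by (rule ssum_disjoint[where F=F, OF assms(4), symmetric]) (rule inv)
    then show ?thesis by (simp only:) (rule nn_integral_ssum, measurable)
  qed
  also have "\<dots> = (\<integral>\<^sup>+\<xi>. indicator {\<xi>. set \<xi> \<subseteq> A} \<xi> * (\<integral>\<^sup>+\<zeta>. indicator {\<xi>. set \<xi> \<subseteq> B} \<zeta> * F (\<xi> @ \<zeta>) \<partial>ell \<mu>) \<partial>ell \<mu>)"
    by (intro nn_integral_cong nn_integral_cmult) measurable
  finally show ?thesis ..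
qed

end

section \<open>The consistent family of densities and its transition kernels\<close>

context fp
begin

text \<open>The recursion of \<open>psiL\<close> singles out the first root, so symmetry is read off
  instead from \<open>jan_eq\<close> in finite volume and passed to the limit.\<close>

lemma jan_mset:
  assumes B: "B \<in> sets borel" "bounded B" and xs: "set xs \<subseteq> G" and eq: "mset xs = mset ys"
  shows "jan B xs = jan B ys"
proof -
  obtain n where n: "B \<subseteq> Lam n" using bounded_Lam[OF B(2)] by auto
  have ys: "set ys \<subseteq> G" using xs mset_eq_setD[OF eq] by simp
  have "janM M B xs = janM M B ys" for M
  proof -
    interpret R: gibbs_fp "restr (Lam M) \<mu>" v b T G "PM M" by (rule PM_gibbs)
    show ?thesis unfolding R.jan_eq[OF B xs] R.jan_eq[OF B ys]
      using eH_mset[OF v_sym eq] vL_mset[OF eq] by simp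
  qed
  then show ?thesis
    using LIMSEQ_unique[OF janM_tendsto[OF B(1) n xs]] janM_tendsto[OF B(1) n ys] by simp
qed

text \<open>Transition kernels must be defined for every configuration. The value 0 off G makes
  bounds, symmetry and consistency hold everywhere instead of almost everywhere.\<close>

definition JJ :: "nat \<Rightarrow> 'a list \<Rightarrow> real" where
  "JJ i \<xi> = (if set \<xi> \<subseteq> G then jan (Lam i) \<xi> else 0)"

lemma JJ_measurable[measurable (raw)]: "f \<in> measurable M LS \<Longrightarrow> (\<lambda>m. JJ i (f m)) \<in> borel_measurable M"
proof -
  assume [measurable]: "f \<in> measurable M LS"
  show ?thesis unfolding JJ_def by measurable
qed

lemma JJ_bounds: "0 \<le> JJ i \<xi>" "JJ i \<xi> \<le> 1"
  unfolding JJ_def using jan_bounds[OF Lam_sets Lam_bounded] by auto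

lemma JJ_mset: "mset \<xi> = mset \<xi>' \<Longrightarrow> JJ i \<xi> = JJ i \<xi>'"
  unfolding JJ_def using jan_mset[OF Lam_sets Lam_bounded] mset_eq_setD by metis

lemma JJ_0: "JJ 0 [] = 1"
proof -
  have "jan {} [] = (\<integral>\<xi>. indicator {\<xi>. set \<xi> \<subseteq> {}} \<xi> \<partial>ell \<mu>)"
    unfolding jan_def by (intro Bochner_Integration.integral_cong) (auto simp: indicator_def phi_Nil)
  also have "\<dots> = measure (ell \<mu>) {\<xi>. set \<xi> \<subseteq> {}}"
    by simp
  also have "\<dots> = 1" using emeasure_ell_subset[of "{}"] by (simp add: measure_def)
  finally show ?thesis by (simp add: JJ_def)
qed

text \<open>\<open>janossy\<close> for the shell, with the wall on the inner ball and the field of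
  \<xi> already contained in the potential: the inner ball holds nothing besides \<xi>, and the
  integral runs over what the shell contains.\<close>

lemma JJ_consistent_M:
  assumes xs: "set \<xi> \<subseteq> G" and M: "Suc m \<le> M"
  shows "ennreal (janM M (Lam m) \<xi>) = (\<integral>\<^sup>+\<zeta>. indicator {\<zeta>. set \<zeta> \<subseteq> Lam (Suc m)} \<zeta> * indicator {\<zeta>. set \<zeta> \<subseteq> shell m} \<zeta> * ennreal (janM M (Lam (Suc m)) (\<xi> @ \<zeta>)) \<partial>ell \<mu>)"
proof -
  interpret R: gibbs_fp "restr (Lam M) \<mu>" v b T G "PM M" by (rule PM_gibbs)
  have sb: "bounded (shell m :: 'a set)" by (rule bounded_subset[OF Lam_bounded[of "Suc m"]]) (auto simp: shell_def)
  let ?u = "\<lambda>y. hardB (Lam m) y + vL v \<xi> y"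
  have u[measurable]: "?u \<in> borel_measurable borel" by measurable
  have "ennreal (janM M (Lam m) \<xi>) = ennreal (eH v \<xi>) * ennreal (LL (PM M) ?u)"
    unfolding R.jan_eq[OF Lam_sets Lam_bounded xs] by (simp add: ennreal_mult)
  also have "ennreal (LL (PM M) ?u) = (\<integral>\<^sup>+\<eta>. 1 * ennreal (expneg (\<integral>\<^sup>+y. ?u y \<partial>\<eta>)) \<partial>PM M)"
    by (simp add: R.nn_LL[OF u])
  also have "\<dots> = (\<integral>\<^sup>+\<zeta>. indicator {\<zeta>. set \<zeta> \<subseteq> shell m} \<zeta> * 1 *
      ennreal (eH v \<zeta> * prod_list (map (\<lambda>y. expneg (?u y)) \<zeta>) * LL (PM M) (\<lambda>y. hardB (shell m) y + (?u y + vL v \<zeta> y))) \<partial>ell (restr (Lam M) \<mu>))"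
    by (rule R.janossy) (use sb in auto)
  also have "ennreal (eH v \<xi>) * \<dots> = (\<integral>\<^sup>+\<zeta>. indicator {\<zeta>. set \<zeta> \<subseteq> shell m} \<zeta> * (ennreal (eH v \<xi>) *
      ennreal (eH v \<zeta> * prod_list (map (\<lambda>y. expneg (?u y)) \<zeta>) * LL (PM M) (\<lambda>y. hardB (shell m) y + (?u y + vL v \<zeta> y)))) \<partial>ell (restr (Lam M) \<mu>))"
    by (subst nn_integral_cmult[symmetric]) (auto intro!: nn_integral_cong simp: mult_ac)
  also have "\<dots> = (\<integral>\<^sup>+\<zeta>. indicator {\<zeta>. set \<zeta> \<subseteq> shell m} \<zeta> * ennreal (janM M (Lam (Suc m)) (\<xi> @ \<zeta>)) \<partial>ell (restr (Lam M) \<mu>))"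
  proof (rule nn_integral_cong_AE)
    show "AE \<zeta> in ell (restr (Lam M) \<mu>). indicator {\<zeta>. set \<zeta> \<subseteq> shell m} \<zeta> * (ennreal (eH v \<xi>) *
      ennreal (eH v \<zeta> * prod_list (map (\<lambda>y. expneg (?u y)) \<zeta>) * LL (PM M) (\<lambda>y. hardB (shell m) y + (?u y + vL v \<zeta> y)))) =
      indicator {\<zeta>. set \<zeta> \<subseteq> shell m} \<zeta> * ennreal (janM M (Lam (Suc m)) (\<xi> @ \<zeta>))"
      using R.AE_ell_G
    proof eventually_elim
      case (elim \<zeta>)
      show ?case
      proof (cases "set \<zeta> \<subseteq> shell m")
        case True
        then have "prod_list (map (\<lambda>y. expneg (hardB (Lam m) y)) \<zeta>) = 1"
          by (induction \<zeta>) (auto simp: hardB_def shell_def)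
        then have p: "prod_list (map (\<lambda>y. expneg (?u y)) \<zeta>) = prod_list (map (\<lambda>y. expneg (vL v \<xi> y)) \<zeta>)"
          by (simp add: expneg_add prod_list_mult)
        \<comment> \<open>The walls on the inner ball and on the shell add up to the wall on the
          larger ball.\<close>
        have "hardB (shell m) y + (?u y + vL v \<zeta> y) = hardB (Lam (Suc m)) y + vL v (\<xi> @ \<zeta>) y" for y
          using Lam_mono[of m "Suc m"] by (auto simp: hardB_def shell_def vL_append)
        then have "janM M (Lam (Suc m)) (\<xi> @ \<zeta>) = eH v \<xi> * (eH v \<zeta> * prod_list (map (\<lambda>y. expneg (?u y)) \<zeta>) * LL (PM M) (\<lambda>y. hardB (shell m) y + (?u y + vL v \<zeta> y)))"
          using elim xs unfolding p by (subst R.jan_eq) (simp_all add: eH_append crossH_eq mult_ac)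
        then show ?thesis by (simp add: ennreal_mult')
      qed simp
    qed
  qed
  also have "\<dots> = (\<integral>\<^sup>+\<zeta>. indicator {\<xi>. set \<xi> \<subseteq> Lam M} \<zeta> * (indicator {\<zeta>. set \<zeta> \<subseteq> shell m} \<zeta> * ennreal (janM M (Lam (Suc m)) (\<xi> @ \<zeta>))) \<partial>ell \<mu>)"
    by (rule nn_integral_ell_restr) measurable
  also have "\<dots> = (\<integral>\<^sup>+\<zeta>. indicator {\<zeta>. set \<zeta> \<subseteq> Lam (Suc m)} \<zeta> * indicator {\<zeta>. set \<zeta> \<subseteq> shell m} \<zeta> * ennreal (janM M (Lam (Suc m)) (\<xi> @ \<zeta>)) \<partial>ell \<mu>)"
    using Lam_mono[OF M] by (intro nn_integral_cong) (force simp: indicator_def shell_def)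
  finally show ?thesis .
qed

text \<open>The finite-volume identity passes to the limit on both sides, by
  \<open>janM_tendsto\<close> and by \<open>nn_jan_tendsto\<close> with the indicator of the shell
  as test function.\<close>

lemma JJ_consistent:
  "(\<integral>\<^sup>+\<zeta>. indicator {\<zeta>. set \<zeta> \<subseteq> shell m} \<zeta> * ennreal (JJ (Suc m) (\<xi> @ \<zeta>)) \<partial>ell \<mu>) = ennreal (JJ m \<xi>)"
proof (cases "set \<xi> \<subseteq> G")
  case True
  have "(\<lambda>M. \<integral>\<^sup>+\<zeta>. indicator {\<zeta>. set \<zeta> \<subseteq> Lam (Suc m)} \<zeta> * indicator {\<zeta>. set \<zeta> \<subseteq> shell m} \<zeta> * ennreal (janM M (Lam (Suc m)) (\<xi> @ \<zeta>)) \<partial>ell \<mu>) \<longlonglongrightarrow>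
    (\<integral>\<^sup>+\<zeta>. indicator {\<zeta>. set \<zeta> \<subseteq> Lam (Suc m)} \<zeta> * indicator {\<zeta>. set \<zeta> \<subseteq> shell m} \<zeta> * ennreal (jan (Lam (Suc m)) (\<xi> @ \<zeta>)) \<partial>ell \<mu>)"
    by (rule nn_jan_tendsto[OF Lam_sets Lam_bounded _ _ True]) (auto simp: indicator_def)
  moreover have "eventually (\<lambda>M. (\<integral>\<^sup>+\<zeta>. indicator {\<zeta>. set \<zeta> \<subseteq> Lam (Suc m)} \<zeta> * indicator {\<zeta>. set \<zeta> \<subseteq> shell m} \<zeta> * ennreal (janM M (Lam (Suc m)) (\<xi> @ \<zeta>)) \<partial>ell \<mu>) = ennreal (janM M (Lam m) \<xi>)) sequentially"
    using eventually_ge_at_top[of "Suc m"] by eventually_elim (rule JJ_consistent_M[OF True, symmetric])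
  ultimately have "(\<lambda>M. ennreal (janM M (Lam m) \<xi>)) \<longlonglongrightarrow>
    (\<integral>\<^sup>+\<zeta>. indicator {\<zeta>. set \<zeta> \<subseteq> Lam (Suc m)} \<zeta> * indicator {\<zeta>. set \<zeta> \<subseteq> shell m} \<zeta> * ennreal (jan (Lam (Suc m)) (\<xi> @ \<zeta>)) \<partial>ell \<mu>)"
    by (rule Lim_transform_eventually)
  moreover have "(\<lambda>M. ennreal (janM M (Lam m) \<xi>)) \<longlonglongrightarrow> ennreal (jan (Lam m) \<xi>)"
    by (intro tendsto_ennrealI janM_tendsto[OF Lam_sets order_refl True])
  ultimately have "ennreal (jan (Lam m) \<xi>) = (\<integral>\<^sup>+\<zeta>. indicator {\<zeta>. set \<zeta> \<subseteq> Lam (Suc m)} \<zeta> * indicator {\<zeta>. set \<zeta> \<subseteq> shell m} \<zeta> * ennreal (jan (Lam (Suc m)) (\<xi> @ \<zeta>)) \<partial>ell \<mu>)"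
    by (rule LIMSEQ_unique[symmetric])
  also have "\<dots> = (\<integral>\<^sup>+\<zeta>. indicator {\<zeta>. set \<zeta> \<subseteq> shell m} \<zeta> * ennreal (JJ (Suc m) (\<xi> @ \<zeta>)) \<partial>ell \<mu>)"
  proof (rule nn_integral_cong_AE)
    show "AE \<zeta> in ell \<mu>. indicator {\<zeta>. set \<zeta> \<subseteq> Lam (Suc m)} \<zeta> * indicator {\<zeta>. set \<zeta> \<subseteq> shell m} \<zeta> * ennreal (jan (Lam (Suc m)) (\<xi> @ \<zeta>)) =
       indicator {\<zeta>. set \<zeta> \<subseteq> shell m} \<zeta> * ennreal (JJ (Suc m) (\<xi> @ \<zeta>))"
      using AE_ell_G by eventually_elim (use True in \<open>auto simp: indicator_def JJ_def shell_def\<close>)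
  qed
  finally show ?thesis using True by (simp add: JJ_def)
qed (simp add: JJ_def)

text \<open>Conditional law of the configuration in the shell \<open>i\<close> given the configuration \<open>\<xi>\<close> in \<open>Lam i\<close>.\<close>

definition KK :: "nat \<Rightarrow> 'a list \<Rightarrow> 'a list measure" where
  "KK i \<xi> = (if 0 < JJ i \<xi> then density (ell \<mu>) (\<lambda>\<zeta>. indicator {\<zeta>. set \<zeta> \<subseteq> shell i} \<zeta> * ennreal (JJ (Suc i) (\<xi> @ \<zeta>) / JJ i \<xi>))
     else return LS [])"

lemma sets_KK[simp]: "sets (KK i \<xi>) = sets LS"
  and space_KK[simp]: "space (KK i \<xi>) = UNIV"
  by (simp_all add: KK_def)

text \<open>Multiplication by \<open>JJ i \<xi>\<close> covers the degenerate case as well: if this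
  density vanishes, consistency forces the right-hand side to vanish. The filter appears because
  \<open>chain\<close> applies it to every sampled list.\<close>

lemma nn_integral_KK:
  assumes [measurable]: "F \<in> borel_measurable LS"
  shows "ennreal (JJ i \<xi>) * (\<integral>\<^sup>+\<zeta>. F (filter (\<lambda>x. x \<in> shell i) \<zeta>) \<partial>KK i \<xi>) = (\<integral>\<^sup>+\<zeta>. indicator {\<zeta>. set \<zeta> \<subseteq> shell i} \<zeta> * (F \<zeta> * ennreal (JJ (Suc i) (\<xi> @ \<zeta>))) \<partial>ell \<mu>)"
proof (cases "0 < JJ i \<xi>")
  case True
  have "ennreal (JJ i \<xi>) * (\<integral>\<^sup>+\<zeta>. F (filter (\<lambda>x. x \<in> shell i) \<zeta>) \<partial>KK i \<xi>) =
    ennreal (JJ i \<xi>) * (\<integral>\<^sup>+\<zeta>. indicator {\<zeta>. set \<zeta> \<subseteq> shell i} \<zeta> * ennreal (JJ (Suc i) (\<xi> @ \<zeta>) / JJ i \<xi>) * F (filter (\<lambda>x. x \<in> shell i) \<zeta>) \<partial>ell \<mu>)"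
    using True by (simp add: KK_def nn_integral_density)
  also have "\<dots> = (\<integral>\<^sup>+\<zeta>. ennreal (JJ i \<xi>) * (indicator {\<zeta>. set \<zeta> \<subseteq> shell i} \<zeta> * ennreal (JJ (Suc i) (\<xi> @ \<zeta>) / JJ i \<xi>) * F (filter (\<lambda>x. x \<in> shell i) \<zeta>)) \<partial>ell \<mu>)"
    by (rule nn_integral_cmult[symmetric]) measurable
  also have "\<dots> = (\<integral>\<^sup>+\<zeta>. indicator {\<zeta>. set \<zeta> \<subseteq> shell i} \<zeta> * (F \<zeta> * ennreal (JJ (Suc i) (\<xi> @ \<zeta>))) \<partial>ell \<mu>)"
  proof (rule nn_integral_cong)
    fix \<zeta>
    have "ennreal (JJ i \<xi>) * ennreal (JJ (Suc i) (\<xi> @ \<zeta>) / JJ i \<xi>) = ennreal (JJ (Suc i) (\<xi> @ \<zeta>))"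
      using True JJ_bounds by (subst ennreal_mult[symmetric]) auto
    moreover have "set \<zeta> \<subseteq> shell i \<Longrightarrow> filter (\<lambda>x. x \<in> shell i) \<zeta> = \<zeta>" by (rule filter_True) auto
    ultimately show "ennreal (JJ i \<xi>) * (indicator {\<zeta>. set \<zeta> \<subseteq> shell i} \<zeta> * ennreal (JJ (Suc i) (\<xi> @ \<zeta>) / JJ i \<xi>) * F (filter (\<lambda>x. x \<in> shell i) \<zeta>)) =
       indicator {\<zeta>. set \<zeta> \<subseteq> shell i} \<zeta> * (F \<zeta> * ennreal (JJ (Suc i) (\<xi> @ \<zeta>)))"
      by (auto simp: indicator_def mult.assoc[symmetric]) (simp add: mult.commute)
  qed
  finally show ?thesis .
next
  case False
  then have 0: "JJ i \<xi> = 0" using JJ_bounds(1)[of i \<xi>] by simp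
  have "AE \<zeta> in ell \<mu>. indicator {\<zeta>. set \<zeta> \<subseteq> shell i} \<zeta> * ennreal (JJ (Suc i) (\<xi> @ \<zeta>)) = 0"
  proof (rule nn_integral_0_iff_AE[THEN iffD1, rotated])
    show "(\<integral>\<^sup>+\<zeta>. indicator {\<zeta>. set \<zeta> \<subseteq> shell i} \<zeta> * ennreal (JJ (Suc i) (\<xi> @ \<zeta>)) \<partial>ell \<mu>) = 0"
      using JJ_consistent[of i \<xi>] 0 by simp
  qed measurable
  then have "(\<integral>\<^sup>+\<zeta>. indicator {\<zeta>. set \<zeta> \<subseteq> shell i} \<zeta> * (F \<zeta> * ennreal (JJ (Suc i) (\<xi> @ \<zeta>))) \<partial>ell \<mu>) = (\<integral>\<^sup>+\<zeta>. 0 \<partial>ell \<mu>)"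
    by (intro nn_integral_cong_AE) (auto elim!: eventually_mono)
  then show ?thesis using 0 by simp
qed

lemma prob_space_KK: "prob_space (KK i \<xi>)"
proof (cases "0 < JJ i \<xi>")
  case True
  have "ennreal (JJ i \<xi>) * emeasure (KK i \<xi>) UNIV = ennreal (JJ i \<xi>)"
    using nn_integral_KK[of "\<lambda>_. 1" i \<xi>] by (simp add: JJ_consistent)
  also have "\<dots> = ennreal (JJ i \<xi>) * 1" by simp
  finally have "emeasure (KK i \<xi>) UNIV = 1"
    using True by (subst (asm) ennreal_mult_cancel_left) auto
  then show ?thesis by (intro prob_spaceI) simp
next
  case False
  then show ?thesis by (simp add: KK_def prob_space_return)
qed

lemma measurable_KK: "KK i \<in> measurable LS (subprob_algebra LS)"
proof (rule measurable_subprob_algebra)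
  fix A :: "'a list set" assume A[measurable]: "A \<in> sets LS"
  have "emeasure (KK i \<xi>) A = (if 0 < JJ i \<xi> then \<integral>\<^sup>+\<zeta>. indicator {\<zeta>. set \<zeta> \<subseteq> shell i} \<zeta> * ennreal (JJ (Suc i) (\<xi> @ \<zeta>) / JJ i \<xi>) * indicator A \<zeta> \<partial>ell \<mu> else indicator A [])" for \<xi>
    by (simp add: KK_def emeasure_density)
  moreover have "(\<lambda>\<xi>. if 0 < JJ i \<xi> then \<integral>\<^sup>+\<zeta>. indicator {\<zeta>. set \<zeta> \<subseteq> shell i} \<zeta> * ennreal (JJ (Suc i) (\<xi> @ \<zeta>) / JJ i \<xi>) * indicator A \<zeta> \<partial>ell \<mu> else indicator A []) \<in> borel_measurable LS"
    by measurable
  ultimately show "(\<lambda>\<xi>. emeasure (KK i \<xi>) A) \<in> borel_measurable LS" by simp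
qed (auto intro: prob_space_imp_subprob_space prob_space_KK)

end

text \<open>The filter forces the i-th list into the i-th shell for every \<omega>, not just almost
  surely, so that \<open>config \<omega>\<close> is locally finite without exception.\<close>

primrec chain :: "nat \<Rightarrow> (nat \<Rightarrow> 'a::metric_space list) \<Rightarrow> 'a list" where
  "chain 0 \<omega> = []"
| "chain (Suc i) \<omega> = chain i \<omega> @ filter (\<lambda>x. x \<in> shell i) (\<omega> i)"

lemma measurable_chain: "{0..<i} \<subseteq> I \<Longrightarrow> chain i \<in> measurable (PiM I (\<lambda>_. LS)) (LS :: 'a::metric_space list measure)"
proof (induction i)
  case (Suc i)
  have "{0..<i} \<subseteq> I" using Suc.prems by auto
  from Suc.IH[OF this] have [measurable]: "chain i \<in> measurable (PiM I (\<lambda>_. LS)) (LS :: 'a list measure)" .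
  have [measurable]: "(\<lambda>\<omega>. \<omega> i) \<in> measurable (PiM I (\<lambda>_. LS)) (LS :: 'a list measure)"
    using Suc.prems by (intro measurable_component_singleton) auto
  show ?case unfolding chain.simps by measurable
next
  case 0
  have "(\<lambda>\<omega>. []) \<in> measurable (PiM I (\<lambda>_. LS)) (LS :: 'a list measure)" by measurable
  then show ?case by (subst measurable_cong[where g="\<lambda>_. []"]) auto
qed

lemma chain_cong: "(\<And>j. j < i \<Longrightarrow> \<omega> j = \<omega>' j) \<Longrightarrow> chain i \<omega> = chain i \<omega>'"
  by (induction i) auto

definition config :: "(nat \<Rightarrow> 'a::metric_space list) \<Rightarrow> 'a measure" where
  "config \<omega> = msum (\<lambda>i. conf (filter (\<lambda>x. x \<in> shell i) (\<omega> i)))"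

lemma sets_config[simp]: "sets (config \<omega>) = sets borel"
  by (simp add: config_def)

lemma config_Lam:
  assumes [measurable]: "A \<in> sets borel"
  shows "emeasure (config \<omega>) (A \<inter> Lam n) = emeasure (conf (chain n \<omega>)) A"
proof -
  have "emeasure (config \<omega>) (A \<inter> Lam n) = (\<Sum>i. emeasure (conf (filter (\<lambda>x. x \<in> shell i) (\<omega> i))) (A \<inter> Lam n))"
    unfolding config_def by (rule emeasure_msum) auto
  also have "\<dots> = (\<Sum>i<n. emeasure (conf (filter (\<lambda>x. x \<in> shell i) (\<omega> i))) A)"
  proof (subst suminf_finite[of "{..<n}"])
    fix i assume "i \<notin> {..<n}"
    then have "shell i \<inter> Lam n = ({} :: 'a set)" using Lam_mono[of n i] by (auto simp: shell_def)
    then have "sum_list (map (indicator (A \<inter> Lam n)) (filter (\<lambda>x. x \<in> shell i) xs)) = (0::ennreal)" for xs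
      by (induction xs) (auto simp: indicator_def)
    then show "emeasure (conf (filter (\<lambda>x. x \<in> shell i) (\<omega> i))) (A \<inter> Lam n) = 0"
      by (simp add: emeasure_conf)
  next
    have "emeasure (conf (filter (\<lambda>x. x \<in> shell i) (\<omega> i))) (A \<inter> Lam n) = emeasure (conf (filter (\<lambda>x. x \<in> shell i) (\<omega> i))) A" if "i < n" for i
    proof -
      have "shell i \<subseteq> (Lam n :: 'a set)" using Lam_mono[of "Suc i" n] that by (auto simp: shell_def)
      then have "sum_list (map (indicator (A \<inter> Lam n)) (filter (\<lambda>x. x \<in> shell i) xs)) = (sum_list (map (indicator A) (filter (\<lambda>x. x \<in> shell i) xs)) :: ennreal)" for xs
        by (induction xs) (auto simp: indicator_def)
      then show ?thesis by (simp add: emeasure_conf)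
    qed
    then show "(\<Sum>i<n. emeasure (conf (filter (\<lambda>x. x \<in> shell i) (\<omega> i))) (A \<inter> Lam n)) = (\<Sum>i<n. emeasure (conf (filter (\<lambda>x. x \<in> shell i) (\<omega> i))) A)"
      by simp
  qed simp
  also have "\<dots> = emeasure (conf (chain n \<omega>)) A"
    by (induction n) (simp_all add: emeasure_conf)
  finally show ?thesis .
qed

text \<open>Serves to show that counts on unbounded sets, being limits of counts in balls, are still
  natural numbers or infinite.\<close>

lemma SUP_of_nat_ennreal: "(SUP n. of_nat (f n) :: ennreal) \<in> insert \<infinity> (range of_nat)"
proof (cases "finite (range f)")
  case True
  have "(SUP n. of_nat (f n) :: ennreal) = of_nat (Max (range f))"
  proof (rule antisym)
    show "(SUP n. of_nat (f n) :: ennreal) \<le> of_nat (Max (range f))"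
      using True by (intro SUP_least) simp
    obtain n where "f n = Max (range f)" using Max_in[OF True] by auto
    then show "of_nat (Max (range f)) \<le> (SUP n. of_nat (f n) :: ennreal)"
      by (metis SUP_upper UNIV_I)
  qed
  then show ?thesis by auto
next
  case False
  have "of_nat N \<le> (SUP n. of_nat (f n) :: ennreal)" for N
  proof -
    obtain n where "N \<le> f n" using False by (auto simp: infinite_nat_iff_unbounded_le)
    then show ?thesis by (intro order_trans[OF _ SUP_upper[of n]]) auto
  qed
  then have "(SUP N. of_nat N :: ennreal) \<le> (SUP n. of_nat (f n) :: ennreal)" by (intro SUP_least)
  then show ?thesis by (simp add: ennreal_SUP_of_nat_eq_top top_unique)
qed

lemma config_NN: "config \<omega> \<in> (NN :: 'a::metric_space measure set)"
proof -
  have fin: "emeasure (config \<omega>) (B \<inter> Lam n) \<in> range of_nat" if "B \<in> sets borel" for B :: "'a set" and n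
  proof -
    have "sum_list (map (indicator B) xs) \<in> (range of_nat :: ennreal set)" for xs
    proof (induction xs)
      case (Cons x xs)
      then obtain k where "sum_list (map (indicator B) xs) = (of_nat k :: ennreal)" by auto
      then have "sum_list (map (indicator B) (x # xs)) = (of_nat (k + (if x \<in> B then 1 else 0)) :: ennreal)" by simp
      then show ?case by blast
    qed (auto intro!: image_eqI[of _ _ 0])
    then show ?thesis using that by (simp add: config_Lam emeasure_conf)
  qed
  have "emeasure (config \<omega>) B \<in> insert \<infinity> (range of_nat)" if B: "B \<in> sets borel" for B :: "'a set"
  proof -
    have "\<forall>n. \<exists>k. emeasure (config \<omega>) (B \<inter> Lam n) = of_nat k"
      using fin[OF B] by blast
    from choice[OF this] obtain f where f: "\<And>n. emeasure (config \<omega>) (B \<inter> Lam n) = of_nat (f n)"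
      by blast
    have "(\<Union>n. B \<inter> Lam n) = B" using Lam_cover by blast
    then have "emeasure (config \<omega>) B = emeasure (config \<omega>) (\<Union>n. B \<inter> Lam n)" by simp
    also have "\<dots> = (SUP n. emeasure (config \<omega>) (B \<inter> Lam n))"
      using B Lam_mono by (intro SUP_emeasure_incseq[symmetric]) (auto simp: incseq_def)
    finally show ?thesis using SUP_of_nat_ennreal[of f] by (simp add: f)
  qed
  moreover have "emeasure (config \<omega>) B < \<infinity>" if B: "B \<in> sets borel" and Bb: "bounded B" for B :: "'a set"
  proof -
    obtain n where "B \<subseteq> Lam n" using bounded_Lam[OF Bb] by auto
    then have "B \<inter> Lam n = B" by auto
    then show ?thesis using fin[OF B, of n] by (auto simp: of_nat_less_top)
  qed
  ultimately show ?thesis by (simp add: NN_def)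
qed

lemma restr_config: "restr (Lam n) (config \<omega>) = conf (chain n \<omega>)"
  by (rule measure_eqI) (simp_all add: emeasure_restr config_Lam)

lemma measurable_config: "config \<in> measurable (PiM UNIV (\<lambda>_. LS)) (NNsig :: 'a::metric_space measure measure)"
proof (rule measurable_NNsigI)
  fix B :: "'a set" assume B[measurable]: "B \<in> sets borel" "bounded B"
  obtain n where "B \<subseteq> Lam n" using bounded_Lam[OF B(2)] by auto
  then have "B = B \<inter> Lam n" by auto
  then have eq: "emeasure (config \<omega>) B = emeasure (conf (chain n \<omega>)) B" for \<omega>
    using config_Lam[OF B(1), of \<omega> n] by simp
  have [measurable]: "chain n \<in> measurable (PiM UNIV (\<lambda>_. LS)) (LS :: 'a list measure)" by (rule measurable_chain) simp
  show "(\<lambda>\<omega>. emeasure (config \<omega>) B) \<in> borel_measurable (PiM UNIV (\<lambda>_. LS))"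
    unfolding eq by measurable
qed (rule config_NN)

section \<open>The point process with Janossy densities \<open>jan\<close>\<close>

context fp
begin

text \<open>Shell by shell, \<open>KK\<close> draws the new points given those already present. The
  law of the first i shells has density \<open>JJ i\<close>: in the induction this factor cancels
  the denominator of the kernel, and \<open>superposition\<close> merges the ball with the next
  shell.\<close>

lemma janossy_process_exists:
  "\<exists>P. prob_space P \<and> sets P = sets NNsig \<and>
    (\<forall>n F. F \<in> borel_measurable NNsig \<longrightarrow>
      (\<integral>\<^sup>+\<eta>. F (restr (Lam n) \<eta>) \<partial>P) = (\<integral>\<^sup>+\<zeta>. indicator {\<zeta>. set \<zeta> \<subseteq> Lam n} \<zeta> * F (conf \<zeta>) * ennreal (jan (Lam n) \<zeta>) \<partial>ell \<mu>))"
proof -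
  interpret IT: Ionescu_Tulcea "\<lambda>i \<omega>. KK i (chain i \<omega>)" "\<lambda>_. LS"
  proof (rule Ionescu_Tulcea.intro)
    show "(\<lambda>\<omega>. KK i (chain i \<omega>)) \<in> measurable (PiM {0..<i} (\<lambda>_. LS)) (subprob_algebra LS)" for i
      by (rule measurable_compose[OF measurable_chain measurable_KK]) simp
  qed (rule prob_space_KK)
  \<comment> \<open>Only symmetric F can be treated, since the chain lists the points shell by
    shell; this suffices because \<open>conf\<close> forgets the order.\<close>
  have law: "(\<integral>\<^sup>+\<omega>. F (chain i \<omega>) \<partial>IT.C 0 i (\<lambda>_. undefined)) = (\<integral>\<^sup>+\<xi>. indicator {\<xi>. set \<xi> \<subseteq> Lam i} \<xi> * (F \<xi> * ennreal (JJ i \<xi>)) \<partial>ell \<mu>)"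
    if "F \<in> borel_measurable LS" "\<And>\<xi> \<xi>'. mset \<xi> = mset \<xi>' \<Longrightarrow> F \<xi> = F \<xi>'" for F and i
    using that
  proof (induction i arbitrary: F)
    case (0 F)
    note [measurable] = 0(1)
    have "(\<integral>\<^sup>+\<omega>. F (chain 0 \<omega>) \<partial>IT.C 0 0 (\<lambda>_. undefined)) = F []"
    proof -
      have "(\<lambda>_. undefined) \<in> space (PiM {0..<0} (\<lambda>_. LS :: 'a list measure))"
      by (auto simp: space_PiM PiE_iff extensional_def)
      then interpret C: prob_space "IT.C 0 0 (\<lambda>_. undefined)" by (rule IT.prob_space_C)
      show ?thesis using C.emeasure_space_1 by (simp del: IT.C.simps)
    qed
    moreover have "(\<integral>\<^sup>+\<xi>. indicator {\<xi>. set \<xi> \<subseteq> Lam 0} \<xi> * (F \<xi> * ennreal (JJ 0 \<xi>)) \<partial>ell \<mu>) = (\<integral>\<^sup>+\<xi>. F [] * indicator {\<xi>. set \<xi> \<subseteq> {}} \<xi> \<partial>ell \<mu>)"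
      by (intro nn_integral_cong) (auto simp: indicator_def JJ_0)
    moreover have "\<dots> = F [] * emeasure (ell \<mu>) {\<xi>. set \<xi> \<subseteq> {}}"
      using set_subset_in_LS[of "{}::'a set"] by (intro nn_integral_cmult_indicator) simp
    moreover have "emeasure (ell \<mu>) {\<xi>. set \<xi> \<subseteq> {}} = 1" by (subst emeasure_ell_subset) auto
    ultimately show ?case by simp
  next
    case (Suc i F)
    note [measurable] = Suc.prems(1) and inv = Suc.prems(2)
    define F' where "F' \<xi> = (\<integral>\<^sup>+\<zeta>. F (\<xi> @ filter (\<lambda>x. x \<in> shell i) \<zeta>) \<partial>KK i \<xi>)" for \<xi>
    have F'm: "F' \<in> borel_measurable LS" unfolding F'_def
      by (rule nn_integral_measurable_subprob_algebra2[OF _ measurable_KK]) measurable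
    have F'inv: "F' \<xi> = F' \<xi>'" if "mset \<xi> = mset \<xi>'" for \<xi> \<xi>'
    proof -
      have "JJ i \<xi> = JJ i \<xi>'" "\<And>\<zeta>. JJ (Suc i) (\<xi> @ \<zeta>) = JJ (Suc i) (\<xi>' @ \<zeta>)" "\<And>\<zeta>. F (\<xi> @ \<zeta>) = F (\<xi>' @ \<zeta>)"
        using that by (auto intro!: JJ_mset inv)
      then show ?thesis by (simp add: F'_def KK_def)
    qed
    have undef: "(\<lambda>_. undefined) \<in> space (PiM {0..<0} (\<lambda>_. LS :: 'a list measure))"
      by (auto simp: space_PiM PiE_iff extensional_def)
    have "(\<integral>\<^sup>+\<omega>. F (chain (Suc i) \<omega>) \<partial>IT.C 0 (Suc i) (\<lambda>_. undefined)) = (\<integral>\<^sup>+\<omega>. (\<integral>\<^sup>+\<omega>'. F (chain (Suc i) \<omega>') \<partial>IT.eP i \<omega>) \<partial>IT.C 0 i (\<lambda>_. undefined))"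
    proof -
      have "(\<lambda>\<omega>. F (chain (Suc i) \<omega>)) \<in> borel_measurable (PiM {0..<Suc i} (\<lambda>_. LS))"
        by (rule measurable_compose[OF measurable_chain Suc.prems(1)]) simp
      moreover have "IT.eP i \<in> measurable (IT.C 0 i (\<lambda>_. undefined)) (subprob_algebra (PiM {0..<Suc i} (\<lambda>_. LS)))"
        using IT.measurable_eP[of i] IT.sets_C[OF undef, of i] by (simp cong: measurable_cong_sets)
      ultimately show ?thesis by (simp add: nn_integral_bind del: chain.simps)
    qed
    also have "\<dots> = (\<integral>\<^sup>+\<omega>. F' (chain i \<omega>) \<partial>IT.C 0 i (\<lambda>_. undefined))"
    proof (rule nn_integral_cong)
      fix \<omega> assume "\<omega> \<in> space (IT.C 0 i (\<lambda>_. undefined))"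
      then have \<omega>: "\<omega> \<in> space (PiM {0..<i} (\<lambda>_. LS))" using IT.space_C[OF undef, of i] by simp
      have "(\<lambda>\<omega>. F (chain (Suc i) \<omega>)) \<in> borel_measurable (PiM {0..<Suc i} (\<lambda>_. LS))"
        by (rule measurable_compose[OF measurable_chain Suc.prems(1)]) simp
      then have "(\<integral>\<^sup>+\<omega>'. F (chain (Suc i) \<omega>') \<partial>IT.eP i \<omega>) = (\<integral>\<^sup>+\<zeta>. F (chain (Suc i) (fun_upd \<omega> i \<zeta>)) \<partial>KK i (chain i \<omega>))"
        by (rule IT.nn_integral_eP[OF \<omega>])
      also have "\<dots> = F' (chain i \<omega>)"
      proof -
        have "chain i (fun_upd \<omega> i \<zeta>) = chain i \<omega>" for \<zeta> by (rule chain_cong) simp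
        then show ?thesis by (simp add: F'_def)
      qed
      finally show "(\<integral>\<^sup>+\<omega>'. F (chain (Suc i) \<omega>') \<partial>IT.eP i \<omega>) = F' (chain i \<omega>)" .
    qed
    also have "\<dots> = (\<integral>\<^sup>+\<xi>. indicator {\<xi>. set \<xi> \<subseteq> Lam i} \<xi> * (F' \<xi> * ennreal (JJ i \<xi>)) \<partial>ell \<mu>)"
      by (rule Suc.IH[OF F'm F'inv])
    also have "\<dots> = (\<integral>\<^sup>+\<xi>. indicator {\<xi>. set \<xi> \<subseteq> Lam i} \<xi> * (\<integral>\<^sup>+\<zeta>. indicator {\<xi>. set \<xi> \<subseteq> shell i} \<zeta> * (F (\<xi> @ \<zeta>) * ennreal (JJ (Suc i) (\<xi> @ \<zeta>))) \<partial>ell \<mu>) \<partial>ell \<mu>)"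
    proof (intro nn_integral_cong arg_cong2[where f="(*)"] refl)
      fix \<xi>
      have "(\<lambda>\<zeta>. F (\<xi> @ \<zeta>)) \<in> borel_measurable LS" by measurable
      from nn_integral_KK[OF this, of i \<xi>]
      show "F' \<xi> * ennreal (JJ i \<xi>) = (\<integral>\<^sup>+\<zeta>. indicator {\<xi>. set \<xi> \<subseteq> shell i} \<zeta> * (F (\<xi> @ \<zeta>) * ennreal (JJ (Suc i) (\<xi> @ \<zeta>))) \<partial>ell \<mu>)"
        by (simp add: F'_def mult.commute)
    qed
    also have "\<dots> = (\<integral>\<^sup>+\<xi>. indicator {\<xi>. set \<xi> \<subseteq> Lam i \<union> shell i} \<xi> * (F \<xi> * ennreal (JJ (Suc i) \<xi>)) \<partial>ell \<mu>)"
    proof (rule superposition)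
      show "F \<xi> * ennreal (JJ (Suc i) \<xi>) = F \<xi>' * ennreal (JJ (Suc i) \<xi>')" if "mset \<xi> = mset \<xi>'" for \<xi> \<xi>'
        using inv[OF that] JJ_mset[OF that] by simp
    qed (auto simp: shell_def)
    also have "Lam i \<union> shell i = (Lam (Suc i) :: 'a set)"
      using Lam_mono[of i "Suc i"] by (auto simp: shell_def)
    finally show ?case .
  qed
  define P where "P = distr IT.PF.lim NNsig config"
  have sets_lim: "sets IT.PF.lim = sets (PiM UNIV (\<lambda>_. LS))" by (rule IT.PF.sets_lim)
  have cm: "config \<in> measurable IT.PF.lim NNsig"
    using measurable_config by (simp add: measurable_cong_sets[OF sets_lim refl])
  \<comment> \<open>\<open>chain n\<close> depends on the first n coordinates only, so the
    projective limit may be replaced by its marginal on them.\<close>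
  have lim: "(\<integral>\<^sup>+\<omega>. F (chain n \<omega>) \<partial>IT.PF.lim) = (\<integral>\<^sup>+\<omega>. F (chain n \<omega>) \<partial>IT.C 0 n (\<lambda>_. undefined))"
    if F: "F \<in> borel_measurable LS" for F n
  proof -
    have up: "IT.up_to {0..<n} = n"
    proof (rule antisym)
      show "IT.up_to {0..<n} \<le> n" by (simp add: IT.up_to_iff)
      show "n \<le> IT.up_to {0..<n}"
        using IT.up_to_less[of "{0..<n}" "n - 1"] by (cases n) auto
    qed
    have undef: "(\<lambda>_. undefined) \<in> space (PiM {0..<0} (\<lambda>_. LS :: 'a list measure))"
      by (auto simp: space_PiM PiE_iff extensional_def)
    have Fm: "(\<lambda>\<omega>. F (chain n \<omega>)) \<in> borel_measurable (PiM {0..<n} (\<lambda>_. LS))"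
      by (rule measurable_compose[OF measurable_chain F]) simp
    have r: "chain n (restrict \<omega> {0..<n}) = chain n \<omega>" for \<omega> :: "nat \<Rightarrow> 'a list" by (rule chain_cong) simp
    have rm1: "(\<lambda>\<omega>. restrict \<omega> {0..<n}) \<in> measurable IT.PF.lim (PiM {0..<n} (\<lambda>_. LS))"
      by (subst measurable_cong_sets[OF sets_lim refl]) (rule measurable_restrict_subset, simp)
    have rm2: "(\<lambda>\<omega>. restrict \<omega> {0..<n}) \<in> measurable (IT.C 0 n (\<lambda>_. undefined)) (PiM {0..<n} (\<lambda>_. LS))"
      using IT.sets_C[OF undef, of n] by (subst measurable_cong_sets[OF _ refl]) (auto intro!: measurable_restrict_subset)
    have "(\<integral>\<^sup>+\<omega>. F (chain n \<omega>) \<partial>IT.PF.lim) = (\<integral>\<^sup>+\<omega>. F (chain n \<omega>) \<partial>distr IT.PF.lim (PiM {0..<n} (\<lambda>_. LS)) (\<lambda>\<omega>. restrict \<omega> {0..<n}))"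
      using Fm rm1 by (subst nn_integral_distr) (auto simp: r)
    also have "\<dots> = (\<integral>\<^sup>+\<omega>. F (chain n \<omega>) \<partial>IT.CI {0..<n})"
      by (subst IT.distr_lim) auto
    also have "\<dots> = (\<integral>\<^sup>+\<omega>. F (chain n \<omega>) \<partial>IT.C 0 n (\<lambda>_. undefined))"
      unfolding IT.CI_def up using Fm rm2 by (subst nn_integral_distr) (auto simp: r)
    finally show ?thesis .
  qed
  have "(\<integral>\<^sup>+\<eta>. F (restr (Lam n) \<eta>) \<partial>P) = (\<integral>\<^sup>+\<zeta>. indicator {\<zeta>. set \<zeta> \<subseteq> Lam n} \<zeta> * F (conf \<zeta>) * ennreal (jan (Lam n) \<zeta>) \<partial>ell \<mu>)"
    if F: "F \<in> borel_measurable NNsig" for F n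
  proof -
    have Fc: "(\<lambda>\<xi>. F (conf \<xi>)) \<in> borel_measurable LS" by (rule measurable_compose[OF measurable_conf F])
    have Fr: "(\<lambda>\<eta>. F (restr (Lam n) \<eta>)) \<in> borel_measurable NNsig" by (rule measurable_compose[OF _ F]) measurable
    have "(\<integral>\<^sup>+\<eta>. F (restr (Lam n) \<eta>) \<partial>P) = (\<integral>\<^sup>+\<omega>. F (conf (chain n \<omega>)) \<partial>IT.PF.lim)"
      unfolding P_def using Fr cm by (subst nn_integral_distr) (auto simp: restr_config)
    also have "\<dots> = (\<integral>\<^sup>+\<xi>. indicator {\<xi>. set \<xi> \<subseteq> Lam n} \<xi> * (F (conf \<xi>) * ennreal (JJ n \<xi>)) \<partial>ell \<mu>)"
      unfolding lim[OF Fc] by (rule law[OF Fc]) (metis conf_mset_cong)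
    also have "\<dots> = (\<integral>\<^sup>+\<zeta>. indicator {\<zeta>. set \<zeta> \<subseteq> Lam n} \<zeta> * F (conf \<zeta>) * ennreal (jan (Lam n) \<zeta>) \<partial>ell \<mu>)"
    proof (rule nn_integral_cong_AE)
      show "AE \<xi> in ell \<mu>. indicator {\<xi>. set \<xi> \<subseteq> Lam n} \<xi> * (F (conf \<xi>) * ennreal (JJ n \<xi>)) = indicator {\<zeta>. set \<zeta> \<subseteq> Lam n} \<xi> * F (conf \<xi>) * ennreal (jan (Lam n) \<xi>)"
        using AE_ell_G by eventually_elim (simp add: JJ_def mult.assoc)
    qed
    finally show ?thesis .
  qed
  moreover have "prob_space P"
  proof -
    have undef: "(\<lambda>_. undefined) \<in> space (PiM {0..<0} (\<lambda>_. LS :: 'a list measure))"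
      by (auto simp: space_PiM PiE_iff extensional_def)
    interpret C: prob_space "IT.C 0 0 (\<lambda>_. undefined)" by (rule IT.prob_space_C[OF undef])
    have "emeasure IT.PF.lim (space IT.PF.lim) = 1"
      using lim[of "\<lambda>_. 1" 0] C.emeasure_space_1 by (simp del: IT.C.simps)
    then have "prob_space IT.PF.lim" by (rule prob_spaceI)
    then show ?thesis unfolding P_def by (rule prob_space.prob_space_distr[OF _ cm])
  qed
  moreover have "sets P = sets NNsig" by (simp add: P_def)
  ultimately show ?thesis by blast
qed

end

section \<open>The limit process is a Gibbs measure\<close>

text \<open>The Campbell measure is the left-hand side of the Gibbs equation. In this form the
  equation becomes an equality of two measures, which may be tested on a generator stable under
  intersections.\<close>

definition campbell :: "'a::metric_space measure measure \<Rightarrow> ('a \<times> 'a measure) measure" where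
  "campbell P = measure_of (UNIV \<times> NN) (sets (borel \<Otimes>\<^sub>M NNsig)) (\<lambda>S. \<integral>\<^sup>+\<eta>. \<integral>\<^sup>+x. indicator S (x, \<eta>) \<partial>\<eta> \<partial>P)"

lemma space_borel_NNsig: "space (borel \<Otimes>\<^sub>M NNsig) = UNIV \<times> NN"
  by (simp add: space_pair_measure space_NNsig)

lemma sets_campbell[simp, measurable_cong]: "sets (campbell P) = sets (borel \<Otimes>\<^sub>M NNsig)"
  unfolding campbell_def space_borel_NNsig[symmetric] by simp

lemma space_campbell: "space (campbell P) = UNIV \<times> NN"
  using sets_eq_imp_space_eq[OF sets_campbell] by (simp add: space_borel_NNsig)

lemma measurable_inner_NNsig:
  assumes "F \<in> borel_measurable (borel \<Otimes>\<^sub>M NNsig)"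
  shows "(\<lambda>\<eta>. \<integral>\<^sup>+x. F (x, \<eta>) \<partial>\<eta>) \<in> borel_measurable (NNsig :: 'a::metric_space measure measure)"
proof (rule measurable_nn_integral_NN)
  show "(\<lambda>(\<eta>, x). F (x, \<eta>)) \<in> borel_measurable (NNsig \<Otimes>\<^sub>M borel)"
    using measurable_pair_swap[OF assms] by (simp add: case_prod_unfold)
qed simp

lemma measurable_section_NN:
  assumes "F \<in> borel_measurable (borel \<Otimes>\<^sub>M NNsig)" "\<eta> \<in> NN"
  shows "(\<lambda>x. F (x, \<eta>)) \<in> borel_measurable \<eta>"
  by (rule NN_measurable[OF assms(2) measurable_compose[OF measurable_Pair2' assms(1)]])
     (simp add: space_NNsig assms(2))

lemma emeasure_campbell:
  assumes P: "sets P = sets NNsig" and S: "S \<in> sets (borel \<Otimes>\<^sub>M NNsig)"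
  shows "emeasure (campbell P) S = (\<integral>\<^sup>+\<eta>. \<integral>\<^sup>+x. indicator S (x, \<eta>) \<partial>\<eta> \<partial>P)"
proof (rule emeasure_measure_of[OF campbell_def])
  show "countably_additive (sets (campbell P)) (\<lambda>S. \<integral>\<^sup>+\<eta>. \<integral>\<^sup>+x. indicator S (x, \<eta>) \<partial>\<eta> \<partial>P)"
  proof (rule countably_additiveI)
    fix A :: "nat \<Rightarrow> ('a \<times> 'a measure) set"
    assume A: "range A \<subseteq> sets (campbell P)" "disjoint_family A" "\<Union> (range A) \<in> sets (campbell P)"
    then have m: "(indicator (A i) :: _ \<Rightarrow> ennreal) \<in> borel_measurable (borel \<Otimes>\<^sub>M NNsig)" for i by auto
    have sp: "space P = NN" using sets_eq_imp_space_eq[OF P] by (simp add: space_NNsig)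
    have "(\<Sum>i. \<integral>\<^sup>+\<eta>. \<integral>\<^sup>+x. indicator (A i) (x, \<eta>) \<partial>\<eta> \<partial>P) = (\<integral>\<^sup>+\<eta>. (\<Sum>i. \<integral>\<^sup>+x. indicator (A i) (x, \<eta>) \<partial>\<eta>) \<partial>P)"
      using measurable_inner_NNsig[OF m] by (intro nn_integral_suminf[symmetric]) (simp add: measurable_cong_sets[OF P refl])
    also have "\<dots> = (\<integral>\<^sup>+\<eta>. \<integral>\<^sup>+x. indicator (\<Union> (range A)) (x, \<eta>) \<partial>\<eta> \<partial>P)"
    proof (rule nn_integral_cong)
      fix \<eta> assume "\<eta> \<in> space P"
      then have N: "\<eta> \<in> NN" by (simp add: sp)
      have "(\<Sum>i. \<integral>\<^sup>+x. indicator (A i) (x, \<eta>) \<partial>\<eta>) = (\<integral>\<^sup>+x. (\<Sum>i. indicator (A i) (x, \<eta>)) \<partial>\<eta>)"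
        by (intro nn_integral_suminf[symmetric] measurable_section_NN m N)
      then show "(\<Sum>i. \<integral>\<^sup>+x. indicator (A i) (x, \<eta>) \<partial>\<eta>) = (\<integral>\<^sup>+x. indicator (\<Union> (range A)) (x, \<eta>) \<partial>\<eta>)"
        using A(2) by (simp add: suminf_indicator)
    qed
    finally show "(\<Sum>i. \<integral>\<^sup>+\<eta>. \<integral>\<^sup>+x. indicator (A i) (x, \<eta>) \<partial>\<eta> \<partial>P) = (\<integral>\<^sup>+\<eta>. \<integral>\<^sup>+x. indicator (\<Union> (range A)) (x, \<eta>) \<partial>\<eta> \<partial>P)" .
  qed
next
  show "sets (borel \<Otimes>\<^sub>M NNsig) \<subseteq> Pow (UNIV \<times> (NN :: 'a measure set))"
    using sets.space_closed[of "borel \<Otimes>\<^sub>M NNsig"] by (simp add: space_borel_NNsig)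
qed (use S in \<open>auto simp: positive_def\<close>)

lemma nn_integral_campbell:
  assumes P: "sets P = sets NNsig" and F: "F \<in> borel_measurable (borel \<Otimes>\<^sub>M NNsig)"
  shows "(\<integral>\<^sup>+p. F p \<partial>campbell P) = (\<integral>\<^sup>+\<eta>. \<integral>\<^sup>+x. F (x, \<eta>) \<partial>\<eta> \<partial>(P :: 'a::metric_space measure measure))"
proof -
  have sp: "space P = NN" using sets_eq_imp_space_eq[OF P] by (simp add: space_NNsig)
  have inner: "(\<lambda>\<eta>. \<integral>\<^sup>+x. F (x, \<eta>) \<partial>\<eta>) \<in> borel_measurable P" if "F \<in> borel_measurable (borel \<Otimes>\<^sub>M NNsig)" for F
    using measurable_inner_NNsig[OF that] by (simp add: measurable_cong_sets[OF P refl])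
  have mc: "f \<in> borel_measurable (campbell P)" if "f \<in> borel_measurable (borel \<Otimes>\<^sub>M NNsig)" for f :: "_ \<Rightarrow> ennreal"
    using that by (simp add: measurable_cong_sets[OF sets_campbell refl])
  show ?thesis using F
  proof (induction rule: borel_measurable_induct)
    case (cong f g)
    have "(\<integral>\<^sup>+p. f p \<partial>campbell P) = (\<integral>\<^sup>+p. g p \<partial>campbell P)"
      using cong(3) by (intro nn_integral_cong) (auto simp: space_campbell space_borel_NNsig)
    moreover have "(\<integral>\<^sup>+\<eta>. \<integral>\<^sup>+x. f (x, \<eta>) \<partial>\<eta> \<partial>P) = (\<integral>\<^sup>+\<eta>. \<integral>\<^sup>+x. g (x, \<eta>) \<partial>\<eta> \<partial>P)"
      using cong(3) by (intro nn_integral_cong) (auto simp: sp space_borel_NNsig)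
    ultimately show ?case using cong(4) by simp
  next
    case (set A)
    then show ?case by (simp add: emeasure_campbell[OF P])
  next
    case (mult u c)
    have "(\<integral>\<^sup>+\<eta>. \<integral>\<^sup>+x. c * u (x, \<eta>) \<partial>\<eta> \<partial>P) = (\<integral>\<^sup>+\<eta>. c * (\<integral>\<^sup>+x. u (x, \<eta>) \<partial>\<eta>) \<partial>P)"
      by (intro nn_integral_cong nn_integral_cmult measurable_section_NN mult) (simp add: sp)
    also have "\<dots> = c * (\<integral>\<^sup>+\<eta>. \<integral>\<^sup>+x. u (x, \<eta>) \<partial>\<eta> \<partial>P)"
      by (intro nn_integral_cmult inner mult)
    finally show ?case using mult by (simp add: nn_integral_cmult mc)
  next
    case (add u w)
    have "(\<integral>\<^sup>+\<eta>. \<integral>\<^sup>+x. w (x, \<eta>) + u (x, \<eta>) \<partial>\<eta> \<partial>P) = (\<integral>\<^sup>+\<eta>. (\<integral>\<^sup>+x. w (x, \<eta>) \<partial>\<eta>) + (\<integral>\<^sup>+x. u (x, \<eta>) \<partial>\<eta>) \<partial>P)"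
      by (intro nn_integral_cong nn_integral_add measurable_section_NN add) (simp_all add: sp)
    also have "\<dots> = (\<integral>\<^sup>+\<eta>. \<integral>\<^sup>+x. w (x, \<eta>) \<partial>\<eta> \<partial>P) + (\<integral>\<^sup>+\<eta>. \<integral>\<^sup>+x. u (x, \<eta>) \<partial>\<eta> \<partial>P)"
      by (intro nn_integral_add inner add)
    finally show ?case using add by (simp add: nn_integral_add mc)
  next
    case (seq U)
    have "(\<integral>\<^sup>+\<eta>. \<integral>\<^sup>+x. (SUP i. U i (x, \<eta>)) \<partial>\<eta> \<partial>P) = (\<integral>\<^sup>+\<eta>. (SUP i. \<integral>\<^sup>+x. U i (x, \<eta>) \<partial>\<eta>) \<partial>P)"
      by (intro nn_integral_cong nn_integral_monotone_convergence_SUP measurable_section_NN seq)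
         (use seq(3) in \<open>auto simp: sp incseq_def le_fun_def\<close>)
    also have "\<dots> = (SUP i. \<integral>\<^sup>+\<eta>. \<integral>\<^sup>+x. U i (x, \<eta>) \<partial>\<eta> \<partial>P)"
      by (intro nn_integral_monotone_convergence_SUP inner seq)
         (use seq(3) in \<open>auto simp: incseq_def le_fun_def intro!: nn_integral_mono\<close>)
    also have "\<dots> = (SUP i. \<integral>\<^sup>+p. U i p \<partial>campbell P)" using seq by simp
    also have "\<dots> = (\<integral>\<^sup>+p. (SUP i. U i p) \<partial>campbell P)"
      by (intro nn_integral_monotone_convergence_SUP[symmetric] mc seq)
    finally show ?case by (simp add: image_comp)
  qed
qed

definition local_rect :: "('a::metric_space \<times> 'a measure) set set" where
  "local_rect = {C \<times> X | C X. C \<in> sets borel \<and> X \<in> local_sets}"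

lemma sets_borel_NNsig_local: "sets (borel \<Otimes>\<^sub>M NNsig) = sigma_sets (UNIV \<times> NN) (local_rect :: ('a::metric_space \<times> 'a measure) set set)"
proof
  show "sigma_sets (UNIV \<times> NN) local_rect \<subseteq> sets (borel \<Otimes>\<^sub>M (NNsig :: 'a measure measure))"
    unfolding space_borel_NNsig[symmetric] local_rect_def
    by (rule sets.sigma_sets_subset) (use local_sets_subset in auto)
  interpret R: sigma_algebra "UNIV \<times> NN" "sigma_sets (UNIV \<times> NN) (local_rect :: ('a \<times> 'a measure) set set)"
    by (rule sigma_algebra_sigma_sets) (auto simp: local_rect_def local_sets_def)
  show "sets (borel \<Otimes>\<^sub>M (NNsig :: 'a measure measure)) \<subseteq> sigma_sets (UNIV \<times> NN) local_rect"
    unfolding sets_pair_measure space_NNsig space_borel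
  proof (rule sigma_sets_mono, safe)
    fix a :: "'a set" and b :: "'a measure set" assume a: "a \<in> sets borel" and "b \<in> sets NNsig"
    then have "b \<in> sigma_sets NN local_sets" by (simp add: sets_NNsig_local)
    then show "a \<times> b \<in> sigma_sets (UNIV \<times> NN) local_rect"
    proof induction
      case (Basic b)
      then show ?case using a by (intro sigma_sets.Basic) (auto simp: local_rect_def)
    next
      case Empty
      show ?case by simp
    next
      case (Compl b)
      have "a \<times> NN \<in> sigma_sets (UNIV \<times> NN) local_rect"
        using a NN_local by (intro sigma_sets.Basic) (auto simp: local_rect_def)
      then have "a \<times> NN - a \<times> b \<in> sigma_sets (UNIV \<times> NN) local_rect" using Compl.IH by (rule R.Diff)
      also have "a \<times> NN - a \<times> b = a \<times> (NN - b)" by auto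
      finally show ?case .
    next
      case (Union B)
      have "(\<Union>i. a \<times> B i) \<in> sigma_sets (UNIV \<times> NN) local_rect" using Union by (intro sigma_sets.Union) auto
      also have "(\<Union>i. a \<times> B i) = a \<times> (\<Union>i. B i)" by auto
      finally show ?case .
    qed
  qed
qed

lemma Int_stable_local_rect: "Int_stable local_rect"
proof (rule Int_stableI)
  fix A B :: "('a::metric_space \<times> 'a measure) set" assume "A \<in> local_rect" "B \<in> local_rect"
  then obtain C X D Y where "A = C \<times> X" "B = D \<times> Y" "C \<in> sets borel" "D \<in> sets borel" "X \<in> local_sets" "Y \<in> local_sets"
    by (auto simp: local_rect_def)
  then have "A \<inter> B = (C \<inter> D) \<times> (X \<inter> Y)" "C \<inter> D \<in> sets borel" "X \<inter> Y \<in> local_sets"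
    using Int_stableD[OF Int_stable_local] by auto
  then show "A \<inter> B \<in> local_rect" by (auto simp: local_rect_def)
qed

section \<open>Volume-independent control of the far interaction\<close>

context gibbs_meas
begin

text \<open>Interpolating from potential 0 to w and bounding every Laplace functional in the
  remainder by 1 gives E (1 - exp (- \<integral> w d\<eta>)) \<le> \<integral> (1 - exp (- w))
  d\<mu>. It is stated as a sum so as to make sense when the integral is infinite.\<close>

lemma one_minus_LL_le:
  assumes w[measurable]: "w \<in> borel_measurable borel"
  shows "1 \<le> ennreal (LL P w) + (\<integral>\<^sup>+y. ennreal (1 - expneg (w y)) \<partial>\<mu>)"
proof (cases "(\<integral>\<^sup>+y. ennreal (1 - expneg (w y)) \<partial>\<mu>) < \<infinity>")
  case True
  let ?g = "\<lambda>y. 1 - expneg (w y)"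
  have "ennreal (LL P (\<lambda>_. 0)) = ennreal (LL P (\<lambda>y. lg 1 (?g y) + 0)) +
    (\<integral>\<^sup>+r. (\<integral>\<^sup>+x. ennreal (?g x * expneg 0) * ennreal (LL P (\<lambda>y. lg r (?g y) + (0 + v x y))) \<partial>\<mu>) * indicator {0..<1} r \<partial>lborel)"
    by (rule interpolation) (use True in auto)
  also have "\<dots> \<le> ennreal (LL P w) + (\<integral>\<^sup>+r. (\<integral>\<^sup>+x. ennreal (?g x) \<partial>\<mu>) * indicator {0..<1::real} r \<partial>lborel)"
  proof (intro add_mono nn_integral_mono mult_right_mono)
    show "ennreal (LL P (\<lambda>y. lg 1 (1 - expneg (w y)) + 0)) \<le> ennreal (LL P w)" by (simp add: lg_expneg)
    show "ennreal (?g x * expneg 0) * ennreal (LL P (\<lambda>y. lg r (?g y) + (0 + v x y))) \<le> ennreal (?g x)" for r x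
      using mult_left_mono[of "ennreal (LL P (\<lambda>y. lg r (?g y) + (0 + v x y)))" 1 "ennreal (?g x)"]
      by (simp add: ennreal_le_1 LL_le_1)
  qed simp
  also have "(\<integral>\<^sup>+r. (\<integral>\<^sup>+x. ennreal (?g x) \<partial>\<mu>) * indicator {0..<1::real} r \<partial>lborel) = (\<integral>\<^sup>+x. ennreal (?g x) \<partial>\<mu>)"
    by (subst nn_integral_cmult_indicator) auto
  finally show ?thesis by (simp add: LL_def prob_space del: space_P)
next
  case False
  then have "(\<integral>\<^sup>+y. ennreal (1 - expneg (w y)) \<partial>\<mu>) = \<top>"
    unfolding infinity_ennreal_def by (rule contrapos_np) (simp only: top.not_eq_extremum)
  then show ?thesis by simp
qed

end

locale janossy_process = fp \<mu> v b T G for \<mu> :: "'a::polish_space measure" and v b T G +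
  fixes P :: "'a measure measure"
  assumes probP: "prob_space P" and sets_P[simp, measurable_cong]: "sets P = sets NNsig"
    and law: "F \<in> borel_measurable NNsig \<Longrightarrow>
      (\<integral>\<^sup>+\<eta>. F (restr (Lam n) \<eta>) \<partial>P) = (\<integral>\<^sup>+\<zeta>. indicator {\<zeta>. set \<zeta> \<subseteq> Lam n} \<zeta> * F (conf \<zeta>) * ennreal (jan (Lam n) \<zeta>) \<partial>ell \<mu>)"
begin

sublocale prob_space P by (rule probP)

lemma space_P[simp]: "space P = NN"
  using sets_eq_imp_space_eq[OF sets_P] by (simp add: space_NNsig)

text \<open>The weight of the roots \<open>xs\<close> is nonlocal, but by \<open>local_law\<close>
  it only adds roots to the finite-volume Janossy density, which converges.\<close>

lemma PM_local_tendsto: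
  assumes F: "F \<in> borel_measurable NNsig" "\<And>\<eta>. F \<eta> \<le> 1" and xs: "set xs \<subseteq> G"
  shows "(\<lambda>M. ennreal (eH v xs) * (\<integral>\<^sup>+\<eta>. F (restr (Lam n) \<eta>) * ennreal (expneg (\<integral>\<^sup>+y. vL v xs y \<partial>\<eta>)) \<partial>PM M)) \<longlonglongrightarrow>
    (\<integral>\<^sup>+\<zeta>. indicator {\<zeta>. set \<zeta> \<subseteq> Lam n} \<zeta> * F (conf \<zeta>) * ennreal (jan (Lam n) (xs @ \<zeta>)) \<partial>ell \<mu>)"
proof -
  have Fc[measurable]: "(\<lambda>\<zeta>. F (conf \<zeta>)) \<in> borel_measurable LS"
    by (rule measurable_compose[OF measurable_conf F(1)])
  have eq: "ennreal (eH v xs) * (\<integral>\<^sup>+\<eta>. F (restr (Lam n) \<eta>) * ennreal (expneg (\<integral>\<^sup>+y. vL v xs y \<partial>\<eta>)) \<partial>PM M) =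
    (\<integral>\<^sup>+\<zeta>. indicator {\<zeta>. set \<zeta> \<subseteq> Lam n} \<zeta> * F (conf \<zeta>) * ennreal (janM M (Lam n) (xs @ \<zeta>)) \<partial>ell \<mu>)" if "n \<le> M" for M
  proof -
    interpret R: gibbs_fp "restr (Lam M) \<mu>" v b T G "PM M" by (rule PM_gibbs)
    have "ennreal (eH v xs) * (\<integral>\<^sup>+\<eta>. F (restr (Lam n) \<eta>) * ennreal (expneg (\<integral>\<^sup>+y. vL v xs y \<partial>\<eta>)) \<partial>PM M) =
      (\<integral>\<^sup>+\<zeta>. indicator {\<zeta>. set \<zeta> \<subseteq> Lam n} \<zeta> * F (conf \<zeta>) * ennreal (janM M (Lam n) (xs @ \<zeta>)) \<partial>ell (restr (Lam M) \<mu>))"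
      by (rule R.local_law[OF Lam_sets Lam_bounded F xs])
    also have "\<dots> = (\<integral>\<^sup>+\<zeta>. indicator {\<zeta>. set \<zeta> \<subseteq> Lam M} \<zeta> * (indicator {\<zeta>. set \<zeta> \<subseteq> Lam n} \<zeta> * F (conf \<zeta>) * ennreal (janM M (Lam n) (xs @ \<zeta>))) \<partial>ell \<mu>)"
      by (rule nn_integral_ell_restr) measurable
    also have "\<dots> = (\<integral>\<^sup>+\<zeta>. indicator {\<zeta>. set \<zeta> \<subseteq> Lam n} \<zeta> * F (conf \<zeta>) * ennreal (janM M (Lam n) (xs @ \<zeta>)) \<partial>ell \<mu>)"
      using Lam_mono[OF that] by (intro nn_integral_cong) (force simp: indicator_def)
    finally show ?thesis .
  qed
  have "(\<lambda>M. \<integral>\<^sup>+\<zeta>. indicator {\<zeta>. set \<zeta> \<subseteq> Lam n} \<zeta> * F (conf \<zeta>) * ennreal (janM M (Lam n) (xs @ \<zeta>)) \<partial>ell \<mu>) \<longlonglongrightarrow>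
    (\<integral>\<^sup>+\<zeta>. indicator {\<zeta>. set \<zeta> \<subseteq> Lam n} \<zeta> * F (conf \<zeta>) * ennreal (jan (Lam n) (xs @ \<zeta>)) \<partial>ell \<mu>)"
    by (rule nn_jan_tendsto[OF Lam_sets Lam_bounded Fc F(2) xs])
  moreover have "eventually (\<lambda>M. (\<integral>\<^sup>+\<zeta>. indicator {\<zeta>. set \<zeta> \<subseteq> Lam n} \<zeta> * F (conf \<zeta>) * ennreal (janM M (Lam n) (xs @ \<zeta>)) \<partial>ell \<mu>) =
     ennreal (eH v xs) * (\<integral>\<^sup>+\<eta>. F (restr (Lam n) \<eta>) * ennreal (expneg (\<integral>\<^sup>+y. vL v xs y \<partial>\<eta>)) \<partial>PM M)) sequentially"
    using eventually_ge_at_top[of n] by eventually_elim (simp add: eq)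
  ultimately show ?thesis by (rule Lim_transform_eventually)
qed

lemma cut_off_measurable:
  assumes [measurable]: "w \<in> borel_measurable borel"
  shows "(\<lambda>\<eta>. ennreal (expneg (\<integral>\<^sup>+y. w y \<partial>\<eta>))) \<in> borel_measurable (NNsig :: 'a measure measure)"
proof -
  have "(\<lambda>\<eta>. \<integral>\<^sup>+y. w y \<partial>\<eta>) \<in> borel_measurable (NNsig :: 'a measure measure)"
    by (rule measurable_nn_integral_NN) measurable
  then show ?thesis by measurable
qed

text \<open>The weight \<open>exp (- W (x; \<eta>))\<close> is not local. It is approximated by the weight of the points in
  \<open>Lam k\<close>, with an error in expectation that is uniform in the volume \<open>M\<close>.\<close>

lemma law_weighted:
  assumes F: "F \<in> borel_measurable NNsig" "\<And>\<eta>. F \<eta> \<le> 1" and x: "x \<in> G"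
  shows "(\<integral>\<^sup>+\<eta>. F (restr (Lam n) \<eta>) * ennreal (expneg (WW v x \<eta>)) \<partial>P) =
    (\<integral>\<^sup>+\<zeta>. indicator {\<zeta>. set \<zeta> \<subseteq> Lam n} \<zeta> * F (conf \<zeta>) * ennreal (jan (Lam n) (x # \<zeta>)) \<partial>ell \<mu>)"
proof -
  define R where "R = (\<integral>\<^sup>+\<zeta>. indicator {\<zeta>. set \<zeta> \<subseteq> Lam n} \<zeta> * F (conf \<zeta>) * ennreal (jan (Lam n) (x # \<zeta>)) \<partial>ell \<mu>)"
  have Fn: "(\<lambda>\<eta>. F (restr (Lam n) \<eta>)) \<in> borel_measurable (NNsig :: 'a measure measure)"
    by (rule measurable_compose[OF _ F(1)]) measurable
  define A where "A k \<eta> = ennreal (expneg (\<integral>\<^sup>+y. v x y * indicator (Lam k) y \<partial>\<eta>))" for k \<eta>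
  have Am: "A k \<in> borel_measurable (NNsig :: 'a measure measure)" for k
    unfolding A_def[abs_def] by (rule cut_off_measurable) measurable
  have Wm: "(\<lambda>\<eta>. ennreal (expneg (WW v x \<eta>))) \<in> borel_measurable (NNsig :: 'a measure measure)"
    unfolding WW_def by (rule cut_off_measurable) measurable
  \<comment> \<open>The mass of \<bar>f(x, .)\<bar> outside the ball; it tends to 0 because this
    function is integrable for x in G.\<close>
  define \<epsilon> where "\<epsilon> k = (\<integral>\<^sup>+y. ennreal (1 - expneg (v x y)) * indicator (- Lam k) y \<partial>\<mu>)" for k
  have eps: "\<epsilon> \<longlonglongrightarrow> 0"
  proof -
    have "(\<lambda>k. \<integral>\<^sup>+y. ennreal (1 - expneg (v x y)) * indicator (- Lam k) y \<partial>\<mu>) \<longlonglongrightarrow> (\<integral>\<^sup>+y. 0 \<partial>\<mu>)"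
    proof (rule nn_integral_dominated_convergence[where w="\<lambda>y. ennreal (1 - expneg (v x y))"])
      show "AE y in \<mu>. (\<lambda>k. ennreal (1 - expneg (v x y)) * indicator (- Lam k) y) \<longlonglongrightarrow> 0"
      proof (rule AE_I2)
        fix y :: 'a
        obtain n where "y \<in> Lam n" using Lam_cover by blast
        then have yk: "y \<in> Lam k" if "n \<le> k" for k using Lam_mono[OF that] by blast
        have "eventually (\<lambda>k. ennreal (1 - expneg (v x y)) * indicator (- Lam k) y = 0) sequentially"
          using eventually_ge_at_top[of n] by eventually_elim (simp add: indicator_def yk)
        then show "(\<lambda>k. ennreal (1 - expneg (v x y)) * indicator (- Lam k) y) \<longlonglongrightarrow> 0" by (rule tendsto_eventually)
      qed
    qed (use integral_f_finite[OF x] in \<open>auto simp: indicator_def\<close>)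
    then show ?thesis by (simp add: \<epsilon>_def[abs_def])
  qed
  have cut: "ennreal (expneg (WW v x \<eta>)) \<le> A k \<eta> \<and> A k \<eta> + ennreal (expneg (\<integral>\<^sup>+y. v x y * indicator (- Lam k) y \<partial>\<eta>)) \<le> ennreal (expneg (WW v x \<eta>)) + 1"
    if "\<eta> \<in> NN" for \<eta> k
  proof -
    have "WW v x \<eta> = (\<integral>\<^sup>+y. v x y * indicator (Lam k) y + v x y * indicator (- Lam k) y \<partial>\<eta>)"
      unfolding WW_def by (intro nn_integral_cong) (simp add: indicator_def)
    also have "\<dots> = (\<integral>\<^sup>+y. v x y * indicator (Lam k) y \<partial>\<eta>) + (\<integral>\<^sup>+y. v x y * indicator (- Lam k) y \<partial>\<eta>)"
      by (intro nn_integral_add NN_measurable[OF that]) measurable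
    finally have W: "expneg (WW v x \<eta>) = expneg (\<integral>\<^sup>+y. v x y * indicator (Lam k) y \<partial>\<eta>) * expneg (\<integral>\<^sup>+y. v x y * indicator (- Lam k) y \<partial>\<eta>)"
      by (simp add: expneg_add)
    \<comment> \<open>With a the near and c the far factor, dropping c costs at most 1 - c; written
      without subtraction for use in [0, \<infinity>].\<close>
    have r: "a * c \<le> a \<and> a + c \<le> a * c + 1" if "0 \<le> a" "a \<le> 1" "0 \<le> c" "c \<le> 1" for a c :: real
    proof -
      have "0 \<le> (1 - a) * (1 - c)" using that by simp
      then show ?thesis using that mult_left_le[of c a] by (simp add: algebra_simps)
    qed
    show ?thesis unfolding A_def W
      using r[of "expneg (\<integral>\<^sup>+y. v x y * indicator (Lam k) y \<partial>\<eta>)" "expneg (\<integral>\<^sup>+y. v x y * indicator (- Lam k) y \<partial>\<eta>)"]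
      by (auto simp: ennreal_1[symmetric] ennreal_plus[symmetric] simp del: ennreal_plus ennreal_1 intro!: ennreal_leI)
  qed
  have loc: "\<exists>Fk. Fk \<in> borel_measurable NNsig \<and> (\<forall>\<eta>. Fk \<eta> \<le> 1) \<and> (\<forall>\<eta>\<in>NN. Fk (restr (Lam k) \<eta>) = F (restr (Lam n) \<eta>) * A k \<eta>)" if "n \<le> k" for k
  proof (intro exI conjI ballI allI)
    let ?F = "\<lambda>\<eta>. F (restr (Lam n) \<eta>) * ennreal (expneg (\<integral>\<^sup>+y. v x y \<partial>\<eta>))"
    have "(\<lambda>\<eta>. ennreal (expneg (\<integral>\<^sup>+y. v x y \<partial>\<eta>))) \<in> borel_measurable (NNsig :: 'a measure measure)"
      by (rule cut_off_measurable) measurable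
    then show "?F \<in> borel_measurable NNsig" using Fn by measurable
    show "?F \<eta> \<le> 1" for \<eta> using mult_mono[OF F(2)[of "restr (Lam n) \<eta>"], of "ennreal (expneg (\<integral>\<^sup>+y. v x y \<partial>\<eta>))" 1] by (simp add: ennreal_le_1)
    fix \<eta> :: "'a measure" assume N: "\<eta> \<in> NN"
    have "Lam n \<inter> Lam k = (Lam n :: 'a set)" using Lam_mono[OF that] by auto
    then show "?F (restr (Lam k) \<eta>) = F (restr (Lam n) \<eta>) * A k \<eta>"
      using N by (simp add: A_def restr_restr NN_sets nn_integral_restr)
  qed
  \<comment> \<open>The truncated weight makes the integrand a function of the configuration in
    \<open>Lam k\<close>, where the laws are known to converge.\<close>
  have PMlim: "(\<lambda>M. \<integral>\<^sup>+\<eta>. F (restr (Lam n) \<eta>) * A k \<eta> \<partial>PM M) \<longlonglongrightarrow> (\<integral>\<^sup>+\<eta>. F (restr (Lam n) \<eta>) * A k \<eta> \<partial>P)" if k: "n \<le> k" for k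
  proof -
    obtain Fk where Fk: "Fk \<in> borel_measurable NNsig" "\<And>\<eta>. Fk \<eta> \<le> 1" "\<And>\<eta>. \<eta> \<in> NN \<Longrightarrow> Fk (restr (Lam k) \<eta>) = F (restr (Lam n) \<eta>) * A k \<eta>"
      using loc[OF k] by blast
    have "(\<integral>\<^sup>+\<eta>. F (restr (Lam n) \<eta>) * A k \<eta> \<partial>P) = (\<integral>\<^sup>+\<eta>. Fk (restr (Lam k) \<eta>) \<partial>P)"
      by (intro nn_integral_cong) (simp add: Fk)
    moreover have "(\<integral>\<^sup>+\<eta>. F (restr (Lam n) \<eta>) * A k \<eta> \<partial>PM M) = (\<integral>\<^sup>+\<eta>. Fk (restr (Lam k) \<eta>) \<partial>PM M)" for M
    proof -
      interpret R: gibbs_fp "restr (Lam M) \<mu>" v b T G "PM M" by (rule PM_gibbs)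
      show ?thesis by (intro nn_integral_cong) (simp add: Fk)
    qed
    ultimately show ?thesis using PM_local_tendsto[OF Fk(1,2), of "[]" k] law[OF Fk(1), of k] by simp
  qed
  \<comment> \<open>The full weight is accounted for by the single additional root x, which gives
    the limit although the integrand is not local.\<close>
  have PMR: "(\<lambda>M. \<integral>\<^sup>+\<eta>. F (restr (Lam n) \<eta>) * ennreal (expneg (WW v x \<eta>)) \<partial>PM M) \<longlonglongrightarrow> R"
    using PM_local_tendsto[OF F, of "[x]" n] x by (simp add: R_def WW_def vL_def)
  have bounds: "(\<integral>\<^sup>+\<eta>. F (restr (Lam n) \<eta>) * ennreal (expneg (WW v x \<eta>)) \<partial>PM M) \<le> (\<integral>\<^sup>+\<eta>. F (restr (Lam n) \<eta>) * A k \<eta> \<partial>PM M) \<and>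
      (\<integral>\<^sup>+\<eta>. F (restr (Lam n) \<eta>) * A k \<eta> \<partial>PM M) \<le> (\<integral>\<^sup>+\<eta>. F (restr (Lam n) \<eta>) * ennreal (expneg (WW v x \<eta>)) \<partial>PM M) + \<epsilon> k" for M k
  proof -
    interpret R: gibbs_fp "restr (Lam M) \<mu>" v b T G "PM M" by (rule PM_gibbs)
    let ?w = "\<lambda>y. v x y * indicator (- Lam k) y"
    let ?E = "\<lambda>\<eta>. ennreal (expneg (\<integral>\<^sup>+y. ?w y \<partial>\<eta>))"
    let ?W = "\<lambda>\<eta>. ennreal (expneg (WW v x \<eta>))"
    have [measurable]: "?w \<in> borel_measurable borel" by measurable
    note [measurable] = Fn Am Wm cut_off_measurable[OF \<open>?w \<in> _\<close>]
    have 1: "(\<integral>\<^sup>+\<eta>. F (restr (Lam n) \<eta>) * ?W \<eta> \<partial>PM M) \<le> (\<integral>\<^sup>+\<eta>. F (restr (Lam n) \<eta>) * A k \<eta> \<partial>PM M)"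
      using cut by (intro nn_integral_mono mult_left_mono) auto
    have E1: "(\<integral>\<^sup>+\<eta>. ?E \<eta> \<partial>PM M) = ennreal (LL (PM M) ?w)" by (rule R.nn_LL) measurable
    have "(\<integral>\<^sup>+\<eta>. F (restr (Lam n) \<eta>) * A k \<eta> \<partial>PM M) + (\<integral>\<^sup>+\<eta>. ?E \<eta> \<partial>PM M) = (\<integral>\<^sup>+\<eta>. F (restr (Lam n) \<eta>) * A k \<eta> + ?E \<eta> \<partial>PM M)"
      by (rule nn_integral_add[symmetric]) measurable
    also have "\<dots> \<le> (\<integral>\<^sup>+\<eta>. F (restr (Lam n) \<eta>) * ?W \<eta> + 1 \<partial>PM M)"
    proof (rule nn_integral_mono)
      fix \<eta> assume "\<eta> \<in> space (PM M)"
      then have c: "A k \<eta> + ?E \<eta> \<le> ?W \<eta> + 1" "?W \<eta> \<le> A k \<eta>" using cut[of \<eta> k] by auto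
      define f where "f = F (restr (Lam n) \<eta>)"
      have f: "f \<le> 1" by (simp add: f_def F)
      \<comment> \<open>A test value at most 1 can only shrink the nonnegative truncation error, so
        the inequality of \<open>cut\<close> survives multiplication.\<close>
      then obtain fr where fr: "f = ennreal fr" "0 \<le> fr" "fr \<le> 1" by (cases f) (auto simp: top_unique)
      obtain ar where ar: "A k \<eta> = ennreal ar" "0 \<le> ar" unfolding A_def by (auto intro: that)
      have "ar + expneg (\<integral>\<^sup>+y. ?w y \<partial>\<eta>) \<le> expneg (WW v x \<eta>) + 1" "expneg (WW v x \<eta>) \<le> ar"
        using c ar by (simp_all add: ennreal_1[symmetric] ennreal_plus[symmetric] del: ennreal_plus ennreal_1)
      moreover from this(2) have "fr * (ar - expneg (WW v x \<eta>)) \<le> 1 * (ar - expneg (WW v x \<eta>))"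
        using fr by (intro mult_right_mono) auto
      ultimately have "fr * ar + expneg (\<integral>\<^sup>+y. ?w y \<partial>\<eta>) \<le> fr * expneg (WW v x \<eta>) + 1"
        by (simp add: algebra_simps)
      then have "ennreal (fr * ar + expneg (\<integral>\<^sup>+y. ?w y \<partial>\<eta>)) \<le> ennreal (fr * expneg (WW v x \<eta>) + 1)" by (rule ennreal_leI)
      then show "F (restr (Lam n) \<eta>) * A k \<eta> + ?E \<eta> \<le> F (restr (Lam n) \<eta>) * ?W \<eta> + 1"
        unfolding f_def[symmetric] fr(1) ar(1) using fr ar by (simp add: ennreal_mult)
    qed
    also have "\<dots> = (\<integral>\<^sup>+\<eta>. F (restr (Lam n) \<eta>) * ?W \<eta> \<partial>PM M) + 1"
      using R.emeasure_space_1 by (subst nn_integral_add) auto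
    also have "\<dots> \<le> (\<integral>\<^sup>+\<eta>. F (restr (Lam n) \<eta>) * ?W \<eta> \<partial>PM M) + (ennreal (LL (PM M) ?w) + \<epsilon> k)"
    proof (intro add_left_mono)
      have "1 \<le> ennreal (LL (PM M) ?w) + (\<integral>\<^sup>+y. ennreal (1 - expneg (?w y)) \<partial>restr (Lam M) \<mu>)"
        by (rule R.one_minus_LL_le) measurable
      also have "(\<integral>\<^sup>+y. ennreal (1 - expneg (?w y)) \<partial>restr (Lam M) \<mu>) \<le> \<epsilon> k"
        unfolding \<epsilon>_def by (subst nn_integral_restr) (auto intro!: nn_integral_mono simp: indicator_def)
      finally show "1 \<le> ennreal (LL (PM M) ?w) + \<epsilon> k" by (simp add: add_left_mono)
    qed
    finally have "ennreal (LL (PM M) ?w) + (\<integral>\<^sup>+\<eta>. F (restr (Lam n) \<eta>) * A k \<eta> \<partial>PM M) \<le> ennreal (LL (PM M) ?w) + ((\<integral>\<^sup>+\<eta>. F (restr (Lam n) \<eta>) * ?W \<eta> \<partial>PM M) + \<epsilon> k)"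
      unfolding E1 by (simp add: ac_simps)
    then show ?thesis using 1 by (simp add: ennreal_add_left_cancel_le)
  qed
  \<comment> \<open>First the volume M tends to infinity with k fixed, which works because the error
    is uniform in M; afterwards k does.\<close>
  have sandwich: "R \<le> (\<integral>\<^sup>+\<eta>. F (restr (Lam n) \<eta>) * A k \<eta> \<partial>P)" "(\<integral>\<^sup>+\<eta>. F (restr (Lam n) \<eta>) * A k \<eta> \<partial>P) \<le> R + \<epsilon> k" if k: "n \<le> k" for k
  proof -
    show "R \<le> (\<integral>\<^sup>+\<eta>. F (restr (Lam n) \<eta>) * A k \<eta> \<partial>P)"
      by (rule LIMSEQ_le[OF PMR PMlim[OF k]]) (use bounds in auto)
    show "(\<integral>\<^sup>+\<eta>. F (restr (Lam n) \<eta>) * A k \<eta> \<partial>P) \<le> R + \<epsilon> k"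
      by (rule LIMSEQ_le[OF PMlim[OF k] tendsto_add[OF PMR tendsto_const]]) (use bounds in auto)
  qed
  have Plim: "(\<lambda>k. \<integral>\<^sup>+\<eta>. F (restr (Lam n) \<eta>) * A k \<eta> \<partial>P) \<longlonglongrightarrow> (\<integral>\<^sup>+\<eta>. F (restr (Lam n) \<eta>) * ennreal (expneg (WW v x \<eta>)) \<partial>P)"
  proof (rule nn_integral_dominated_convergence[where w="\<lambda>_. 1"])
    show "AE \<eta> in P. F (restr (Lam n) \<eta>) * A k \<eta> \<le> 1" for k
      using mult_mono[OF F(2), of "A k _" 1] by (intro AE_I2) (simp add: A_def ennreal_le_1)
    show "(\<integral>\<^sup>+\<eta>. 1 \<partial>P) < \<infinity>" using emeasure_space_1 by simp
    show "AE \<eta> in P. (\<lambda>k. F (restr (Lam n) \<eta>) * A k \<eta>) \<longlonglongrightarrow> F (restr (Lam n) \<eta>) * ennreal (expneg (WW v x \<eta>))"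
    proof (rule AE_I2)
      fix \<eta> assume "\<eta> \<in> space P"
      then have N: "\<eta> \<in> NN" by simp
      have "incseq (\<lambda>k. \<integral>\<^sup>+y. v x y * indicator (Lam k) y \<partial>\<eta>)"
        by (intro incseq_SucI nn_integral_mono) (auto simp: indicator_def dest: Lam_mono[OF le_SucI[OF order_refl], THEN subsetD])
      then have "(\<lambda>k. \<integral>\<^sup>+y. v x y * indicator (Lam k) y \<partial>\<eta>) \<longlonglongrightarrow> (SUP k. \<integral>\<^sup>+y. v x y * indicator (Lam k) y \<partial>\<eta>)"
        by (rule LIMSEQ_SUP)
      also have "(SUP k. \<integral>\<^sup>+y. v x y * indicator (Lam k) y \<partial>\<eta>) = WW v x \<eta>"
        unfolding WW_def by (rule nn_integral_Lam_SUP[symmetric]) (use N in \<open>simp_all add: NN_sets\<close>)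
      finally have "(\<lambda>k. A k \<eta>) \<longlonglongrightarrow> ennreal (expneg (WW v x \<eta>))"
        unfolding A_def by (intro tendsto_ennrealI tendsto_expneg)
      moreover have "F (restr (Lam n) \<eta>) < \<infinity>" using le_less_trans[OF F(2), of \<infinity>] by simp
      ultimately show "(\<lambda>k. F (restr (Lam n) \<eta>) * A k \<eta>) \<longlonglongrightarrow> F (restr (Lam n) \<eta>) * ennreal (expneg (WW v x \<eta>))"
        by (intro ennreal_tendsto_cmult) auto
    qed
  qed (use Fn Am Wm in \<open>auto simp: measurable_cong_sets[OF sets_P refl]\<close>)
  have "R \<le> (\<integral>\<^sup>+\<eta>. F (restr (Lam n) \<eta>) * ennreal (expneg (WW v x \<eta>)) \<partial>P)"
    by (rule LIMSEQ_le[OF tendsto_const Plim]) (use sandwich in auto)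
  moreover have "(\<integral>\<^sup>+\<eta>. F (restr (Lam n) \<eta>) * ennreal (expneg (WW v x \<eta>)) \<partial>P) \<le> R + 0"
    by (rule LIMSEQ_le[OF Plim tendsto_add[OF tendsto_const eps]]) (use sandwich in auto)
  ultimately show ?thesis unfolding R_def by simp
qed

text \<open>The Mecke formula applied to the law in \<open>Lam n\<close>. Marking a point x leaves
  the density \<open>jan (Lam n) (x # \<zeta>)\<close>, which \<open>law_weighted\<close> identifies
  as that of the law weighted by exp (- W (x; \<eta>)).\<close>

lemma GNZ_local:
  assumes C: "C \<in> sets borel" "C \<subseteq> Lam n" and F: "F \<in> borel_measurable NNsig" "\<And>\<eta>. F \<eta> \<le> 1"
  shows "(\<integral>\<^sup>+\<eta>. emeasure \<eta> C * F (restr (Lam n) \<eta>) \<partial>P) =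
    (\<integral>\<^sup>+x. indicator C x * (\<integral>\<^sup>+\<eta>. F (restr (Lam n) (add_dirac \<eta> x)) * ennreal (expneg (WW v x \<eta>)) \<partial>P) \<partial>\<mu>)"
proof -
  note [measurable] = C(1)
  have Fm[measurable (raw)]: "(\<lambda>m. F (f m)) \<in> borel_measurable M" if "f \<in> measurable M NNsig" for f M
    using measurable_compose[OF that F(1)] by simp
  have [measurable]: "(\<lambda>\<zeta>. F (conf \<zeta>)) \<in> borel_measurable LS" by (rule Fm) measurable
  let ?g = "\<lambda>x \<zeta>. indicator C x * (indicator {\<zeta>. set \<zeta> \<subseteq> Lam n} \<zeta> * F (conf \<zeta>) * ennreal (JJ n \<zeta>))"
  have Fe: "(\<lambda>\<eta>. emeasure \<eta> C * F \<eta>) \<in> borel_measurable NNsig" using F(1) by measurable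
  have "(\<integral>\<^sup>+\<eta>. emeasure \<eta> C * F (restr (Lam n) \<eta>) \<partial>P) = (\<integral>\<^sup>+\<eta>. emeasure (restr (Lam n) \<eta>) C * F (restr (Lam n) \<eta>) \<partial>P)"
    using C by (intro nn_integral_cong) (simp add: emeasure_restr NN_sets Int_absorb2)
  also have "\<dots> = (\<integral>\<^sup>+\<zeta>. indicator {\<zeta>. set \<zeta> \<subseteq> Lam n} \<zeta> * (emeasure (conf \<zeta>) C * F (conf \<zeta>)) * ennreal (jan (Lam n) \<zeta>) \<partial>ell \<mu>)"
    by (rule law[OF Fe])
  also have "\<dots> = (\<integral>\<^sup>+\<zeta>. sum_list (map (\<lambda>x. ?g x \<zeta>) \<zeta>) \<partial>ell \<mu>)"
  proof (rule nn_integral_cong_AE)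
    show "AE \<zeta> in ell \<mu>. indicator {\<zeta>. set \<zeta> \<subseteq> Lam n} \<zeta> * (emeasure (conf \<zeta>) C * F (conf \<zeta>)) * ennreal (jan (Lam n) \<zeta>) = sum_list (map (\<lambda>x. ?g x \<zeta>) \<zeta>)"
      using AE_ell_G
    proof eventually_elim
      case (elim \<zeta>)
      then show ?case by (subst sum_list_mult_const) (simp add: JJ_def emeasure_conf mult_ac)
    qed
  qed
  also have "\<dots> = (\<integral>\<^sup>+x. \<integral>\<^sup>+\<zeta>. ?g x (x # \<zeta>) \<partial>ell \<mu> \<partial>\<mu>)"
  proof (rule nn_integral_sum_list_ell)
    show "(\<lambda>(x, \<zeta>). ?g x \<zeta>) \<in> borel_measurable (borel \<Otimes>\<^sub>M LS)" by measurable
    show "?g x \<xi> = ?g x \<xi>'" if "mset \<xi> = mset \<xi>'" for x \<xi> \<xi>'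
      using conf_mset_cong[OF that] JJ_mset[OF that] mset_eq_setD[OF that] by (simp add: indicator_def)
  qed
  also have "\<dots> = (\<integral>\<^sup>+x. indicator C x * (\<integral>\<^sup>+\<eta>. F (restr (Lam n) (add_dirac \<eta> x)) * ennreal (expneg (WW v x \<eta>)) \<partial>P) \<partial>\<mu>)"
  proof (rule nn_integral_cong_AE)
    show "AE x in \<mu>. (\<integral>\<^sup>+\<zeta>. ?g x (x # \<zeta>) \<partial>ell \<mu>) = indicator C x * (\<integral>\<^sup>+\<eta>. F (restr (Lam n) (add_dirac \<eta> x)) * ennreal (expneg (WW v x \<eta>)) \<partial>P)"
      using AE_G
    proof eventually_elim
      case (elim x)
      show ?case
      proof (cases "x \<in> C")
        case True
        then have xL: "x \<in> Lam n" using C by auto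
        have Fx: "(\<lambda>\<eta>. F (add_dirac \<eta> x)) \<in> borel_measurable NNsig" by (rule Fm) measurable
        have "(\<integral>\<^sup>+\<eta>. F (restr (Lam n) (add_dirac \<eta> x)) * ennreal (expneg (WW v x \<eta>)) \<partial>P) = (\<integral>\<^sup>+\<eta>. F (add_dirac (restr (Lam n) \<eta>) x) * ennreal (expneg (WW v x \<eta>)) \<partial>P)"
          using xL by (intro nn_integral_cong) (simp add: restr_add_dirac NN_sets)
        also have "\<dots> = (\<integral>\<^sup>+\<zeta>. indicator {\<zeta>. set \<zeta> \<subseteq> Lam n} \<zeta> * F (add_dirac (conf \<zeta>) x) * ennreal (jan (Lam n) (x # \<zeta>)) \<partial>ell \<mu>)"
          by (rule law_weighted[OF Fx F(2) elim])
        also have "\<dots> = (\<integral>\<^sup>+\<zeta>. ?g x (x # \<zeta>) \<partial>ell \<mu>)"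
        proof (rule nn_integral_cong_AE)
          show "AE \<zeta> in ell \<mu>. indicator {\<zeta>. set \<zeta> \<subseteq> Lam n} \<zeta> * F (add_dirac (conf \<zeta>) x) * ennreal (jan (Lam n) (x # \<zeta>)) = ?g x (x # \<zeta>)"
            using AE_ell_G by eventually_elim (use True xL elim in \<open>simp add: JJ_def indicator_def\<close>)
        qed
        finally show ?thesis using True by simp
      qed simp
    qed
  qed
  finally show ?thesis .
qed

text \<open>The right-hand side of the Gibbs equation is also a measure on pairs, \<open>M2\<close>.
  The two measures agree on products of Borel sets and local events by \<open>GNZ_local\<close>, and
  the sets \<open>Lam m \<times> NN\<close> have finite mass and exhaust the space.\<close>

lemma gibbs: "gibbsm \<mu> v P"
proof -
  define w where "w p = ennreal (expneg (WW v (fst p) (snd p)))" for p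
  have w[measurable]: "w \<in> borel_measurable (borel \<Otimes>\<^sub>M NNsig)" unfolding w_def by measurable
  have am: "(\<lambda>p. (fst p, add_dirac (snd p) (fst p))) \<in> measurable (borel \<Otimes>\<^sub>M NNsig) (borel \<Otimes>\<^sub>M (NNsig :: 'a measure measure))"
    by measurable
  define M2 where "M2 = distr (density (\<mu> \<Otimes>\<^sub>M P) w) (borel \<Otimes>\<^sub>M NNsig) (\<lambda>p. (fst p, add_dirac (snd p) (fst p)))"
  have s2: "sets (\<mu> \<Otimes>\<^sub>M P) = sets (borel \<Otimes>\<^sub>M (NNsig :: 'a measure measure))" by (intro sets_pair_measure_cong) auto
  interpret muP: pair_sigma_finite \<mu> P by standard
  have nnM2: "(\<integral>\<^sup>+p. F p \<partial>M2) = (\<integral>\<^sup>+ x. (\<integral>\<^sup>+ \<eta>. F (x, add_dirac \<eta> x) * ennreal (expneg (WW v x \<eta>)) \<partial>P) \<partial>\<mu>)"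
    if F: "F \<in> borel_measurable (borel \<Otimes>\<^sub>M NNsig)" for F
  proof -
    have Fa: "(\<lambda>p. F (fst p, add_dirac (snd p) (fst p))) \<in> borel_measurable (borel \<Otimes>\<^sub>M (NNsig :: 'a measure measure))"
      by (rule measurable_compose[OF am F])
    have "(\<integral>\<^sup>+p. F p \<partial>M2) = (\<integral>\<^sup>+p. w p * F (fst p, add_dirac (snd p) (fst p)) \<partial>(\<mu> \<Otimes>\<^sub>M P))"
      unfolding M2_def using F Fa am w s2
      by (subst nn_integral_distr) (simp_all add: nn_integral_density measurable_cong_sets[OF s2 refl])
    also have "\<dots> = (\<integral>\<^sup>+x. \<integral>\<^sup>+\<eta>. w (x, \<eta>) * F (x, add_dirac \<eta> x) \<partial>P \<partial>\<mu>)"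
      using Fa w by (subst sigma_finite_measure.nn_integral_fst[OF prob_space_imp_sigma_finite[OF probP], symmetric]) (simp_all add: measurable_cong_sets[OF s2 refl])
    finally show ?thesis by (simp add: w_def mult.commute)
  qed
  have sM2: "sets M2 = sets (borel \<Otimes>\<^sub>M NNsig)" by (simp add: M2_def)
  have rect: "emeasure (campbell P) ((C \<inter> Lam m) \<times> X) = emeasure M2 ((C \<inter> Lam m) \<times> X)" if C: "C \<in> sets borel" and X: "X \<in> local_sets" for C X m
  proof -
    obtain n0 A where A: "A \<in> sets NNsig" "\<And>n. n0 \<le> n \<Longrightarrow> X = restr (Lam n) -` A \<inter> NN"
      using local_sets_level[OF X] by blast
    \<comment> \<open>Large enough that X is determined in \<open>Lam n\<close> and that the Borel
      set cut by \<open>Lam m\<close> lies in \<open>Lam n\<close>.\<close>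
    define n where "n = max n0 m"
    have Xn: "X = restr (Lam n) -` A \<inter> NN" using A(2)[of n] by (simp add: n_def)
    have CL: "C \<inter> Lam m \<subseteq> Lam n" using Lam_mono[of m n] by (auto simp: n_def)
    have Cm: "C \<inter> Lam m \<in> sets borel" using C by simp
    have S: "(C \<inter> Lam m) \<times> X \<in> sets (borel \<Otimes>\<^sub>M NNsig)" using Cm X local_sets_subset by auto
    have ind: "(indicator A :: _ \<Rightarrow> ennreal) \<in> borel_measurable NNsig" using A(1) by simp
    have "emeasure (campbell P) ((C \<inter> Lam m) \<times> X) = (\<integral>\<^sup>+\<eta>. emeasure \<eta> (C \<inter> Lam m) * indicator A (restr (Lam n) \<eta>) \<partial>P)"
      unfolding emeasure_campbell[OF sets_P S]
    proof (rule nn_integral_cong)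
      fix \<eta> assume "\<eta> \<in> space P"
      then have N: "\<eta> \<in> NN" by simp
      have "(\<integral>\<^sup>+x. indicator ((C \<inter> Lam m) \<times> X) (x, \<eta>) \<partial>\<eta>) = (\<integral>\<^sup>+x. indicator A (restr (Lam n) \<eta>) * indicator (C \<inter> Lam m) x \<partial>\<eta>)"
        using N by (intro nn_integral_cong) (auto simp: Xn indicator_def)
      also have "\<dots> = indicator A (restr (Lam n) \<eta>) * emeasure \<eta> (C \<inter> Lam m)"
        using Cm N by (intro nn_integral_cmult_indicator) (simp add: NN_sets)
      finally show "(\<integral>\<^sup>+x. indicator ((C \<inter> Lam m) \<times> X) (x, \<eta>) \<partial>\<eta>) = emeasure \<eta> (C \<inter> Lam m) * indicator A (restr (Lam n) \<eta>)"
        by (simp add: mult.commute)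
    qed
    also have "\<dots> = (\<integral>\<^sup>+x. indicator (C \<inter> Lam m) x * (\<integral>\<^sup>+\<eta>. indicator A (restr (Lam n) (add_dirac \<eta> x)) * ennreal (expneg (WW v x \<eta>)) \<partial>P) \<partial>\<mu>)"
      by (rule GNZ_local[OF Cm CL ind]) (simp add: indicator_def)
    also have "\<dots> = (\<integral>\<^sup>+ x. (\<integral>\<^sup>+ \<eta>. indicator ((C \<inter> Lam m) \<times> X) (x, add_dirac \<eta> x) * ennreal (expneg (WW v x \<eta>)) \<partial>P) \<partial>\<mu>)"
    proof (rule nn_integral_cong)
      fix x
      show "indicator (C \<inter> Lam m) x * (\<integral>\<^sup>+\<eta>. indicator A (restr (Lam n) (add_dirac \<eta> x)) * ennreal (expneg (WW v x \<eta>)) \<partial>P) =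
        (\<integral>\<^sup>+ \<eta>. indicator ((C \<inter> Lam m) \<times> X) (x, add_dirac \<eta> x) * ennreal (expneg (WW v x \<eta>)) \<partial>P)"
      proof (cases "x \<in> C \<inter> Lam m")
        case True
        then have "(\<integral>\<^sup>+ \<eta>. indicator ((C \<inter> Lam m) \<times> X) (x, add_dirac \<eta> x) * ennreal (expneg (WW v x \<eta>)) \<partial>P) = (\<integral>\<^sup>+\<eta>. indicator A (restr (Lam n) (add_dirac \<eta> x)) * ennreal (expneg (WW v x \<eta>)) \<partial>P)"
          by (intro nn_integral_cong) (auto simp: Xn indicator_def add_dirac_NN)
        then show ?thesis using True by simp
      next
        case False
        then have "indicator ((C \<inter> Lam m) \<times> X) (x, \<eta>) = (0::ennreal)" "indicator (C \<inter> Lam m) x = (0::ennreal)" for \<eta>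
          by (auto simp: indicator_def)
        then show ?thesis by simp
      qed
    qed
    also have "\<dots> = (\<integral>\<^sup>+p. indicator ((C \<inter> Lam m) \<times> X) p \<partial>M2)"
      using S by (intro nnM2[symmetric]) simp
    also have "\<dots> = emeasure M2 ((C \<inter> Lam m) \<times> X)" using S sM2 by simp
    finally show ?thesis .
  qed
  have "campbell P = M2"
  proof (rule measure_eqI_generator_eq[where E=local_rect and \<Omega>="UNIV \<times> NN" and A="\<lambda>m. Lam m \<times> NN"])
    show "local_rect \<subseteq> Pow (UNIV \<times> (NN :: 'a measure set))" by (auto simp: local_rect_def local_sets_def)
    show "range (\<lambda>m. Lam m \<times> NN) \<subseteq> (local_rect :: ('a \<times> 'a measure) set set)"
      unfolding local_rect_def using NN_local Lam_sets by blast
    show "(\<Union>m. Lam m \<times> NN) = UNIV \<times> (NN :: 'a measure set)" using Lam_cover by auto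
    show "emeasure (campbell P) (Lam m \<times> NN) \<noteq> \<infinity>" for m
    proof -
      have S: "(Lam m :: 'a set) \<times> NN \<in> sets (borel \<Otimes>\<^sub>M (NNsig :: 'a measure measure))" using sets.top[of "NNsig :: 'a measure measure"] by (auto simp: space_NNsig)
      have "emeasure (campbell P) (Lam m \<times> NN) = emeasure M2 (Lam m \<times> NN)" using rect[of UNIV NN m] NN_local by simp
      also have "\<dots> = (\<integral>\<^sup>+p. indicator (Lam m \<times> NN) p \<partial>M2)"
        using S sM2 by (intro nn_integral_indicator[symmetric]) simp
      also have "\<dots> = (\<integral>\<^sup>+ x. (\<integral>\<^sup>+ \<eta>. indicator (Lam m \<times> NN) (x, add_dirac \<eta> x) * ennreal (expneg (WW v x \<eta>)) \<partial>P) \<partial>\<mu>)"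
        using S by (intro nnM2) simp
      also have "\<dots> \<le> (\<integral>\<^sup>+ x. (\<integral>\<^sup>+ \<eta>. indicator (Lam m) x \<partial>P) \<partial>\<mu>)"
        by (intro nn_integral_mono) (auto simp: indicator_def ennreal_le_1)
      also have "\<dots> = emeasure \<mu> (Lam m)" using emeasure_space_1 by simp
      also have "\<dots> < \<infinity>" by (rule fin_mu) auto
      finally show ?thesis by simp
    qed
    fix S :: "('a \<times> 'a measure) set" assume "S \<in> local_rect"
    then obtain C X where S: "S = C \<times> X" "C \<in> sets borel" "X \<in> local_sets" by (auto simp: local_rect_def)
    have sets: "(C \<inter> Lam m) \<times> X \<in> sets (borel \<Otimes>\<^sub>M (NNsig :: 'a measure measure))" for m using S local_sets_subset by auto
    have U: "(\<Union>m. (C \<inter> Lam m) \<times> X) = S" using Lam_cover by (auto simp: S)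
    have inc: "incseq (\<lambda>m. (C \<inter> Lam m) \<times> X)" using Lam_mono by (fastforce simp: incseq_def)
    have "emeasure (campbell P) S = (SUP m. emeasure (campbell P) ((C \<inter> Lam m) \<times> X))"
      unfolding U[symmetric] using sets inc by (intro SUP_emeasure_incseq[symmetric]) auto
    also have "\<dots> = (SUP m. emeasure M2 ((C \<inter> Lam m) \<times> X))" using rect S by simp
    also have "\<dots> = emeasure M2 S"
      unfolding U[symmetric] using sets inc by (intro SUP_emeasure_incseq) (auto simp: sM2)
    finally show "emeasure (campbell P) S = emeasure M2 S" .
  qed (simp_all add: sM2 sets_borel_NNsig_local Int_stable_local_rect)
  then have "(\<integral>\<^sup>+ \<eta>. (\<integral>\<^sup>+ x. F (x, \<eta>) \<partial>\<eta>) \<partial>P) =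
        (\<integral>\<^sup>+ x. (\<integral>\<^sup>+ \<eta>. F (x, add_dirac \<eta> x) * ennreal (expneg (WW v x \<eta>)) \<partial>P) \<partial>\<mu>)"
    if "F \<in> borel_measurable (borel \<Otimes>\<^sub>M NNsig)" for F
    using nn_integral_campbell[OF sets_P that] nnM2[OF that] by simp
  then show ?thesis
    unfolding gibbsm_def using probP sets_P by blast
qed

end

context fp
begin

lemma gibbs_ex1: "\<exists>!P. gibbsm \<mu> v P"
proof -
  obtain P where P: "prob_space P" "sets P = sets NNsig"
    "\<And>n F. F \<in> borel_measurable NNsig \<Longrightarrow>
      (\<integral>\<^sup>+\<eta>. F (restr (Lam n) \<eta>) \<partial>P) = (\<integral>\<^sup>+\<zeta>. indicator {\<zeta>. set \<zeta> \<subseteq> Lam n} \<zeta> * F (conf \<zeta>) * ennreal (jan (Lam n) \<zeta>) \<partial>ell \<mu>)"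
    using janossy_process_exists by blast
  interpret janossy_process \<mu> v b T G P
    by (rule janossy_process.intro[OF fp_axioms janossy_process_axioms.intro[OF P]])
  show ?thesis using gibbs gibbs_unique by blast
qed

end

section \<open>Identification of the rooted graph sums\<close>

text \<open>\<open>DD\<close> for arbitrary sets of vertices and roots: removing a root leaves the
  initial segments of the natural numbers.\<close>

definition rooted_graphs :: "nat set \<Rightarrow> nat set \<Rightarrow> nat set set set" where
  "rooted_graphs R V = {E \<in> Pow {{i, j} | i j. i \<in> V \<and> j \<in> V \<and> i \<noteq> j}. \<forall>j\<in>V - R. \<exists>i\<in>R. (j, i) \<in> (adj E)\<^sup>*}"

text \<open>\<open>Min\<close> and \<open>Max\<close> choose an orientation of the edge, as in
  \<open>psi\<close>; by symmetry of v any other choice gives the same value.\<close>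

definition edge_weight :: "('a \<Rightarrow> 'a \<Rightarrow> ennreal) \<Rightarrow> (nat \<Rightarrow> 'a) \<Rightarrow> nat set \<Rightarrow> real" where
  "edge_weight v X e = ff v (X (Min e)) (X (Max e))"

definition rooted_sum :: "('a \<Rightarrow> 'a \<Rightarrow> ennreal) \<Rightarrow> (nat \<Rightarrow> 'a) \<Rightarrow> nat set \<Rightarrow> nat set \<Rightarrow> real" where
  "rooted_sum v X R V = (\<Sum>E\<in>rooted_graphs R V. \<Prod>e\<in>E. edge_weight v X e)"

lemma edge_weight_pair:
  assumes "\<And>x y. v x y = v y x" shows "edge_weight v X {i, j} = ff v (X i) (X j)"
  using assms by (cases "i \<le> j") (simp_all add: edge_weight_def ff_def)

lemma psi_eq_rooted_sum:
  assumes v: "\<And>x y. v x y = v y x" and "k \<le> n"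
  shows "psi v k n X = rooted_sum v X {..<k} {..<n}"
proof -
  have "{k..<n} = {..<n} - {..<k}" by auto
  then have D: "DD k n = rooted_graphs {..<k} {..<n}"
    by (auto simp: DD_def rooted_graphs_def graphs_def)
  have "(\<Prod>(i,j)\<in>{(i,j). i < j \<and> {i,j} \<in> E}. ff v (X i) (X j)) = (\<Prod>e\<in>E. edge_weight v X e)"
    if Eg: "E \<in> rooted_graphs {..<k} {..<n}" for E
  proof (rule prod.reindex_bij_witness[where i="\<lambda>e. (Min e, Max e)" and j="\<lambda>(i, j). {i, j}"])
    fix e assume "e \<in> E"
    then obtain i j where e: "e = {i, j}" "i \<noteq> j" using Eg unfolding rooted_graphs_def by blast
    show "(case (Min e, Max e) of (i, j) \<Rightarrow> {i, j}) = e" "(Min e, Max e) \<in> {(i, j). i < j \<and> {i, j} \<in> E}"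
      using e \<open>e \<in> E\<close> by (cases "i < j"; auto simp: insert_commute max_def min_def)+
  qed (auto simp: edge_weight_pair[OF v])
  then show ?thesis by (simp add: psi_def rooted_sum_def D)
qed

lemma finite_edges: "finite V \<Longrightarrow> finite {{i, j} | i j. i \<in> V \<and> j \<in> V \<and> i \<noteq> (j::nat)}"
  by (rule finite_subset[of _ "Pow V"]) auto

lemma adj_mono: "E' \<subseteq> E \<Longrightarrow> adj E' \<subseteq> adj E"
  by (auto simp: adj_def)

text \<open>A vertex reaches r only through a neighbour of r. So after deleting r the connection
  condition is the same, provided that the neighbours of r among the non-roots are promoted to
  roots.\<close>

lemma rooted_remove:
  fixes r :: nat
  assumes r: "r \<notin> W" and W: "W = R \<union> Z" and E: "E \<subseteq> {{i, j} | i j. i \<in> insert r W \<and> j \<in> insert r W \<and> i \<noteq> j}"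
  defines "N \<equiv> {i\<in>W. {r, i} \<in> E}" and "E' \<equiv> {e\<in>E. r \<notin> e}"
  shows "(\<forall>j\<in>insert r W - insert r R. \<exists>i\<in>insert r R. (j, i) \<in> (adj E)\<^sup>*) \<longleftrightarrow>
    (\<forall>j\<in>W - (R \<union> (N \<inter> Z)). \<exists>i\<in>R \<union> (N \<inter> Z). (j, i) \<in> (adj E')\<^sup>*)"
proof
  assume *: "\<forall>j\<in>insert r W - insert r R. \<exists>i\<in>insert r R. (j, i) \<in> (adj E)\<^sup>*"
  show "\<forall>j\<in>W - (R \<union> (N \<inter> Z)). \<exists>i\<in>R \<union> (N \<inter> Z). (j, i) \<in> (adj E')\<^sup>*"
  proof
    fix j assume j: "j \<in> W - (R \<union> (N \<inter> Z))"
    then obtain i where i: "i \<in> insert r R" "(j, i) \<in> (adj E)\<^sup>*" using * r by blast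
    \<comment> \<open>Induction backwards along the path. A path through r is cut at the vertex
      preceding r; the alternative j = r keeps the claim inductive at r itself.\<close>
    from i(2) have "j = r \<or> (\<exists>i'\<in>R \<union> (N \<inter> Z). (j, i') \<in> (adj E')\<^sup>*)"
    proof (induction rule: converse_rtrancl_induct)
      case base
      then show ?case using i(1) by auto
    next
      case (step j k)
      show ?case
      proof (cases "j = r")
        case False
        have e: "{j, k} \<in> E" using step.hyps(1) by (simp add: adj_def)
        then have jW: "j \<in> W" using E False by (auto simp: doubleton_eq_iff)
        show ?thesis
        proof (cases "k = r")
          case True
          then have "j \<in> N" using e jW by (simp add: N_def insert_commute)
          then show ?thesis using jW W by auto
        next
          case k: False
          then obtain i' where "i' \<in> R \<union> (N \<inter> Z)" "(k, i') \<in> (adj E')\<^sup>*" using step.IH by auto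
          moreover have "(j, k) \<in> adj E'" using e False k by (auto simp: adj_def E'_def)
          ultimately show ?thesis by (meson converse_rtrancl_into_rtrancl)
        qed
      qed simp
    qed
    then show "\<exists>i\<in>R \<union> (N \<inter> Z). (j, i) \<in> (adj E')\<^sup>*" using j r by auto
  qed
next
  assume *: "\<forall>j\<in>W - (R \<union> (N \<inter> Z)). \<exists>i\<in>R \<union> (N \<inter> Z). (j, i) \<in> (adj E')\<^sup>*"
  have Nr: "(i, r) \<in> adj E" if "i \<in> N" for i using that by (simp add: N_def adj_def insert_commute)
  have mono: "(adj E')\<^sup>* \<subseteq> (adj E)\<^sup>*" by (intro rtrancl_mono adj_mono) (auto simp: E'_def)
  show "\<forall>j\<in>insert r W - insert r R. \<exists>i\<in>insert r R. (j, i) \<in> (adj E)\<^sup>*"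
  proof
    fix j assume j: "j \<in> insert r W - insert r R"
    show "\<exists>i\<in>insert r R. (j, i) \<in> (adj E)\<^sup>*"
    proof (cases "j \<in> N")
      case True then show ?thesis using Nr by blast
    next
      case False
      then obtain i where i: "i \<in> R \<union> (N \<inter> Z)" "(j, i) \<in> (adj E')\<^sup>*" using * j by blast
      show ?thesis
      proof (cases "i \<in> R")
        case True then show ?thesis using i mono by blast
      next
        case False
        then have "(i, r) \<in> adj E" using i Nr by blast
        moreover have "(j, i) \<in> (adj E)\<^sup>*" using i mono by blast
        ultimately show ?thesis by (meson insertI1 rtrancl.rtrancl_into_rtrancl)
      qed
    qed
  qed
qed

lemma sum_Pow_Un:
  fixes h :: "'b set \<Rightarrow> 'b set \<Rightarrow> 'c::comm_monoid_add"
  assumes "A \<inter> B = {}"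
  shows "(\<Sum>N\<in>Pow (A \<union> B). h (N \<inter> A) (N \<inter> B)) = (\<Sum>X\<in>Pow A. \<Sum>Y\<in>Pow B. h X Y)"
  unfolding sum.cartesian_product
  by (rule sum.reindex_bij_witness[where i="\<lambda>(X, Y). X \<union> Y" and j="\<lambda>N. (N \<inter> A, N \<inter> B)"])
     (use assms in auto)

lemma prod_one_plus_Pow:
  fixes f :: "'b \<Rightarrow> real"
  shows "finite A \<Longrightarrow> (\<Sum>X\<in>Pow A. \<Prod>i\<in>X. f i) = (\<Prod>i\<in>A. 1 + f i)"
proof (induction A rule: finite_induct)
  case (insert a A)
  have "(\<Sum>X\<in>Pow (insert a A). \<Prod>i\<in>X. f i) = (\<Sum>X\<in>Pow A. \<Prod>i\<in>X. f i) + (\<Sum>X\<in>insert a ` Pow A. \<Prod>i\<in>X. f i)"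
    unfolding Pow_insert using insert by (intro sum.union_disjoint) auto
  also have "(\<Sum>X\<in>insert a ` Pow A. \<Prod>i\<in>X. f i) = (\<Sum>X\<in>Pow A. f a * (\<Prod>i\<in>X. f i))"
  proof (subst sum.reindex)
    show "inj_on (insert a) (Pow A)" using insert(2) by (auto simp: inj_on_def)
    show "(\<Sum>X\<in>Pow A. ((\<lambda>X. \<Prod>i\<in>X. f i) \<circ> insert a) X) = (\<Sum>X\<in>Pow A. f a * (\<Prod>i\<in>X. f i))"
      using insert(1,2) by (intro sum.cong refl) (auto simp: finite_subset intro!: prod.insert)
  qed
  finally show ?case using insert by (simp add: sum_distrib_left[symmetric] algebra_simps)
qed simp

text \<open>A graph amounts to the neighbourhood N of r together with a graph E' on the remaining
  vertices. The neighbours among the old roots are unconstrained, and summing over them gives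
  \<Prod> (1 + f), a product of Boltzmann factors; the neighbours in Z form the set J of new roots.
  This is the recursion by which \<open>psiL\<close> is defined.\<close>

lemma rooted_sum_insert:
  assumes v: "\<And>x y. v x y = v y x" and r: "r \<notin> R \<union> Z" and RZ: "R \<inter> Z = {}" and fin: "finite R" "finite Z"
  shows "rooted_sum v X (insert r R) (insert r (R \<union> Z)) = (\<Prod>i\<in>R. expneg (v (X r) (X i))) *
    (\<Sum>J\<in>Pow Z. (\<Prod>j\<in>J. ff v (X r) (X j)) * rooted_sum v X (R \<union> J) (R \<union> Z))"
proof -
  define W where "W = R \<union> Z"
  let ?star = "\<lambda>N. (\<lambda>i. {r, i}) ` N"
  let ?w = "edge_weight v X"
  have rW: "r \<notin> W" and finW: "finite W" using r fin by (auto simp: W_def)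
  have fing: "finite E" if "E \<subseteq> {{i, j} | i j. i \<in> W \<and> j \<in> W \<and> i \<noteq> j}" for E
    by (rule finite_subset[OF that finite_edges[OF finW]])
  have finrg: "finite (rooted_graphs R' W)" for R'
    unfolding rooted_graphs_def using finite_edges[OF finW] by auto
  have "rooted_sum v X (insert r R) (insert r W) = (\<Sum>(N, E')\<in>Sigma (Pow W) (\<lambda>N. rooted_graphs (R \<union> (N \<inter> Z)) W). (\<Prod>i\<in>N. ?w {r, i}) * (\<Prod>e\<in>E'. ?w e))"
    unfolding rooted_sum_def
  proof (rule sum.reindex_bij_witness[where i="\<lambda>(N, E'). E' \<union> ?star N" and j="\<lambda>E. ({i\<in>W. {r, i} \<in> E}, {e\<in>E. r \<notin> e})"])
    fix E assume "E \<in> rooted_graphs (insert r R) (insert r W)"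
    then have E: "E \<subseteq> {{i, j} | i j. i \<in> insert r W \<and> j \<in> insert r W \<and> i \<noteq> j}"
      and c: "\<forall>j\<in>insert r W - insert r R. \<exists>i\<in>insert r R. (j, i) \<in> (adj E)\<^sup>*"
      by (auto simp: rooted_graphs_def)
    let ?N = "{i\<in>W. {r, i} \<in> E}" and ?E' = "{e\<in>E. r \<notin> e}"
    have "E \<subseteq> ?E' \<union> ?star ?N"
    proof
      fix e assume e: "e \<in> E"
      then obtain i j where ij: "e = {i, j}" "i \<in> insert r W" "j \<in> insert r W" "i \<noteq> j" using E by blast
      show "e \<in> ?E' \<union> ?star ?N"
      proof (cases "r \<in> e")
        case True
        then obtain k where "e = {r, k}" "k \<in> W" using ij by (auto simp: insert_commute)
        then show ?thesis using e by auto
      qed (use e in auto)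
    qed
    then have EE: "?E' \<union> ?star ?N = E" by auto
    then show "(case (?N, ?E') of (N, E') \<Rightarrow> E' \<union> ?star N) = E" by simp
    have E'W: "?E' \<subseteq> {{i, j} | i j. i \<in> W \<and> j \<in> W \<and> i \<noteq> j}"
    proof
      fix e assume "e \<in> ?E'"
      then have e: "e \<in> E" "r \<notin> e" by auto
      then obtain i j where "e = {i, j}" "i \<in> insert r W" "j \<in> insert r W" "i \<noteq> j" using E by blast
      then show "e \<in> {{i, j} | i j. i \<in> W \<and> j \<in> W \<and> i \<noteq> j}" using e by blast
    qed
    then show "(?N, ?E') \<in> Sigma (Pow W) (\<lambda>N. rooted_graphs (R \<union> (N \<inter> Z)) W)"
      using c unfolding rooted_remove[OF rW W_def E] by (auto simp: rooted_graphs_def)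
    have "(\<Prod>e\<in>E. ?w e) = (\<Prod>e\<in>?E'. ?w e) * (\<Prod>e\<in>?star ?N. ?w e)"
      by (subst EE[symmetric], rule prod.union_disjoint) (use fing[OF E'W] finW in auto)
    also have "(\<Prod>e\<in>?star ?N. ?w e) = (\<Prod>i\<in>?N. ?w {r, i})"
      by (subst prod.reindex) (auto simp: inj_on_def doubleton_eq_iff)
    finally show "(case (?N, ?E') of (N, E') \<Rightarrow> (\<Prod>i\<in>N. ?w {r, i}) * (\<Prod>e\<in>E'. ?w e)) = (\<Prod>e\<in>E. ?w e)"
      by (simp add: mult.commute)
  next
    fix p assume "p \<in> Sigma (Pow W) (\<lambda>N. rooted_graphs (R \<union> (N \<inter> Z)) W)"
    then obtain N E' where p: "p = (N, E')" "N \<subseteq> W" "E' \<in> rooted_graphs (R \<union> (N \<inter> Z)) W" by auto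
    have E'W: "E' \<subseteq> {{i, j} | i j. i \<in> W \<and> j \<in> W \<and> i \<noteq> j}" using p by (auto simp: rooted_graphs_def)
    have rE': "r \<notin> e" if "e \<in> E'" for e using E'W that rW by blast
    let ?E = "E' \<union> ?star N"
    have 1: "{i\<in>W. {r, i} \<in> ?E} = N"
      using rE' p(2) by (auto simp: doubleton_eq_iff)
    have 2: "{e\<in>?E. r \<notin> e} = E'" using rE' by auto
    show "(case (case p of (N, E') \<Rightarrow> E' \<union> ?star N) of E \<Rightarrow> ({i\<in>W. {r, i} \<in> E}, {e\<in>E. r \<notin> e})) = p"
      using 1 2 by (simp add: p(1))
    have E: "?E \<subseteq> {{i, j} | i j. i \<in> insert r W \<and> j \<in> insert r W \<and> i \<noteq> j}"
      using E'W p(2) rW by blast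
    have "\<forall>j\<in>W - (R \<union> (N \<inter> Z)). \<exists>i\<in>R \<union> (N \<inter> Z). (j, i) \<in> (adj E')\<^sup>*" using p(3) by (auto simp: rooted_graphs_def)
    then have "\<forall>j\<in>insert r W - insert r R. \<exists>i\<in>insert r R. (j, i) \<in> (adj ?E)\<^sup>*"
      using rooted_remove[OF rW W_def E] unfolding 1 2 by blast
    then show "(case p of (N, E') \<Rightarrow> E' \<union> ?star N) \<in> rooted_graphs (insert r R) (insert r W)"
      using E unfolding p(1) rooted_graphs_def by simp
  qed
  also have "\<dots> = (\<Sum>N\<in>Pow W. (\<Prod>i\<in>N. ?w {r, i}) * rooted_sum v X (R \<union> (N \<inter> Z)) W)"
    using finW finrg by (subst sum.Sigma[symmetric]) (auto simp: rooted_sum_def sum_distrib_left)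
  also have "\<dots> = (\<Sum>N\<in>Pow (R \<union> Z). (\<Prod>i\<in>N \<inter> R. ?w {r, i}) * ((\<Prod>i\<in>N \<inter> Z. ?w {r, i}) * rooted_sum v X (R \<union> (N \<inter> Z)) W))"
    unfolding W_def
  proof (rule sum.cong[OF refl])
    fix N assume "N \<in> Pow (R \<union> Z)"
    then have "N = (N \<inter> R) \<union> (N \<inter> Z)" by auto
    then have "(\<Prod>i\<in>N. ?w {r, i}) = (\<Prod>i\<in>(N \<inter> R) \<union> (N \<inter> Z). ?w {r, i})" by simp
    also have "\<dots> = (\<Prod>i\<in>N \<inter> R. ?w {r, i}) * (\<Prod>i\<in>N \<inter> Z. ?w {r, i})"
      using fin RZ by (intro prod.union_disjoint) auto
    finally show "(\<Prod>i\<in>N. ?w {r, i}) * rooted_sum v X (R \<union> (N \<inter> Z)) (R \<union> Z) =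
      (\<Prod>i\<in>N \<inter> R. ?w {r, i}) * ((\<Prod>i\<in>N \<inter> Z. ?w {r, i}) * rooted_sum v X (R \<union> (N \<inter> Z)) (R \<union> Z))" by simp
  qed
  also have "\<dots> = (\<Sum>A\<in>Pow R. \<Sum>J\<in>Pow Z. (\<Prod>i\<in>A. ?w {r, i}) * ((\<Prod>i\<in>J. ?w {r, i}) * rooted_sum v X (R \<union> J) W))"
    by (rule sum_Pow_Un[OF RZ])
  also have "\<dots> = (\<Prod>i\<in>R. 1 + ?w {r, i}) * (\<Sum>J\<in>Pow Z. (\<Prod>i\<in>J. ?w {r, i}) * rooted_sum v X (R \<union> J) W)"
    unfolding prod_one_plus_Pow[OF fin(1), symmetric] sum_product ..
  finally show ?thesis by (simp add: W_def edge_weight_pair[OF v] ff_def)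
qed

lemma ssum_cong_mset:
  "(\<And>J K. mset J + mset K = mset zs \<Longrightarrow> G J K = G' J K) \<Longrightarrow> ssum zs G = ssum zs G'"
proof (induction zs arbitrary: G G')
  case (Cons y zs)
  have "ssum zs (\<lambda>J K. G (y # J) K) = ssum zs (\<lambda>J K. G' (y # J) K)"
    "ssum zs (\<lambda>J K. G J (y # K)) = ssum zs (\<lambda>J K. G' J (y # K))"
    by (intro Cons.IH Cons.prems; simp)+
  then show ?case by simp
qed simp

lemma ssum_Pow: "distinct zs \<Longrightarrow> ssum zs (\<lambda>J K. H (set J)) = (\<Sum>J\<in>Pow (set zs). H J :: real)"
proof (induction zs arbitrary: H)
  case (Cons y zs)
  have "ssum (y # zs) (\<lambda>J K. H (set J)) = (\<Sum>J\<in>Pow (set zs). H (insert y J)) + (\<Sum>J\<in>Pow (set zs). H J)"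
    using Cons.IH[of "\<lambda>J. H (insert y J)"] Cons.IH[of H] Cons.prems by simp
  also have "(\<Sum>J\<in>Pow (set zs). H (insert y J)) = (\<Sum>J\<in>insert y ` Pow (set zs). H J)"
    using Cons.prems by (subst sum.reindex) (auto simp: inj_on_def)
  also have "\<dots> + (\<Sum>J\<in>Pow (set zs). H J) = (\<Sum>J\<in>Pow (set (y # zs)). H J)"
    using Cons.prems unfolding list.set Pow_insert by (subst sum.union_disjoint) (auto simp: add.commute)
  finally show ?case .
qed simp

text \<open>The comparison is made for lists of distinct labels, since the points X i themselves may
  coincide.\<close>

lemma psiL_eq_rooted_sum:
  assumes v: "\<And>x y. v x y = v y x"
  shows "distinct (rs @ zs) \<Longrightarrow> psiL v (map X rs) (map X zs) = rooted_sum v X (set rs) (set rs \<union> set zs)"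
proof (induction "length rs + length zs" arbitrary: rs zs rule: less_induct)
  case less
  show ?case
  proof (cases rs)
    case Nil
    show ?thesis
    proof (cases zs)
      case Nil
      have "rooted_graphs {} {} = {{}}" by (auto simp: rooted_graphs_def)
      then show ?thesis using \<open>rs = []\<close> Nil by (simp add: rooted_sum_def)
    next
      case (Cons z zs')
      then have "rooted_graphs {} (set zs) = {}" by (auto simp: rooted_graphs_def)
      then show ?thesis using \<open>rs = []\<close> Cons by (simp add: rooted_sum_def)
    qed
  next
    case (Cons r rs')
    have d: "distinct rs'" "distinct zs" "r \<notin> set rs'" "r \<notin> set zs" "set rs' \<inter> set zs = {}"
      using less.prems Cons by auto
    have "psiL v (map X rs) (map X zs) = prod_list (map (\<lambda>i. expneg (v (X r) (X i))) rs') *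
      ssum zs (\<lambda>J K. prod_list (map (\<lambda>j. ff v (X r) (X j)) J) * psiL v (map X (rs' @ J)) (map X K))"
      by (simp add: Cons ssum_map comp_def)
    also have "prod_list (map (\<lambda>i. expneg (v (X r) (X i))) rs') = (\<Prod>i\<in>set rs'. expneg (v (X r) (X i)))"
      by (rule prod.distinct_set_conv_list[OF d(1), symmetric])
    also have "ssum zs (\<lambda>J K. prod_list (map (\<lambda>j. ff v (X r) (X j)) J) * psiL v (map X (rs' @ J)) (map X K)) =
      ssum zs (\<lambda>J K. (\<Prod>j\<in>set J. ff v (X r) (X j)) * rooted_sum v X (set rs' \<union> set J) (set rs' \<union> set zs))"
    proof (rule ssum_cong_mset)
      fix J K assume m: "mset J + mset K = mset zs"
      then have "mset (J @ K) = mset zs" by simp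
      then have dJK: "distinct (J @ K)" and sJK: "set J \<union> set K = set zs" and lJK: "length J + length K = length zs"
        using d(2) mset_eq_imp_distinct_iff mset_eq_setD mset_eq_length by (metis, metis set_append, metis length_append)
      have "psiL v (map X (rs' @ J)) (map X K) = rooted_sum v X (set (rs' @ J)) (set (rs' @ J) \<union> set K)"
        using dJK sJK lJK d by (intro less.hyps) (auto simp: Cons)
      also have "set (rs' @ J) \<union> set K = set rs' \<union> set zs" using sJK by auto
      finally have "psiL v (map X (rs' @ J)) (map X K) = rooted_sum v X (set rs' \<union> set J) (set rs' \<union> set zs)" by simp
      moreover have "prod_list (map (\<lambda>j. ff v (X r) (X j)) J) = (\<Prod>j\<in>set J. ff v (X r) (X j))"
        using dJK by (intro prod.distinct_set_conv_list[symmetric]) simp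
      ultimately show "prod_list (map (\<lambda>j. ff v (X r) (X j)) J) * psiL v (map X (rs' @ J)) (map X K) =
        (\<Prod>j\<in>set J. ff v (X r) (X j)) * rooted_sum v X (set rs' \<union> set J) (set rs' \<union> set zs)" by simp
    qed
    also have "\<dots> = (\<Sum>J\<in>Pow (set zs). (\<Prod>j\<in>J. ff v (X r) (X j)) * rooted_sum v X (set rs' \<union> J) (set rs' \<union> set zs))"
      by (rule ssum_Pow[OF d(2)])
    also have "(\<Prod>i\<in>set rs'. expneg (v (X r) (X i))) * \<dots> = rooted_sum v X (insert r (set rs')) (insert r (set rs' \<union> set zs))"
      using d by (intro rooted_sum_insert[OF v, symmetric]) auto
    finally show ?thesis by (simp add: Cons)
  qed
qed

text \<open>The reversed lists match the convention of \<open>Lk\<close>; the order is harmless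
  because \<open>rooted_sum\<close> depends on the sets of labels only.\<close>

lemma psiL_eq_psi:
  assumes v: "\<And>x y. v x y = v y x"
  shows "psiL v (map x (rev [0..<n])) (map y (rev [0..<k])) = psi v n (n + k) (append_pts n x y)"
proof -
  let ?X = "append_pts n x y"
  have "map x (rev [0..<n]) = map ?X (rev [0..<n])" by (simp add: append_pts_def)
  moreover have "map y (rev [0..<k]) = map ?X (rev [n..<n+k])"
    unfolding rev_map[symmetric] by (rule arg_cong[where f=rev], rule nth_equalityI) (auto simp: append_pts_def)
  ultimately have "psiL v (map x (rev [0..<n])) (map y (rev [0..<k])) = psiL v (map ?X (rev [0..<n])) (map ?X (rev [n..<n+k]))" by (simp only:)
  also have "\<dots> = rooted_sum v ?X (set (rev [0..<n])) (set (rev [0..<n]) \<union> set (rev [n..<n+k]))"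
    by (rule psiL_eq_rooted_sum[OF v]) auto
  also have "set (rev [0..<n]) \<union> set (rev [n..<n+k]) = {..<n+k}" by auto
  also have "set (rev [0..<n]) = {..<n}" by auto
  also have "rooted_sum v ?X {..<n} {..<n+k} = psi v n (n + k) ?X"
    by (rule psi_eq_rooted_sum[OF v, symmetric]) simp
  finally show ?thesis .
qed

lemma psiL_Nil_eq_psi:
  assumes v: "\<And>x y. v x y = v y x"
  shows "psiL v (map x (rev [0..<n])) [] = psi v n n x"
proof -
  have "psiL v (map x (rev [0..<n])) (map x []) = rooted_sum v x (set (rev [0..<n])) (set (rev [0..<n]) \<union> set [])"
    by (rule psiL_eq_rooted_sum[OF v]) auto
  also have "\<dots> = rooted_sum v x {..<n} {..<n}" by (simp add: lessThan_atLeast0)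
  also have "\<dots> = psi v n n x" by (rule psi_eq_rooted_sum[OF v, symmetric]) simp
  finally show ?thesis by simp
qed

section \<open>Translation back to integrals over product spaces, and the theorem\<close>

lemma prod_list_rev_upt: "prod_list (map g (map y (rev [0..<k]))) = (\<Prod>j<k. g (y j) :: real)"
  by (induction k) (simp_all add: mult.commute)

lemma pairs_Suc: "{(i, j). i < j \<and> j < Suc n} = {(i, j). i < j \<and> j < n} \<union> (\<lambda>i. (i, n)) ` {..<n}"
  by auto

lemma finite_pairs: "finite {(i, j). i < j \<and> j < (n::nat)}"
  by (rule finite_subset[of _ "{..<n} \<times> {..<n}"]) auto

lemma eH_rev_upt:
  assumes v: "\<And>x y. v x y = v y x"
  shows "eH v (map y (rev [0..<n])) = (\<Prod>(i,j)\<in>{(i,j). i < j \<and> j < n}. expneg (v (y i) (y j)))"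
proof (induction n)
  case (Suc n)
  have "(\<Prod>(i,j)\<in>{(i,j). i < j \<and> j < Suc n}. expneg (v (y i) (y j))) =
    (\<Prod>(i,j)\<in>{(i,j). i < j \<and> j < n}. expneg (v (y i) (y j))) * (\<Prod>(i,j)\<in>(\<lambda>i. (i, n)) ` {..<n}. expneg (v (y i) (y j)))"
    unfolding pairs_Suc by (rule prod.union_disjoint) (auto simp: finite_pairs)
  also have "(\<Prod>(i,j)\<in>(\<lambda>i. (i, n)) ` {..<n}. expneg (v (y i) (y j))) = (\<Prod>i<n. expneg (v (y n) (y i)))"
    by (subst prod.reindex) (auto simp: inj_on_def v[of "y n"])
  finally show ?case
    using Suc prod_list_rev_upt[of "\<lambda>x. expneg (v (y n) x)" y n] by (simp add: mult.commute comp_def)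
qed simp

context bd_finite
begin

lemma nn_integral_Lk_density:
  assumes z[measurable]: "z \<in> borel_measurable borel" and z0: "\<And>x. 0 \<le> (z x :: real)"
    and d: "bd_finite (density \<mu> (\<lambda>x. ennreal (z x)))" and F: "F \<in> borel_measurable LS"
  shows "(\<integral>\<^sup>+\<xi>. F \<xi> \<partial>Lk (density \<mu> (\<lambda>x. ennreal (z x))) k) = (\<integral>\<^sup>+\<xi>. F \<xi> * ennreal (prod_list (map z \<xi>)) \<partial>Lk \<mu> k)"
  using F
proof (induction k arbitrary: F)
  case (0 F)
  interpret D: bd_finite "density \<mu> (\<lambda>x. ennreal (z x))" by (rule d)
  note [measurable] = 0
  show ?case by simp
next
  case (Suc k F)
  interpret D: bd_finite "density \<mu> (\<lambda>x. ennreal (z x))" by (rule d)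
  note [measurable] = Suc.prems
  have z0': "0 \<le> prod_list (map z \<xi>)" for \<xi> using z0 by (intro prod_list_nonneg) auto
  have "(\<integral>\<^sup>+\<xi>. F \<xi> \<partial>Lk (density \<mu> (\<lambda>x. ennreal (z x))) (Suc k)) =
     (\<integral>\<^sup>+x. \<integral>\<^sup>+\<xi>. F (x # \<xi>) * ennreal (prod_list (map z \<xi>)) \<partial>Lk \<mu> k \<partial>density \<mu> (\<lambda>x. ennreal (z x)))"
    by (simp add: D.nn_integral_Lk_Suc Suc.IH)
  also have "\<dots> = (\<integral>\<^sup>+x. ennreal (z x) * (\<integral>\<^sup>+\<xi>. F (x # \<xi>) * ennreal (prod_list (map z \<xi>)) \<partial>Lk \<mu> k) \<partial>\<mu>)"
    by (rule nn_integral_density) measurable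
  also have "\<dots> = (\<integral>\<^sup>+x. \<integral>\<^sup>+\<xi>. F (x # \<xi>) * ennreal (prod_list (map z (x # \<xi>))) \<partial>Lk \<mu> k \<partial>\<mu>)"
  proof (rule nn_integral_cong)
    fix x
    show "ennreal (z x) * (\<integral>\<^sup>+\<xi>. F (x # \<xi>) * ennreal (prod_list (map z \<xi>)) \<partial>Lk \<mu> k) = (\<integral>\<^sup>+\<xi>. F (x # \<xi>) * ennreal (prod_list (map z (x # \<xi>))) \<partial>Lk \<mu> k)"
      by (subst nn_integral_cmult[symmetric]) (auto intro!: nn_integral_cong simp: ennreal_mult z0 z0' mult_ac)
  qed
  also have "\<dots> = (\<integral>\<^sup>+\<xi>. F \<xi> * ennreal (prod_list (map z \<xi>)) \<partial>Lk \<mu> (Suc k))"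
    by (rule nn_integral_Lk_Suc[symmetric]) measurable
  finally show ?case .
qed

lemma integral_Lk:
  fixes F :: "'a list \<Rightarrow> real"
  assumes "F \<in> borel_measurable LS"
  shows "(\<integral>\<xi>. F \<xi> \<partial>Lk \<mu> k) = (\<integral>x. F (map x (rev [0..<k])) \<partial>(\<Pi>\<^sub>M i\<in>{..<k}. \<mu>))"
  unfolding Lk_def using measurable_map_rev assms by (rule integral_distr)

lemma integral_Lk_0:
  fixes F :: "'a list \<Rightarrow> real"
  assumes "F \<in> borel_measurable LS"
  shows "(\<integral>\<xi>. F \<xi> \<partial>Lk \<mu> 0) = F []"
  by (simp add: integral_Lk[OF assms] PiM_empty lebesgue_integral_count_space_finite)

lemma AE_PiM_lessThan:
  fixes n :: nat
  assumes "AE x in \<mu>. Q x"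
  shows "AE x in (\<Pi>\<^sub>M i\<in>{..<n}. \<mu>). \<forall>i<n. Q (x i)"
proof -
  have "AE x in (\<Pi>\<^sub>M i\<in>{..<n}. \<mu>). \<forall>y\<in>set (map x (rev [0..<n])). Q y"
    using AE_Lk[OF assms, of n] unfolding Lk_def by (rule AE_distrD[OF measurable_map_rev])
  then show ?thesis by eventually_elim auto
qed

end

lemma gibbs_iff_gibbsm:
  fixes lam :: "'a::polish_space measure"
  assumes lam: "bd_finite lam" and pot: "potential (density lam (\<lambda>x. ennreal (z x))) v"
    and z[measurable]: "z \<in> borel_measurable borel"
  shows "gibbs lam v z P \<longleftrightarrow> gibbsm (density lam (\<lambda>x. ennreal (z x))) v P"
proof -
  interpret lam: bd_finite lam by (rule lam)
  interpret potential "density lam (\<lambda>x. ennreal (z x))" v by (rule pot)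
  have "(\<integral>\<^sup>+ x. (\<integral>\<^sup>+ \<eta>. F (x, add_dirac \<eta> x) * ennreal (expneg (WW v x \<eta>)) \<partial>P) * ennreal (z x) \<partial>lam) =
     (\<integral>\<^sup>+ x. (\<integral>\<^sup>+ \<eta>. F (x, add_dirac \<eta> x) * ennreal (expneg (WW v x \<eta>)) \<partial>P) \<partial>density lam (\<lambda>x. ennreal (z x)))"
    if P: "prob_space P" and s[measurable_cong]: "sets P = sets NNsig" and F: "F \<in> borel_measurable (borel \<Otimes>\<^sub>M NNsig)" for F
  proof -
    interpret prob_space P by (rule P)
    have Fm[measurable (raw)]: "(\<lambda>m. F (f m, h m)) \<in> borel_measurable M" if "f \<in> borel_measurable M" "h \<in> measurable M NNsig" for f h M
      using measurable_compose[OF measurable_Pair[OF that] F] by simp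
    have "(\<lambda>x. \<integral>\<^sup>+ \<eta>. F (x, add_dirac \<eta> x) * ennreal (expneg (WW v x \<eta>)) \<partial>P) \<in> borel_measurable borel"
      by measurable
    then show ?thesis by (subst nn_integral_density) (auto simp: mult.commute)
  qed
  then show ?thesis
    unfolding gibbs_def gibbsm_def by (auto dest: sets_eq_imp_space_eq simp: space_NNsig)
qed

theorem mainTheorem4:
  fixes lam :: "'a::polish_space measure"
    and v :: "'a \<Rightarrow> 'a \<Rightarrow> ennreal"
    and z a :: "'a \<Rightarrow> real"
    and t :: real
  assumes lam_sets: "sets lam = sets borel"
    and lam_fin: "\<forall>B\<in>sets borel. bounded B \<longrightarrow> emeasure lam B < \<infinity>"
    and v_meas: "(\<lambda>p. v (fst p) (snd p)) \<in> borel_measurable (borel \<Otimes>\<^sub>M borel)"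
    and v_sym: "\<forall>x y. v x y = v y x"
    and z_meas: "z \<in> borel_measurable borel"
    and z_nonneg: "\<forall>x. z x \<ge> 0"
    and z_loc: "\<forall>B\<in>sets borel. bounded B \<longrightarrow> (\<integral>\<^sup>+ x\<in>B. ennreal (z x) \<partial>lam) < \<infinity>"
    and f_nonpos: "AE p in lam \<Otimes>\<^sub>M lam. ff v (fst p) (snd p) \<le> 0"
    and a_meas: "a \<in> borel_measurable borel"
    and a_nonneg: "\<forall>x. a x \<ge> 0"
    and t_pos: "t > 0"
    and cond: "AE x0 in lam.
       (\<Sum>k. ennreal (exp (t * real (Suc k)) / fact (Suc k)) *
          (\<integral>\<^sup>+ y. ennreal ((\<Prod>j<Suc k. \<bar>ff v x0 (y j)\<bar>) *
                 (\<Prod>(i,j)\<in>{(i,j). i < j \<and> j < Suc k}. 1 + ff v (y i) (y j)) *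
                 (\<Prod>j<Suc k. z (y j) * exp (a (y j))))
             \<partial>(\<Pi>\<^sub>M j\<in>{..<Suc k}. lam)))
       \<le> ennreal (exp (a x0) - 1)"
  shows "(\<exists>!P. gibbs lam v z P) \<and>
    (\<forall>P. gibbs lam v z P \<longrightarrow> (\<forall>n\<ge>1. AE x in (\<Pi>\<^sub>M j\<in>{..<n}. lam).
       corr v z P n x =
         (\<Prod>j<n. z (x j)) *
         (psi v n n x +
          (\<Sum>k. (1 / fact (Suc k)) *
             (\<integral> y. psi v n (n + Suc k) (append_pts n x y)
                \<partial>(\<Pi>\<^sub>M j\<in>{..<Suc k}. density lam (\<lambda>y. ennreal (z y))))))
       \<and>
       ennreal \<bar>psi v n n x\<bar> +
         (\<Sum>k. ennreal (exp (t * real (Suc k)) / fact (Suc k)) *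
            (\<integral>\<^sup>+ y. ennreal \<bar>psi v n (n + Suc k) (append_pts n x y)\<bar>
                \<partial>(\<Pi>\<^sub>M j\<in>{..<Suc k}. density lam (\<lambda>y. ennreal (z y)))))
       \<le> ennreal ((\<Prod>(i,j)\<in>{(i,j). i < j \<and> j < n}. 1 + ff v (x i) (x j)) *
                  exp (\<Sum>i<n. a (x i)))))"
proof -
  have v_sym': "v x y = v y x" for x y using v_sym by simp
  define \<mu> where "\<mu> = density lam (\<lambda>y. ennreal (z y))"
  define b where "b x = exp (a x)" for x
  have z0: "0 \<le> z x" for x using z_nonneg by simp
  note [measurable] = z_meas a_meas
  interpret lam: bd_finite lam by standard (use lam_sets lam_fin in auto)
  interpret bd_finite \<mu>
  proof
    fix B :: "'a set" assume B: "B \<in> sets borel" "bounded B"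
    have "emeasure \<mu> B = (\<integral>\<^sup>+ x\<in>B. ennreal (z x) \<partial>lam)"
      unfolding \<mu>_def using B by (intro emeasure_density) auto
    then show "emeasure \<mu> B < \<infinity>" using z_loc B by simp
  qed (simp add: \<mu>_def)
  have bd: "bd_finite (density lam (\<lambda>y. ennreal (z y)))" using bd_finite_axioms by (simp add: \<mu>_def)
  interpret potential \<mu> v by standard (use v_meas v_sym in auto)
  let ?S = "\<lambda>x0. \<Sum>k. ennreal (exp (t * real (Suc k)) / fact (Suc k)) *
          (\<integral>\<^sup>+ y. ennreal ((\<Prod>j<Suc k. \<bar>ff v x0 (y j)\<bar>) *
                 (\<Prod>(i,j)\<in>{(i,j). i < j \<and> j < Suc k}. 1 + ff v (y i) (y j)) *
                 (\<Prod>j<Suc k. z (y j) * exp (a (y j))))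
             \<partial>(\<Pi>\<^sub>M j\<in>{..<Suc k}. lam))"
  \<comment> \<open>The good points are chosen as the complement of a measurable null set containing
    all exceptional points, which makes G measurable at once.\<close>
  obtain N where N: "N \<in> sets lam" "emeasure lam N = 0" "{x\<in>space lam. \<not> ?S x \<le> ennreal (exp (a x) - 1)} \<subseteq> N"
    using cond by (auto elim!: AE_E)
  define G where "G = - N"
  have GS: "?S x \<le> ennreal (exp (a x) - 1)" if "x \<in> G" for x using N(3) that by (auto simp: G_def)
  have AEG: "AE x in lam. x \<in> G"
    using AE_not_in[of N lam] N(1,2) by (auto simp: G_def null_sets_def)
  have e0: "1 + ff v x y = expneg (v x y)" for x y by (simp add: ff_def)
  have cond': "(\<integral>\<^sup>+\<xi>. ennreal (exp t ^ length \<xi> * prod_list (map (\<lambda>y. (1 - expneg (v x y)) * b y) \<xi>) * eH v \<xi>) \<partial>ell \<mu>) \<le> ennreal (b x)"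
    if x: "x \<in> G" for x
  proof -
    let ?F = "\<lambda>\<xi>. exp t ^ length \<xi> * prod_list (map (\<lambda>y. (1 - expneg (v x y)) * b y) \<xi>) * eH v \<xi>"
    have bm[measurable]: "b \<in> borel_measurable borel" unfolding b_def by measurable
    have Fm[measurable]: "?F \<in> borel_measurable LS" by measurable
    have F0: "0 \<le> ?F \<xi>" for \<xi> by (intro mult_nonneg_nonneg prod_list_nonneg) (auto simp: b_def)
    have tm: "ennreal (1 / fact k) * (\<integral>\<^sup>+\<xi>. ennreal (?F \<xi>) \<partial>Lk \<mu> k) =
       ennreal (exp (t * real k) / fact k) * (\<integral>\<^sup>+ y. ennreal ((\<Prod>j<k. \<bar>ff v x (y j)\<bar>) *
                 (\<Prod>(i,j)\<in>{(i,j). i < j \<and> j < k}. 1 + ff v (y i) (y j)) *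
                 (\<Prod>j<k. z (y j) * exp (a (y j))))
             \<partial>(\<Pi>\<^sub>M j\<in>{..<k}. lam))" for k
    proof -
      have m1: "(\<lambda>\<xi>. ennreal (?F \<xi>) * ennreal (prod_list (map z \<xi>))) \<in> borel_measurable LS" by measurable
      have m2: "(\<lambda>\<xi>. ennreal (prod_list (map (\<lambda>y. 1 - expneg (v x y)) \<xi>) * eH v \<xi> * prod_list (map (\<lambda>y. z y * b y) \<xi>))) \<in> borel_measurable LS" by measurable
      have "(\<integral>\<^sup>+\<xi>. ennreal (?F \<xi>) \<partial>Lk \<mu> k) = (\<integral>\<^sup>+\<xi>. ennreal (?F \<xi>) * ennreal (prod_list (map z \<xi>)) \<partial>Lk lam k)"
        unfolding \<mu>_def by (rule lam.nn_integral_Lk_density[OF z_meas z0 bd]) measurable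
      also have "\<dots> = (\<integral>\<^sup>+\<xi>. ennreal (exp t ^ k) * ennreal (prod_list (map (\<lambda>y. 1 - expneg (v x y)) \<xi>) * eH v \<xi> * prod_list (map (\<lambda>y. z y * b y) \<xi>)) \<partial>Lk lam k)"
      proof (rule nn_integral_cong_AE)
        show "AE \<xi> in Lk lam k. ennreal (?F \<xi>) * ennreal (prod_list (map z \<xi>)) =
          ennreal (exp t ^ k) * ennreal (prod_list (map (\<lambda>y. 1 - expneg (v x y)) \<xi>) * eH v \<xi> * prod_list (map (\<lambda>y. z y * b y) \<xi>))"
          using lam.AE_Lk_length[of k]
        proof eventually_elim
          case (elim \<xi>)
          have "ennreal (?F \<xi>) * ennreal (prod_list (map z \<xi>)) = ennreal (?F \<xi> * prod_list (map z \<xi>))"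
            using F0[of \<xi>] by (rule ennreal_mult'[symmetric])
          also have "?F \<xi> * prod_list (map z \<xi>) = exp t ^ k * (prod_list (map (\<lambda>y. 1 - expneg (v x y)) \<xi>) * eH v \<xi> * prod_list (map (\<lambda>y. z y * b y) \<xi>))"
            using elim by (simp add: prod_list_mult mult_ac)
          finally show ?case by (simp only: ennreal_mult'[OF zero_le_power[OF exp_ge_zero]])
        qed
      qed
      also have "\<dots> = ennreal (exp t ^ k) * (\<integral>\<^sup>+\<xi>. ennreal (prod_list (map (\<lambda>y. 1 - expneg (v x y)) \<xi>) * eH v \<xi> * prod_list (map (\<lambda>y. z y * b y) \<xi>)) \<partial>Lk lam k)"
        using m2 by (intro nn_integral_cmult) simp
      also have "(\<integral>\<^sup>+\<xi>. ennreal (prod_list (map (\<lambda>y. 1 - expneg (v x y)) \<xi>) * eH v \<xi> * prod_list (map (\<lambda>y. z y * b y) \<xi>)) \<partial>Lk lam k) =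
        (\<integral>\<^sup>+ y. ennreal ((\<Prod>j<k. \<bar>ff v x (y j)\<bar>) *
                 (\<Prod>(i,j)\<in>{(i,j). i < j \<and> j < k}. 1 + ff v (y i) (y j)) *
                 (\<Prod>j<k. z (y j) * exp (a (y j))))
             \<partial>(\<Pi>\<^sub>M j\<in>{..<k}. lam))"
        by (subst lam.nn_integral_Lk[OF m2], unfold prod_list_rev_upt eH_rev_upt[OF v_sym']) (simp only: abs_ff e0 b_def)
      finally have eq: "(\<integral>\<^sup>+\<xi>. ennreal (?F \<xi>) \<partial>Lk \<mu> k) = ennreal (exp t ^ k) * (\<integral>\<^sup>+ y. ennreal ((\<Prod>j<k. \<bar>ff v x (y j)\<bar>) *
                 (\<Prod>(i,j)\<in>{(i,j). i < j \<and> j < k}. 1 + ff v (y i) (y j)) *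
                 (\<Prod>j<k. z (y j) * exp (a (y j)))) \<partial>(\<Pi>\<^sub>M j\<in>{..<k}. lam))" .
      have "ennreal (1 / fact k) * ennreal (exp t ^ k) = ennreal (exp (t * real k) / fact k)"
        by (simp add: ennreal_mult[symmetric] exp_of_nat2_mult)
      then show ?thesis unfolding eq by (simp only: mult.assoc[symmetric])
    qed
    have "(\<integral>\<^sup>+\<xi>. ennreal (?F \<xi>) \<partial>ell \<mu>) = (\<Sum>k. ennreal (1 / fact k) * (\<integral>\<^sup>+\<xi>. ennreal (?F \<xi>) \<partial>Lk \<mu> k))"
      by (rule nn_integral_ell) measurable
    \<comment> \<open>The series of the hypothesis starts with one point; the empty configuration
      contributes the missing 1 and turns exp (a x) - 1 into b x.\<close>
    also have "\<dots> = (\<Sum>k. ennreal (1 / fact (Suc k)) * (\<integral>\<^sup>+\<xi>. ennreal (?F \<xi>) \<partial>Lk \<mu> (Suc k))) + 1"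
      by (subst suminf_offset[OF summableI, of _ 1]) (simp del: fact_Suc)
    also have "\<dots> = ?S x + 1" unfolding tm ..
    also have "\<dots> \<le> ennreal (exp (a x) - 1) + 1" by (intro add_right_mono GS x)
    also have "\<dots> = ennreal (b x)" using a_nonneg by (simp add: b_def ennreal_1[symmetric] ennreal_plus[symmetric] del: ennreal_1 ennreal_plus)
    finally show ?thesis .
  qed
  interpret fp \<mu> v b "exp t" G
  proof
    show "AE x in \<mu>. x \<in> G" unfolding \<mu>_def using AEG by (subst AE_density) auto
    show "G \<in> sets borel" using N(1) lam_sets by (simp add: G_def)
    show "b \<in> borel_measurable borel" unfolding b_def by measurable
    show "1 \<le> b x" for x using a_nonneg by (simp add: b_def)
    show "1 < exp t" using t_pos by simp
  qed (rule cond')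
  have gibbs_iff: "gibbs lam v z P \<longleftrightarrow> gibbsm \<mu> v P" for P
    using gibbs_iff_gibbsm[OF lam.bd_finite_axioms, of z v P] potential_axioms by (simp add: \<mu>_def)
  show ?thesis
  proof (intro conjI allI impI)
    show "\<exists>!P. gibbs lam v z P" unfolding gibbs_iff by (rule gibbs_ex1)
    fix P and n :: nat assume "gibbs lam v z P"
    then have gP: "gibbsm \<mu> v P" by (simp add: gibbs_iff)
    interpret gibbs_fp \<mu> v b "exp t" G P by standard (rule gP)
    show "AE x in (\<Pi>\<^sub>M j\<in>{..<n}. lam).
       corr v z P n x =
         (\<Prod>j<n. z (x j)) *
         (psi v n n x +
          (\<Sum>k. (1 / fact (Suc k)) *
             (\<integral> y. psi v n (n + Suc k) (append_pts n x y)
                \<partial>(\<Pi>\<^sub>M j\<in>{..<Suc k}. density lam (\<lambda>y. ennreal (z y)))))) \<and>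
       ennreal \<bar>psi v n n x\<bar> +
         (\<Sum>k. ennreal (exp (t * real (Suc k)) / fact (Suc k)) *
            (\<integral>\<^sup>+ y. ennreal \<bar>psi v n (n + Suc k) (append_pts n x y)\<bar>
                \<partial>(\<Pi>\<^sub>M j\<in>{..<Suc k}. density lam (\<lambda>y. ennreal (z y)))))
       \<le> ennreal ((\<Prod>(i,j)\<in>{(i,j). i < j \<and> j < n}. 1 + ff v (x i) (x j)) *
                  exp (\<Sum>i<n. a (x i)))"
      \<comment> \<open>The only exceptional tuples are those with an entry outside G; for all
        others both claims are proved pointwise.\<close>
      using lam.AE_PiM_lessThan[OF AEG, of n]
    proof eventually_elim
      case (elim x)
      let ?xs = "map x (rev [0..<n])"
      have xs: "set ?xs \<subseteq> G" using elim by auto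
      have eH: "eH v ?xs = expneg (\<Sum>(i,j)\<in>{(i,j). i < j \<and> j < n}. v (x i) (x j))"
        unfolding eH_rev_upt[OF v_sym'] expneg_sum by (simp add: case_prod_unfold)
      have LL: "LL P (vL v ?xs) = (\<integral> \<eta>. expneg (\<Sum>i<n. WW v (x i) \<eta>) \<partial>P)"
        unfolding LL_def
      proof (rule Bochner_Integration.integral_cong[OF refl])
        fix \<eta> assume "\<eta> \<in> space P"
        then have \<eta>: "\<eta> \<in> NN" by simp
        have "vL v ?xs y = (\<Sum>i<n. v (x i) y)" for y
          unfolding vL_def by (induction n) (simp_all add: add.commute)
        then have "(\<integral>\<^sup>+y. vL v ?xs y \<partial>\<eta>) = (\<integral>\<^sup>+y. (\<Sum>i<n. v (x i) y) \<partial>\<eta>)" by (simp only:)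
        also have "\<dots> = (\<Sum>i<n. WW v (x i) \<eta>)"
          unfolding WW_def by (intro nn_integral_sum NN_measurable[OF \<eta>]) measurable
        finally show "expneg (\<integral>\<^sup>+y. vL v ?xs y \<partial>\<eta>) = expneg (\<Sum>i<n. WW v (x i) \<eta>)" by simp
      qed
      have corr: "corr v z P n x = (\<Prod>j<n. z (x j)) * phi ?xs"
        unfolding corr_def RR_eq_phi[OF xs, symmetric] RR_def eH LL by (simp only: mult.assoc)
      have pm: "psiL v ?xs \<in> borel_measurable LS" by measurable
      have L: "(\<integral>\<xi>. psiL v ?xs \<xi> \<partial>Lk \<mu> k) = (\<integral> y. psi v n (n + k) (append_pts n x y) \<partial>(\<Pi>\<^sub>M j\<in>{..<k}. density lam (\<lambda>y. ennreal (z y))))" for k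
        unfolding integral_Lk[OF pm] psiL_eq_psi[OF v_sym'] unfolding \<mu>_def ..
      have sums: "(\<lambda>k. (1 / fact k) * (\<integral>\<xi>. psiL v ?xs \<xi> \<partial>Lk \<mu> k)) sums phi ?xs"
        unfolding phi_def by (rule sums_ell[OF psiL_integrable[OF xs]])
      \<comment> \<open>The term without additional points is then split off; it is the summand
        \<open>psi v n n x\<close> of the claim.\<close>
      have "phi ?xs = (\<Sum>k. (1 / fact k) * (\<integral>\<xi>. psiL v ?xs \<xi> \<partial>Lk \<mu> k))" using sums by (rule sums_unique)
      also have "\<dots> = (\<Sum>k. (1 / fact (Suc k)) * (\<integral>\<xi>. psiL v ?xs \<xi> \<partial>Lk \<mu> (Suc k))) + (1 / fact 0) * (\<integral>\<xi>. psiL v ?xs \<xi> \<partial>Lk \<mu> 0)"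
        using suminf_split_head[OF sums_summable[OF sums]] by linarith
      also have "(1 / fact 0) * (\<integral>\<xi>. psiL v ?xs \<xi> \<partial>Lk \<mu> 0) = psi v n n x"
        unfolding integral_Lk_0[OF pm] psiL_Nil_eq_psi[OF v_sym'] by simp
      finally have phi: "phi ?xs = psi v n n x + (\<Sum>k. (1 / fact (Suc k)) * (\<integral> y. psi v n (n + Suc k) (append_pts n x y)
                \<partial>(\<Pi>\<^sub>M j\<in>{..<Suc k}. density lam (\<lambda>y. ennreal (z y)))))"
        unfolding L by (simp only: add.commute)
      let ?Q = "\<lambda>\<xi>. ennreal (exp t ^ length \<xi> * \<bar>psiL v ?xs \<xi>\<bar>)"
      have qm: "?Q \<in> borel_measurable LS" by measurable
      have Q: "ennreal (1 / fact k) * (\<integral>\<^sup>+\<xi>. ?Q \<xi> \<partial>Lk \<mu> k) = ennreal (exp (t * real k) / fact k) *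
          (\<integral>\<^sup>+ y. ennreal \<bar>psi v n (n + k) (append_pts n x y)\<bar> \<partial>(\<Pi>\<^sub>M j\<in>{..<k}. density lam (\<lambda>y. ennreal (z y))))" for k
      proof -
        have m: "(\<lambda>\<xi>. ennreal \<bar>psiL v ?xs \<xi>\<bar>) \<in> borel_measurable LS" by measurable
        have "(\<integral>\<^sup>+\<xi>. ?Q \<xi> \<partial>Lk \<mu> k) = (\<integral>\<^sup>+\<xi>. ennreal (exp t ^ k) * ennreal \<bar>psiL v ?xs \<xi>\<bar> \<partial>Lk \<mu> k)"
          by (rule nn_integral_cong_AE) (use AE_Lk_length[of k] in \<open>eventually_elim, simp add: ennreal_mult\<close>)
        also have "\<dots> = ennreal (exp t ^ k) * (\<integral>\<^sup>+\<xi>. ennreal \<bar>psiL v ?xs \<xi>\<bar> \<partial>Lk \<mu> k)"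
          using m by (intro nn_integral_cmult) simp
        also have "(\<integral>\<^sup>+\<xi>. ennreal \<bar>psiL v ?xs \<xi>\<bar> \<partial>Lk \<mu> k) = (\<integral>\<^sup>+ y. ennreal \<bar>psi v n (n + k) (append_pts n x y)\<bar> \<partial>(\<Pi>\<^sub>M j\<in>{..<k}. density lam (\<lambda>y. ennreal (z y))))"
          unfolding nn_integral_Lk[OF m] psiL_eq_psi[OF v_sym'] unfolding \<mu>_def ..
        finally have eq: "(\<integral>\<^sup>+\<xi>. ?Q \<xi> \<partial>Lk \<mu> k) = ennreal (exp t ^ k) * (\<integral>\<^sup>+ y. ennreal \<bar>psi v n (n + k) (append_pts n x y)\<bar> \<partial>(\<Pi>\<^sub>M j\<in>{..<k}. density lam (\<lambda>y. ennreal (z y))))" .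
        have "ennreal (1 / fact k) * ennreal (exp t ^ k) = ennreal (exp (t * real k) / fact k)"
          by (simp add: ennreal_mult[symmetric] exp_of_nat2_mult)
        then show ?thesis unfolding eq by (simp only: mult.assoc[symmetric])
      qed
      have Q0: "ennreal (1 / fact 0) * (\<integral>\<^sup>+\<xi>. ?Q \<xi> \<partial>Lk \<mu> 0) = ennreal \<bar>psi v n n x\<bar>"
        unfolding nn_integral_Lk_0[OF qm] psiL_Nil_eq_psi[OF v_sym'] by simp
      have "(\<integral>\<^sup>+\<xi>. ?Q \<xi> \<partial>ell \<mu>) = (\<Sum>k. ennreal (1 / fact k) * (\<integral>\<^sup>+\<xi>. ?Q \<xi> \<partial>Lk \<mu> k))"
        by (rule nn_integral_ell[OF qm])
      also have "\<dots> = (\<Sum>k. ennreal (1 / fact (Suc k)) * (\<integral>\<^sup>+\<xi>. ?Q \<xi> \<partial>Lk \<mu> (Suc k))) + ennreal (1 / fact 0) * (\<integral>\<^sup>+\<xi>. ?Q \<xi> \<partial>Lk \<mu> 0)"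
        by (subst suminf_offset[OF summableI, of _ 1]) (simp del: fact_Suc nn_integral_Lk_0)
      also have "\<dots> = ennreal \<bar>psi v n n x\<bar> + (\<Sum>k. ennreal (exp (t * real (Suc k)) / fact (Suc k)) *
            (\<integral>\<^sup>+ y. ennreal \<bar>psi v n (n + Suc k) (append_pts n x y)\<bar>
                \<partial>(\<Pi>\<^sub>M j\<in>{..<Suc k}. density lam (\<lambda>y. ennreal (z y)))))"
        unfolding Q0 unfolding Q by (rule add.commute)
      finally have eqQ: "(\<integral>\<^sup>+\<xi>. ?Q \<xi> \<partial>ell \<mu>) = \<dots>" .
      have "(\<integral>\<^sup>+\<xi>. ?Q \<xi> \<partial>ell \<mu>) \<le> ennreal (eH v ?xs * prod_list (map b ?xs))"
        by (rule psiL_bound[OF xs])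
      also have "eH v ?xs * prod_list (map b ?xs) = (\<Prod>(i,j)\<in>{(i,j). i < j \<and> j < n}. 1 + ff v (x i) (x j)) * exp (\<Sum>i<n. a (x i))"
        unfolding prod_list_rev_upt eH_rev_upt[OF v_sym'] e0 b_def exp_sum[OF finite_lessThan] ..
      finally show ?case
        unfolding corr phi eqQ by (intro conjI refl)
    qed
  qed
qed

end
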